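(* Let $\mathcal{R}\subset\mathbb{R}^N\setminus\{0\}$ be a reduced root system. If $a>0$ and $k$ is a non-negative multiplicity function such that $a+2\langle k\rangle+N-2>0$, then the representation $\omega_{k,a}$ of $\mathfrak{sl}(2,\mathbb{R})$ lifts to a unitary representation of the universal covering group $\widetilde{SL(2,\mathbb{R})}$ of $SL(2,\mathbb{R})$ on $L^2(\mathbb{R}^N,\vartheta_{k,a}(x)dx)$.
   Context: Let $N\ge1$, $\langle\cdot,\cdot\rangle$ the standard inner product on $\mathbb{R}^N$, $\|x\|=\langle x,x\rangle^{1/2}$, $r_\alpha(x)=x-2\frac{\langle\alpha,x\rangle}{\|\alpha\|^2}\alpha$. A (reduced) root system is a finite set $\mathcal{R}\subset\mathbb{R}^N\setminus\{0\}$ with $r_\alpha(\mathcal{R})=\mathcal{R}$ and $\mathcal{R}\cap\mathbb{R}\alpha=\{\pm\alpha\}$ for all $\alpha\in\mathcal{R}$. $\mathfrak{C}$ is the finite Coxeter group generated by $\{r_\alpha\}$, $\mathcal{R}^+$ a positive subsystem. A multiplicity function is a $\mathfrak{C}$-invariant function $k=(k_\alpha)$ on $\mathcal{R}$; non-negative means all $k_\alpha\ge0$; $\langle k\rangle=\sum_{\alpha\in\mathcal{R}^+}k_\alpha$. Dunkl operators: $T_\xi(k)f(x)=\partial_\xi f(x)+\sum_{\alpha\in\mathcal{R}^+}k_\alpha\langle\alpha,\xi\rangle\frac{f(x)-f(r_\alpha x)}{\langle\alpha,x\rangle}$; Dunkl Laplacian $\Delta_k=\sum_{j=1}^NT_{\xi_j}(k)^2$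 for an orthonormal basis $(\xi_j)$. $\vartheta_{k,a}(x)=\|x\|^{a-2}\prod_{\alpha\in\mathcal{R}}|\langle\alpha,x\rangle|^{k_\alpha}$. Let $\mathbf{e}^+=\begin{pmatrix}0&1\\0&0\end{pmatrix}$, $\mathbf{e}^-=\begin{pmatrix}0&0\\1&0\end{pmatrix}$, $\mathbf{h}=\begin{pmatrix}1&0\\0&-1\end{pmatrix}$. $\omega_{k,a}$ is the Lie algebra representation of $\mathfrak{sl}(2,\mathbb{R})$ on $C^\infty(\mathbb{R}^N\setminus\{0\})$ with $\omega_{k,a}(\mathbf{e}^+)=\frac ia\|x\|^a$, $\omega_{k,a}(\mathbf{e}^-)=\frac ia\|x\|^{2-a}\Delta_k$, $\omega_{k,a}(\mathbf{h})=\frac2a\sum_ix_i\partial_i+\frac{N+2\langle k\rangle+a-2}{a}$. Let $\mathcal{H}_k^m(\mathbb{R}^N)$ be the homogeneous polynomials $p$ of degree $m$ with $\Delta_kp=0$, $\lambda_{k,a,m}=\frac{2m+2\langle k\rangle+N-2}{a}$, $L_\ell^{(\lambda)}$ the Laguerre polynomials, and $W_{k,a}(\mathbb{R}^N)$ the complex span of the functions $p(x)L_\ell^{(\lambda_{k,a,m})}(\frac2a\|x\|^a)e^{-\|x\|^a/a}$ ($\ell,m\in\mathbb{N}$, $p\in\mathcal{H}_k^m(\mathbb{R}^N)$), a dense $\omega_{k,a}$-invariant subspace of $L^2(\mathbb{R}^N,\vartheta_{k,a}(x)dx)$. "$\omega_{k,a}$ lifts to a unitary representation $\Omega$" means: $\Omega$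 is a (strongly continuous) unitary representation with $\frac{d}{dt}\big|_{t=0}\Omega(\operatorname{Exp}(tX))f=\omega_{k,a}(X)f$ for all $X\in\mathfrak{sl}(2,\mathbb{R})$, $f\in W_{k,a}(\mathbb{R}^N)$, where $\operatorname{Exp}:\mathfrak{sl}(2,\mathbb{R})\to\widetilde{SL(2,\mathbb{R})}$ is the exponential map. *)

theory Defs
  imports "HOL-Analysis.Analysis" "HOL-Algebra.Bij" "HOL-Algebra.Generated_Groups"
begin

definition refl_along :: "real^'n \<Rightarrow> real^'n \<Rightarrow> real^'n" where
  "refl_along \<alpha> x = x - (2 * (\<alpha> \<bullet> x) / (norm \<alpha>)\<^sup>2) *\<^sub>R \<alpha>"

definition root_system :: "(real^'n) set \<Rightarrow> bool" where
  "root_system R \<longleftrightarrow> finite R \<and> 0 \<notin> R \<and>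
     (\<forall>\<alpha>\<in>R. refl_along \<alpha> ` R = R \<and> R \<inter> range (\<lambda>c. c *\<^sub>R \<alpha>) = {\<alpha>, - \<alpha>})"

definition positive_subsystem :: "(real^'n) set \<Rightarrow> (real^'n) set \<Rightarrow> bool" where
  "positive_subsystem R P \<longleftrightarrow>
     (\<exists>\<beta>. (\<forall>\<alpha>\<in>R. \<alpha> \<bullet> \<beta> \<noteq> 0) \<and> P = {\<alpha>\<in>R. \<alpha> \<bullet> \<beta> > 0})"

definition coxeter_group :: "(real^'n) set \<Rightarrow> (real^'n \<Rightarrow> real^'n) set" where
  "coxeter_group R = generate (BijGroup UNIV) (refl_along ` R)"

text \<open>Only the values of \<open>k\<close> on \<open>R\<close> matter.\<close>

definition multiplicity_function :: "(real^'n) set \<Rightarrow> (real^'n \<Rightarrow> real) \<Rightarrow> bool" where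
  "multiplicity_function R k \<longleftrightarrow> (\<forall>w\<in>coxeter_group R. \<forall>\<alpha>\<in>R. k (w \<alpha>) = k \<alpha>)"

text \<open>Functions on \<open>\<real>\<^sup>N - {0}\<close> are represented by total functions on \<open>\<real>\<^sup>N\<close>; the operators below are
  meaningful at \<open>x \<noteq> 0\<close> when applied to functions that are smooth away from the origin.\<close>

definition dir_deriv :: "real^'n \<Rightarrow> (real^'n \<Rightarrow> complex) \<Rightarrow> real^'n \<Rightarrow> complex" where
  "dir_deriv \<xi> f x = frechet_derivative f (at x) \<xi>"

text \<open>For smooth \<open>f\<close> the quotient \<open>(f x - f (r\<^sub>\<alpha> x)) / \<langle>\<alpha>,x\<rangle>\<close> extends smoothly across the hyperplane
  \<open>\<langle>\<alpha>,x\<rangle> = 0\<close>. If \<open>\<langle>\<alpha>,x\<rangle> = 0\<close>, its value at \<open>x + s \<alpha>\<close> is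
  \<open>(f (x + s \<alpha>) - f (x - s \<alpha>)) / (s \<parallel>\<alpha>\<parallel>\<^sup>2)\<close>, so the value on the hyperplane is the limit for \<open>s \<rightarrow> 0\<close>
  (division by zero would give the wrong value 0 there).\<close>

definition refl_quotient :: "real^'n \<Rightarrow> (real^'n \<Rightarrow> complex) \<Rightarrow> real^'n \<Rightarrow> complex" where
  "refl_quotient \<alpha> f x =
     (if \<alpha> \<bullet> x = 0 then of_real (2 / (norm \<alpha>)\<^sup>2) * dir_deriv \<alpha> f x
      else (f x - f (refl_along \<alpha> x)) / of_real (\<alpha> \<bullet> x))"

text \<open>Here and below \<open>P\<close> is the positive subsystem.\<close>

definition dunkl_op ::
    "(real^'n) set \<Rightarrow> (real^'n \<Rightarrow> real) \<Rightarrow> real^'n \<Rightarrow> (real^'n \<Rightarrow> complex) \<Rightarrow> real^'n \<Rightarrow> complex" where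
  "dunkl_op P k \<xi> f x =
     dir_deriv \<xi> f x + (\<Sum>\<alpha>\<in>P. of_real (k \<alpha> * (\<alpha> \<bullet> \<xi>)) * refl_quotient \<alpha> f x)"

definition dunkl_laplacian ::
    "(real^'n) set \<Rightarrow> (real^'n \<Rightarrow> real) \<Rightarrow> (real^'n \<Rightarrow> complex) \<Rightarrow> real^'n \<Rightarrow> complex" where
  "dunkl_laplacian P k f x = (\<Sum>j\<in>UNIV. dunkl_op P k (axis j 1) (dunkl_op P k (axis j 1) f) x)"

definition sl2 :: "(real^2^2) set" where
  "sl2 = {X. trace X = 0}"

definition omega_e_plus :: "real \<Rightarrow> (real^'n \<Rightarrow> complex) \<Rightarrow> real^'n \<Rightarrow> complex" where
  "omega_e_plus a f x = (\<i> / of_real a) * of_real (norm x powr a) * f x"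

definition omega_e_minus ::
    "(real^'n) set \<Rightarrow> (real^'n \<Rightarrow> real) \<Rightarrow> real \<Rightarrow> (real^'n \<Rightarrow> complex) \<Rightarrow> real^'n \<Rightarrow> complex" where
  "omega_e_minus P k a f x =
     (\<i> / of_real a) * of_real (norm x powr (2 - a)) * dunkl_laplacian P k f x"

definition omega_h ::
    "(real^'n) set \<Rightarrow> (real^'n \<Rightarrow> real) \<Rightarrow> real \<Rightarrow> (real^'n \<Rightarrow> complex) \<Rightarrow> real^'n \<Rightarrow> complex" where
  "omega_h P k a f x =
     of_real (2 / a) * (\<Sum>i\<in>UNIV. of_real (x $ i) * dir_deriv (axis i 1) f x)
     + of_real ((real CARD('n) + 2 * sum k P + a - 2) / a) * f x"

text \<open>A matrix \<open>X\<close> of trace 0 equals \<open>X\<^sub>1\<^sub>1 h + X\<^sub>1\<^sub>2 e\<^sup>+ + X\<^sub>2\<^sub>1 e\<^sup>-\<close>.\<close>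

definition omega ::
    "(real^'n) set \<Rightarrow> (real^'n \<Rightarrow> real) \<Rightarrow> real \<Rightarrow> real^2^2
      \<Rightarrow> (real^'n \<Rightarrow> complex) \<Rightarrow> real^'n \<Rightarrow> complex" where
  "omega P k a X f x =
     of_real (X $ 1 $ 1) * omega_h P k a f x
     + of_real (X $ 1 $ 2) * omega_e_plus a f x
     + of_real (X $ 2 $ 1) * omega_e_minus P k a f x"

definition dunkl_harmonics ::
    "(real^'n) set \<Rightarrow> (real^'n \<Rightarrow> real) \<Rightarrow> nat \<Rightarrow> (real^'n \<Rightarrow> complex) set" where
  "dunkl_harmonics P k m =
     {p. polynomial_function p \<and> (\<forall>t x. p (t *\<^sub>R x) = of_real (t ^ m) * p x)
         \<and> (\<forall>x. dunkl_laplacian P k p x = 0)}"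

definition laguerre :: "nat \<Rightarrow> real \<Rightarrow> real \<Rightarrow> real" where
  "laguerre l lam t =
     (\<Sum>j\<le>l. (-1) ^ j * ((real l + lam) gchoose (l - j)) * t ^ j / fact j)"

definition lambda_kam :: "(real^'n) set \<Rightarrow> (real^'n \<Rightarrow> real) \<Rightarrow> real \<Rightarrow> nat \<Rightarrow> real" where
  "lambda_kam P k a m = (2 * real m + 2 * sum k P + real CARD('n) - 2) / a"

definition W_generators ::
    "(real^'n) set \<Rightarrow> (real^'n \<Rightarrow> real) \<Rightarrow> real \<Rightarrow> (real^'n \<Rightarrow> complex) set" where
  "W_generators P k a =
     {(\<lambda>x. p x * of_real (laguerre l (lambda_kam P k a m) (2 / a * norm x powr a)
                          * exp (- (norm x powr a) / a)))
      | p l m. p \<in> dunkl_harmonics P k m}"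

definition W_space ::
    "(real^'n) set \<Rightarrow> (real^'n \<Rightarrow> real) \<Rightarrow> real \<Rightarrow> (real^'n \<Rightarrow> complex) set" where
  "W_space P k a =
     {(\<lambda>x. \<Sum>g\<in>S. c g * g x) | S c. finite S \<and> S \<subseteq> W_generators P k a}"

text \<open>Since \<open>0 powr 0 = 0\<close>, the formula differs from the intended one at the origin and on the
  hyperplanes \<open>\<langle>\<alpha>,x\<rangle> = 0\<close> with \<open>k \<alpha> = 0\<close>, which are Lebesgue null sets and do not affect the measure.\<close>

definition theta :: "(real^'n) set \<Rightarrow> (real^'n \<Rightarrow> real) \<Rightarrow> real \<Rightarrow> real^'n \<Rightarrow> real" where
  "theta R k a x = norm x powr (a - 2) * (\<Prod>\<alpha>\<in>R. \<bar>\<alpha> \<bullet> x\<bar> powr k \<alpha>)"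

definition theta_measure :: "(real^'n) set \<Rightarrow> (real^'n \<Rightarrow> real) \<Rightarrow> real \<Rightarrow> (real^'n) measure" where
  "theta_measure R k a = density lborel (\<lambda>x. ennreal (theta R k a x))"

text \<open>Elements of \<open>L\<^sup>2(M)\<close> are handled through representatives; equality in \<open>L\<^sup>2(M)\<close> is equality almost
  everywhere.\<close>

definition L2 :: "'x measure \<Rightarrow> ('x \<Rightarrow> complex) set" where
  "L2 M = {f \<in> borel_measurable M. integrable M (\<lambda>x. (cmod (f x))\<^sup>2)}"

definition L2_inner :: "'x measure \<Rightarrow> ('x \<Rightarrow> complex) \<Rightarrow> ('x \<Rightarrow> complex) \<Rightarrow> complex" where
  "L2_inner M f g = (\<integral>x. f x * cnj (g x) \<partial>M)"

definition L2_norm :: "'x measure \<Rightarrow> ('x \<Rightarrow> complex) \<Rightarrow> real" where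
  "L2_norm M f = sqrt (\<integral>x. (cmod (f x))\<^sup>2 \<partial>M)"

text \<open>Linearity and isometry force a unitary operator to map almost everywhere equal functions to
  almost everywhere equal functions, so it induces an operator on the quotient.\<close>

definition L2_unitary :: "'x measure \<Rightarrow> (('x \<Rightarrow> complex) \<Rightarrow> ('x \<Rightarrow> complex)) \<Rightarrow> bool" where
  "L2_unitary M U \<longleftrightarrow>
     (\<forall>f\<in>L2 M. U f \<in> L2 M) \<and>
     (\<forall>f\<in>L2 M. \<forall>g\<in>L2 M. AE x in M. U (\<lambda>y. f y + g y) x = U f x + U g x) \<and>
     (\<forall>f\<in>L2 M. \<forall>c. AE x in M. U (\<lambda>y. c * f y) x = c * U f x) \<and>
     (\<forall>f\<in>L2 M. \<forall>g\<in>L2 M. L2_inner M (U f) (U g) = L2_inner M f g) \<and>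
     (\<forall>g\<in>L2 M. \<exists>f\<in>L2 M. AE x in M. U f x = g x)"

definition has_L2_derivative ::
    "'x measure \<Rightarrow> (real \<Rightarrow> 'x \<Rightarrow> complex) \<Rightarrow> ('x \<Rightarrow> complex) \<Rightarrow> real \<Rightarrow> bool" where
  "has_L2_derivative M F D s \<longleftrightarrow>
     (\<forall>t. F t \<in> L2 M) \<and> D \<in> L2 M \<and>
     ((\<lambda>t. L2_norm M (\<lambda>x. (F t x - F s x) / of_real (t - s) - D x)) \<longlongrightarrow> 0) (at s)"

definition unitary_representation ::
    "('g, 'b) monoid_scheme \<Rightarrow> 'g topology \<Rightarrow> 'x measure
      \<Rightarrow> ('g \<Rightarrow> ('x \<Rightarrow> complex) \<Rightarrow> ('x \<Rightarrow> complex)) \<Rightarrow> bool" where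
  "unitary_representation G T M \<Omega> \<longleftrightarrow>
     (\<forall>g\<in>carrier G. L2_unitary M (\<Omega> g)) \<and>
     (\<forall>f\<in>L2 M. AE x in M. \<Omega> \<one>\<^bsub>G\<^esub> f x = f x) \<and>
     (\<forall>g\<in>carrier G. \<forall>h\<in>carrier G. \<forall>f\<in>L2 M.
        AE x in M. \<Omega> (g \<otimes>\<^bsub>G\<^esub> h) f x = \<Omega> g (\<Omega> h f) x) \<and>
     (\<forall>f\<in>L2 M. \<forall>g\<in>carrier G.
        ((\<lambda>h. L2_norm M (\<lambda>x. \<Omega> h f x - \<Omega> g f x)) \<longlongrightarrow> 0) (atin T g))"

text \<open>The universal cover is realised as the set of homotopy classes (with fixed endpoints) of paths
  in \<open>SL(2,\<real>)\<close> that start at the identity, with pointwise multiplication of paths. The covering map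
  sends the class of \<open>\<gamma>\<close> to its endpoint \<open>\<gamma> 1\<close>.\<close>

definition SL2 :: "(real^2^2) set" where
  "SL2 = {A. det A = 1}"

definition SL2_paths :: "(real \<Rightarrow> real^2^2) set" where
  "SL2_paths = {\<gamma>. path \<gamma> \<and> path_image \<gamma> \<subseteq> SL2 \<and> pathstart \<gamma> = mat 1}"

definition SL2_homotopy :: "((real \<Rightarrow> real^2^2) \<times> (real \<Rightarrow> real^2^2)) set" where
  "SL2_homotopy = {(\<gamma>, \<delta>). \<gamma> \<in> SL2_paths \<and> \<delta> \<in> SL2_paths \<and> homotopic_paths SL2 \<gamma> \<delta>}"

definition SL2_cover :: "(real \<Rightarrow> real^2^2) set monoid" where
  "SL2_cover =
     \<lparr> carrier = SL2_paths // SL2_homotopy,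
       mult = (\<lambda>c d. \<Union>\<gamma>\<in>c. \<Union>\<delta>\<in>d. SL2_homotopy `` {\<lambda>t. \<gamma> t ** \<delta> t}),
       one = SL2_homotopy `` {\<lambda>t. mat 1} \<rparr>"

text \<open>The standard base of the topology of the universal cover: the basic set given by a class \<open>c\<close> and
  an open \<open>U\<close> consists of the classes of all prolongations of paths in \<open>c\<close> by a path running inside
  \<open>U\<close>.\<close>

definition SL2_cover_basic :: "(real \<Rightarrow> real^2^2) set \<Rightarrow> (real^2^2) set
    \<Rightarrow> (real \<Rightarrow> real^2^2) set set" where
  "SL2_cover_basic c U =
     {SL2_homotopy `` {\<gamma> +++ \<eta>} | \<gamma> \<eta>.
        \<gamma> \<in> c \<and> path \<eta> \<and> path_image \<eta> \<subseteq> U \<and> pathstart \<eta> = pathfinish \<gamma>}"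

definition SL2_cover_topology :: "(real \<Rightarrow> real^2^2) set topology" where
  "SL2_cover_topology = topology_generated_by
     {SL2_cover_basic c U | c U. c \<in> carrier SL2_cover \<and> openin (top_of_set SL2) U}"

definition matrix_exp :: "real^2^2 \<Rightarrow> real^2^2" where
  "matrix_exp X = (\<Sum>n. (1 / fact n) *\<^sub>R (((**) X) ^^ n) (mat 1))"

text \<open>The one-parameter subgroup \<open>t \<mapsto> Exp (t X)\<close> is the lift of \<open>t \<mapsto> exp (t X)\<close>; its value at \<open>t = 1\<close>
  is the class of the path \<open>s \<mapsto> exp (s X)\<close>, \<open>0 \<le> s \<le> 1\<close>.\<close>

definition SL2_cover_Exp :: "real^2^2 \<Rightarrow> (real \<Rightarrow> real^2^2) set" where
  "SL2_cover_Exp X = SL2_homotopy `` {\<lambda>s. matrix_exp (s *\<^sub>R X)}"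

definition lifts_omega ::
    "(real^'n) set \<Rightarrow> (real^'n) set \<Rightarrow> (real^'n \<Rightarrow> real) \<Rightarrow> real
      \<Rightarrow> ((real \<Rightarrow> real^2^2) set \<Rightarrow> (real^'n \<Rightarrow> complex) \<Rightarrow> (real^'n \<Rightarrow> complex)) \<Rightarrow> bool" where
  "lifts_omega R P k a \<Omega> \<longleftrightarrow>
     W_space P k a \<subseteq> L2 (theta_measure R k a) \<and>
     (\<forall>X\<in>sl2. \<forall>f\<in>W_space P k a.
        has_L2_derivative (theta_measure R k a)
          (\<lambda>t. \<Omega> (SL2_cover_Exp (t *\<^sub>R X)) f) (omega P k a X f) 0)"

end

theory Submission
  imports Defs "HOL-Complex_Analysis.Conformal_Mappings"
begin

text \<open>
  The operators \<open>\<omega>(X)\<close> look like a differential-difference representation on all functions, but on a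
  function \<open>p(x) f(u)\<close> with \<open>u = \<parallel>x\<parallel>\<^sup>a / a\<close> and a Dunkl harmonic \<open>p\<close> of degree \<open>m\<close> they reduce to ordinary
  differential operators in \<open>u\<close>: multiplication by \<open>\<i> u\<close>, the confluent operator \<open>\<i> (u f'' + \<kappa> f')\<close> and the
  Euler operator \<open>2 u f' + \<kappa> f\<close>, with \<open>\<kappa> = \<lambda> + 1\<close> (\<open>omega_gauss\<close>). These are the operators of the lowest
  weight representation of weight \<open>\<kappa>\<close>, which can be integrated explicitly in its holomorphic model: for
  \<open>\<tau>\<close> in the upper half-plane the group should send the Gaussian \<open>p(x) e\<^bsup>\<i> \<tau> u\<^esup>\<close> to
  \<open>(c \<tau> + d)\<^bsup>- \<kappa>\<^esup> p(x) e\<^bsup>\<i> (A \<tau>) u\<^esup>\<close>, where \<open>A \<tau> = (a \<tau> + b) / (c \<tau> + d)\<close>. Since \<open>\<kappa>\<close> is an arbitrary positive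
  number, the power of \<open>c \<tau> + d\<close> requires a logarithm. It is continued along paths in \<open>SL(2, \<real>)\<close> and depends
  on the homotopy class of the path only, which is why the universal cover acts.

  This prescription is unitary because of one identity. The inner product of the Gaussians with
  parameters \<open>\<tau>\<close>, \<open>\<sigma>\<close> and harmonics \<open>p\<close>, \<open>q\<close> is a constant times \<open>(- \<i> (\<tau> - cnj \<sigma>))\<^bsup>- \<kappa>\<^esup>\<close>, and vanishes if the
  degrees of \<open>p\<close> and \<open>q\<close> differ (\<open>gram_integral_eq\<close>): for real parameters this is polar coordinates
  and the orthogonality of Dunkl harmonics of different degrees (\<open>gaussian_harmonics_orthogonal\<close>),
  and it extends by holomorphy. The formula \<open>A \<tau> - cnj (A \<sigma>) = (\<tau> - cnj \<sigma>) / ((c \<tau> + d) cnj (c \<sigma> + d))\<close> then shows that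
  the Gram matrix is preserved. A map that preserves the Gram matrix of a total family
  extends uniquely to a unitary operator (locale \<open>gram_equivalent\<close>); the cocycle law for the logarithms
  makes these operators multiplicative and their strong continuity follows from continuity on the
  Gaussians (\<open>Omega_representation\<close>). To make the family total, all functions orthogonal to the Gaussians
  are added to it; the group leaves them fixed.

  It remains to differentiate. On the Gaussians \<open>p(x) e\<^bsup>- z u\<^esup>\<close> the derivative of the one-parameter group
  of \<open>X\<close> is immediate from the explicit formula (\<open>generates_gauss_0\<close>). The elements of \<open>W\<close> are combinations of the functions
  \<open>p(x) u\<^sup>j e\<^bsup>- z u\<^esup>\<close>, which arise from the Gaussians by differentiation in \<open>z\<close>, that is, as limits of difference
  quotients in \<open>L\<^sup>2\<close>. The generator of a unitary one-parameter group is closed (\<open>generates_closed\<close>), so the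
  formula for the generator may be differentiated in \<open>z\<close> as well (\<open>generates_gauss\<close>), and the result is \<open>\<omega>(X)\<close>
  (\<open>generator_eq_omega\<close>).\<close>

section \<open>Square-integrable functions\<close>

lemma borel_measurable_cnj:
  assumes "f \<in> borel_measurable M"
  shows "(\<lambda>x. cnj (f x)) \<in> borel_measurable M"
  by (rule measurable_compose[OF assms borel_measurable_continuous_onI]) (intro continuous_intros)

lemma L2_measurable: "f \<in> L2 M \<Longrightarrow> f \<in> borel_measurable M"
  by (simp add: L2_def)

lemma L2_integrable_mult:
  assumes "f \<in> L2 M" "g \<in> L2 M"
  shows "integrable M (\<lambda>x. f x * cnj (g x))"
proof (rule Bochner_Integration.integrable_bound)
  show "integrable M (\<lambda>x. (cmod (f x))\<^sup>2 + (cmod (g x))\<^sup>2)"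
    using assms by (intro Bochner_Integration.integrable_add) (auto simp: L2_def)
  show "(\<lambda>x. f x * cnj (g x)) \<in> borel_measurable M"
    by (intro borel_measurable_times borel_measurable_cnj assms[THEN L2_measurable])
  have "cmod (f x) * cmod (g x) \<le> (cmod (f x))\<^sup>2 + (cmod (g x))\<^sup>2" for x
    using sum_squares_bound[of "cmod (f x)" "cmod (g x)"]
      mult_nonneg_nonneg[OF norm_ge_zero norm_ge_zero, of "f x" "g x"] by linarith
  then show "AE x in M. norm (f x * cnj (g x)) \<le> norm ((cmod (f x))\<^sup>2 + (cmod (g x))\<^sup>2)"
    by (auto simp: norm_mult)
qed

lemma L2_cmult: "f \<in> L2 M \<Longrightarrow> (\<lambda>x. c * f x) \<in> L2 M"
  by (auto simp: L2_def norm_mult power_mult_distrib)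

lemma L2_add:
  assumes "f \<in> L2 M" "g \<in> L2 M"
  shows "(\<lambda>x. f x + g x) \<in> L2 M"
proof -
  have m: "(\<lambda>x. f x + g x) \<in> borel_measurable M"
    using assms[THEN L2_measurable] by measurable
  have "integrable M (\<lambda>x. (cmod (f x + g x))\<^sup>2)"
  proof (rule Bochner_Integration.integrable_bound)
    show "integrable M (\<lambda>x. 2 * (cmod (f x))\<^sup>2 + 2 * (cmod (g x))\<^sup>2)"
      using assms by (auto simp: L2_def)
    show "(\<lambda>x. (cmod (f x + g x))\<^sup>2) \<in> borel_measurable M" using m by measurable
    have "(cmod (f x + g x))\<^sup>2 \<le> 2 * (cmod (f x))\<^sup>2 + 2 * (cmod (g x))\<^sup>2" for x
    proof -
      have "(cmod (f x + g x))\<^sup>2 \<le> (cmod (f x) + cmod (g x))\<^sup>2"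
        by (intro power_mono norm_triangle_ineq) auto
      also have "\<dots> \<le> 2 * (cmod (f x))\<^sup>2 + 2 * (cmod (g x))\<^sup>2"
        using sum_squares_bound[of "cmod (f x)" "cmod (g x)"] by (simp add: power2_sum)
      finally show ?thesis .
    qed
    then show "AE x in M. norm ((cmod (f x + g x))\<^sup>2) \<le> norm (2 * (cmod (f x))\<^sup>2 + 2 * (cmod (g x))\<^sup>2)"
      by auto
  qed
  then show ?thesis using m by (simp add: L2_def)
qed

lemma L2_diff: "f \<in> L2 M \<Longrightarrow> g \<in> L2 M \<Longrightarrow> (\<lambda>x. f x - g x) \<in> L2 M"
  using L2_add[of f M "\<lambda>x. (-1) * g x"] L2_cmult[of g M "-1"] by simp

lemma L2_zero: "(\<lambda>x. 0) \<in> L2 M"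
  by (simp add: L2_def)

lemma L2_sum: "(\<And>i. i \<in> S \<Longrightarrow> f i \<in> L2 M) \<Longrightarrow> (\<lambda>x. \<Sum>i\<in>S. f i x) \<in> L2 M"
  by (induction S rule: infinite_finite_induct) (auto intro: L2_add L2_zero)

lemma L2_cong_AE:
  assumes "f \<in> L2 M" "g \<in> borel_measurable M" "AE x in M. f x = g x"
  shows "g \<in> L2 M"
proof -
  have "integrable M (\<lambda>x. (cmod (g x))\<^sup>2)"
    by (rule integrable_cong_AE_imp[of M "\<lambda>x. (cmod (f x))\<^sup>2"]) (use assms in \<open>auto simp: L2_def\<close>)
  then show ?thesis using assms by (simp add: L2_def)
qed

lemma L2_norm_cong_AE:
  assumes "AE x in M. f x = g x" "f \<in> borel_measurable M" "g \<in> borel_measurable M"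
  shows "L2_norm M f = L2_norm M g"
  unfolding L2_norm_def
  by (rule arg_cong[where f = sqrt], rule integral_cong_AE) (use assms in auto)

lemma L2_inner_cong_AE:
  assumes "AE x in M. f x = f' x" "AE x in M. g x = g' x"
    "f \<in> L2 M" "f' \<in> L2 M" "g \<in> L2 M" "g' \<in> L2 M"
  shows "L2_inner M f g = L2_inner M f' g'"
  unfolding L2_inner_def
proof (rule integral_cong_AE)
  show "(\<lambda>x. f x * cnj (g x)) \<in> borel_measurable M" "(\<lambda>x. f' x * cnj (g' x)) \<in> borel_measurable M"
    by (intro borel_measurable_times borel_measurable_cnj assms(3-6)[THEN L2_measurable])+
  show "AE x in M. f x * cnj (g x) = f' x * cnj (g' x)"
    using assms(1,2) by auto
qed

lemma L2_inner_add_left: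
  "f \<in> L2 M \<Longrightarrow> g \<in> L2 M \<Longrightarrow> h \<in> L2 M \<Longrightarrow>
    L2_inner M (\<lambda>x. f x + g x) h = L2_inner M f h + L2_inner M g h"
  unfolding L2_inner_def distrib_right
  by (rule Bochner_Integration.integral_add) (auto intro: L2_integrable_mult)

lemma L2_inner_cmult_left: "L2_inner M (\<lambda>x. c * f x) h = c * L2_inner M f h"
  unfolding L2_inner_def by (simp add: mult.assoc)

lemma L2_inner_cnj: "L2_inner M g f = cnj (L2_inner M f g)"
proof -
  have "cnj (L2_inner M f g) = (\<integral>x. cnj (f x * cnj (g x)) \<partial>M)"
    unfolding L2_inner_def by (rule Bochner_Integration.integral_cnj[symmetric])
  then show ?thesis by (simp add: L2_inner_def mult.commute)
qed

lemma L2_inner_add_right: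
  "f \<in> L2 M \<Longrightarrow> g \<in> L2 M \<Longrightarrow> h \<in> L2 M \<Longrightarrow>
    L2_inner M h (\<lambda>x. f x + g x) = L2_inner M h f + L2_inner M h g"
  unfolding L2_inner_def complex_cnj_add distrib_left
  by (rule Bochner_Integration.integral_add) (auto intro: L2_integrable_mult)

lemma L2_inner_cmult_right: "L2_inner M h (\<lambda>x. c * f x) = cnj c * L2_inner M h f"
  unfolding L2_inner_def by (simp add: mult.left_commute)

lemma L2_inner_diff_left:
  "f \<in> L2 M \<Longrightarrow> g \<in> L2 M \<Longrightarrow> h \<in> L2 M \<Longrightarrow>
    L2_inner M (\<lambda>x. f x - g x) h = L2_inner M f h - L2_inner M g h"
  using L2_inner_add_left[of f M "\<lambda>x. (-1) * g x" h] L2_cmult[of g M "-1"]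
  by (simp only: L2_inner_cmult_left) simp

lemma L2_inner_diff_right:
  "f \<in> L2 M \<Longrightarrow> g \<in> L2 M \<Longrightarrow> h \<in> L2 M \<Longrightarrow>
    L2_inner M h (\<lambda>x. f x - g x) = L2_inner M h f - L2_inner M h g"
  unfolding L2_inner_def complex_cnj_diff right_diff_distrib
  by (rule Bochner_Integration.integral_diff) (auto intro: L2_integrable_mult)

lemma L2_inner_zero_left: "L2_inner M (\<lambda>x. 0) h = 0"
  by (simp add: L2_inner_def)

lemma L2_inner_sum_left:
  "(\<And>i. i \<in> S \<Longrightarrow> f i \<in> L2 M) \<Longrightarrow> h \<in> L2 M \<Longrightarrow>
    L2_inner M (\<lambda>x. \<Sum>i\<in>S. c i * f i x) h = (\<Sum>i\<in>S. c i * L2_inner M (f i) h)"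
  by (induction S rule: infinite_finite_induct)
    (auto simp: L2_inner_zero_left L2_inner_add_left L2_inner_cmult_left L2_cmult L2_sum)

lemma L2_inner_sum_right:
  "(\<And>i. i \<in> S \<Longrightarrow> f i \<in> L2 M) \<Longrightarrow> h \<in> L2 M \<Longrightarrow>
    L2_inner M h (\<lambda>x. \<Sum>i\<in>S. c i * f i x) = (\<Sum>i\<in>S. cnj (c i) * L2_inner M h (f i))"
  by (induction S rule: infinite_finite_induct)
    (auto simp: L2_inner_def[of M h "\<lambda>x. 0"] L2_inner_add_right L2_inner_cmult_right L2_cmult L2_sum)

lemma L2_norm_nonneg: "L2_norm M f \<ge> 0"
  by (simp add: L2_norm_def)

lemma L2_inner_self: "L2_inner M f f = of_real ((L2_norm M f)\<^sup>2)"
proof -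
  have "L2_inner M f f = (\<integral>x. of_real ((cmod (f x))\<^sup>2) \<partial>M)"
    unfolding L2_inner_def by (simp only: complex_norm_square)
  also have "\<dots> = of_real (\<integral>x. (cmod (f x))\<^sup>2 \<partial>M)" by (rule integral_complex_of_real)
  finally show ?thesis by (simp add: L2_norm_def)
qed

lemma L2_norm_sq: "(L2_norm M f)\<^sup>2 = Re (L2_inner M f f)"
  by (simp add: L2_inner_self)

lemma L2_norm_cmult: "L2_norm M (\<lambda>x. c * f x) = cmod c * L2_norm M f"
  unfolding L2_norm_def by (simp add: norm_mult power_mult_distrib real_sqrt_mult)

lemma L2_norm_uminus: "L2_norm M (\<lambda>x. - f x) = L2_norm M f"
  by (simp add: L2_norm_def)

lemma L2_norm_minus_commute: "L2_norm M (\<lambda>x. f x - g x) = L2_norm M (\<lambda>x. g x - f x)"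
  by (simp add: L2_norm_def norm_minus_commute)

lemma L2_norm_zero: "L2_norm M (\<lambda>x. 0) = 0"
  by (simp add: L2_norm_def)

lemma L2_norm_add_cmult_sq:
  assumes "f \<in> L2 M" "g \<in> L2 M"
  shows "(L2_norm M (\<lambda>x. f x + c * g x))\<^sup>2
    = (L2_norm M f)\<^sup>2 + 2 * Re (cnj c * L2_inner M f g) + (cmod c)\<^sup>2 * (L2_norm M g)\<^sup>2"
proof -
  have "L2_inner M (\<lambda>x. f x + c * g x) (\<lambda>x. f x + c * g x) =
     L2_inner M f f + (cnj c * L2_inner M f g + cnj (cnj c * L2_inner M f g)) + c * cnj c * L2_inner M g g"
    using assms L2_inner_cnj[of M g f]
    by (simp add: L2_inner_add_left L2_inner_add_right L2_add L2_cmult L2_inner_cmult_left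
      L2_inner_cmult_right algebra_simps)
  then have "Re (L2_inner M (\<lambda>x. f x + c * g x) (\<lambda>x. f x + c * g x)) =
     Re (L2_inner M f f) + 2 * Re (cnj c * L2_inner M f g) + Re (c * cnj c * L2_inner M g g)"
    by (simp only: plus_complex.sel complex_cnj_cancel_iff) simp
  moreover have "Re (c * cnj c * L2_inner M g g) = (cmod c)\<^sup>2 * (L2_norm M g)\<^sup>2"
    by (simp add: L2_inner_self cmod_def power2_eq_square)
  ultimately show ?thesis by (simp add: L2_norm_sq)
qed

lemma L2_Cauchy_Schwarz:
  assumes "f \<in> L2 M" "g \<in> L2 M"
  shows "cmod (L2_inner M f g) \<le> L2_norm M f * L2_norm M g"
proof -
  define c where "c = L2_inner M f g"
  define F where "F = (L2_norm M f)\<^sup>2"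
  define G where "G = (L2_norm M g)\<^sup>2"
  have FG: "F \<ge> 0" "G \<ge> 0" by (auto simp: F_def G_def)
  \<comment> \<open>The square of the norm of \<open>f - t c g\<close>; the choice \<open>t = 1 / G\<close> gives the inequality, and for \<open>G = 0\<close> a
    large \<open>t\<close> shows \<open>c = 0\<close>.\<close>
  have key: "0 \<le> F - 2 * t * (cmod c)\<^sup>2 + t\<^sup>2 * (cmod c)\<^sup>2 * G" for t :: real
  proof -
    have "Re (cnj (- (of_real t * c)) * c) = - (t * (cmod c)\<^sup>2)"
      by (simp add: cmod_def power2_eq_square algebra_simps)
    moreover have "(cmod (- (of_real t * c)))\<^sup>2 = t\<^sup>2 * (cmod c)\<^sup>2"
      by (simp add: norm_mult power_mult_distrib)
    moreover have "0 \<le> F + 2 * Re (cnj (- (of_real t * c)) * c) + (cmod (- (of_real t * c)))\<^sup>2 * G"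
      using L2_norm_add_cmult_sq[OF assms, of "- (of_real t * c)"]
        zero_le_power2[of "L2_norm M (\<lambda>x. f x + - (of_real t * c) * g x)"]
      unfolding c_def F_def G_def by linarith
    ultimately show ?thesis by simp
  qed
  have "(cmod c)\<^sup>2 \<le> F * G"
  proof (cases "G = 0")
    case True
    have "cmod c = 0"
    proof (rule ccontr)
      assume "cmod c \<noteq> 0"
      then have "2 * ((F + 1) / (2 * (cmod c)\<^sup>2)) * (cmod c)\<^sup>2 = F + 1" by (simp add: field_simps)
      with key[of "(F + 1) / (2 * (cmod c)\<^sup>2)"] True show False by simp
    qed
    then show ?thesis using FG by simp
  next
    case False
    then have "G > 0" using FG by simp
    have "0 \<le> F - 2 * (1/G) * (cmod c)\<^sup>2 + (1/G)\<^sup>2 * (cmod c)\<^sup>2 * G" by (rule key)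
    also have "\<dots> = F - (cmod c)\<^sup>2 / G" using \<open>G > 0\<close> by (simp add: power2_eq_square field_simps)
    finally show ?thesis using \<open>G > 0\<close> by (simp add: field_simps)
  qed
  then have "(cmod c)\<^sup>2 \<le> (L2_norm M f * L2_norm M g)\<^sup>2"
    by (simp add: F_def G_def power_mult_distrib)
  then show ?thesis unfolding c_def
    by (rule power2_le_imp_le) (simp add: L2_norm_nonneg)
qed

lemma L2_norm_triangle:
  assumes "f \<in> L2 M" "g \<in> L2 M"
  shows "L2_norm M (\<lambda>x. f x + g x) \<le> L2_norm M f + L2_norm M g"
proof -
  have "(L2_norm M (\<lambda>x. f x + g x))\<^sup>2 = (L2_norm M f)\<^sup>2 + 2 * Re (L2_inner M f g) + (L2_norm M g)\<^sup>2"
    using L2_norm_add_cmult_sq[OF assms, of 1] by simp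
  also have "Re (L2_inner M f g) \<le> L2_norm M f * L2_norm M g"
    using L2_Cauchy_Schwarz[OF assms] complex_Re_le_cmod order_trans by blast
  then have "(L2_norm M f)\<^sup>2 + 2 * Re (L2_inner M f g) + (L2_norm M g)\<^sup>2 \<le> (L2_norm M f + L2_norm M g)\<^sup>2"
    by (simp add: power2_sum)
  finally show ?thesis by (rule power2_le_imp_le) (simp add: L2_norm_nonneg)
qed

lemma L2_norm_triangle_diff:
  assumes "f \<in> L2 M" "g \<in> L2 M" "h \<in> L2 M"
  shows "L2_norm M (\<lambda>x. f x - h x) \<le> L2_norm M (\<lambda>x. f x - g x) + L2_norm M (\<lambda>x. g x - h x)"
  using L2_norm_triangle[OF L2_diff[OF assms(1,2)] L2_diff[OF assms(2,3)]] by simp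

lemma L2_norm_sum:
  "(\<And>i. i \<in> S \<Longrightarrow> f i \<in> L2 M) \<Longrightarrow>
    L2_norm M (\<lambda>x. \<Sum>i\<in>S. f i x) \<le> (\<Sum>i\<in>S. L2_norm M (f i))"
  by (induction S rule: infinite_finite_induct)
    (auto simp: L2_norm_zero intro!: L2_sum order_trans[OF L2_norm_triangle])

lemma L2_norm_eq_0_iff:
  assumes "f \<in> L2 M"
  shows "L2_norm M f = 0 \<longleftrightarrow> (AE x in M. f x = 0)"
  using assms by (simp add: L2_norm_def L2_def integral_nonneg_eq_0_iff_AE)

lemma L2_nn_integral:
  assumes "f \<in> L2 M"
  shows "(\<integral>\<^sup>+x. ennreal ((cmod (f x))\<^sup>2) \<partial>M) = ennreal ((L2_norm M f)\<^sup>2)"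
  using assms by (simp add: L2_def L2_norm_def nn_integral_eq_integral)

lemma L2_if_nn_integral_le:
  assumes "f \<in> borel_measurable M" "(\<integral>\<^sup>+x. ennreal ((cmod (f x))\<^sup>2) \<partial>M) \<le> ennreal (B\<^sup>2)" "B \<ge> 0"
  shows "f \<in> L2 M \<and> L2_norm M f \<le> B"
proof -
  have "f \<in> L2 M" unfolding L2_def
    using assms by (auto simp: integrable_iff_bounded ennreal_less_top le_less_trans)
  moreover from this have "(L2_norm M f)\<^sup>2 \<le> B\<^sup>2"
    using L2_nn_integral[of f M] assms by (simp)
  ultimately show ?thesis using assms(3) power2_le_imp_le by blast
qed

section \<open>Completeness and total families\<close>

lemma ennreal_le_suminf: "f i \<le> (\<Sum>i. f i :: ennreal)"
  using sum_le_suminf[of f "{i}"] by simp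

text \<open>Riesz--Fischer. Along a subsequence whose increments \<open>d\<^sub>i\<close> have norm at most \<open>2\<^bsup>-i\<^esup>\<close> the series of
  \<open>2\<^sup>i \<bar>d\<^sub>i\<bar>\<^sup>2\<close> has finite integral, hence the subsequence converges almost everywhere; the lemma of
  Fatou identifies the pointwise limit as the limit in norm.\<close>

lemma L2_complete:
  assumes F: "\<And>n. F n \<in> L2 M"
    and Cauchy: "\<And>\<epsilon>. \<epsilon> > 0 \<Longrightarrow> \<exists>N. \<forall>m\<ge>N. \<forall>n\<ge>N. L2_norm M (\<lambda>x. F m x - F n x) < \<epsilon>"
  shows "\<exists>f\<in>L2 M. (\<lambda>n. L2_norm M (\<lambda>x. F n x - f x)) \<longlonglongrightarrow> 0"
proof -
  have "\<forall>i. \<exists>N. \<forall>m\<ge>N. \<forall>n\<ge>N. L2_norm M (\<lambda>x. F m x - F n x) < (1/2) ^ i"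
    by (intro allI Cauchy) simp
  then obtain N where N: "\<And>i m n. m \<ge> N i \<Longrightarrow> n \<ge> N i \<Longrightarrow> L2_norm M (\<lambda>x. F m x - F n x) < (1/2) ^ i"
    by metis
  define r where "r i = i + (\<Sum>j\<le>i. N j)" for i
  have r_ge: "r i \<ge> N i" "r i \<ge> i" for i
    unfolding r_def by (auto intro: trans_le_add2 member_le_sum)
  have r_mono: "r (Suc i) \<ge> r i" for i by (simp add: r_def)
  define G where "G i = F (r i)" for i
  have G: "G i \<in> L2 M" for i by (simp add: G_def F)
  define d where "d i x = G (Suc i) x - G i x" for i x
  have d: "d i \<in> L2 M" for i unfolding d_def by (intro L2_diff G)
  have d_norm: "L2_norm M (d i) \<le> (1/2) ^ i" for i
    unfolding d_def G_def using N[of i "r (Suc i)" "r i"] r_ge(1)[of i] r_mono[of i] by force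
  note [measurable] = d[THEN L2_measurable] G[THEN L2_measurable] F[THEN L2_measurable]
  have "(\<integral>\<^sup>+x. (\<Sum>i. ennreal (2 ^ i * (cmod (d i x))\<^sup>2)) \<partial>M) = (\<Sum>i. \<integral>\<^sup>+x. ennreal (2 ^ i * (cmod (d i x))\<^sup>2) \<partial>M)"
    by (rule nn_integral_suminf) measurable
  also have "\<dots> \<le> (\<Sum>i. ennreal ((1/2) ^ i))"
  proof (rule suminf_le)
    fix i
    have "(\<integral>\<^sup>+x. ennreal (2 ^ i * (cmod (d i x))\<^sup>2) \<partial>M) = ennreal (2 ^ i) * ennreal ((L2_norm M (d i))\<^sup>2)"
      by (simp add: ennreal_mult nn_integral_cmult L2_nn_integral[OF d])
    also have "\<dots> = ennreal (2 ^ i * (L2_norm M (d i))\<^sup>2)" by (simp add: ennreal_mult)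
    also have "\<dots> \<le> ennreal ((1/2) ^ i)"
    proof (rule ennreal_leI)
      have "(L2_norm M (d i))\<^sup>2 \<le> ((1/2) ^ i)\<^sup>2" by (intro power_mono d_norm L2_norm_nonneg)
      then have "2 ^ i * (L2_norm M (d i))\<^sup>2 \<le> 2 ^ i * ((1/2) ^ i)\<^sup>2" by simp
      also have "\<dots> = (1/2::real) ^ i" by (simp add: power_divide power2_eq_square)
      finally show "2 ^ i * (L2_norm M (d i))\<^sup>2 \<le> (1/2) ^ i" .
    qed
    finally show "(\<integral>\<^sup>+x. ennreal (2 ^ i * (cmod (d i x))\<^sup>2) \<partial>M) \<le> ennreal ((1/2) ^ i)" .
  qed auto
  also have "\<dots> = ennreal (\<Sum>i. (1/2) ^ i)" by (rule suminf_ennreal2) (auto intro: summable_geometric)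
  finally have "(\<integral>\<^sup>+x. (\<Sum>i. ennreal (2 ^ i * (cmod (d i x))\<^sup>2)) \<partial>M) \<noteq> \<infinity>"
    by (auto simp: top_unique)
  then have AE_fin: "AE x in M. (\<Sum>i. ennreal (2 ^ i * (cmod (d i x))\<^sup>2)) \<noteq> \<infinity>"
    by (intro nn_integral_PInf_AE) measurable
  have AE_conv: "AE x in M. convergent (\<lambda>i. G i x)"
    using AE_fin
  proof eventually_elim
    case (elim x)
    define s where "s = (\<Sum>i. ennreal (2 ^ i * (cmod (d i x))\<^sup>2))"
    have "s \<noteq> \<infinity>" using elim unfolding s_def .
    then obtain C where "s = ennreal C" and C0: "C \<ge> 0" by (cases s) auto
    then have C: "(\<Sum>i. ennreal (2 ^ i * (cmod (d i x))\<^sup>2)) = ennreal C" by (simp only: s_def)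
    have bound: "cmod (d i x) \<le> sqrt C * (1 / sqrt 2) ^ i" for i
    proof -
      have "ennreal (2 ^ i * (cmod (d i x))\<^sup>2) \<le> (\<Sum>i. ennreal (2 ^ i * (cmod (d i x))\<^sup>2))"
        by (rule ennreal_le_suminf)
      then have "ennreal (2 ^ i * (cmod (d i x))\<^sup>2) \<le> ennreal C" by (simp only: C)
      then have "2 ^ i * (cmod (d i x))\<^sup>2 \<le> C" using C0 by simp
      then have "(cmod (d i x))\<^sup>2 \<le> C / 2 ^ i" by (simp add: field_simps)
      then have "cmod (d i x) \<le> sqrt (C / 2 ^ i)" by (rule real_le_rsqrt)
      then show ?thesis by (simp add: real_sqrt_divide real_sqrt_power power_divide)
    qed
    have "summable (\<lambda>i. d i x)"
    proof (rule summable_comparison_test')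
      show "summable (\<lambda>i. sqrt C * (1 / sqrt 2) ^ i)"
        by (intro summable_mult summable_geometric) simp
    qed (use bound in auto)
    then have "convergent (\<lambda>n. \<Sum>i<n. d i x)" by (simp add: summable_iff_convergent)
    moreover have "(\<Sum>i<n. d i x) = G n x - G 0 x" for n
      unfolding d_def by (rule sum_lessThan_telescope)
    ultimately have "convergent (\<lambda>n. G n x - G 0 x)" by simp
    then show ?case using convergent_diff_const_right_iff by blast
  qed
  define f where "f x = lim (\<lambda>i. G i x)" for x
  have f_meas [measurable]: "f \<in> borel_measurable M" unfolding f_def by measurable
  have AE_lim: "AE x in M. (\<lambda>i. G i x) \<longlonglongrightarrow> f x"
    using AE_conv by eventually_elim (auto simp: f_def convergent_LIMSEQ_iff)
  have key: "(\<lambda>x. F n x - f x) \<in> L2 M \<and> L2_norm M (\<lambda>x. F n x - f x) \<le> \<epsilon>"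
    if \<epsilon>: "\<epsilon> > 0" and n: "\<And>m. m \<ge> K \<Longrightarrow> L2_norm M (\<lambda>x. F n x - F m x) < \<epsilon>" for n \<epsilon> K
  proof (rule L2_if_nn_integral_le)
    have "(\<integral>\<^sup>+x. ennreal ((cmod (F n x - f x))\<^sup>2) \<partial>M)
        = (\<integral>\<^sup>+x. liminf (\<lambda>i. ennreal ((cmod (F n x - G i x))\<^sup>2)) \<partial>M)"
    proof (rule nn_integral_cong_AE)
      show "AE x in M. ennreal ((cmod (F n x - f x))\<^sup>2) = liminf (\<lambda>i. ennreal ((cmod (F n x - G i x))\<^sup>2))"
        using AE_lim
      proof eventually_elim
        case (elim x)
        then have "(\<lambda>i. ennreal ((cmod (F n x - G i x))\<^sup>2)) \<longlonglongrightarrow> ennreal ((cmod (F n x - f x))\<^sup>2)"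
          by (intro tendsto_intros)
        then show ?case by (rule lim_imp_Liminf[OF trivial_limit_sequentially, symmetric])
      qed
    qed
    also have "\<dots> \<le> liminf (\<lambda>i. \<integral>\<^sup>+x. ennreal ((cmod (F n x - G i x))\<^sup>2) \<partial>M)"
      by (rule nn_integral_liminf) measurable
    also have "\<dots> \<le> liminf (\<lambda>i. ennreal (\<epsilon>\<^sup>2))"
    proof (rule Liminf_mono)
      show "\<forall>\<^sub>F i in sequentially. (\<integral>\<^sup>+x. ennreal ((cmod (F n x - G i x))\<^sup>2) \<partial>M) \<le> ennreal (\<epsilon>\<^sup>2)"
        unfolding eventually_sequentially
      proof (intro exI allI impI)
        fix i assume "K \<le> i"
        then have "r i \<ge> K" using r_ge(2)[of i] by simp
        from n[OF this] have "L2_norm M (\<lambda>x. F n x - G i x) \<le> \<epsilon>" by (simp add: G_def)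
        then show "(\<integral>\<^sup>+x. ennreal ((cmod (F n x - G i x))\<^sup>2) \<partial>M) \<le> ennreal (\<epsilon>\<^sup>2)"
          by (subst L2_nn_integral) (auto intro!: L2_diff F G ennreal_leI power_mono L2_norm_nonneg)
      qed
    qed
    also have "\<dots> = ennreal (\<epsilon>\<^sup>2)" by (simp add: Liminf_const)
    finally show "(\<integral>\<^sup>+x. ennreal ((cmod (F n x - f x))\<^sup>2) \<partial>M) \<le> ennreal (\<epsilon>\<^sup>2)" .
  qed (use \<epsilon> in auto)
  have lim: "(\<lambda>n. L2_norm M (\<lambda>x. F n x - f x)) \<longlonglongrightarrow> 0"
  proof (rule LIMSEQ_I)
    fix \<epsilon> :: real assume "\<epsilon> > 0"
    then obtain K where K: "\<And>m n. m \<ge> K \<Longrightarrow> n \<ge> K \<Longrightarrow> L2_norm M (\<lambda>x. F m x - F n x) < \<epsilon> / 2"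
      using Cauchy[of "\<epsilon> / 2"] by auto
    have "norm (L2_norm M (\<lambda>x. F n x - f x) - 0) < \<epsilon>" if "n \<ge> K" for n
    proof -
      have "L2_norm M (\<lambda>x. F n x - f x) \<le> \<epsilon> / 2"
        using key[of "\<epsilon> / 2" K n] K that \<open>\<epsilon> > 0\<close> by auto
      then show ?thesis using \<open>\<epsilon> > 0\<close> L2_norm_nonneg[of M "\<lambda>x. F n x - f x"] by simp
    qed
    then show "\<exists>no. \<forall>n\<ge>no. norm (L2_norm M (\<lambda>x. F n x - f x) - 0) < \<epsilon>" by blast
  qed
  obtain K where "\<And>m n. m \<ge> K \<Longrightarrow> n \<ge> K \<Longrightarrow> L2_norm M (\<lambda>x. F m x - F n x) < 1"
    using Cauchy[of 1] by auto
  then have "(\<lambda>x. F K x - f x) \<in> L2 M" using key[of 1 K K] by auto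
  from L2_diff[OF F[of K] this] have "f \<in> L2 M" by simp
  with lim show ?thesis by blast
qed

definition L2_total :: "'x measure \<Rightarrow> ('i \<Rightarrow> 'x \<Rightarrow> complex) \<Rightarrow> 'i set \<Rightarrow> bool" where
  "L2_total M e I \<longleftrightarrow>
     (\<forall>f\<in>L2 M. \<forall>\<epsilon>>0. \<exists>S c. finite S \<and> S \<subseteq> I \<and> L2_norm M (\<lambda>x. f x - (\<Sum>i\<in>S. c i * e i x)) < \<epsilon>)"

lemma L2_parallelogram:
  assumes "f \<in> L2 M" "g \<in> L2 M"
  shows "(L2_norm M (\<lambda>x. f x + g x))\<^sup>2 + (L2_norm M (\<lambda>x. f x - g x))\<^sup>2
    = 2 * (L2_norm M f)\<^sup>2 + 2 * (L2_norm M g)\<^sup>2"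
  using L2_norm_add_cmult_sq[OF assms, of 1] L2_norm_add_cmult_sq[OF assms, of "-1"] by simp

lemma L2_best_approximation_orthogonal:
  assumes f: "f \<in> L2 M" and g: "g \<in> L2 M"
    and min: "\<And>c. L2_norm M f \<le> L2_norm M (\<lambda>x. f x + c * g x)"
  shows "L2_inner M f g = 0"
proof (rule ccontr)
  assume "L2_inner M f g \<noteq> 0"
  define b where "b = L2_inner M f g"
  define t where "t = 1 / (1 + (L2_norm M g)\<^sup>2)"
  have t: "t > 0" "t * (L2_norm M g)\<^sup>2 < 1" "t \<le> 1"
    unfolding t_def by (auto simp: field_simps add_pos_nonneg)
  have b: "(cmod b)\<^sup>2 > 0" using \<open>L2_inner M f g \<noteq> 0\<close> by (simp add: b_def)
  have "(L2_norm M f)\<^sup>2 \<le> (L2_norm M (\<lambda>x. f x + (- (of_real t * b)) * g x))\<^sup>2"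
    by (intro power_mono min L2_norm_nonneg)
  also have "\<dots> = (L2_norm M f)\<^sup>2 + 2 * Re (cnj (- (of_real t * b)) * b) + (cmod (of_real t * b))\<^sup>2 * (L2_norm M g)\<^sup>2"
    using L2_norm_add_cmult_sq[OF f g, of "- (of_real t * b)"] by (simp add: b_def)
  also have "Re (cnj (- (of_real t * b)) * b) = - (t * (cmod b)\<^sup>2)"
    by (simp add: cmod_def power2_eq_square algebra_simps)
  also have "(cmod (of_real t * b))\<^sup>2 = t * t * (cmod b)\<^sup>2"
    by (simp add: norm_mult power_mult_distrib power2_eq_square)
  finally have "2 * (t * (cmod b)\<^sup>2) \<le> (t * (cmod b)\<^sup>2) * (t * (L2_norm M g)\<^sup>2)"
    by (simp add: algebra_simps)
  moreover have "(t * (cmod b)\<^sup>2) * (t * (L2_norm M g)\<^sup>2) \<le> (t * (cmod b)\<^sup>2) * 1"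
    by (intro mult_left_mono) (use t b in auto)
  ultimately show False using t b by simp
qed

text \<open>In a complete space, a family to which only null functions are orthogonal has dense span: the
  difference between a function and its best approximation from the closed span is orthogonal to the
  family.\<close>

lemma L2_total_if_only_null_orthogonal:
  assumes e: "\<And>i. i \<in> I \<Longrightarrow> e i \<in> L2 M"
    and null: "\<And>u. u \<in> L2 M \<Longrightarrow> (\<And>i. i \<in> I \<Longrightarrow> L2_inner M u (e i) = 0) \<Longrightarrow> L2_norm M u = 0"
  shows "L2_total M e I"
  unfolding L2_total_def
proof (intro ballI allI impI)
  fix f and \<epsilon> :: real
  assume f: "f \<in> L2 M" and \<epsilon>: "\<epsilon> > 0"
  define V where "V = {(\<lambda>x. \<Sum>i\<in>S. c i * e i x) | S c. finite S \<and> S \<subseteq> I}"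
  have V_L2: "V \<subseteq> L2 M" unfolding V_def using e by (auto intro!: L2_sum L2_cmult)
  have V_add: "(\<lambda>x. v x + a * w x) \<in> V" if "v \<in> V" "w \<in> V" for v w a
  proof -
    from that obtain S c T b where *: "v = (\<lambda>x. \<Sum>i\<in>S. c i * e i x)" "finite S" "S \<subseteq> I"
      "w = (\<lambda>x. \<Sum>i\<in>T. b i * e i x)" "finite T" "T \<subseteq> I" by (auto simp: V_def)
    have "v x + a * w x = (\<Sum>i\<in>S \<union> T. ((if i \<in> S then c i else 0) + a * (if i \<in> T then b i else 0)) * e i x)" for x
    proof -
      have "v x = (\<Sum>i\<in>S \<union> T. (if i \<in> S then c i else 0) * e i x)"
        unfolding * by (rule sum.mono_neutral_cong_left) (use * in auto)
      moreover have "w x = (\<Sum>i\<in>S \<union> T. (if i \<in> T then b i else 0) * e i x)"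
        unfolding * by (rule sum.mono_neutral_cong_left) (use * in auto)
      ultimately show ?thesis by (simp add: sum_distrib_left sum.distrib distrib_right mult.assoc)
    qed
    then show ?thesis unfolding V_def
      using * by (auto intro!: exI[of _ "S \<union> T"] exI[of _ "\<lambda>i. (if i \<in> S then c i else 0) + a * (if i \<in> T then b i else 0)"])
  qed
  have V0: "(\<lambda>x. 0) \<in> V" unfolding V_def by (auto intro: exI[of _ "{}"])
  have V_e: "e i \<in> V" if "i \<in> I" for i unfolding V_def
    using that by (auto intro!: exI[of _ "{i}"] exI[of _ "\<lambda>_. 1"])
  define D where "D = (\<lambda>v. L2_norm M (\<lambda>x. f x - v x)) ` V"
  define \<delta> where "\<delta> = Inf D"
  have D: "D \<noteq> {}" "bdd_below D" unfolding D_def using V0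
    by (auto intro!: bdd_belowI[of _ 0] L2_norm_nonneg)
  have \<delta>_le: "\<delta> \<le> L2_norm M (\<lambda>x. f x - v x)" if "v \<in> V" for v
    unfolding \<delta>_def by (rule cInf_lower) (use that D in \<open>auto simp: D_def\<close>)
  have \<delta>0: "\<delta> \<ge> 0" unfolding \<delta>_def using D by (intro cInf_greatest) (auto simp: D_def L2_norm_nonneg)
  have "\<exists>v\<in>V. L2_norm M (\<lambda>x. f x - v x) < \<delta> + 1 / Suc n" for n
    using cInf_lessD[OF D(1), of "\<delta> + 1 / Suc n"] by (auto simp: \<delta>_def D_def)
  then obtain v where v: "\<And>n. v n \<in> V" "\<And>n. L2_norm M (\<lambda>x. f x - v n x) < \<delta> + 1 / Suc n" by metis
  have vL: "v n \<in> L2 M" for n using v V_L2 by auto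
  have bound: "(L2_norm M (\<lambda>x. v m x - v n x))\<^sup>2 \<le> (8 * \<delta> + 4) / Suc N"
    if "m \<ge> N" "n \<ge> N" for m n N
  proof -
    have "(L2_norm M (\<lambda>x. (f x - v n x) + (f x - v m x)))\<^sup>2 + (L2_norm M (\<lambda>x. (f x - v n x) - (f x - v m x)))\<^sup>2
       = 2 * (L2_norm M (\<lambda>x. f x - v n x))\<^sup>2 + 2 * (L2_norm M (\<lambda>x. f x - v m x))\<^sup>2"
      by (rule L2_parallelogram) (intro L2_diff f vL)+
    moreover have "(L2_norm M (\<lambda>x. (f x - v n x) + (f x - v m x)))\<^sup>2 \<ge> (2 * \<delta>)\<^sup>2"
    proof (rule power_mono)
      have "(\<lambda>x. (1/2) * ((0 + 1 * v n x) + 1 * v m x)) \<in> V"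
        using V_add[OF V0 V_add[OF V_add[OF V0 v(1)] v(1)], of "1/2" 1 n 1 m] by simp
      from \<delta>_le[OF this] have "2 * \<delta> \<le> 2 * L2_norm M (\<lambda>x. f x - (1/2) * ((0 + 1 * v n x) + 1 * v m x))" by simp
      also have "\<dots> = L2_norm M (\<lambda>x. 2 * (f x - (1/2) * ((0 + 1 * v n x) + 1 * v m x)))"
        by (subst L2_norm_cmult) simp
      also have "\<dots> = L2_norm M (\<lambda>x. (f x - v n x) + (f x - v m x))"
        by (rule arg_cong[where f = "L2_norm M"]) (auto simp: field_simps)
      finally show "2 * \<delta> \<le> L2_norm M (\<lambda>x. (f x - v n x) + (f x - v m x))" .
    qed (use \<delta>0 in auto)
    moreover have "(L2_norm M (\<lambda>x. f x - v i x))\<^sup>2 \<le> \<delta>\<^sup>2 + (2 * \<delta> + 1) / Suc N" if "i \<ge> N" for i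
    proof -
      have "L2_norm M (\<lambda>x. f x - v i x) \<le> \<delta> + 1 / Suc i" using v(2)[of i] by simp
      also have "\<dots> \<le> \<delta> + 1 / Suc N" using that by (simp add: frac_le)
      finally have "(L2_norm M (\<lambda>x. f x - v i x))\<^sup>2 \<le> (\<delta> + 1 / Suc N)\<^sup>2"
        by (intro power_mono L2_norm_nonneg)
      also have "\<dots> = \<delta>\<^sup>2 + (2 * \<delta> + 1 / Suc N) * (1 / Suc N)"
        by (simp add: power2_eq_square algebra_simps)
      also have "\<dots> \<le> \<delta>\<^sup>2 + (2 * \<delta> + 1) * (1 / Suc N)"
        by (intro add_left_mono mult_right_mono) (auto simp: field_simps)
      finally show ?thesis by simp
    qed
    from this[OF that(1)] this[OF that(2)]
    have "2 * (L2_norm M (\<lambda>x. f x - v n x))\<^sup>2 + 2 * (L2_norm M (\<lambda>x. f x - v m x))\<^sup>2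
      \<le> 4 * \<delta>\<^sup>2 + 4 * ((2 * \<delta> + 1) / Suc N)" by linarith
    moreover have "4 * ((2 * \<delta> + 1) / Suc N) = (8 * \<delta> + 4) / Suc N" by (simp add: field_simps)
    moreover have "(2 * \<delta>)\<^sup>2 = 4 * \<delta>\<^sup>2" by (simp add: power_mult_distrib)
    moreover have "(L2_norm M (\<lambda>x. (f x - v n x) - (f x - v m x)))\<^sup>2 = (L2_norm M (\<lambda>x. v m x - v n x))\<^sup>2"
      by (rule arg_cong[where f = "\<lambda>h. (L2_norm M h)\<^sup>2"]) auto
    ultimately show ?thesis by linarith
  qed
  have "\<exists>w\<in>L2 M. (\<lambda>n. L2_norm M (\<lambda>x. v n x - w x)) \<longlonglongrightarrow> 0"
  proof (rule L2_complete[OF vL])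
    fix \<eta> :: real assume \<eta>: "\<eta> > 0"
    obtain N :: nat where "(8 * \<delta> + 4) / \<eta>\<^sup>2 < N" using reals_Archimedean2 by blast
    then have "(8 * \<delta> + 4) / Suc N < \<eta>\<^sup>2" using \<eta> by (simp add: field_simps) (smt (verit) mult_nonneg_nonneg zero_le_power2)
    then have "L2_norm M (\<lambda>x. v m x - v n x) < \<eta>" if "m \<ge> N" "n \<ge> N" for m n
      using bound[OF that] \<eta> by (intro power2_less_imp_less[of _ \<eta>]) auto
    then show "\<exists>N. \<forall>m\<ge>N. \<forall>n\<ge>N. L2_norm M (\<lambda>x. v m x - v n x) < \<eta>" by blast
  qed
  then obtain w where w: "w \<in> L2 M" "(\<lambda>n. L2_norm M (\<lambda>x. v n x - w x)) \<longlonglongrightarrow> 0" by blast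
  have le: "L2_norm M (\<lambda>x. f x - w x) \<le> \<delta>"
  proof (rule LIMSEQ_le_const)
    show "(\<lambda>n. (\<delta> + 1 / Suc n) + L2_norm M (\<lambda>x. v n x - w x)) \<longlonglongrightarrow> \<delta>"
      using tendsto_add[OF tendsto_add[OF tendsto_const LIMSEQ_inverse_real_of_nat] w(2), of \<delta>]
      by (simp add: inverse_eq_divide)
    show "\<exists>N. \<forall>n\<ge>N. L2_norm M (\<lambda>x. f x - w x) \<le> (\<delta> + 1 / Suc n) + L2_norm M (\<lambda>x. v n x - w x)"
      using L2_norm_triangle_diff[OF f vL w(1)] v(2) by (meson add_le_cancel_right less_eq_real_def order_trans)
  qed
  have "L2_norm M (\<lambda>x. f x - w x) = 0"
  proof (rule null)
    show fw: "(\<lambda>x. f x - w x) \<in> L2 M" by (intro L2_diff f w)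
    fix i assume i: "i \<in> I"
    show "L2_inner M (\<lambda>x. f x - w x) (e i) = 0"
    proof (rule L2_best_approximation_orthogonal[OF fw e[OF i]])
      fix c
      have "\<delta> \<le> L2_norm M (\<lambda>x. (f x - w x) + c * e i x)"
      proof (rule LIMSEQ_le_const)
        show "(\<lambda>n. L2_norm M (\<lambda>x. (f x - w x) + c * e i x) + L2_norm M (\<lambda>x. v n x - w x)) \<longlonglongrightarrow> L2_norm M (\<lambda>x. (f x - w x) + c * e i x)"
          using tendsto_add[OF tendsto_const w(2)] by simp
        have "\<delta> \<le> L2_norm M (\<lambda>x. (f x - w x) + c * e i x) + L2_norm M (\<lambda>x. v n x - w x)" for n
        proof -
          have "\<delta> \<le> L2_norm M (\<lambda>x. f x - (v n x + (- c) * e i x))"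
            by (intro \<delta>_le V_add v V_e i)
          also have "\<dots> = L2_norm M (\<lambda>x. ((f x - w x) + c * e i x) + (w x - v n x))"
            by (rule arg_cong[where f = "L2_norm M"]) auto
          also have "\<dots> \<le> L2_norm M (\<lambda>x. (f x - w x) + c * e i x) + L2_norm M (\<lambda>x. w x - v n x)"
            by (intro L2_norm_triangle L2_add L2_diff f w vL L2_cmult e i)
          finally show ?thesis using L2_norm_minus_commute[of M w "v n"] by simp
        qed
        then show "\<exists>N. \<forall>n\<ge>N. \<delta> \<le> L2_norm M (\<lambda>x. (f x - w x) + c * e i x) + L2_norm M (\<lambda>x. v n x - w x)" by blast
      qed
      with le show "L2_norm M (\<lambda>x. f x - w x) \<le> L2_norm M (\<lambda>x. (f x - w x) + c * e i x)" by simp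
    qed
  qed
  then have "\<forall>\<^sub>F n in sequentially. L2_norm M (\<lambda>x. v n x - w x) < \<epsilon>"
    using w(2) \<epsilon> order_tendstoD(2) by blast
  then obtain n where n: "L2_norm M (\<lambda>x. v n x - w x) < \<epsilon>" by (auto simp: eventually_sequentially)
  have "L2_norm M (\<lambda>x. f x - v n x) \<le> L2_norm M (\<lambda>x. f x - w x) + L2_norm M (\<lambda>x. w x - v n x)"
    by (rule L2_norm_triangle_diff[OF f w(1) vL])
  then have "L2_norm M (\<lambda>x. f x - v n x) < \<epsilon>"
    using n \<open>L2_norm M (\<lambda>x. f x - w x) = 0\<close> L2_norm_minus_commute[of M w "v n"] by simp
  moreover obtain S c where "v n = (\<lambda>x. \<Sum>i\<in>S. c i * e i x)" "finite S" "S \<subseteq> I"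
    using v(1)[of n] unfolding V_def by blast
  ultimately show "\<exists>S c. finite S \<and> S \<subseteq> I \<and> L2_norm M (\<lambda>x. f x - (\<Sum>i\<in>S. c i * e i x)) < \<epsilon>"
    by (intro exI[of _ S] exI[of _ c]) simp
qed

section \<open>Unitary operators from Gram matrices\<close>

definition L2_tendsto :: "'x measure \<Rightarrow> 'h filter \<Rightarrow> ('h \<Rightarrow> 'x \<Rightarrow> complex) \<Rightarrow> ('x \<Rightarrow> complex) \<Rightarrow> bool" where
  "L2_tendsto M F f l \<longleftrightarrow> ((\<lambda>h. L2_norm M (\<lambda>x. f h x - l x)) \<longlongrightarrow> 0) F"

lemma L2_tendstoI:
  assumes "\<forall>\<^sub>F h in F. L2_norm M (\<lambda>x. f h x - l x) \<le> b h" "(b \<longlongrightarrow> 0) F"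
  shows "L2_tendsto M F f l"
  unfolding L2_tendsto_def
  by (rule tendsto_sandwich[OF _ assms(1) tendsto_const assms(2)]) (simp add: L2_norm_nonneg)

lemma L2_tendsto_const: "L2_tendsto M F (\<lambda>_. f) f"
  by (simp add: L2_tendsto_def L2_norm_zero)

lemma L2_tendsto_add:
  assumes "L2_tendsto M F f l" "L2_tendsto M F g m"
    "\<And>h. f h \<in> L2 M" "\<And>h. g h \<in> L2 M" "l \<in> L2 M" "m \<in> L2 M"
  shows "L2_tendsto M F (\<lambda>h x. f h x + g h x) (\<lambda>x. l x + m x)"
proof (rule L2_tendstoI)
  show "\<forall>\<^sub>F h in F. L2_norm M (\<lambda>x. f h x + g h x - (l x + m x))
      \<le> L2_norm M (\<lambda>x. f h x - l x) + L2_norm M (\<lambda>x. g h x - m x)"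
    using L2_norm_triangle[OF L2_diff[OF assms(3,5)] L2_diff[OF assms(4,6)]]
    by (intro always_eventually allI) (simp add: algebra_simps)
  show "((\<lambda>h. L2_norm M (\<lambda>x. f h x - l x) + L2_norm M (\<lambda>x. g h x - m x)) \<longlongrightarrow> 0) F"
    using tendsto_add[OF assms(1,2)[unfolded L2_tendsto_def]] by simp
qed

lemma L2_tendsto_cmult:
  assumes c: "(c \<longlongrightarrow> c0) F" and f: "L2_tendsto M F f l" and L2: "\<forall>\<^sub>F h in F. f h \<in> L2 M" "l \<in> L2 M"
  shows "L2_tendsto M F (\<lambda>h x. c h * f h x) (\<lambda>x. c0 * l x)"
proof (rule L2_tendstoI)
  have "L2_norm M (\<lambda>x. c h * f h x - c0 * l x)
      \<le> cmod (c h) * L2_norm M (\<lambda>x. f h x - l x) + cmod (c h - c0) * L2_norm M l" if "f h \<in> L2 M" for h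
  proof -
    have "L2_norm M (\<lambda>x. c h * f h x - c0 * l x)
        = L2_norm M (\<lambda>x. c h * (f h x - l x) + (c h - c0) * l x)"
      by (simp add: algebra_simps)
    also have "\<dots> \<le> L2_norm M (\<lambda>x. c h * (f h x - l x)) + L2_norm M (\<lambda>x. (c h - c0) * l x)"
      by (intro L2_norm_triangle L2_cmult L2_diff L2 that)
    finally show ?thesis by (simp only: L2_norm_cmult)
  qed
  with L2(1) show "\<forall>\<^sub>F h in F. L2_norm M (\<lambda>x. c h * f h x - c0 * l x)
      \<le> cmod (c h) * L2_norm M (\<lambda>x. f h x - l x) + cmod (c h - c0) * L2_norm M l"
    by (rule eventually_mono)
  have "((\<lambda>h. cmod (c h) * L2_norm M (\<lambda>x. f h x - l x) + cmod (c h - c0) * L2_norm M l)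
      \<longlongrightarrow> cmod c0 * 0 + cmod (c0 - c0) * L2_norm M l) F"
    by (intro tendsto_intros c f[unfolded L2_tendsto_def])
  then show "((\<lambda>h. cmod (c h) * L2_norm M (\<lambda>x. f h x - l x) + cmod (c h - c0) * L2_norm M l) \<longlongrightarrow> 0) F"
    by simp
qed

lemma L2_tendsto_inner:
  assumes "L2_tendsto M F f l" "L2_tendsto M F g m"
    and L2: "\<And>h. f h \<in> L2 M" "\<And>h. g h \<in> L2 M" "l \<in> L2 M" "m \<in> L2 M"
  shows "((\<lambda>h. L2_inner M (f h) (g h)) \<longlongrightarrow> L2_inner M l m) F"
proof (rule LIM_zero_cancel, rule Lim_null_comparison)
  let ?b = "\<lambda>h. L2_norm M (\<lambda>x. f h x - l x) * (L2_norm M (\<lambda>x. g h x - m x) + L2_norm M m)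
    + L2_norm M l * L2_norm M (\<lambda>x. g h x - m x)"
  have "cmod (L2_inner M (f h) (g h) - L2_inner M l m) \<le> ?b h" for h
  proof -
    have "L2_inner M (f h) (g h) - L2_inner M l m
      = L2_inner M (\<lambda>x. f h x - l x) (g h) + L2_inner M l (\<lambda>x. g h x - m x)"
      by (simp add: L2_inner_diff_left L2_inner_diff_right L2)
    then have "cmod (L2_inner M (f h) (g h) - L2_inner M l m)
       \<le> cmod (L2_inner M (\<lambda>x. f h x - l x) (g h)) + cmod (L2_inner M l (\<lambda>x. g h x - m x))"
      by (simp add: norm_triangle_ineq)
    also have "\<dots> \<le> L2_norm M (\<lambda>x. f h x - l x) * L2_norm M (g h) + L2_norm M l * L2_norm M (\<lambda>x. g h x - m x)"
      by (intro add_mono L2_Cauchy_Schwarz L2_diff L2)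
    also have "L2_norm M (g h) \<le> L2_norm M (\<lambda>x. g h x - m x) + L2_norm M m"
      using L2_norm_triangle[OF L2_diff[OF L2(2,4)] L2(4), of h] by simp
    finally show ?thesis by (simp add: L2_norm_nonneg mult_left_mono)
  qed
  then show "\<forall>\<^sub>F h in F. cmod (L2_inner M (f h) (g h) - L2_inner M l m) \<le> ?b h" by simp
  have "(?b \<longlongrightarrow> 0 * (0 + L2_norm M m) + L2_norm M l * 0) F"
    by (intro tendsto_intros assms(1,2)[unfolded L2_tendsto_def])
  then show "(?b \<longlongrightarrow> 0) F" by simp
qed

lemma AE_eq_if_L2_dist_0:
  assumes "f \<in> L2 M" "g \<in> L2 M" "L2_norm M (\<lambda>x. f x - g x) = 0"
  shows "AE x in M. f x = g x"
  using L2_norm_eq_0_iff[OF L2_diff[OF assms(1,2)]] assms(3) by auto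

lemma L2_total_orthogonal_null:
  assumes tot: "L2_total M e I" and e: "\<And>i. i \<in> I \<Longrightarrow> e i \<in> L2 M" and d: "d \<in> L2 M"
    and orth: "\<And>i. i \<in> I \<Longrightarrow> L2_inner M d (e i) = 0"
  shows "L2_norm M d = 0"
proof (rule ccontr)
  assume nz: "L2_norm M d \<noteq> 0"
  then have "L2_norm M d > 0" using L2_norm_nonneg[of M d] by simp
  then obtain S c where S: "finite S" "S \<subseteq> I"
    "L2_norm M (\<lambda>x. d x - (\<Sum>i\<in>S. c i * e i x)) < L2_norm M d"
    using tot d unfolding L2_total_def by meson
  have v: "(\<lambda>x. \<Sum>i\<in>S. c i * e i x) \<in> L2 M" using S e by (auto intro!: L2_sum L2_cmult)
  have "L2_inner M d (\<lambda>x. \<Sum>i\<in>S. c i * e i x) = 0"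
    using S e d orth by (subst L2_inner_sum_right) (auto intro!: sum.neutral)
  then have "L2_inner M d (\<lambda>x. d x - (\<Sum>i\<in>S. c i * e i x)) = L2_inner M d d"
    by (simp add: L2_inner_diff_right d v)
  then have "(L2_norm M d)\<^sup>2 = Re (L2_inner M d (\<lambda>x. d x - (\<Sum>i\<in>S. c i * e i x)))"
    by (simp add: L2_norm_sq)
  also have "\<dots> \<le> L2_norm M d * L2_norm M (\<lambda>x. d x - (\<Sum>i\<in>S. c i * e i x))"
    using L2_Cauchy_Schwarz[OF d L2_diff[OF d v]] complex_Re_le_cmod order_trans by blast
  also have "\<dots> < L2_norm M d * L2_norm M d"
    using S(3) \<open>L2_norm M d > 0\<close> by (intro mult_strict_left_mono)
  finally show False by (simp add: power2_eq_square)
qed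

text \<open>The extension of \<open>e i \<mapsto> T i\<close> is characterised by its inner products with the total family \<open>T\<close>. In this
  form it needs no choice of approximating sequences, and its algebraic properties follow by comparing
  inner products.\<close>

definition isometric_extension ::
    "'x measure \<Rightarrow> 'i set \<Rightarrow> ('i \<Rightarrow> 'x \<Rightarrow> complex) \<Rightarrow> ('i \<Rightarrow> 'x \<Rightarrow> complex)
      \<Rightarrow> ('x \<Rightarrow> complex) \<Rightarrow> 'x \<Rightarrow> complex" where
  "isometric_extension M I e T f =
     (SOME u. u \<in> L2 M \<and> (\<forall>i\<in>I. L2_inner M u (T i) = L2_inner M f (e i)))"

text \<open>Total families with equal Gram matrices: linear combinations of them with the same coefficients have
  the same norm, which makes \<open>e i \<mapsto> T i\<close> well defined and isometric; totality of \<open>T\<close> makes it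
  surjective.\<close>

locale gram_equivalent =
  fixes M :: "'x measure" and I :: "'i set" and e T :: "'i \<Rightarrow> 'x \<Rightarrow> complex"
  assumes e: "i \<in> I \<Longrightarrow> e i \<in> L2 M" and T: "i \<in> I \<Longrightarrow> T i \<in> L2 M"
    and gram: "i \<in> I \<Longrightarrow> j \<in> I \<Longrightarrow> L2_inner M (T i) (T j) = L2_inner M (e i) (e j)"
    and total_e: "L2_total M e I" and total_T: "L2_total M T I"
begin

lemma swapped: "gram_equivalent M I T e"
  by standard (auto simp: e T gram total_e total_T)

lemma inner_combinations:
  assumes "S \<subseteq> I" "S' \<subseteq> I"
  shows "L2_inner M (\<lambda>x. \<Sum>i\<in>S. c i * T i x) (\<lambda>x. \<Sum>j\<in>S'. d j * T j x)
    = L2_inner M (\<lambda>x. \<Sum>i\<in>S. c i * e i x) (\<lambda>x. \<Sum>j\<in>S'. d j * e j x)"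
proof -
  have *: "i \<in> S \<Longrightarrow> i \<in> I" "j \<in> S' \<Longrightarrow> j \<in> I" for i j using assms by auto
  show ?thesis
    by (simp add: * e T gram L2_inner_sum_left L2_inner_sum_right L2_sum L2_cmult cong: sum.cong)
qed

lemma norm_combinations:
  assumes "finite S" "S \<subseteq> I" "finite S'" "S' \<subseteq> I"
  shows "L2_norm M (\<lambda>x. (\<Sum>i\<in>S. c i * T i x) - (\<Sum>j\<in>S'. d j * T j x))
    = L2_norm M (\<lambda>x. (\<Sum>i\<in>S. c i * e i x) - (\<Sum>j\<in>S'. d j * e j x))"
proof -
  have *: "i \<in> S \<Longrightarrow> i \<in> I" "j \<in> S' \<Longrightarrow> j \<in> I" for i j using assms by auto
  define u u' v v' where "u = (\<lambda>x. \<Sum>i\<in>S. c i * T i x)" "u' = (\<lambda>x. \<Sum>j\<in>S'. d j * T j x)"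
    "v = (\<lambda>x. \<Sum>i\<in>S. c i * e i x)" "v' = (\<lambda>x. \<Sum>j\<in>S'. d j * e j x)"
  note defs = this
  have L2: "u \<in> L2 M" "u' \<in> L2 M" "v \<in> L2 M" "v' \<in> L2 M"
    unfolding defs by (intro L2_sum L2_cmult e T *; assumption)+
  have "L2_inner M u u = L2_inner M v v" "L2_inner M u u' = L2_inner M v v'"
    "L2_inner M u' u = L2_inner M v' v" "L2_inner M u' u' = L2_inner M v' v'"
    unfolding defs by (intro inner_combinations assms)+
  then have "(L2_norm M (\<lambda>x. u x - u' x))\<^sup>2 = (L2_norm M (\<lambda>x. v x - v' x))\<^sup>2"
    unfolding L2_norm_sq by (simp add: L2_inner_diff_left L2_inner_diff_right L2_diff L2)
  then have "L2_norm M (\<lambda>x. u x - u' x) = L2_norm M (\<lambda>x. v x - v' x)"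
    using L2_norm_nonneg power2_eq_iff_nonneg by blast
  then show ?thesis unfolding defs .
qed

text \<open>The graph of the extension: simultaneous limits of linear combinations with the same coefficients.\<close>

definition limit_pair :: "('x \<Rightarrow> complex) \<Rightarrow> ('x \<Rightarrow> complex) \<Rightarrow> bool" where
  "limit_pair f u \<longleftrightarrow> f \<in> L2 M \<and> u \<in> L2 M \<and>
     (\<exists>S c. (\<forall>n. finite (S n) \<and> S n \<subseteq> I) \<and>
        L2_tendsto M sequentially (\<lambda>n x. \<Sum>i\<in>S n. c n i * e i x) f \<and>
        L2_tendsto M sequentially (\<lambda>n x. \<Sum>i\<in>S n. c n i * T i x) u)"

lemma limit_pair_basis: "i \<in> I \<Longrightarrow> limit_pair (e i) (T i)"
  unfolding limit_pair_def
  by (intro conjI e T exI[of _ "\<lambda>_. {i}"] exI[of _ "\<lambda>_ _. 1"]) (auto simp: L2_tendsto_const)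

lemma limit_pair_inner:
  assumes "limit_pair f u" "limit_pair g w"
  shows "L2_inner M u w = L2_inner M f g"
proof -
  obtain S c where 1: "f \<in> L2 M" "u \<in> L2 M" "\<And>n. finite (S n)" "\<And>n. S n \<subseteq> I"
    "L2_tendsto M sequentially (\<lambda>n x. \<Sum>i\<in>S n. c n i * e i x) f"
    "L2_tendsto M sequentially (\<lambda>n x. \<Sum>i\<in>S n. c n i * T i x) u"
    using assms(1) unfolding limit_pair_def by blast
  obtain S' d where 2: "g \<in> L2 M" "w \<in> L2 M" "\<And>n. finite (S' n)" "\<And>n. S' n \<subseteq> I"
    "L2_tendsto M sequentially (\<lambda>n x. \<Sum>i\<in>S' n. d n i * e i x) g"
    "L2_tendsto M sequentially (\<lambda>n x. \<Sum>i\<in>S' n. d n i * T i x) w"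
    using assms(2) unfolding limit_pair_def by blast
  have I: "i \<in> S n \<Longrightarrow> i \<in> I" "i \<in> S' n \<Longrightarrow> i \<in> I" for i n using 1(4) 2(4) by blast+
  have "(\<lambda>n. L2_inner M (\<lambda>x. \<Sum>i\<in>S n. c n i * T i x) (\<lambda>x. \<Sum>i\<in>S' n. d n i * T i x)) \<longlonglongrightarrow> L2_inner M u w"
    by (intro L2_tendsto_inner 1 2 L2_sum L2_cmult T I)
  moreover have "(\<lambda>n. L2_inner M (\<lambda>x. \<Sum>i\<in>S n. c n i * e i x) (\<lambda>x. \<Sum>i\<in>S' n. d n i * e i x)) \<longlonglongrightarrow> L2_inner M f g"
    by (intro L2_tendsto_inner 1 2 L2_sum L2_cmult e I)
  ultimately show ?thesis using inner_combinations[OF 1(4) 2(4)] LIMSEQ_unique by auto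
qed

lemma limit_pair_exists:
  assumes f: "f \<in> L2 M"
  shows "\<exists>u. limit_pair f u"
proof -
  have "\<forall>n. \<exists>S c. finite S \<and> S \<subseteq> I \<and> L2_norm M (\<lambda>x. f x - (\<Sum>i\<in>S. c i * e i x)) < 1 / Suc n"
    using total_e f unfolding L2_total_def by simp
  from this[unfolded choice_iff] obtain S c where S: "\<And>n. finite (S n)" "\<And>n. S n \<subseteq> I"
    and bd: "\<And>n. L2_norm M (\<lambda>x. f x - (\<Sum>i\<in>S n. c n i * e i x)) < 1 / Suc n" by blast
  have I: "i \<in> S n \<Longrightarrow> i \<in> I" for i n using S(2) by blast
  have L2: "(\<lambda>x. \<Sum>i\<in>S n. c n i * e i x) \<in> L2 M" "(\<lambda>x. \<Sum>i\<in>S n. c n i * T i x) \<in> L2 M" for n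
    by (auto intro!: L2_sum L2_cmult e T dest: I)
  have to_f: "L2_tendsto M sequentially (\<lambda>n x. \<Sum>i\<in>S n. c n i * e i x) f"
  proof (rule L2_tendstoI)
    show "\<forall>\<^sub>F n in sequentially. L2_norm M (\<lambda>x. (\<Sum>i\<in>S n. c n i * e i x) - f x) \<le> 1 / Suc n"
      using bd by (intro always_eventually allI) (simp add: L2_norm_minus_commute[of M _ f] less_imp_le)
    show "(\<lambda>n. 1 / Suc n) \<longlonglongrightarrow> 0" using LIMSEQ_inverse_real_of_nat by (simp add: inverse_eq_divide)
  qed
  have "\<exists>u\<in>L2 M. (\<lambda>n. L2_norm M (\<lambda>x. (\<Sum>i\<in>S n. c n i * T i x) - u x)) \<longlonglongrightarrow> 0"
  proof (rule L2_complete[OF L2(2)])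
    fix \<epsilon> :: real assume "\<epsilon> > 0"
    then obtain N where N: "2 / \<epsilon> < real N" using reals_Archimedean2 by blast
    have "L2_norm M (\<lambda>x. (\<Sum>i\<in>S m. c m i * T i x) - (\<Sum>i\<in>S n. c n i * T i x)) < \<epsilon>"
      if "m \<ge> N" "n \<ge> N" for m n
    proof -
      have "L2_norm M (\<lambda>x. (\<Sum>i\<in>S m. c m i * T i x) - (\<Sum>i\<in>S n. c n i * T i x))
        = L2_norm M (\<lambda>x. (\<Sum>i\<in>S m. c m i * e i x) - (\<Sum>i\<in>S n. c n i * e i x))"
        by (intro norm_combinations S)
      also have "\<dots> \<le> L2_norm M (\<lambda>x. (\<Sum>i\<in>S m. c m i * e i x) - f x) + L2_norm M (\<lambda>x. f x - (\<Sum>i\<in>S n. c n i * e i x))"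
        by (intro L2_norm_triangle_diff L2 f)
      also have "\<dots> < 1 / Suc m + 1 / Suc n"
        using bd[of m] bd[of n] by (subst L2_norm_minus_commute) linarith
      also have "\<dots> \<le> 1 / Suc N + 1 / Suc N" using that by (intro add_mono frac_le) auto
      also have "\<dots> < \<epsilon>"
      proof -
        have "2 < \<epsilon> * real N" using N \<open>\<epsilon> > 0\<close> by (simp add: field_simps)
        then show ?thesis using \<open>\<epsilon> > 0\<close> by (simp add: field_simps)
      qed
      finally show ?thesis .
    qed
    then show "\<exists>N. \<forall>m\<ge>N. \<forall>n\<ge>N. L2_norm M (\<lambda>x. (\<Sum>i\<in>S m. c m i * T i x) - (\<Sum>i\<in>S n. c n i * T i x)) < \<epsilon>" by blast
  qed
  then obtain u where u: "u \<in> L2 M" "L2_tendsto M sequentially (\<lambda>n x. \<Sum>i\<in>S n. c n i * T i x) u"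
    unfolding L2_tendsto_def by blast
  show ?thesis unfolding limit_pair_def
    by (intro exI[of _ u] exI[of _ S] exI[of _ c] conjI allI f u to_f S)
qed

lemma extension_exists:
  assumes "f \<in> L2 M"
  shows "\<exists>u. u \<in> L2 M \<and> (\<forall>i\<in>I. L2_inner M u (T i) = L2_inner M f (e i))"
proof -
  obtain u where u: "limit_pair f u" using limit_pair_exists[OF assms] by blast
  then have "u \<in> L2 M" by (simp add: limit_pair_def)
  with limit_pair_inner[OF u limit_pair_basis] show ?thesis by blast
qed

abbreviation U where "U \<equiv> isometric_extension M I e T"

lemma U_L2: "f \<in> L2 M \<Longrightarrow> U f \<in> L2 M"
  and U_inner: "f \<in> L2 M \<Longrightarrow> i \<in> I \<Longrightarrow> L2_inner M (U f) (T i) = L2_inner M f (e i)"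
  using someI_ex[OF extension_exists] unfolding isometric_extension_def by blast+

lemma U_eqI:
  assumes "f \<in> L2 M" "u \<in> L2 M" "\<And>i. i \<in> I \<Longrightarrow> L2_inner M u (T i) = L2_inner M f (e i)"
  shows "AE x in M. U f x = u x"
proof (rule AE_eq_if_L2_dist_0[OF U_L2[OF assms(1)] assms(2)])
  show "L2_norm M (\<lambda>x. U f x - u x) = 0"
    by (rule L2_total_orthogonal_null[OF total_T T])
      (auto simp: L2_diff L2_inner_diff_left U_L2 U_inner assms T)
qed

lemma U_basis: "i \<in> I \<Longrightarrow> AE x in M. U (e i) x = T i x"
  by (rule U_eqI) (auto simp: e T gram)

lemma U_unitary: "L2_unitary M U"
  unfolding L2_unitary_def
proof (intro conjI ballI allI)
  fix f g assume f: "f \<in> L2 M" and g: "g \<in> L2 M"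
  show "AE x in M. U (\<lambda>y. f y + g y) x = U f x + U g x"
    by (rule U_eqI) (auto simp: f g L2_add U_L2 L2_inner_add_left U_inner T e)
  obtain u where u: "limit_pair f u" using limit_pair_exists[OF f] by blast
  obtain w where w: "limit_pair g w" using limit_pair_exists[OF g] by blast
  have L2: "u \<in> L2 M" "w \<in> L2 M" using u w by (simp_all add: limit_pair_def)
  have "AE x in M. U f x = u x" "AE x in M. U g x = w x"
    by (intro U_eqI f g L2 limit_pair_inner[OF u limit_pair_basis] limit_pair_inner[OF w limit_pair_basis]; assumption)+
  then have "L2_inner M (U f) (U g) = L2_inner M u w"
    by (intro L2_inner_cong_AE U_L2 f g L2)
  also have "\<dots> = L2_inner M f g" by (rule limit_pair_inner[OF u w])
  finally show "L2_inner M (U f) (U g) = L2_inner M f g" .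
next
  fix f c assume f: "f \<in> L2 M"
  show "AE x in M. U (\<lambda>y. c * f y) x = c * U f x"
    by (rule U_eqI) (auto simp: f L2_cmult U_L2 L2_inner_cmult_left U_inner)
next
  fix g assume g: "g \<in> L2 M"
  obtain f where f: "f \<in> L2 M" "\<forall>i\<in>I. L2_inner M f (e i) = L2_inner M g (T i)"
    using gram_equivalent.extension_exists[OF swapped g] by blast
  then have "AE x in M. U f x = g x" by (intro U_eqI g) auto
  with f show "\<exists>f\<in>L2 M. AE x in M. U f x = g x" by blast
qed (rule U_L2)

end

lemma L2_unitaryD:
  assumes "L2_unitary M U"
  shows "f \<in> L2 M \<Longrightarrow> U f \<in> L2 M"
    "f \<in> L2 M \<Longrightarrow> g \<in> L2 M \<Longrightarrow> AE x in M. U (\<lambda>y. f y + g y) x = U f x + U g x"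
    "f \<in> L2 M \<Longrightarrow> AE x in M. U (\<lambda>y. c * f y) x = c * U f x"
    "f \<in> L2 M \<Longrightarrow> g \<in> L2 M \<Longrightarrow> L2_inner M (U f) (U g) = L2_inner M f g"
  using assms unfolding L2_unitary_def by blast+

lemma L2_unitary_norm:
  assumes "L2_unitary M U" "f \<in> L2 M"
  shows "L2_norm M (U f) = L2_norm M f"
proof -
  have "(L2_norm M (U f))\<^sup>2 = (L2_norm M f)\<^sup>2"
    by (simp only: L2_norm_sq L2_unitaryD(4)[OF assms(1) assms(2) assms(2)])
  then show ?thesis using L2_norm_nonneg by (metis power2_eq_iff_nonneg)
qed

lemma L2_unitary_diff:
  assumes U: "L2_unitary M U" and f: "f \<in> L2 M" and g: "g \<in> L2 M"
  shows "AE x in M. U (\<lambda>y. f y - g y) x = U f x - U g x"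
proof -
  have "AE x in M. U (\<lambda>y. f y + (-1) * g y) x = U f x + U (\<lambda>y. (-1) * g y) x"
    by (intro L2_unitaryD[OF U] f L2_cmult g)
  moreover have "AE x in M. U (\<lambda>y. (-1) * g y) x = (-1) * U g x"
    by (intro L2_unitaryD[OF U] g)
  ultimately show ?thesis by eventually_elim simp
qed

lemma L2_unitary_dist:
  assumes U: "L2_unitary M U" and f: "f \<in> L2 M" and g: "g \<in> L2 M"
  shows "L2_norm M (\<lambda>x. U f x - U g x) = L2_norm M (\<lambda>x. f x - g x)"
proof -
  have "L2_norm M (\<lambda>x. U f x - U g x) = L2_norm M (U (\<lambda>y. f y - g y))"
    by (rule L2_norm_cong_AE, use L2_unitary_diff[OF U f g] in eventually_elim)
      (auto intro!: L2_measurable L2_diff L2_unitaryD[OF U] f g)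
  also have "\<dots> = L2_norm M (\<lambda>x. f x - g x)" by (intro L2_unitary_norm[OF U] L2_diff f g)
  finally show ?thesis .
qed

lemma L2_unitary_combination:
  assumes U: "L2_unitary M U" and e: "\<And>i. i \<in> S \<Longrightarrow> e i \<in> L2 M" and "finite S"
  shows "AE x in M. U (\<lambda>y. \<Sum>i\<in>S. c i * e i y) x = (\<Sum>i\<in>S. c i * U (e i) x)"
  using assms(3) e
proof (induction S)
  case empty
  have "AE x in M. U (\<lambda>y. 0 * (0::complex)) x = 0 * U (\<lambda>y. 0) x"
    by (rule L2_unitaryD(3)[OF U L2_zero])
  then show ?case by simp
next
  case (insert i S)
  have "AE x in M. U (\<lambda>y. c i * e i y + (\<Sum>i\<in>S. c i * e i y)) x
      = U (\<lambda>y. c i * e i y) x + U (\<lambda>y. \<Sum>i\<in>S. c i * e i y) x"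
    by (intro L2_unitaryD[OF U] L2_cmult L2_sum insert) auto
  moreover have "AE x in M. U (\<lambda>y. c i * e i y) x = c i * U (e i) x"
    by (intro L2_unitaryD[OF U] insert) auto
  ultimately show ?case using insert.IH insert.prems
    by (simp add: insert.hyps) (auto simp: insert.hyps elim!: eventually_elim2)
qed

text \<open>Isometries are equicontinuous, so strong convergence has to be checked on a total family only.\<close>

lemma L2_unitary_tendsto:
  assumes U: "\<forall>\<^sub>F h in F. L2_unitary M (U h)" and V: "L2_unitary M V"
    and tot: "L2_total M e I" and e: "\<And>i. i \<in> I \<Longrightarrow> e i \<in> L2 M"
    and conv: "\<And>i. i \<in> I \<Longrightarrow> L2_tendsto M F (\<lambda>h. U h (e i)) (V (e i))" and f: "f \<in> L2 M"
  shows "L2_tendsto M F (\<lambda>h. U h f) (V f)"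
  unfolding L2_tendsto_def
proof (rule tendstoI)
  fix \<epsilon> :: real assume \<epsilon>: "\<epsilon> > 0"
  then obtain S c where S: "finite S" "S \<subseteq> I"
    and v: "L2_norm M (\<lambda>x. f x - (\<Sum>i\<in>S. c i * e i x)) < \<epsilon> / 3"
    using tot f unfolding L2_total_def by (meson divide_pos_pos zero_less_numeral)
  define w where "w = (\<lambda>x. \<Sum>i\<in>S. c i * e i x)"
  have eS: "i \<in> S \<Longrightarrow> e i \<in> L2 M" for i using S e by auto
  have w: "w \<in> L2 M" unfolding w_def by (intro L2_sum L2_cmult eS)
  have "((\<lambda>h. \<Sum>i\<in>S. cmod (c i) * L2_norm M (\<lambda>x. U h (e i) x - V (e i) x)) \<longlongrightarrow> (\<Sum>i\<in>S. cmod (c i) * 0)) F"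
    using S conv by (intro tendsto_intros) (auto simp: L2_tendsto_def)
  then have "\<forall>\<^sub>F h in F. (\<Sum>i\<in>S. cmod (c i) * L2_norm M (\<lambda>x. U h (e i) x - V (e i) x)) < \<epsilon> / 3"
    using \<epsilon> by (intro order_tendstoD(2)[where y = 0]) auto
  with U show "\<forall>\<^sub>F h in F. dist (L2_norm M (\<lambda>x. U h f x - V f x)) 0 < \<epsilon>"
  proof eventually_elim
    case (elim h)
    note Uh = elim(1)
    have comb: "AE x in M. U h w x - V w x = (\<Sum>i\<in>S. c i * (U h (e i) x - V (e i) x))"
    proof -
      have "AE x in M. U h w x = (\<Sum>i\<in>S. c i * U h (e i) x)"
        unfolding w_def by (rule L2_unitary_combination[OF Uh _ S(1)]) (rule eS)
      moreover have "AE x in M. V w x = (\<Sum>i\<in>S. c i * V (e i) x)"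
        unfolding w_def by (rule L2_unitary_combination[OF V _ S(1)]) (rule eS)
      ultimately show ?thesis by eventually_elim (simp add: sum_subtractf right_diff_distrib)
    qed
    have "L2_norm M (\<lambda>x. U h w x - V w x) = L2_norm M (\<lambda>x. \<Sum>i\<in>S. c i * (U h (e i) x - V (e i) x))"
      by (rule L2_norm_cong_AE[OF comb])
        (auto intro!: L2_measurable L2_diff L2_unitaryD[OF Uh] L2_unitaryD[OF V] w L2_sum L2_cmult eS)
    also have "\<dots> \<le> (\<Sum>i\<in>S. L2_norm M (\<lambda>x. c i * (U h (e i) x - V (e i) x)))"
      by (intro L2_norm_sum L2_cmult L2_diff L2_unitaryD[OF Uh] L2_unitaryD[OF V] eS)
    also have "\<dots> < \<epsilon> / 3" using elim(2) by (simp add: L2_norm_cmult)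
    finally have 1: "L2_norm M (\<lambda>x. U h w x - V w x) < \<epsilon> / 3" .
    have "L2_norm M (\<lambda>x. U h f x - V f x) \<le> L2_norm M (\<lambda>x. U h f x - U h w x) + L2_norm M (\<lambda>x. U h w x - V f x)"
      by (intro L2_norm_triangle_diff L2_unitaryD[OF Uh] L2_unitaryD[OF V] f w)
    also have "L2_norm M (\<lambda>x. U h w x - V f x) \<le> L2_norm M (\<lambda>x. U h w x - V w x) + L2_norm M (\<lambda>x. V w x - V f x)"
      by (intro L2_norm_triangle_diff L2_unitaryD[OF Uh] L2_unitaryD[OF V] f w)
    finally have "L2_norm M (\<lambda>x. U h f x - V f x) \<le> L2_norm M (\<lambda>x. f x - w x) + L2_norm M (\<lambda>x. U h w x - V w x) + L2_norm M (\<lambda>x. w x - f x)"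
      by (simp add: L2_unitary_dist[OF Uh f w] L2_unitary_dist[OF V w f])
    also have "\<dots> < \<epsilon>" using 1 v L2_norm_minus_commute[of M w f] unfolding w_def by simp
    finally show ?case by (simp add: L2_norm_nonneg)
  qed
qed

section \<open>Generators of unitary one-parameter groups\<close>

lemma has_L2_derivative_iff:
  "has_L2_derivative M F D 0 \<longleftrightarrow> (\<forall>t. F t \<in> L2 M) \<and> D \<in> L2 M \<and>
     L2_tendsto M (at 0) (\<lambda>t x. (F t x - F 0 x) / of_real t) D"
  by (simp add: has_L2_derivative_def L2_tendsto_def)

text \<open>One-parameter groups act on representatives of classes, hence their laws hold almost everywhere
  only. The aim of this section is that the generator is a closed operator.\<close>

locale unitary_group =
  fixes M :: "'x measure" and U :: "real \<Rightarrow> ('x \<Rightarrow> complex) \<Rightarrow> 'x \<Rightarrow> complex"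
  assumes unitary: "L2_unitary M (U t)"
    and zero: "f \<in> L2 M \<Longrightarrow> AE x in M. U 0 f x = f x"
    and add: "f \<in> L2 M \<Longrightarrow> AE x in M. U (s + t) f x = U s (U t f) x"
    and continuous: "f \<in> L2 M \<Longrightarrow> L2_tendsto M (at 0) (\<lambda>t. U t f) f"
begin

lemma U_L2: "f \<in> L2 M \<Longrightarrow> U t f \<in> L2 M"
  by (rule L2_unitaryD(1)[OF unitary])

definition generates :: "('x \<Rightarrow> complex) \<Rightarrow> ('x \<Rightarrow> complex) \<Rightarrow> bool" where
  "generates f g \<longleftrightarrow> has_L2_derivative M (\<lambda>t. U t f) g 0"

lemma generates_L2: "generates f g \<Longrightarrow> f \<in> L2 M \<Longrightarrow> g \<in> L2 M"
  by (simp add: generates_def has_L2_derivative_iff)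

definition remainder :: "('x \<Rightarrow> complex) \<Rightarrow> ('x \<Rightarrow> complex) \<Rightarrow> real \<Rightarrow> real" where
  "remainder f g t = L2_norm M (\<lambda>x. U t f x - (f x + of_real t * g x))"

lemma remainder_div:
  assumes f: "f \<in> L2 M" and g: "g \<in> L2 M" and t: "t \<noteq> 0"
  shows "L2_norm M (\<lambda>x. (U t f x - U 0 f x) / of_real t - g x) = remainder f g t / \<bar>t\<bar>"
proof -
  have "L2_norm M (\<lambda>x. (U t f x - U 0 f x) / of_real t - g x) = L2_norm M (\<lambda>x. of_real (1 / t) * (U t f x - (f x + of_real t * g x)))"
  proof (rule L2_norm_cong_AE)
    show "AE x in M. (U t f x - U 0 f x) / of_real t - g x = of_real (1 / t) * (U t f x - (f x + of_real t * g x))"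
      using zero[OF f] by eventually_elim (use t in \<open>simp add: field_simps\<close>)
    note [measurable] = L2_measurable[OF f] L2_measurable[OF g] L2_measurable[OF U_L2[OF f]]
    show "(\<lambda>x. (U t f x - U 0 f x) / of_real t - g x) \<in> borel_measurable M"
      "(\<lambda>x. of_real (1 / t) * (U t f x - (f x + of_real t * g x))) \<in> borel_measurable M" by measurable
  qed
  then show ?thesis
    unfolding L2_norm_cmult norm_of_real remainder_def by (simp add: divide_inverse mult.commute)
qed

lemma generates_iff:
  assumes f: "f \<in> L2 M" and g: "g \<in> L2 M"
  shows "generates f g \<longleftrightarrow> ((\<lambda>t. remainder f g t / \<bar>t\<bar>) \<longlongrightarrow> 0) (at 0)"
proof -
  have "((\<lambda>t. L2_norm M (\<lambda>x. (U t f x - U 0 f x) / of_real t - g x)) \<longlongrightarrow> 0) (at 0)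
    \<longleftrightarrow> ((\<lambda>t. remainder f g t / \<bar>t\<bar>) \<longlongrightarrow> 0) (at 0)"
    by (intro filterlim_cong refl) (auto simp: eventually_at_filter remainder_div[OF f g])
  then show ?thesis unfolding generates_def has_L2_derivative_iff L2_tendsto_def using U_L2[OF f] g by simp
qed

lemma remainder_nonneg: "remainder f g t \<ge> 0"
  by (simp add: remainder_def L2_norm_nonneg)

text \<open>One step of length \<open>s\<close> after \<open>n\<close> steps contributes the remainder of a single step, transported by an
  isometry, and the distance between \<open>g\<close> and its translate.\<close>

lemma remainder_mult:
  assumes f: "f \<in> L2 M" and g: "g \<in> L2 M"
    and B: "\<And>i. i < n \<Longrightarrow> L2_norm M (\<lambda>x. U (real i * s) g x - g x) \<le> B"
  shows "remainder f g (real n * s) \<le> real n * (remainder f g s + \<bar>s\<bar> * B)"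
  using B
proof (induction n)
  case 0
  have "remainder f g 0 = L2_norm M (\<lambda>x. 0)" unfolding remainder_def
    by (rule L2_norm_cong_AE) (use zero[OF f] in \<open>auto intro!: L2_measurable L2_diff L2_add L2_zero U_L2 f elim: eventually_mono\<close>)
  then show ?case by (simp add: L2_norm_zero)
next
  case (Suc n)
  let ?V = "U (real n * s)"
  define w where "w x = U s f x - (f x + of_real s * g x)" for x
  have sg: "(\<lambda>x. f x + of_real s * g x) \<in> L2 M" by (intro L2_add L2_cmult f g)
  have w: "w \<in> L2 M" unfolding w_def by (intro L2_diff sg U_L2 f)
  have ae: "AE x in M. U (real (Suc n) * s) f x - (f x + of_real (real (Suc n) * s) * g x)
    = ?V w x + ((?V f x - (f x + of_real (real n * s) * g x)) + of_real s * (?V g x - g x))"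
  proof -
    have "AE x in M. U (real n * s + s) f x = ?V (U s f) x" by (rule add[OF f])
    moreover have "AE x in M. ?V w x = ?V (U s f) x - ?V (\<lambda>x. f x + of_real s * g x) x"
      unfolding w_def by (rule L2_unitary_diff[OF unitary U_L2[OF f] sg])
    moreover have "AE x in M. ?V (\<lambda>x. f x + of_real s * g x) x = ?V f x + ?V (\<lambda>x. of_real s * g x) x"
      by (intro L2_unitaryD[OF unitary] f L2_cmult g)
    moreover have "AE x in M. ?V (\<lambda>x. of_real s * g x) x = of_real s * ?V g x"
      by (rule L2_unitaryD(3)[OF unitary g])
    ultimately show ?thesis by eventually_elim (simp add: algebra_simps)
  qed
  have V: "?V w \<in> L2 M" "(\<lambda>x. ?V f x - (f x + of_real (real n * s) * g x)) \<in> L2 M" "(\<lambda>x. of_real s * (?V g x - g x)) \<in> L2 M"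
    by (intro U_L2 w L2_diff L2_add L2_cmult f g)+
  have "remainder f g (real (Suc n) * s) = L2_norm M (\<lambda>x. ?V w x + ((?V f x - (f x + of_real (real n * s) * g x)) + of_real s * (?V g x - g x)))"
    unfolding remainder_def
    by (rule L2_norm_cong_AE[OF ae]) (intro L2_measurable L2_diff L2_add U_L2 L2_cmult f g V)+
  also have "\<dots> \<le> L2_norm M (?V w) + L2_norm M (\<lambda>x. (?V f x - (f x + of_real (real n * s) * g x)) + of_real s * (?V g x - g x))"
    by (intro L2_norm_triangle L2_add V)
  also have "\<dots> \<le> L2_norm M (?V w) + (L2_norm M (\<lambda>x. ?V f x - (f x + of_real (real n * s) * g x)) + L2_norm M (\<lambda>x. of_real s * (?V g x - g x)))"
    by (intro add_left_mono L2_norm_triangle V)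
  also have "L2_norm M (?V w) = remainder f g s"
    using L2_unitary_norm[OF unitary w, of "real n * s"] unfolding remainder_def w_def[abs_def] .
  also have "L2_norm M (\<lambda>x. ?V f x - (f x + of_real (real n * s) * g x)) = remainder f g (real n * s)"
    by (simp add: remainder_def)
  also have "remainder f g (real n * s) \<le> real n * (remainder f g s + \<bar>s\<bar> * B)"
    by (rule Suc.IH) (simp add: Suc.prems)
  also have "L2_norm M (\<lambda>x. of_real s * (?V g x - g x)) \<le> \<bar>s\<bar> * B"
    unfolding L2_norm_cmult norm_of_real by (intro mult_left_mono Suc.prems) auto
  finally show ?case by (simp add: algebra_simps)
qed

text \<open>The mean value inequality for the orbit map, obtained by cutting \<open>[0, t]\<close> into \<open>n\<close> steps and
  letting \<open>n\<close> tend to infinity. Unlike the derivative it only involves norms and therefore survives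
  limits in \<open>f\<close> and \<open>g\<close>.\<close>

lemma remainder_le:
  assumes f: "f \<in> L2 M" and fg: "generates f g"
    and B: "\<And>s. \<bar>s\<bar> \<le> \<bar>t\<bar> \<Longrightarrow> L2_norm M (\<lambda>x. U s g x - g x) \<le> B"
  shows "remainder f g t \<le> \<bar>t\<bar> * B"
proof (cases "t = 0")
  case True
  have "remainder f g 0 = 0" using remainder_mult[OF f generates_L2[OF fg f], of 0 1 0] remainder_nonneg[of f g 0] by simp
  then show ?thesis using True by simp
next
  case False
  have g: "g \<in> L2 M" by (rule generates_L2[OF fg f])
  define s where "s n = t / real (Suc n)" for n
  have s0: "s n \<noteq> 0" for n using False by (simp add: s_def)
  have "filterlim s (at 0) sequentially"
  proof -
    have "(\<lambda>n. t * inverse (real (Suc n))) \<longlonglongrightarrow> t * 0" by (intro tendsto_intros LIMSEQ_inverse_real_of_nat)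
    then show ?thesis using s0 unfolding filterlim_at by (simp add: s_def[abs_def] divide_inverse)
  qed
  moreover have "((\<lambda>t. remainder f g t / \<bar>t\<bar>) \<longlongrightarrow> 0) (at 0)" using fg generates_iff[OF f g] by simp
  ultimately have lim: "(\<lambda>n. remainder f g (s n) / \<bar>s n\<bar>) \<longlonglongrightarrow> 0" by (rule filterlim_compose[rotated])
  have "remainder f g t \<le> \<bar>t\<bar> * (remainder f g (s n) / \<bar>s n\<bar>) + \<bar>t\<bar> * B" for n
  proof -
    have "remainder f g (real (Suc n) * s n) \<le> real (Suc n) * (remainder f g (s n) + \<bar>s n\<bar> * B)"
    proof (rule remainder_mult[OF f g])
      fix i assume "i < Suc n"
      have "\<bar>real i * s n\<bar> = (real i / real (Suc n)) * \<bar>t\<bar>" by (simp add: s_def abs_mult)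
      also have "\<dots> \<le> 1 * \<bar>t\<bar>" using \<open>i < Suc n\<close> by (intro mult_right_mono) auto
      finally show "L2_norm M (\<lambda>x. U (real i * s n) g x - g x) \<le> B" by (intro B) simp
    qed
    also have "real (Suc n) * s n = t" by (simp add: s_def)
    also have "real (Suc n) * (remainder f g (s n) + \<bar>s n\<bar> * B) = \<bar>t\<bar> * (remainder f g (s n) / \<bar>s n\<bar>) + \<bar>t\<bar> * B"
      using s0[of n] False by (simp add: s_def field_simps)
    finally show ?thesis .
  qed
  moreover have "(\<lambda>n. \<bar>t\<bar> * (remainder f g (s n) / \<bar>s n\<bar>) + \<bar>t\<bar> * B) \<longlonglongrightarrow> \<bar>t\<bar> * 0 + \<bar>t\<bar> * B"
    by (intro tendsto_intros lim)
  ultimately show ?thesis using LIMSEQ_le_const by (metis (no_types, lifting) add_0 mult_zero_right)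
qed

text \<open>By \<open>remainder_le\<close> the remainder of \<open>(f\<^sub>h, g\<^sub>h)\<close> is at most \<open>\<bar>t\<bar>\<close> times the modulus of continuity of the orbit
  of \<open>g\<^sub>h\<close>. This bound passes to the limit, where the modulus tends to \<open>0\<close> with \<open>t\<close>.\<close>

lemma generates_closed:
  assumes F: "F \<noteq> bot" and f: "f \<in> L2 M" and g: "g \<in> L2 M"
    and gen: "\<forall>\<^sub>F h in F. fh h \<in> L2 M \<and> generates (fh h) (gh h)"
    and lim: "L2_tendsto M F fh f" "L2_tendsto M F gh g"
  shows "generates f g"
  unfolding generates_iff[OF f g]
proof (rule tendstoI)
  fix \<epsilon> :: real assume \<epsilon>: "\<epsilon> > 0"
  have "\<forall>\<^sub>F s in at 0. dist (L2_norm M (\<lambda>x. U s g x - g x)) 0 < \<epsilon> / 2"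
    using continuous[OF g] \<epsilon> unfolding L2_tendsto_def by (intro tendstoD) auto
  then obtain \<delta> where \<delta>: "\<delta> > 0" "\<And>s. s \<noteq> 0 \<Longrightarrow> \<bar>s\<bar> < \<delta> \<Longrightarrow> L2_norm M (\<lambda>x. U s g x - g x) < \<epsilon> / 2"
    unfolding eventually_at by (auto simp: abs_of_nonneg[OF L2_norm_nonneg])
  have U0: "L2_norm M (\<lambda>x. U 0 g x - g x) = 0"
  proof -
    have "AE x in M. U 0 g x - g x = 0" using zero[OF g] by eventually_elim simp
    then show ?thesis by (subst L2_norm_eq_0_iff) (intro L2_diff U_L2 g)
  qed
  have sd: "L2_norm M (\<lambda>x. U s g x - g x) \<le> \<epsilon> / 2" if "\<bar>s\<bar> < \<delta>" for s
    using \<delta>(2)[of s] that U0 \<epsilon> by (cases "s = 0") auto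
  have "remainder f g t \<le> \<bar>t\<bar> * (\<epsilon> / 2)" if t: "\<bar>t\<bar> < \<delta>" for t
  proof -
    have ev: "\<forall>\<^sub>F h in F. remainder f g t \<le> 2 * L2_norm M (\<lambda>x. fh h x - f x)
        + \<bar>t\<bar> * L2_norm M (\<lambda>x. gh h x - g x) + \<bar>t\<bar> * (\<epsilon> / 2 + 2 * L2_norm M (\<lambda>x. gh h x - g x))"
      using gen
    proof eventually_elim
      case (elim h)
      have fh: "fh h \<in> L2 M" and gh: "gh h \<in> L2 M" using elim generates_L2 by auto
      let ?u = "fh h" and ?v = "gh h"
      have "L2_norm M (\<lambda>x. U s ?v x - ?v x) \<le> \<epsilon> / 2 + 2 * L2_norm M (\<lambda>x. ?v x - g x)" if "\<bar>s\<bar> \<le> \<bar>t\<bar>" for s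
      proof -
        have "L2_norm M (\<lambda>x. U s ?v x - ?v x) \<le> L2_norm M (\<lambda>x. U s ?v x - U s g x) + L2_norm M (\<lambda>x. U s g x - ?v x)"
          by (intro L2_norm_triangle_diff U_L2 gh g)
        also have "L2_norm M (\<lambda>x. U s g x - ?v x) \<le> L2_norm M (\<lambda>x. U s g x - g x) + L2_norm M (\<lambda>x. g x - ?v x)"
          by (intro L2_norm_triangle_diff U_L2 gh g)
        also have "L2_norm M (\<lambda>x. U s ?v x - U s g x) = L2_norm M (\<lambda>x. ?v x - g x)" by (rule L2_unitary_dist[OF unitary gh g])
        also have "L2_norm M (\<lambda>x. g x - ?v x) = L2_norm M (\<lambda>x. ?v x - g x)" by (rule L2_norm_minus_commute)
        finally show ?thesis using sd[of s] that t by linarith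
      qed
      then have r: "remainder ?u ?v t \<le> \<bar>t\<bar> * (\<epsilon> / 2 + 2 * L2_norm M (\<lambda>x. ?v x - g x))"
        by (intro remainder_le fh) (use elim in auto)
      have fg: "(\<lambda>x. f x + of_real t * g x) \<in> L2 M" "(\<lambda>x. ?u x + of_real t * ?v x) \<in> L2 M"
        by (intro L2_add L2_cmult f g fh gh)+
      have "remainder f g t \<le> L2_norm M (\<lambda>x. U t f x - U t ?u x) + L2_norm M (\<lambda>x. U t ?u x - (f x + of_real t * g x))"
        unfolding remainder_def by (intro L2_norm_triangle_diff U_L2 f fh fg)
      also have "L2_norm M (\<lambda>x. U t ?u x - (f x + of_real t * g x)) \<le> remainder ?u ?v t + L2_norm M (\<lambda>x. (?u x + of_real t * ?v x) - (f x + of_real t * g x))"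
        unfolding remainder_def by (intro L2_norm_triangle_diff U_L2 f fh fg)
      also have "L2_norm M (\<lambda>x. (?u x + of_real t * ?v x) - (f x + of_real t * g x)) = L2_norm M (\<lambda>x. (?u x - f x) + of_real t * (?v x - g x))"
        by (simp add: algebra_simps)
      also have "\<dots> \<le> L2_norm M (\<lambda>x. ?u x - f x) + L2_norm M (\<lambda>x. of_real t * (?v x - g x))"
        by (intro L2_norm_triangle L2_diff L2_cmult f g fh gh)
      also have "L2_norm M (\<lambda>x. of_real t * (?v x - g x)) = \<bar>t\<bar> * L2_norm M (\<lambda>x. ?v x - g x)"
        by (simp only: L2_norm_cmult norm_of_real)
      also have "L2_norm M (\<lambda>x. U t f x - U t ?u x) = L2_norm M (\<lambda>x. ?u x - f x)"
        by (simp only: L2_unitary_dist[OF unitary f fh] L2_norm_minus_commute[of M f])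
      finally show ?case using r by linarith
    qed
    have "((\<lambda>h. 2 * L2_norm M (\<lambda>x. fh h x - f x) + \<bar>t\<bar> * L2_norm M (\<lambda>x. gh h x - g x)
        + \<bar>t\<bar> * (\<epsilon> / 2 + 2 * L2_norm M (\<lambda>x. gh h x - g x))) \<longlongrightarrow> 2 * 0 + \<bar>t\<bar> * 0 + \<bar>t\<bar> * (\<epsilon> / 2 + 2 * 0)) F"
      by (intro tendsto_intros lim[unfolded L2_tendsto_def])
    from tendsto_lowerbound[OF this ev F] show ?thesis by simp
  qed
  then have "remainder f g t / \<bar>t\<bar> \<le> \<epsilon> / 2" if "\<bar>t\<bar> < \<delta>" "t \<noteq> 0" for t
    using that by (simp add: divide_le_eq mult.commute)
  then have "remainder f g t / \<bar>t\<bar> < \<epsilon>" if "\<bar>t\<bar> < \<delta>" "t \<noteq> 0" for t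
    by (rule le_less_trans) (use that \<epsilon> in auto)
  then have "dist (remainder f g t / \<bar>t\<bar>) 0 < \<epsilon>" if "\<bar>t\<bar> < \<delta>" "t \<noteq> 0" for t
    using that by (simp add: dist_real_def abs_of_nonneg[OF remainder_nonneg])
  then show "\<forall>\<^sub>F t in at 0. dist (remainder f g t / \<bar>t\<bar>) 0 < \<epsilon>"
    using \<delta>(1) unfolding eventually_at by (intro exI[of _ \<delta>]) auto
qed

lemma generates_cong_AE:
  assumes "generates f g" "f \<in> L2 M" "g' \<in> L2 M" "AE x in M. g x = g' x"
  shows "generates f g'"
proof -
  have g: "g \<in> L2 M" using generates_L2 assms by blast
  have "remainder f g t = remainder f g' t" for t unfolding remainder_def
    by (rule L2_norm_cong_AE, use assms(4) in eventually_elim) (auto intro!: L2_measurable L2_diff L2_add L2_cmult U_L2 assms(2,3) g)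
  then show ?thesis using assms g by (simp add: generates_iff)
qed

lemma generates_combination:
  assumes S: "finite S" and f: "\<And>i. i \<in> S \<Longrightarrow> f i \<in> L2 M" and gen: "\<And>i. i \<in> S \<Longrightarrow> generates (f i) (g i)"
  shows "generates (\<lambda>x. \<Sum>i\<in>S. c i * f i x) (\<lambda>x. \<Sum>i\<in>S. c i * g i x)"
proof -
  have g: "g i \<in> L2 M" if "i \<in> S" for i using generates_L2[OF gen[OF that] f[OF that]] .
  have fs: "(\<lambda>x. \<Sum>i\<in>S. c i * f i x) \<in> L2 M" and gs: "(\<lambda>x. \<Sum>i\<in>S. c i * g i x) \<in> L2 M"
    by (intro L2_sum L2_cmult f g; assumption)+
  have le: "remainder (\<lambda>x. \<Sum>i\<in>S. c i * f i x) (\<lambda>x. \<Sum>i\<in>S. c i * g i x) t \<le> (\<Sum>i\<in>S. cmod (c i) * remainder (f i) (g i) t)" for t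
  proof -
    have ri: "(\<lambda>x. U t (f i) x - (f i x + of_real t * g i x)) \<in> L2 M" if "i \<in> S" for i
      by (intro L2_diff L2_add L2_cmult U_L2 f g that)
    have "remainder (\<lambda>x. \<Sum>i\<in>S. c i * f i x) (\<lambda>x. \<Sum>i\<in>S. c i * g i x) t
      = L2_norm M (\<lambda>x. \<Sum>i\<in>S. c i * (U t (f i) x - (f i x + of_real t * g i x)))"
      unfolding remainder_def
    proof (rule L2_norm_cong_AE)
      have "AE x in M. U t (\<lambda>x. \<Sum>i\<in>S. c i * f i x) x = (\<Sum>i\<in>S. c i * U t (f i) x)"
        by (rule L2_unitary_combination[OF unitary f S])
      then show "AE x in M. U t (\<lambda>x. \<Sum>i\<in>S. c i * f i x) x - ((\<Sum>i\<in>S. c i * f i x) + of_real t * (\<Sum>i\<in>S. c i * g i x))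
          = (\<Sum>i\<in>S. c i * (U t (f i) x - (f i x + of_real t * g i x)))"
        by eventually_elim (simp add: sum_distrib_left sum_subtractf sum.distrib algebra_simps)
      show "(\<lambda>x. U t (\<lambda>x. \<Sum>i\<in>S. c i * f i x) x - ((\<Sum>i\<in>S. c i * f i x) + of_real t * (\<Sum>i\<in>S. c i * g i x))) \<in> borel_measurable M"
        by (intro L2_measurable L2_diff L2_add L2_cmult U_L2 fs gs)
      show "(\<lambda>x. \<Sum>i\<in>S. c i * (U t (f i) x - (f i x + of_real t * g i x))) \<in> borel_measurable M"
        by (intro L2_measurable L2_sum L2_cmult ri)
    qed
    also have "\<dots> \<le> (\<Sum>i\<in>S. L2_norm M (\<lambda>x. c i * (U t (f i) x - (f i x + of_real t * g i x))))"
      by (intro L2_norm_sum L2_cmult ri)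
    finally show ?thesis by (simp only: L2_norm_cmult remainder_def)
  qed
  have "((\<lambda>t. \<Sum>i\<in>S. cmod (c i) * (remainder (f i) (g i) t / \<bar>t\<bar>)) \<longlongrightarrow> (\<Sum>i\<in>S. cmod (c i) * 0)) (at 0)"
    using gen f g by (intro tendsto_intros) (simp add: generates_iff)
  then have lim: "((\<lambda>t. (\<Sum>i\<in>S. cmod (c i) * remainder (f i) (g i) t) / \<bar>t\<bar>) \<longlongrightarrow> 0) (at 0)"
    by (simp add: sum_divide_distrib)
  show ?thesis unfolding generates_iff[OF fs gs]
  proof (rule tendsto_sandwich[OF _ _ tendsto_const lim])
    show "\<forall>\<^sub>F t in at 0. remainder (\<lambda>x. \<Sum>i\<in>S. c i * f i x) (\<lambda>x. \<Sum>i\<in>S. c i * g i x) t / \<bar>t\<bar> \<le> (\<Sum>i\<in>S. cmod (c i) * remainder (f i) (g i) t) / \<bar>t\<bar>"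
      by (intro always_eventually allI divide_right_mono le) simp
  qed (simp add: remainder_nonneg)
qed

end

section \<open>Logarithms of the automorphy factor along paths\<close>

text \<open>The values of \<open>h\<close> differ by multiples of \<open>2 \<pi> \<i>\<close>, so the continuous function \<open>h\<close> has discrete range.\<close>

lemma exp_lift_constant:
  fixes h :: "'a::topological_space \<Rightarrow> complex"
  assumes "connected S" "continuous_on S h" "\<And>x. x \<in> S \<Longrightarrow> exp (h x) = c" "x \<in> S" "y \<in> S"
  shows "h x = h y"
proof -
  have "h constant_on S"
  proof (rule continuous_discrete_range_constant[OF assms(1,2)])
    fix x assume x: "x \<in> S"
    have "2 * pi \<le> norm (h y - h x)" if "y \<in> S" "h y \<noteq> h x" for y
    proof (rule ccontr)
      assume "\<not> 2 * pi \<le> norm (h y - h x)"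
      then have "\<bar>Im (h y) - Im (h x)\<bar> < 2 * pi" using abs_Im_le_cmod[of "h y - h x"] by simp
      moreover have "exp (h y) = exp (h x)" using assms(3)[OF that(1)] assms(3)[OF x] by simp
      ultimately have "h y = h x" by (rule exp_complex_eqI)
      with that show False by simp
    qed
    then show "\<exists>e>0. \<forall>y. y \<in> S \<and> h y \<noteq> h x \<longrightarrow> e \<le> norm (h y - h x)"
      by (intro exI[of _ "2 * pi"]) auto
  qed
  then show ?thesis using assms(4,5) unfolding constant_on_def by metis
qed

text \<open>The increment along \<open>[0, 1]\<close> of a continuous logarithm of \<open>f\<close>, for \<open>f 0 = 1\<close>.\<close>

definition log_along :: "(real \<Rightarrow> complex) \<Rightarrow> complex" where
  "log_along f = (SOME w. \<exists>g. continuous_on {0..1} g \<and> (\<forall>t\<in>{0..1}. exp (g t) = f t) \<and> g 0 = 0 \<and> g 1 = w)"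

lemma log_along_eq:
  assumes g: "continuous_on {0..1} g" "\<And>t. t \<in> {0..1} \<Longrightarrow> exp (g t) = f t" "g 0 = 0"
  shows "log_along f = g 1"
  unfolding log_along_def
proof (rule some_equality)
  show "\<exists>g'. continuous_on {0..1} g' \<and> (\<forall>t\<in>{0..1}. exp (g' t) = f t) \<and> g' 0 = 0 \<and> g' 1 = g 1"
    by (intro exI[of _ g] conjI ballI g refl)
  fix w assume "\<exists>g. continuous_on {0..1} g \<and> (\<forall>t\<in>{0..1}. exp (g t) = f t) \<and> g 0 = 0 \<and> g 1 = w"
  then obtain g' where g': "continuous_on {0..1} g'" "\<And>t. t \<in> {0..1} \<Longrightarrow> exp (g' t) = f t" "g' 0 = 0" "g' 1 = w"
    by blast
  have "g' 0 - g 0 = g' 1 - g 1"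
  proof (rule exp_lift_constant[where h = "\<lambda>t. g' t - g t" and S = "{0..1}" and c = 1])
    show "continuous_on {0..1} (\<lambda>t. g' t - g t)" by (intro continuous_on_diff g(1) g'(1))
    fix t :: real assume "t \<in> {0..1}"
    then have "exp (g' t) = exp (g t)" using g(2) g'(2) by simp
    then show "exp (g' t - g t) = 1" by (simp add: exp_diff)
  qed auto
  then have "g' 1 - g 1 = 0 - 0" by (simp only: g(3) g'(3))
  then have "g' 1 = g 1" by (simp only: diff_self right_minus_eq)
  then show "w = g 1" by (simp only: g'(4))
qed

lemma log_along_lift:
  assumes "continuous_on {0..1} f" "\<And>t. t \<in> {0..1} \<Longrightarrow> f t \<noteq> 0" "f 0 = 1"
  obtains g where "continuous_on {0..1} g" "\<And>t. t \<in> {0..1} \<Longrightarrow> exp (g t) = f t" "g 0 = 0"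
    "log_along f = g 1"
proof -
  have "contractible {0..1::real}" by (intro convex_imp_contractible) simp
  then obtain g where g: "continuous_on {0..1} g" "\<And>t. t \<in> {0..1} \<Longrightarrow> f t = exp (g t)"
    using continuous_logarithm_on_contractible[OF assms(1) _ assms(2)] by blast
  have "continuous_on {0..1} (\<lambda>t. g t - g 0)" by (intro continuous_intros g(1))
  moreover have "exp (g t - g 0) = f t" if "t \<in> {0..1}" for t
    using g(2)[OF that] g(2)[of 0] assms(3) by (simp add: exp_diff)
  ultimately show thesis using that[of "\<lambda>t. g t - g 0"] log_along_eq[of "\<lambda>t. g t - g 0" f] by simp
qed

text \<open>The factor of automorphy and the fractional linear action of \<open>SL2\<close> on the upper half-plane.\<close>

definition auto_factor :: "real^2^2 \<Rightarrow> complex \<Rightarrow> complex" where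
  "auto_factor A \<tau> = of_real (A $ 2 $ 1) * \<tau> + of_real (A $ 2 $ 2)"

definition mobius_act :: "real^2^2 \<Rightarrow> complex \<Rightarrow> complex" where
  "mobius_act A \<tau> = (of_real (A $ 1 $ 1) * \<tau> + of_real (A $ 1 $ 2)) / auto_factor A \<tau>"

lemma SL2_det: "A \<in> SL2 \<longleftrightarrow> A $ 1 $ 1 * A $ 2 $ 2 - A $ 1 $ 2 * A $ 2 $ 1 = 1"
  by (simp add: SL2_def det_2)

lemma SL2_mult: "A \<in> SL2 \<Longrightarrow> B \<in> SL2 \<Longrightarrow> A ** B \<in> SL2"
  by (simp add: SL2_def det_mul)

lemma SL2_one: "mat 1 \<in> SL2"
  by (simp add: SL2_def)

lemma auto_factor_one [simp]: "auto_factor (mat 1) \<tau> = 1"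
  by (simp add: auto_factor_def mat_def)

lemma mobius_act_one [simp]: "mobius_act (mat 1) \<tau> = \<tau>"
  by (simp add: mobius_act_def) (simp add: mat_def)

lemma auto_factor_nonzero:
  assumes "A \<in> SL2" "Im \<tau> > 0"
  shows "auto_factor A \<tau> \<noteq> 0"
proof
  assume 0: "auto_factor A \<tau> = 0"
  then have "Im (auto_factor A \<tau>) = 0" "Re (auto_factor A \<tau>) = 0" by auto
  then have "A $ 2 $ 1 = 0" "A $ 2 $ 2 = 0" using assms(2) by (auto simp: auto_factor_def)
  then show False using assms(1) by (simp add: SL2_det)
qed

text \<open>The polarised form of the formula for the imaginary part of \<open>A \<tau>\<close>. It is the reason why the Gram
  matrix of the Gaussians is invariant.\<close>

lemma mobius_act_diff_cnj:
  assumes A: "A \<in> SL2" and "Im \<tau> > 0" "Im \<sigma> > 0"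
  shows "mobius_act A \<tau> - cnj (mobius_act A \<sigma>) = (\<tau> - cnj \<sigma>) / (auto_factor A \<tau> * cnj (auto_factor A \<sigma>))"
proof -
  have nz: "auto_factor A \<tau> \<noteq> 0" "cnj (auto_factor A \<sigma>) \<noteq> 0"
    using auto_factor_nonzero[OF A] assms by auto
  have det: "complex_of_real (A $ 1 $ 1) * of_real (A $ 2 $ 2) - of_real (A $ 1 $ 2) * of_real (A $ 2 $ 1) = 1"
    using A by (simp add: SL2_det flip: of_real_mult of_real_diff)
  have "(of_real (A $ 1 $ 1) * \<tau> + of_real (A $ 1 $ 2)) * cnj (auto_factor A \<sigma>)
      - cnj (of_real (A $ 1 $ 1) * \<sigma> + of_real (A $ 1 $ 2)) * auto_factor A \<tau>
    = (of_real (A $ 1 $ 1) * of_real (A $ 2 $ 2) - of_real (A $ 1 $ 2) * of_real (A $ 2 $ 1)) * (\<tau> - cnj \<sigma>)"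
    by (simp add: auto_factor_def algebra_simps)
  also have "\<dots> = \<tau> - cnj \<sigma>" by (simp only: det mult_1)
  finally have "\<tau> - cnj \<sigma> = (of_real (A $ 1 $ 1) * \<tau> + of_real (A $ 1 $ 2)) * cnj (auto_factor A \<sigma>)
      - cnj (of_real (A $ 1 $ 1) * \<sigma> + of_real (A $ 1 $ 2)) * auto_factor A \<tau>" by simp
  then show ?thesis unfolding mobius_act_def complex_cnj_divide using nz by (simp add: diff_frac_eq)
qed

lemma mobius_act_upper_half_plane:
  assumes A: "A \<in> SL2" and "Im \<tau> > 0"
  shows "Im (mobius_act A \<tau>) > 0"
proof -
  have "mobius_act A \<tau> - cnj (mobius_act A \<tau>) = (\<tau> - cnj \<tau>) / (auto_factor A \<tau> * cnj (auto_factor A \<tau>))"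
    by (rule mobius_act_diff_cnj[OF assms assms(2)])
  also have "\<dots> = (\<tau> - cnj \<tau>) / of_real ((cmod (auto_factor A \<tau>))\<^sup>2)" by (simp only: complex_norm_square)
  finally have "Im (mobius_act A \<tau> - cnj (mobius_act A \<tau>)) = Im (\<tau> - cnj \<tau>) / (cmod (auto_factor A \<tau>))\<^sup>2"
    by (simp only: Im_divide_of_real)
  moreover have "(cmod (auto_factor A \<tau>))\<^sup>2 > 0" using auto_factor_nonzero[OF assms] by simp
  moreover have "Im (\<tau> - cnj \<tau>) > 0" using assms(2) by simp
  ultimately have "Im (mobius_act A \<tau> - cnj (mobius_act A \<tau>)) > 0" by (simp only: divide_pos_pos)
  then show ?thesis by simp
qed

lemma matrix_mult_2: "((A::real^2^2) ** B) $ i $ j = A $ i $ 1 * B $ 1 $ j + A $ i $ 2 * B $ 2 $ j"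
  by (simp add: matrix_matrix_mult_def sum_2)

lemma auto_factor_mult:
  assumes "B \<in> SL2" "Im \<tau> > 0"
  shows "auto_factor (A ** B) \<tau> = auto_factor A (mobius_act B \<tau>) * auto_factor B \<tau>"
proof -
  have "auto_factor A (mobius_act B \<tau>) * auto_factor B \<tau>
    = of_real (A $ 2 $ 1) * (mobius_act B \<tau> * auto_factor B \<tau>) + of_real (A $ 2 $ 2) * auto_factor B \<tau>"
    by (simp add: auto_factor_def[of A] algebra_simps)
  also have "mobius_act B \<tau> * auto_factor B \<tau> = of_real (B $ 1 $ 1) * \<tau> + of_real (B $ 1 $ 2)"
    using auto_factor_nonzero[OF assms] by (simp add: mobius_act_def)
  finally show ?thesis by (simp add: auto_factor_def matrix_mult_2 algebra_simps)
qed

lemma mobius_act_mult: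
  assumes "A \<in> SL2" "B \<in> SL2" "Im \<tau> > 0"
  shows "mobius_act (A ** B) \<tau> = mobius_act A (mobius_act B \<tau>)"
proof -
  have nz: "auto_factor B \<tau> \<noteq> 0" "auto_factor A (mobius_act B \<tau>) \<noteq> 0"
    using auto_factor_nonzero mobius_act_upper_half_plane assms by blast+
  have "mobius_act B \<tau> * auto_factor B \<tau> = of_real (B $ 1 $ 1) * \<tau> + of_real (B $ 1 $ 2)"
    using nz by (simp add: mobius_act_def)
  then have "of_real ((A ** B) $ 1 $ 1) * \<tau> + of_real ((A ** B) $ 1 $ 2)
     = (of_real (A $ 1 $ 1) * mobius_act B \<tau> + of_real (A $ 1 $ 2)) * auto_factor B \<tau>"
    by (simp add: distrib_right mult.assoc) (simp add: auto_factor_def matrix_mult_2 algebra_simps)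
  then show ?thesis
    unfolding mobius_act_def[of "A ** B"] mobius_act_def[of A] auto_factor_mult[OF assms(2,3)] using nz by simp
qed

lemma auto_factor_continuous:
  "continuous_on S A \<Longrightarrow> continuous_on S \<tau> \<Longrightarrow> continuous_on S (\<lambda>x. auto_factor (A x) (\<tau> x))"
  unfolding auto_factor_def by (intro continuous_intros)

lemma mobius_act_continuous:
  assumes "continuous_on S A" "continuous_on S \<tau>" "\<And>x. x \<in> S \<Longrightarrow> A x \<in> SL2" "\<And>x. x \<in> S \<Longrightarrow> Im (\<tau> x) > 0"
  shows "continuous_on S (\<lambda>x. mobius_act (A x) (\<tau> x))"
  unfolding mobius_act_def
  by (intro continuous_intros auto_factor_continuous assms ballI auto_factor_nonzero)

text \<open>Real powers of the automorphy factor are not functions on the group; they need a logarithm, which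
  becomes single-valued on homotopy classes of paths.\<close>

definition path_log :: "(real \<Rightarrow> real^2^2) \<Rightarrow> complex \<Rightarrow> complex" where
  "path_log \<gamma> \<tau> = log_along (\<lambda>t. auto_factor (\<gamma> t) \<tau>)"

lemma SL2_pathsD:
  assumes "\<gamma> \<in> SL2_paths"
  shows "continuous_on {0..1} \<gamma>" "t \<in> {0..1} \<Longrightarrow> \<gamma> t \<in> SL2" "\<gamma> 0 = mat 1"
  using assms by (auto simp: SL2_paths_def path_def path_image_def pathstart_def)

lemma SL2_pathsI:
  assumes "continuous_on {0..1} \<gamma>" "\<And>t. t \<in> {0..1} \<Longrightarrow> \<gamma> t \<in> SL2" "\<gamma> 0 = mat 1"
  shows "\<gamma> \<in> SL2_paths"
  using assms by (auto simp: SL2_paths_def path_def path_image_def pathstart_def)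

lemma path_log_lift:
  assumes "\<gamma> \<in> SL2_paths" "Im \<tau> > 0"
  obtains g where "continuous_on {0..1} g" "\<And>t. t \<in> {0..1} \<Longrightarrow> exp (g t) = auto_factor (\<gamma> t) \<tau>"
    "g 0 = 0" "path_log \<gamma> \<tau> = g 1"
  unfolding path_log_def
proof (rule log_along_lift[of "\<lambda>t. auto_factor (\<gamma> t) \<tau>"])
  show "continuous_on {0..1} (\<lambda>t. auto_factor (\<gamma> t) \<tau>)"
    by (intro auto_factor_continuous continuous_on_const SL2_pathsD(1)[OF assms(1)])
qed (use assms SL2_pathsD[OF assms(1)] auto_factor_nonzero in auto)

lemma path_log_eq:
  assumes "continuous_on {0..1} g" "\<And>t. t \<in> {0..1} \<Longrightarrow> exp (g t) = auto_factor (\<gamma> t) \<tau>" "g 0 = 0"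
  shows "path_log \<gamma> \<tau> = g 1"
  unfolding path_log_def by (rule log_along_eq) (use assms in auto)

lemma path_log_one: "path_log (\<lambda>t. mat 1) \<tau> = 0"
  by (subst path_log_eq[of "\<lambda>_. 0"]) auto

lemma contractible_unit_square: "contractible ({0..1::real} \<times> {0..1::real})"
  by (intro convex_imp_contractible convex_Times) auto

text \<open>The automorphy factor along a homotopy is a map without zeros on a square, so it has a continuous
  logarithm there. On the two sides where the homotopy is constant this logarithm is constant.\<close>

lemma path_log_homotopic:
  assumes "homotopic_paths SL2 \<gamma> \<delta>" "\<gamma> 0 = mat 1" "Im \<tau> > 0"
  shows "path_log \<gamma> \<tau> = path_log \<delta> \<tau>"
proof -
  obtain h :: "real \<times> real \<Rightarrow> real^2^2" where h: "continuous_on ({0..1} \<times> {0..1}) h" "h \<in> ({0..1} \<times> {0..1}) \<rightarrow> SL2"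
    "\<And>x. x \<in> {0..1} \<Longrightarrow> h (0, x) = \<gamma> x" "\<And>x. x \<in> {0..1} \<Longrightarrow> h (1, x) = \<delta> x"
    "\<And>t. t \<in> {0..1} \<Longrightarrow> h (t, 0) = \<gamma> 0 \<and> h (t, 1) = \<gamma> 1"
    using assms(1) unfolding homotopic_paths pathstart_def pathfinish_def o_def by blast
  have "continuous_on ({0..1} \<times> {0..1}) (\<lambda>z. auto_factor (h z) \<tau>)"
    by (intro auto_factor_continuous h(1) continuous_on_const)
  moreover have "auto_factor (h z) \<tau> \<noteq> 0" if "z \<in> {0..1} \<times> {0..1}" for z
    using h(2) that assms(3) by (intro auto_factor_nonzero) (auto simp: Pi_iff)
  ultimately obtain g where g: "continuous_on ({0..1} \<times> {0..1}) g" "\<And>z. z \<in> {0..1} \<times> {0..1} \<Longrightarrow> auto_factor (h z) \<tau> = exp (g z)"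
    using continuous_logarithm_on_contractible[OF _ contractible_unit_square, of "\<lambda>z. auto_factor (h z) \<tau>"] by blast
  define G where "G s t = g (s, t) - g (s, 0)" for s t
  have cont: "continuous_on S (\<lambda>x. G (p x) (q x))"
    if "continuous_on S p" "continuous_on S q" "p ` S \<subseteq> {0..1}" "q ` S \<subseteq> {0..1}" for S :: "real set" and p q
    unfolding G_def by (intro continuous_on_diff continuous_on_compose2[OF g(1)] continuous_intros that) (use that in auto)
  have expG: "exp (G s t) = auto_factor (h (s, t)) \<tau>" if "s \<in> {0..1}" "t \<in> {0..1}" for s t
    using that g(2)[of "(s, t)"] g(2)[of "(s, 0)"] h(5)[of s] assms(2) by (simp add: G_def exp_diff)
  have "path_log \<gamma> \<tau> = G 0 1"
    by (rule path_log_eq[of "\<lambda>t. G 0 t"]) (use h expG in \<open>auto intro!: cont continuous_intros simp: G_def[of _ 0]\<close>)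
  moreover have "path_log \<delta> \<tau> = G 1 1"
    by (rule path_log_eq[of "\<lambda>t. G 1 t"]) (use h expG in \<open>auto intro!: cont continuous_intros simp: G_def[of _ 0]\<close>)
  moreover have "G 0 1 = G 1 1"
    by (rule exp_lift_constant[where h = "\<lambda>s. G s 1" and S = "{0..1}" and c = "auto_factor (\<gamma> 1) \<tau>"])
      (use h expG in \<open>auto intro!: cont continuous_intros\<close>)
  ultimately show ?thesis by simp
qed

lemma SL2_paths_mult:
  assumes "\<gamma> \<in> SL2_paths" "\<delta> \<in> SL2_paths"
  shows "(\<lambda>t. \<gamma> t ** \<delta> t) \<in> SL2_paths"
proof (rule SL2_pathsI)
  show "continuous_on {0..1} (\<lambda>t. \<gamma> t ** \<delta> t)"
    unfolding matrix_matrix_mult_def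
    by (intro continuous_on_vec_lambda continuous_intros SL2_pathsD(1) assms)
qed (auto intro: SL2_mult simp: SL2_pathsD[OF assms(1)] SL2_pathsD[OF assms(2)])

text \<open>The cocycle law. Both sides are increments of one logarithm on the square \<open>(s, t) \<mapsto> j(\<gamma> s, \<delta> t \<tau>) j(\<delta> t, \<tau>)\<close>,
  once along the diagonal and once along two sides.\<close>

lemma path_log_mult:
  assumes \<gamma>: "\<gamma> \<in> SL2_paths" and \<delta>: "\<delta> \<in> SL2_paths" and \<tau>: "Im \<tau> > 0"
  shows "path_log (\<lambda>t. \<gamma> t ** \<delta> t) \<tau> = path_log \<gamma> (mobius_act (\<delta> 1) \<tau>) + path_log \<delta> \<tau>"
proof -
  let ?Q = "{0..1::real} \<times> {0..1::real}"
  note \<gamma>' = SL2_pathsD[OF \<gamma>] and \<delta>' = SL2_pathsD[OF \<delta>]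
  define F where "F z = auto_factor (\<gamma> (fst z)) (mobius_act (\<delta> (snd z)) \<tau>)" for z
  have "continuous_on ?Q (\<lambda>z. \<gamma> (fst z))" "continuous_on ?Q (\<lambda>z. \<delta> (snd z))"
    by (rule continuous_on_compose2[OF \<gamma>'(1)] continuous_on_compose2[OF \<delta>'(1)]; auto intro: continuous_intros)+
  then have "continuous_on ?Q F" unfolding F_def
    by (intro auto_factor_continuous mobius_act_continuous continuous_on_const) (auto simp: \<delta>' \<tau>)
  moreover have F0: "F z \<noteq> 0" if "z \<in> ?Q" for z
    unfolding F_def using that by (intro auto_factor_nonzero mobius_act_upper_half_plane \<gamma>' \<delta>' \<tau>) auto
  ultimately obtain g where g: "continuous_on ?Q g" "\<And>z. z \<in> ?Q \<Longrightarrow> F z = exp (g z)"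
    using continuous_logarithm_on_contractible[OF _ contractible_unit_square, of F] by blast
  define G where "G s t = g (s, t) - g (0, t)" for s t
  have cont: "continuous_on S (\<lambda>x. G (p x) (q x))"
    if "continuous_on S p" "continuous_on S q" "p ` S \<subseteq> {0..1}" "q ` S \<subseteq> {0..1}" for S :: "real set" and p q
    unfolding G_def by (intro continuous_on_diff continuous_on_compose2[OF g(1)] continuous_intros that) (use that in auto)
  have expG: "exp (G s t) = F (s, t)" if "s \<in> {0..1}" "t \<in> {0..1}" for s t
    using that g(2)[of "(s, t)"] g(2)[of "(0, t)"] \<gamma>'(3) by (simp add: G_def exp_diff F_def)
  have 1: "path_log \<gamma> (mobius_act (\<delta> 1) \<tau>) = G 1 1"
    by (rule path_log_eq[of "\<lambda>s. G s 1"]) (use expG in \<open>auto intro!: cont continuous_intros simp: G_def[of 0] F_def\<close>)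
  obtain l where l: "continuous_on {0..1} l" "\<And>t. t \<in> {0..1} \<Longrightarrow> exp (l t) = auto_factor (\<delta> t) \<tau>"
    "l 0 = 0" "path_log \<delta> \<tau> = l 1" using path_log_lift[OF \<delta> \<tau>] by blast
  have "path_log (\<lambda>t. \<gamma> t ** \<delta> t) \<tau> = G 1 1 + l 1"
  proof (rule path_log_eq[of "\<lambda>t. G t t + l t"])
    show "continuous_on {0..1} (\<lambda>t. G t t + l t)" by (intro continuous_on_add continuous_on_id cont l(1)) auto
    fix t :: real assume "t \<in> {0..1}"
    then show "exp (G t t + l t) = auto_factor (\<gamma> t ** \<delta> t) \<tau>"
      by (simp add: exp_add expG l(2) F_def auto_factor_mult[OF \<delta>'(2) \<tau>])
  qed (simp add: l(3) G_def)
  then show ?thesis using 1 l(4) by simp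
qed

text \<open>By \<open>mobius_act_diff_cnj\<close> the left-hand side, taken along the path up to time \<open>t\<close>, is a continuous
  logarithm of the constant \<open>- \<i> (\<tau> - cnj \<sigma>)\<close>. Hence it keeps its value at the start of the path, which is
  the right-hand side.\<close>

lemma path_log_gram:
  assumes \<gamma>: "\<gamma> \<in> SL2_paths" and \<tau>: "Im \<tau> > 0" and \<sigma>: "Im \<sigma> > 0"
  shows "path_log \<gamma> \<tau> + cnj (path_log \<gamma> \<sigma>) + Ln (- \<i> * (mobius_act (\<gamma> 1) \<tau> - cnj (mobius_act (\<gamma> 1) \<sigma>)))
    = Ln (- \<i> * (\<tau> - cnj \<sigma>))"
proof -
  note \<gamma>' = SL2_pathsD[OF \<gamma>]
  obtain g where g: "continuous_on {0..1} g" "\<And>t. t \<in> {0..1} \<Longrightarrow> exp (g t) = auto_factor (\<gamma> t) \<tau>"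
    "g 0 = 0" "path_log \<gamma> \<tau> = g 1" using path_log_lift[OF \<gamma> \<tau>] by blast
  obtain l where l: "continuous_on {0..1} l" "\<And>t. t \<in> {0..1} \<Longrightarrow> exp (l t) = auto_factor (\<gamma> t) \<sigma>"
    "l 0 = 0" "path_log \<gamma> \<sigma> = l 1" using path_log_lift[OF \<gamma> \<sigma>] by blast
  define s where "s t = - \<i> * (mobius_act (\<gamma> t) \<tau> - cnj (mobius_act (\<gamma> t) \<sigma>))" for t
  have Re_s: "Re (s t) > 0" if "t \<in> {0..1}" for t
    using mobius_act_upper_half_plane[OF \<gamma>'(2)[OF that] \<tau>] mobius_act_upper_half_plane[OF \<gamma>'(2)[OF that] \<sigma>]
    by (simp add: s_def)
  then have s0: "t \<in> {0..1} \<Longrightarrow> s t \<noteq> 0" "t \<in> {0..1} \<Longrightarrow> s t \<notin> \<real>\<^sub>\<le>\<^sub>0" for t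
    by (force simp: complex_nonpos_Reals_iff)+
  have "g 0 + cnj (l 0) + Ln (s 0) = g 1 + cnj (l 1) + Ln (s 1)"
  proof (rule exp_lift_constant[where h = "\<lambda>t. g t + cnj (l t) + Ln (s t)" and S = "{0..1}"
      and c = "- \<i> * (\<tau> - cnj \<sigma>)"])
    have "continuous_on {0..1} s" unfolding s_def
      by (intro continuous_intros mobius_act_continuous \<gamma>'(1)) (auto simp: \<tau> \<sigma> \<gamma>'(2))
    then show "continuous_on {0..1} (\<lambda>t. g t + cnj (l t) + Ln (s t))"
      by (intro continuous_on_add continuous_on_cnj continuous_on_Ln' g(1) l(1)) (auto simp: s0)
    fix t :: real assume t: "t \<in> {0..1}"
    have nz: "auto_factor (\<gamma> t) \<tau> \<noteq> 0" "cnj (auto_factor (\<gamma> t) \<sigma>) \<noteq> 0"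
      using auto_factor_nonzero[OF \<gamma>'(2)[OF t]] \<tau> \<sigma> by auto
    have "exp (g t + cnj (l t) + Ln (s t)) = auto_factor (\<gamma> t) \<tau> * cnj (auto_factor (\<gamma> t) \<sigma>) * s t"
      using s0(1)[OF t] by (simp add: exp_add g(2)[OF t] l(2)[OF t] flip: exp_cnj)
    also have "\<dots> = - \<i> * (\<tau> - cnj \<sigma>)"
      unfolding s_def mobius_act_diff_cnj[OF \<gamma>'(2)[OF t] \<tau> \<sigma>] using nz by simp
    finally show "exp (g t + cnj (l t) + Ln (s t)) = - \<i> * (\<tau> - cnj \<sigma>)" .
  qed auto
  then show ?thesis by (simp add: g l s_def \<gamma>'(3))
qed

text \<open>On a half-plane the principal branch is a continuous logarithm and prolongs the given one.\<close>

lemma path_log_join: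
  assumes \<gamma>: "\<gamma> \<in> SL2_paths" and \<tau>: "Im \<tau> > 0" and \<eta>: "path \<eta>" "pathstart \<eta> = pathfinish \<gamma>"
    and near: "\<And>A. A \<in> path_image \<eta> \<Longrightarrow> Re (auto_factor A \<tau> / auto_factor (\<gamma> 1) \<tau>) > 0"
  shows "path_log (\<gamma> +++ \<eta>) \<tau> = path_log \<gamma> \<tau> + Ln (auto_factor (\<eta> 1) \<tau> / auto_factor (\<gamma> 1) \<tau>)"
proof -
  note \<gamma>' = SL2_pathsD[OF \<gamma>]
  obtain g where g: "continuous_on {0..1} g" "\<And>t. t \<in> {0..1} \<Longrightarrow> exp (g t) = auto_factor (\<gamma> t) \<tau>"
    "g 0 = 0" "path_log \<gamma> \<tau> = g 1" using path_log_lift[OF \<gamma> \<tau>] by blast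
  define q where "q t = auto_factor (\<eta> t) \<tau> / auto_factor (\<gamma> 1) \<tau>" for t
  have nz: "auto_factor (\<gamma> 1) \<tau> \<noteq> 0" using auto_factor_nonzero \<gamma>' \<tau> by auto
  have Re_q: "Re (q t) > 0" if "t \<in> {0..1}" for t
    unfolding q_def using that by (intro near) (auto simp: path_image_def)
  then have q0: "t \<in> {0..1} \<Longrightarrow> q t \<noteq> 0" "t \<in> {0..1} \<Longrightarrow> q t \<notin> \<real>\<^sub>\<le>\<^sub>0" for t
    by (force simp: complex_nonpos_Reals_iff)+
  have q_start: "q 0 = 1" using \<eta>(2) nz by (simp add: q_def pathstart_def pathfinish_def)
  define k where "k t = g 1 + Ln (q t)" for t
  have "path_log (\<gamma> +++ \<eta>) \<tau> = (g +++ k) 1"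
  proof (rule path_log_eq)
    have "continuous_on {0..1} q" unfolding q_def
      using \<eta>(1) nz by (intro continuous_intros auto_factor_continuous) (auto simp: path_def)
    then have "path k" unfolding path_def k_def
      by (intro continuous_on_add continuous_on_const continuous_on_Ln') (auto simp: q0)
    then have "path (g +++ k)"
      using g(1) q_start by (intro path_join_imp) (auto simp: path_def pathstart_def pathfinish_def k_def)
    then show "continuous_on {0..1} (g +++ k)" by (simp add: path_def)
    fix t :: real assume t: "t \<in> {0..1}"
    show "exp ((g +++ k) t) = auto_factor ((\<gamma> +++ \<eta>) t) \<tau>"
    proof (cases "t \<le> 1 / 2")
      case True
      then show ?thesis using t by (simp add: joinpaths_def g(2))
    next
      case False
      then have "exp (k (2 * t - 1)) = auto_factor (\<eta> (2 * t - 1)) \<tau>"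
        using t nz g(2)[of 1] q0(1)[of "2 * t - 1"] by (simp add: k_def exp_add) (simp add: q_def)
      then show ?thesis using False by (simp add: joinpaths_def)
    qed
  qed (simp add: joinpaths_def g(3))
  then show ?thesis by (simp add: joinpaths_def k_def q_def g(4))
qed

lemma path_log_Ln:
  assumes \<gamma>: "\<gamma> \<in> SL2_paths" and near: "\<And>t. t \<in> {0..1} \<Longrightarrow> Re (auto_factor (\<gamma> t) \<tau>) > 0"
  shows "path_log \<gamma> \<tau> = Ln (auto_factor (\<gamma> 1) \<tau>)"
proof (rule path_log_eq[of "\<lambda>t. Ln (auto_factor (\<gamma> t) \<tau>)"])
  have nz: "t \<in> {0..1} \<Longrightarrow> auto_factor (\<gamma> t) \<tau> \<noteq> 0" "t \<in> {0..1} \<Longrightarrow> auto_factor (\<gamma> t) \<tau> \<notin> \<real>\<^sub>\<le>\<^sub>0" for t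
    using near[of t] by (force simp: complex_nonpos_Reals_iff)+
  show "continuous_on {0..1} (\<lambda>t. Ln (auto_factor (\<gamma> t) \<tau>))"
    by (intro continuous_on_Ln' auto_factor_continuous SL2_pathsD(1)[OF \<gamma>] continuous_on_const) (auto simp: nz)
  show "exp (Ln (auto_factor (\<gamma> t) \<tau>)) = auto_factor (\<gamma> t) \<tau>" if "t \<in> {0..1}" for t
    using nz(1)[OF that] by simp
qed (simp add: SL2_pathsD[OF \<gamma>])

section \<open>The exponential of traceless matrices\<close>

text \<open>If \<open>X\<^sup>2 = \<mu>\<^sup>2\<close> then \<open>exp (t X) = cosh (\<mu> t) + (sinh (\<mu> t) / \<mu>) X\<close>. The number \<open>\<mu>\<close> is real, imaginary or zero
  according to the sign of \<open>det X\<close>; a complex \<open>\<mu>\<close> with the limit value at \<open>\<mu> = 0\<close> covers all cases.\<close>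

definition quadratic_cosh :: "complex \<Rightarrow> real \<Rightarrow> complex" where
  "quadratic_cosh \<mu> t = cosh (\<mu> * of_real t)"

definition quadratic_sinh :: "complex \<Rightarrow> real \<Rightarrow> complex" where
  "quadratic_sinh \<mu> t = (if \<mu> = 0 then of_real t else sinh (\<mu> * of_real t) / \<mu>)"

lemma quadratic_cosh_add:
  "quadratic_cosh \<mu> (s + t) = quadratic_cosh \<mu> s * quadratic_cosh \<mu> t + \<mu>\<^sup>2 * (quadratic_sinh \<mu> s * quadratic_sinh \<mu> t)"
  by (simp add: quadratic_cosh_def quadratic_sinh_def distrib_left cosh_add power2_eq_square)

lemma quadratic_sinh_add:
  "quadratic_sinh \<mu> (s + t) = quadratic_sinh \<mu> s * quadratic_cosh \<mu> t + quadratic_cosh \<mu> s * quadratic_sinh \<mu> t"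
  by (simp add: quadratic_cosh_def quadratic_sinh_def distrib_left sinh_add add_divide_distrib)

lemma quadratic_pythagoras: "(quadratic_cosh \<mu> t)\<^sup>2 - \<mu>\<^sup>2 * (quadratic_sinh \<mu> t)\<^sup>2 = 1"
  using cosh_square_eq[of "\<mu> * of_real t"]
  by (simp add: quadratic_cosh_def quadratic_sinh_def power_divide)

lemma quadratic_cosh_derivative: "(quadratic_cosh \<mu> has_vector_derivative \<mu> * sinh (\<mu> * of_real t)) (at t)"
proof -
  have "((\<lambda>t. cosh (\<mu> * t)) has_field_derivative sinh (\<mu> * of_real t) * \<mu>) (at (of_real t))"
    by (auto intro!: derivative_eq_intros)
  from has_vector_derivative_real_field[OF this] show ?thesis
    unfolding quadratic_cosh_def o_def by (simp add: mult.commute)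
qed

lemma quadratic_sinh_derivative: "(quadratic_sinh \<mu> has_vector_derivative cosh (\<mu> * of_real t)) (at t)"
proof (cases "\<mu> = 0")
  case True
  have "((\<lambda>t. t) has_field_derivative (1::complex)) (at (of_real t))" by (auto intro!: derivative_eq_intros)
  from has_vector_derivative_real_field[OF this] show ?thesis
    unfolding quadratic_sinh_def using True by simp
next
  case False
  have "((\<lambda>t. sinh (\<mu> * t) / \<mu>) has_field_derivative cosh (\<mu> * of_real t)) (at (of_real t))"
    using False by (auto intro!: derivative_eq_intros)
  from has_vector_derivative_real_field[OF this] show ?thesis
    unfolding quadratic_sinh_def using False by simp
qed

lemma trace_2: "trace (X::real^2^2) = X $ 1 $ 1 + X $ 2 $ 2"
  by (simp add: trace_def sum_2)

lemma sl2_square: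
  assumes "X \<in> sl2"
  shows "X ** X = (- det X) *\<^sub>R mat 1"
proof -
  have "X $ 2 $ 2 = - X $ 1 $ 1" using assms by (simp add: sl2_def trace_2)
  then show ?thesis
    by (simp add: vec_eq_iff forall_2 matrix_matrix_mult_def sum_2 det_2 mat_def)
qed

lemma matrix_powers_of_square:
  fixes Y :: "real^2^2"
  assumes "Y ** Y = \<delta> *\<^sub>R mat 1"
  shows "(((**) Y) ^^ n) (mat 1) = (if even n then (\<delta> ^ (n div 2)) *\<^sub>R mat 1 else (\<delta> ^ (n div 2)) *\<^sub>R Y)"
proof (induction n)
  case (Suc n)
  have "Y ** (c *\<^sub>R mat 1) = c *\<^sub>R Y" "Y ** (c *\<^sub>R Y) = (c * \<delta>) *\<^sub>R mat 1" for c
    using assms by (simp_all add: matrix_scalar_ac scalar_matrix_assoc[symmetric])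
  then show ?case using Suc by (auto simp: mult.commute)
qed simp

lemma quadratic_series:
  fixes x y :: complex
  shows "(\<lambda>n. (if even n then (\<mu>\<^sup>2 * (of_real t)\<^sup>2) ^ (n div 2) * x else (\<mu>\<^sup>2 * (of_real t)\<^sup>2) ^ (n div 2) * (of_real t * y)) / fact n)
    sums (quadratic_cosh \<mu> t * x + quadratic_sinh \<mu> t * y)"
proof (cases "\<mu> = 0")
  case True
  have "(\<lambda>n. (if even n then (\<mu>\<^sup>2 * (of_real t)\<^sup>2) ^ (n div 2) * x else (\<mu>\<^sup>2 * (of_real t)\<^sup>2) ^ (n div 2) * (of_real t * y)) / fact n)
    sums (\<Sum>n<2. (if even n then (\<mu>\<^sup>2 * (of_real t)\<^sup>2) ^ (n div 2) * x else (\<mu>\<^sup>2 * (of_real t)\<^sup>2) ^ (n div 2) * (of_real t * y)) / fact n)"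
  proof (rule sums_finite)
    fix n :: nat assume "n \<notin> {..<2}"
    then have "n div 2 > 0" by (simp add: div_greater_zero_iff)
    then show "(if even n then (\<mu>\<^sup>2 * (of_real t)\<^sup>2) ^ (n div 2) * x else (\<mu>\<^sup>2 * (of_real t)\<^sup>2) ^ (n div 2) * (of_real t * y)) / fact n = 0"
      using True by simp
  qed simp
  then show ?thesis using True by (simp add: numeral_2_eq_2 quadratic_cosh_def quadratic_sinh_def)
next
  case False
  define z where "z = \<mu> * of_real t"
  have z2: "\<mu>\<^sup>2 * (of_real t)\<^sup>2 = z\<^sup>2" by (simp add: z_def power_mult_distrib)
  have "(\<lambda>n. (if even n then z ^ n /\<^sub>R fact n else 0) * x + (if even n then 0 else z ^ n /\<^sub>R fact n) * (y / \<mu>))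
    sums (cosh z * x + sinh z * (y / \<mu>))"
    by (intro sums_add sums_mult2 cosh_converges sinh_converges)
  moreover have "(if even n then z ^ n /\<^sub>R fact n else 0) * x + (if even n then 0 else z ^ n /\<^sub>R fact n) * (y / \<mu>)
    = (if even n then (z\<^sup>2) ^ (n div 2) * x else (z\<^sup>2) ^ (n div 2) * (of_real t * y)) / fact n" for n
  proof (cases "even n")
    case True
    then show ?thesis by (simp add: scaleR_conv_of_real field_simps flip: power_mult)
  next
    case False
    then have "z ^ n = (z\<^sup>2) ^ (n div 2) * z" by (simp flip: power_mult power_Suc2)
    then show ?thesis using False \<open>\<mu> \<noteq> 0\<close> by (simp add: scaleR_conv_of_real z_def field_simps)
  qed
  ultimately show ?thesis using False unfolding z2
    by (simp add: quadratic_cosh_def quadratic_sinh_def z_def)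
qed

lemma matrix_exp_sl2:
  assumes X: "X \<in> sl2"
  defines "\<mu> \<equiv> csqrt (of_real (- det X))"
  shows "complex_of_real (matrix_exp (t *\<^sub>R X) $ i $ j)
    = quadratic_cosh \<mu> t * of_real (mat 1 $ i $ j) + quadratic_sinh \<mu> t * of_real (X $ i $ j)"
proof -
  have sq: "(t *\<^sub>R X) ** (t *\<^sub>R X) = (- det X * t\<^sup>2) *\<^sub>R mat 1"
    using sl2_square[OF X] by (simp add: matrix_scalar_ac scalar_matrix_assoc[symmetric] power2_eq_square mult.commute)
  define a where "a n = (1 / fact n) *\<^sub>R (((**) (t *\<^sub>R X)) ^^ n) (mat 1)" for n
  define L where "L i j = quadratic_cosh \<mu> t * of_real (mat 1 $ i $ j) + quadratic_sinh \<mu> t * of_real (X $ i $ j)" for i j :: 2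
  have \<mu>: "\<mu>\<^sup>2 = of_real (- det X)" by (simp add: \<mu>_def)
  have entry: "(\<lambda>n. complex_of_real (a n $ i $ j)) sums L i j" for i j
  proof -
    have "complex_of_real (a n $ i $ j) = (if even n then (\<mu>\<^sup>2 * (of_real t)\<^sup>2) ^ (n div 2) * of_real (mat 1 $ i $ j)
       else (\<mu>\<^sup>2 * (of_real t)\<^sup>2) ^ (n div 2) * (of_real t * of_real (X $ i $ j))) / fact n" for n
      unfolding a_def matrix_powers_of_square[OF sq] \<mu> by simp
    then show ?thesis using quadratic_series[of \<mu> t "of_real (mat 1 $ i $ j)" "of_real (X $ i $ j)"]
      unfolding L_def by (simp only:)
  qed
  have re: "(\<lambda>n. a n $ i $ j) sums Re (L i j)" and im: "Im (L i j) = 0" for i j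
  proof -
    show "(\<lambda>n. a n $ i $ j) sums Re (L i j)" using sums_Re[OF entry[of i j]] by simp
    show "Im (L i j) = 0" using sums_unique2[OF sums_Im[OF entry[of i j]]] by simp
  qed
  have "a sums (\<chi> i j. Re (L i j))"
    unfolding sums_def
  proof (intro vec_tendstoI)
    fix i j show "(\<lambda>n. (\<Sum>i<n. a i) $ i $ j) \<longlonglongrightarrow> (\<chi> i j. Re (L i j)) $ i $ j"
      using re[of i j] by (simp add: sums_def)
  qed
  then have "matrix_exp (t *\<^sub>R X) = (\<chi> i j. Re (L i j))"
    unfolding matrix_exp_def a_def[symmetric] by (simp add: sums_iff)
  then have "complex_of_real (matrix_exp (t *\<^sub>R X) $ i $ j) = of_real (Re (L i j))" by simp
  also have "\<dots> = L i j" using im[of i j] by (simp add: complex_eq_iff)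
  finally show ?thesis by (simp add: L_def)
qed

lemma matrix_exp_entry_derivative:
  assumes X: "X \<in> sl2"
  shows "((\<lambda>t. matrix_exp (t *\<^sub>R X) $ i $ j) has_real_derivative X $ i $ j) (at 0)"
proof -
  define \<mu> where "\<mu> = csqrt (of_real (- det X))"
  have "((\<lambda>t. quadratic_cosh \<mu> t * of_real (mat 1 $ i $ j) + quadratic_sinh \<mu> t * of_real (X $ i $ j))
     has_vector_derivative (\<mu> * sinh (\<mu> * of_real 0)) * of_real (mat 1 $ i $ j) + cosh (\<mu> * of_real 0) * of_real (X $ i $ j)) (at 0)"
    by (intro derivative_intros has_vector_derivative_mult_left quadratic_cosh_derivative quadratic_sinh_derivative)
  then have "((\<lambda>t. complex_of_real (matrix_exp (t *\<^sub>R X) $ i $ j)) has_vector_derivative of_real (X $ i $ j)) (at 0)"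
    unfolding matrix_exp_sl2[OF X] \<mu>_def by simp
  from bounded_linear.has_vector_derivative[OF bounded_linear_Re this] show ?thesis
    by (simp add: has_real_derivative_iff_has_vector_derivative)
qed

lemma matrix_exp_continuous:
  assumes X: "X \<in> sl2"
  shows "continuous_on S (\<lambda>t. matrix_exp (t *\<^sub>R X))"
proof -
  define \<mu> where "\<mu> = csqrt (of_real (- det X))"
  have "continuous_on S (quadratic_cosh \<mu>)" "continuous_on S (quadratic_sinh \<mu>)"
    by (intro continuous_at_imp_continuous_on ballI has_vector_derivative_continuous[OF quadratic_cosh_derivative]
      has_vector_derivative_continuous[OF quadratic_sinh_derivative])+
  then have "continuous_on S (\<lambda>t. Re (quadratic_cosh \<mu> t * of_real (mat 1 $ i $ j) + quadratic_sinh \<mu> t * of_real (X $ i $ j)))" for i j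
    by (intro continuous_intros)
  then have "continuous_on S (\<lambda>t. Re (complex_of_real (matrix_exp (t *\<^sub>R X) $ i $ j)))" for i j
    unfolding matrix_exp_sl2[OF X] \<mu>_def .
  then have "continuous_on S (\<lambda>t. \<chi> i j. matrix_exp (t *\<^sub>R X) $ i $ j)"
    by (intro continuous_on_vec_lambda) simp
  then show ?thesis by simp
qed

lemma matrix_exp_add:
  assumes X: "X \<in> sl2"
  shows "matrix_exp ((s + t) *\<^sub>R X) = matrix_exp (s *\<^sub>R X) ** matrix_exp (t *\<^sub>R X)"
proof -
  define \<mu> where "\<mu> = csqrt (of_real (- det X))"
  have tr: "X $ 2 $ 2 = - X $ 1 $ 1" using X by (simp add: sl2_def trace_2)
  have \<mu>2: "\<mu>\<^sup>2 = (of_real (X $ 1 $ 1))\<^sup>2 + of_real (X $ 1 $ 2) * of_real (X $ 2 $ 1)"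
    unfolding \<mu>_def power2_csqrt by (simp add: det_2 tr power2_eq_square)
  have "complex_of_real (matrix_exp ((s + t) *\<^sub>R X) $ i $ j) = of_real ((matrix_exp (s *\<^sub>R X) ** matrix_exp (t *\<^sub>R X)) $ i $ j)" for i j
  proof -
    have "i = 1 \<or> i = 2" "j = 1 \<or> j = 2" using exhaust_2 by auto
    then show ?thesis
      unfolding matrix_matrix_mult_def vec_lambda_beta sum_2 of_real_add of_real_mult
        matrix_exp_sl2[OF X, folded \<mu>_def] quadratic_cosh_add quadratic_sinh_add \<mu>2
      by (elim disjE; simp add: mat_def tr algebra_simps power2_eq_square)
  qed
  then show ?thesis by (simp add: vec_eq_iff)
qed

lemma matrix_exp_SL2:
  assumes X: "X \<in> sl2"
  shows "matrix_exp (t *\<^sub>R X) \<in> SL2"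
proof -
  define \<mu> where "\<mu> = csqrt (of_real (- det X))"
  have tr: "X $ 2 $ 2 = - X $ 1 $ 1" using X by (simp add: sl2_def trace_2)
  have \<mu>2: "\<mu>\<^sup>2 = (of_real (X $ 1 $ 1))\<^sup>2 + of_real (X $ 1 $ 2) * of_real (X $ 2 $ 1)"
    unfolding \<mu>_def power2_csqrt by (simp add: det_2 tr power2_eq_square)
  have "complex_of_real (det (matrix_exp (t *\<^sub>R X))) = (quadratic_cosh \<mu> t)\<^sup>2 - \<mu>\<^sup>2 * (quadratic_sinh \<mu> t)\<^sup>2"
    unfolding \<mu>2
    by (simp add: det_2 matrix_exp_sl2[OF X, folded \<mu>_def] mat_def tr algebra_simps power2_eq_square)
  also have "\<dots> = 1" by (rule quadratic_pythagoras)
  finally show ?thesis by (simp add: SL2_def)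
qed

lemma matrix_exp_0: "X \<in> sl2 \<Longrightarrow> matrix_exp (0 *\<^sub>R X) = mat 1"
proof -
  assume X: "X \<in> sl2"
  have "complex_of_real (matrix_exp (0 *\<^sub>R X) $ i $ j) = of_real (mat 1 $ i $ j)" for i j
    unfolding matrix_exp_sl2[OF X] by (simp add: quadratic_cosh_def quadratic_sinh_def)
  then show ?thesis by (simp add: vec_eq_iff)
qed

section \<open>Polar coordinates\<close>

lemma nn_integral_lborel_scale:
  fixes f :: "'a::euclidean_space \<Rightarrow> ennreal"
  assumes [measurable]: "f \<in> borel_measurable borel" and c: "c > 0"
  shows "(\<integral>\<^sup>+x. f x \<partial>lborel) = ennreal (c ^ DIM('a)) * (\<integral>\<^sup>+x. f (c *\<^sub>R x) \<partial>lborel)"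
proof -
  have "(\<integral>\<^sup>+x. f x \<partial>lborel) = (\<integral>\<^sup>+x. f x \<partial>(density (distr lborel borel (\<lambda>x. 0 + c *\<^sub>R x)) (\<lambda>_. ennreal (\<bar>c\<bar> ^ DIM('a)))))"
    using lborel_affine[of c "0::'a"] c by simp
  also have "\<dots> = ennreal (c ^ DIM('a)) * (\<integral>\<^sup>+x. f (c *\<^sub>R x) \<partial>lborel)"
    using c by (simp add: nn_integral_density nn_integral_distr nn_integral_cmult)
  finally show ?thesis .
qed

text \<open>The radial part of an integral of total homogeneity \<open>D\<close>.\<close>

definition radial_mass :: "real \<Rightarrow> (real \<Rightarrow> ennreal) \<Rightarrow> ennreal" where
  "radial_mass D g = (\<integral>\<^sup>+r. g r * ennreal (r powr (D - 1)) * indicator {0<..} r \<partial>lborel)"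

lemma radial_mass_scale:
  assumes [measurable]: "g \<in> borel_measurable borel" and s: "s > 0"
  shows "radial_mass D g = ennreal (s powr D) * radial_mass D (\<lambda>r. g (s * r))"
proof -
  have "radial_mass D g = ennreal s * (\<integral>\<^sup>+r. g (s * r) * ennreal ((s * r) powr (D - 1)) * indicator {0<..} (s * r) \<partial>lborel)"
    unfolding radial_mass_def by (subst nn_integral_real_affine[where c = s and t = 0]) (use s in auto)
  also have "(\<integral>\<^sup>+r. g (s * r) * ennreal ((s * r) powr (D - 1)) * indicator {0<..} (s * r) \<partial>lborel)
    = (\<integral>\<^sup>+r. ennreal (s powr (D - 1)) * (g (s * r) * ennreal (r powr (D - 1)) * indicator {0<..} r) \<partial>lborel)"
  proof (rule nn_integral_cong)
    fix r :: real
    show "g (s * r) * ennreal ((s * r) powr (D - 1)) * indicator {0<..} (s * r)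
      = ennreal (s powr (D - 1)) * (g (s * r) * ennreal (r powr (D - 1)) * indicator {0<..} r)"
    proof (cases "r > 0")
      case True
      then have "(s * r) powr (D - 1) = s powr (D - 1) * r powr (D - 1)" using s by (simp add: powr_mult)
      then show ?thesis using True s by (simp add: ennreal_mult ac_simps)
    next
      case False
      then have "indicator {0<..} r = (0::ennreal)" "indicator {0<..} (s * r) = (0::ennreal)"
        using s by (auto simp: indicator_def zero_less_mult_iff)
      then show ?thesis by (simp only: mult_zero_right)
    qed
  qed
  also have "ennreal s * \<dots> = (ennreal s * ennreal (s powr (D - 1))) * radial_mass D (\<lambda>r. g (s * r))"
    unfolding radial_mass_def by (subst nn_integral_cmult) (auto simp: mult.assoc)
  also have "ennreal s * ennreal (s powr (D - 1)) = ennreal (s powr D)"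
    using s by (simp add: powr_diff flip: ennreal_mult)
  finally show ?thesis .
qed

lemma nn_integral_inverse_interval:
  assumes "0 < a" "a \<le> b"
  shows "(\<integral>\<^sup>+t. ennreal (1 / t) * indicator {a..b} t \<partial>lborel) = ennreal (ln b - ln a)"
proof (rule nn_integral_FTC_Icc)
  fix t :: real assume "t \<in> {a..b}"
  then have "t > 0" using assms by auto
  then show "DERIV ln t :> 1 / t" by (auto intro!: derivative_eq_intros simp: field_simps)
  show "0 \<le> 1 / t" using \<open>t > 0\<close> by simp
qed (use assms in auto)

text \<open>Integration in polar coordinates, up to a constant. Both sides arise from the double integral
  of \<open>h x * f (norm x) * g (t * norm x) * t powr (D - 1)\<close> over \<open>x\<close> and \<open>t > 0\<close> with \<open>f\<close> the indicator
  of \<open>[1, e]\<close>: integrating over \<open>t\<close> first gives the right-hand side, rescaling \<open>x\<close> first the left-hand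
  side, because \<open>f\<close> has mass 1 for \<open>dt / t\<close>.\<close>

lemma nn_integral_homogeneous_radial:
  fixes h :: "'a::euclidean_space \<Rightarrow> ennreal"
  assumes h [measurable]: "h \<in> borel_measurable borel" and g [measurable]: "g \<in> borel_measurable borel"
    and hom: "\<And>t x. t > 0 \<Longrightarrow> h (t *\<^sub>R x) = ennreal (t powr d) * h x"
  defines "D \<equiv> d + DIM('a)"
  shows "(\<integral>\<^sup>+x. h x * g (norm x) \<partial>lborel)
    = (\<integral>\<^sup>+x. h x * indicator {1..exp 1} (norm x) * ennreal (norm x powr - D) \<partial>lborel) * radial_mass D g"
proof -
  define f where "f = (indicator {1..exp 1} :: real \<Rightarrow> ennreal)"
  have [measurable]: "f \<in> borel_measurable borel" by (simp add: f_def)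
  define K where "K = radial_mass D g"
  define \<Phi> where "\<Phi> x t = h x * f (norm x) * g (t * norm x) * ennreal (t powr (D - 1)) * indicator {0<..} t" for x t
  have [measurable]: "(\<lambda>(x, t). \<Phi> x t) \<in> borel_measurable (lborel \<Otimes>\<^sub>M lborel)"
    unfolding \<Phi>_def by measurable
  have inner_t: "(\<integral>\<^sup>+t. \<Phi> x t \<partial>lborel) = h x * f (norm x) * ennreal (norm x powr - D) * K" for x
  proof (cases "norm x \<in> {1..exp 1}")
    case True
    define \<rho> where "\<rho> = norm x"
    have "1 \<le> \<rho>" using True by (simp add: \<rho>_def)
    then have \<rho>: "\<rho> > 0" by simp
    have "ennreal (\<rho> powr - D) * K = (ennreal (\<rho> powr - D) * ennreal (\<rho> powr D)) * radial_mass D (\<lambda>r. g (\<rho> * r))"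
      unfolding K_def by (subst radial_mass_scale[OF g \<rho>]) (simp add: mult.assoc)
    also have "ennreal (\<rho> powr - D) * ennreal (\<rho> powr D) = 1"
      using \<rho> by (simp add: powr_minus flip: ennreal_mult)
    finally have *: "ennreal (\<rho> powr - D) * K = radial_mass D (\<lambda>r. g (r * \<rho>))" by (simp add: mult.commute)
    have "(\<integral>\<^sup>+t. \<Phi> x t \<partial>lborel) = (\<integral>\<^sup>+t. (h x * f \<rho>) * (g (t * \<rho>) * ennreal (t powr (D - 1)) * indicator {0<..} t) \<partial>lborel)"
      by (simp add: \<Phi>_def \<rho>_def mult.assoc)
    also have "\<dots> = (h x * f \<rho>) * radial_mass D (\<lambda>r. g (r * \<rho>))"
      unfolding radial_mass_def by (rule nn_integral_cmult) measurable
    finally show ?thesis by (simp add: * mult.assoc flip: \<rho>_def)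
  next
    case False
    then show ?thesis by (simp add: \<Phi>_def f_def)
  qed
  have "(\<integral>\<^sup>+x. h x * f (norm x) * ennreal (norm x powr - D) \<partial>lborel) * K = (\<integral>\<^sup>+x. \<integral>\<^sup>+t. \<Phi> x t \<partial>lborel \<partial>lborel)"
    unfolding inner_t by (rule nn_integral_multc[symmetric]) measurable
  also have "\<dots> = (\<integral>\<^sup>+t. \<integral>\<^sup>+x. \<Phi> x t \<partial>lborel \<partial>lborel)"
    by (rule lborel_pair.Fubini'[symmetric]) measurable
  also have "\<dots> = (\<integral>\<^sup>+t. \<integral>\<^sup>+x. h x * g (norm x) * f (norm x / t) * ennreal (1 / t) * indicator {0<..} t \<partial>lborel \<partial>lborel)"
  proof (rule nn_integral_cong)
    fix t :: real
    show "(\<integral>\<^sup>+x. \<Phi> x t \<partial>lborel) = (\<integral>\<^sup>+x. h x * g (norm x) * f (norm x / t) * ennreal (1 / t) * indicator {0<..} t \<partial>lborel)"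
    proof (cases "t > 0")
      case True
      have e: "(1 / t) ^ DIM('a) * ((1 / t) powr d * t powr (D - 1)) = 1 / t"
      proof -
        have "(1 / t) ^ DIM('a) = t powr - real DIM('a)"
          using True by (simp add: powr_minus powr_realpow divide_inverse power_inverse)
        moreover have "(1 / t) powr d = t powr - d" using True by (simp add: powr_minus powr_divide inverse_eq_divide)
        ultimately have "(1 / t) ^ DIM('a) * ((1 / t) powr d * t powr (D - 1)) = t powr (- real DIM('a) + (- d + (D - 1)))"
          by (simp only: powr_add)
        also have "\<dots> = t powr (- 1)" by (simp add: D_def)
        finally show ?thesis using True by (simp add: powr_minus divide_inverse)
      qed
      have "(\<integral>\<^sup>+x. \<Phi> x t \<partial>lborel) = ennreal ((1 / t) ^ DIM('a)) * (\<integral>\<^sup>+x. \<Phi> ((1 / t) *\<^sub>R x) t \<partial>lborel)"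
        by (rule nn_integral_lborel_scale) (use True in \<open>auto simp: \<Phi>_def\<close>)
      also have "\<dots> = (\<integral>\<^sup>+x. ennreal ((1 / t) ^ DIM('a)) * \<Phi> ((1 / t) *\<^sub>R x) t \<partial>lborel)"
        by (rule nn_integral_cmult[symmetric]) (auto simp: \<Phi>_def)
      also have "\<dots> = (\<integral>\<^sup>+x. h x * g (norm x) * f (norm x / t) * ennreal (1 / t) * indicator {0<..} t \<partial>lborel)"
      proof (rule nn_integral_cong)
        fix x :: 'a
        have "ennreal ((1 / t) ^ DIM('a)) * \<Phi> ((1 / t) *\<^sub>R x) t
          = (ennreal ((1 / t) ^ DIM('a)) * (ennreal ((1 / t) powr d) * ennreal (t powr (D - 1)))) * (h x * g (norm x) * f (norm x / t))"
          using True by (simp add: \<Phi>_def hom ac_simps)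
        also have "ennreal ((1 / t) ^ DIM('a)) * (ennreal ((1 / t) powr d) * ennreal (t powr (D - 1))) = ennreal (1 / t)"
        proof -
          have "ennreal A * (ennreal B * ennreal C) = ennreal (A * (B * C))" if "0 \<le> A" "0 \<le> B" "0 \<le> C" for A B C
            using that by (simp add: ennreal_mult)
          from this[of "(1 / t) ^ DIM('a)" "(1 / t) powr d" "t powr (D - 1)"] show ?thesis
            using True unfolding e by simp
        qed
        finally show "ennreal ((1 / t) ^ DIM('a)) * \<Phi> ((1 / t) *\<^sub>R x) t
           = h x * g (norm x) * f (norm x / t) * ennreal (1 / t) * indicator {0<..} t"
          using True by (simp add: ac_simps)
      qed
      finally show ?thesis .
    qed (simp add: \<Phi>_def)
  qed
  also have "\<dots> = (\<integral>\<^sup>+x. \<integral>\<^sup>+t. h x * g (norm x) * f (norm x / t) * ennreal (1 / t) * indicator {0<..} t \<partial>lborel \<partial>lborel)"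
    by (rule lborel_pair.Fubini') measurable
  also have "\<dots> = (\<integral>\<^sup>+x. h x * g (norm x) \<partial>lborel)"
  proof (rule nn_integral_cong_AE)
    have "AE x in lborel. x \<noteq> (0::'a)" by (rule AE_lborel_singleton)
    then show "AE x in lborel. (\<integral>\<^sup>+t. h x * g (norm x) * f (norm x / t) * ennreal (1 / t) * indicator {0<..} t \<partial>lborel) = h x * g (norm x)"
    proof eventually_elim
      case (elim x)
      then have \<rho>: "norm x > 0" by simp
      have "(\<integral>\<^sup>+t. h x * g (norm x) * f (norm x / t) * ennreal (1 / t) * indicator {0<..} t \<partial>lborel)
        = (\<integral>\<^sup>+t. h x * g (norm x) * (ennreal (1 / t) * indicator {norm x / exp 1..norm x} t) \<partial>lborel)"
      proof (rule nn_integral_cong)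
        fix t :: real
        show "h x * g (norm x) * f (norm x / t) * ennreal (1 / t) * indicator {0<..} t
           = h x * g (norm x) * (ennreal (1 / t) * indicator {norm x / exp 1..norm x} t)"
        proof (cases "t > 0")
          case True
          then have "f (norm x / t) = indicator {norm x / exp 1..norm x} t"
            by (auto simp: f_def indicator_def field_simps)
          then show ?thesis using True by (simp add: ac_simps)
        next
          case False
          then have "t \<notin> {norm x / exp 1..norm x}" using less_le_trans[OF divide_pos_pos[OF \<rho> exp_gt_zero[of 1]], of t] by auto
          then show ?thesis using False by simp
        qed
      qed
      also have "\<dots> = h x * g (norm x) * (\<integral>\<^sup>+t. ennreal (1 / t) * indicator {norm x / exp 1..norm x} t \<partial>lborel)"
        by (rule nn_integral_cmult) measurable
      also have "(\<integral>\<^sup>+t. ennreal (1 / t) * indicator {norm x / exp 1..norm x} t \<partial>lborel) = ennreal (ln (norm x) - ln (norm x / exp 1))"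
        by (rule nn_integral_inverse_interval) (use \<rho> in \<open>auto simp: divide_le_eq\<close>)
      also have "\<dots> = 1" using \<rho> by (simp add: ln_div)
      finally show ?case by simp
    qed
  qed
  finally show ?thesis by (simp add: f_def K_def)
qed

text \<open>Near \<open>0\<close> the power \<open>r\<^bsup>b + D - 1\<^esup>\<close> is integrable; near infinity the exponential is at most \<open>C r\<^bsup>-b - D - 1\<^esup>\<close>.\<close>

lemma radial_mass_powr_exp_finite:
  assumes "a > 0" "c > 0" "b + D > 0"
  shows "radial_mass D (\<lambda>r. ennreal (r powr b * exp (- c * r powr a))) < \<infinity>"
proof -
  define \<beta> where "\<beta> = b + D - 1"
  have \<beta>: "\<beta> > -1" using assms by (simp add: \<beta>_def)
  obtain n :: nat where "(\<beta> + 2) / a \<le> real n" using real_arch_simple by blast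
  then have n: "\<beta> - a * n \<le> - 2" using assms by (simp add: field_simps)
  define C where "C = fact n / c ^ n"
  have C: "C \<ge> 0" using assms by (simp add: C_def)
  have bound: "ennreal (r powr b * exp (- c * r powr a)) * ennreal (r powr (D - 1)) * indicator {0<..} r
     \<le> indicator {0..1} r * ennreal (r powr \<beta>) + ennreal C * (ennreal (r powr (- 2)) * indicator {1..} r)" for r
  proof (cases "r > 0")
    case True
    have e: "ennreal (r powr b * exp (- c * r powr a)) * ennreal (r powr (D - 1)) = ennreal (r powr \<beta> * exp (- c * r powr a))"
      using True by (simp add: \<beta>_def powr_add powr_diff flip: ennreal_mult)
    show ?thesis
    proof (cases "r \<le> 1")
      case r1: True
      have "r powr \<beta> * exp (- c * r powr a) \<le> r powr \<beta> * 1" using assms by (intro mult_left_mono) auto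
      then show ?thesis unfolding e using True r1 by (auto intro!: add_increasing2 ennreal_leI)
    next
      case False
      define y where "y = c * r powr a"
      have y: "y > 0" using True assms by (simp add: y_def)
      have "y ^ n / fact n \<le> exp y"
        using exp_ge_one_plus_x_over_n_power_n y sum_le_suminf[OF summable_exp_generic[of y], of "{n}"] by (simp add: exp_def divide_inverse mult.commute)
      then have "exp (- y) \<le> fact n / y ^ n" using y by (simp add: exp_minus field_simps)
      also have "y ^ n = c ^ n * r powr (a * n)" using True by (simp add: y_def power_mult_distrib powr_powr flip: powr_realpow)
      finally have "r powr \<beta> * exp (- y) \<le> r powr \<beta> * (fact n / (c ^ n * r powr (a * n)))" by (intro mult_left_mono) auto
      also have "\<dots> = C * r powr (\<beta> - a * n)" using True by (simp add: C_def powr_diff)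
      also have "\<dots> \<le> C * r powr (- 2)" using n False C by (intro mult_left_mono powr_mono) auto
      finally have "r powr \<beta> * exp (- c * r powr a) \<le> C * r powr (- 2)" by (simp add: y_def)
      then show ?thesis unfolding e using True False C by (simp add: ennreal_leI flip: ennreal_mult)
    qed
  qed simp
  have "radial_mass D (\<lambda>r. ennreal (r powr b * exp (- c * r powr a)))
    \<le> (\<integral>\<^sup>+r. indicator {0..1} r * ennreal (r powr \<beta>) + ennreal C * (ennreal (r powr (- 2)) * indicator {1..} r) \<partial>lborel)"
    unfolding radial_mass_def by (rule nn_integral_mono) (rule bound)
  also have "\<dots> = (\<integral>\<^sup>+r. indicator {0..1} r * ennreal (r powr \<beta>) \<partial>lborel) + ennreal C * (\<integral>\<^sup>+r. ennreal (r powr (- 2)) * indicator {1..} r \<partial>lborel)"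
    by (simp add: nn_integral_add nn_integral_cmult)
  also have "(\<integral>\<^sup>+r. indicator {0..1} r * ennreal (r powr \<beta>) \<partial>lborel) = ennreal (integral {0..1} (\<lambda>r. r powr \<beta>))"
  proof -
    have "((\<lambda>r. r powr \<beta>) has_integral integral {0..1} (\<lambda>r. r powr \<beta>)) {0..1}"
      using integrable_on_powr_from_0[OF \<beta>, of 1] by (simp add: integrable_integral)
    have "(\<integral>\<^sup>+r. ennreal (indicator {0..1} r * r powr \<beta>) \<partial>lborel) = ennreal (integral {0..1} (\<lambda>r. r powr \<beta>))"
      by (rule nn_integral_has_integral_lebesgue[OF _ \<open>(_ has_integral _) _\<close>]) simp
    then show ?thesis by (simp only: ennreal_mult'[OF indicator_pos_le] ennreal_indicator)
  qed
  also have "(\<integral>\<^sup>+r. ennreal (r powr (- 2)) * indicator {1..} r \<partial>lborel) = ennreal (0 - (- inverse 1))"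
  proof (rule nn_integral_FTC_atLeast[where F = "\<lambda>r. - inverse r" and T = 0])
    fix r :: real assume "1 \<le> r"
    then show "DERIV (\<lambda>r. - inverse r) r :> r powr (- 2)"
      by (auto intro!: derivative_eq_intros simp: powr_minus power2_eq_square)
  next
    show "((\<lambda>r::real. - inverse r) \<longlongrightarrow> 0) at_top"
      using tendsto_minus[OF tendsto_inverse_0_at_top[OF filterlim_ident]] by simp
  qed auto
  finally show ?thesis by (rule le_less_trans) (simp add: ennreal_mult_less_top)
qed

lemma radial_mass_pos:
  assumes [measurable]: "g \<in> borel_measurable borel" and pos: "\<And>r. r > 0 \<Longrightarrow> g r > 0"
  shows "radial_mass D g > 0"
proof (rule ccontr)
  assume "\<not> radial_mass D g > 0"
  then have "radial_mass D g = 0" by simp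
  then have "AE r in lborel. g r * ennreal (r powr (D - 1)) * indicator {0<..} r = 0"
    unfolding radial_mass_def by (subst (asm) nn_integral_0_iff_AE) auto
  then have "AE r in lborel. r \<notin> {0<..<1::real}"
    by eventually_elim (use pos in \<open>auto simp: indicator_def less_le split: if_splits\<close>)
  then have "emeasure lborel {0<..<1::real} = 0" by (subst (asm) AE_iff_measurable[of "{0<..<1}"]) auto
  then show False by simp
qed

section \<open>Dunkl operators and radial functions\<close>

lemma refl_along_linear: "bounded_linear (refl_along \<alpha>)"
proof -
  have "refl_along \<alpha> = (\<lambda>x. x - ((\<alpha> \<bullet> x) * (2 / (norm \<alpha>)\<^sup>2)) *\<^sub>R \<alpha>)"
    by (auto simp: refl_along_def)
  moreover have "bounded_linear (\<lambda>x. x - ((\<alpha> \<bullet> x) * (2 / (norm \<alpha>)\<^sup>2)) *\<^sub>R \<alpha>)"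
    by (intro bounded_linear_sub bounded_linear_ident bounded_linear_scaleR_const
        bounded_linear_mult_const bounded_linear_inner_right)
  ultimately show ?thesis by simp
qed

lemma inner_refl_along: "\<alpha> \<noteq> 0 \<Longrightarrow> \<alpha> \<bullet> refl_along \<alpha> x = - (\<alpha> \<bullet> x)"
  by (simp add: refl_along_def inner_diff_right power2_norm_eq_inner)

lemma refl_along_invol: "\<alpha> \<noteq> 0 \<Longrightarrow> refl_along \<alpha> (refl_along \<alpha> x) = x"
  by (simp add: refl_along_def[of \<alpha> "refl_along \<alpha> x"] inner_refl_along) (simp add: refl_along_def)

lemma refl_along_inner:
  assumes "\<alpha> \<noteq> 0"
  shows "refl_along \<alpha> x \<bullet> refl_along \<alpha> y = x \<bullet> y"
proof -
  have "refl_along \<alpha> x \<bullet> refl_along \<alpha> y = refl_along \<alpha> x \<bullet> y - (2 * (\<alpha> \<bullet> y) / (norm \<alpha>)\<^sup>2) * (\<alpha> \<bullet> refl_along \<alpha> x)"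
    by (simp add: refl_along_def[of \<alpha> y] inner_diff_right inner_commute)
  also have "\<dots> = x \<bullet> y"
    using assms by (simp add: inner_refl_along) (simp add: refl_along_def inner_diff_left)
  finally show ?thesis .
qed

lemma norm_refl_along: "\<alpha> \<noteq> 0 \<Longrightarrow> norm (refl_along \<alpha> x) = norm x"
  by (simp add: norm_eq_sqrt_inner refl_along_inner)

lemma refl_along_orthogonal: "\<alpha> \<bullet> x = 0 \<Longrightarrow> refl_along \<alpha> x = x"
  by (simp add: refl_along_def)

lemma refl_along_self: "\<alpha> \<noteq> 0 \<Longrightarrow> refl_along \<alpha> \<alpha> = - \<alpha>"
  by (simp add: refl_along_def power2_norm_eq_inner scaleR_2)

lemma dir_deriv_eq: "(f has_derivative f') (at x) \<Longrightarrow> dir_deriv \<xi> f x = f' \<xi>"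
  unfolding dir_deriv_def by (metis frechet_derivative_at)

lemma has_derivative_dir_deriv: "f differentiable at x \<Longrightarrow> (f has_derivative (\<lambda>\<xi>. dir_deriv \<xi> f x)) (at x)"
  unfolding dir_deriv_def using frechet_derivative_works by blast

lemma dir_deriv_add:
  "f differentiable at x \<Longrightarrow> g differentiable at x \<Longrightarrow>
    dir_deriv \<xi> (\<lambda>y. f y + g y) x = dir_deriv \<xi> f x + dir_deriv \<xi> g x"
  by (rule dir_deriv_eq) (intro has_derivative_add has_derivative_dir_deriv)

lemma dir_deriv_mult:
  "f differentiable at x \<Longrightarrow> g differentiable at x \<Longrightarrow>
    dir_deriv \<xi> (\<lambda>y. f y * g y) x = f x * dir_deriv \<xi> g x + dir_deriv \<xi> f x * g x"
  by (rule dir_deriv_eq) (intro has_derivative_mult has_derivative_dir_deriv)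

lemma dir_deriv_const: "dir_deriv \<xi> (\<lambda>y. c) x = 0"
  by (rule dir_deriv_eq) (rule has_derivative_const)

lemma dir_deriv_of_real_linear:
  "bounded_linear f \<Longrightarrow> dir_deriv \<xi> (\<lambda>y. of_real (f y)) x = of_real (f \<xi>)"
  by (rule dir_deriv_eq)
    (intro bounded_linear_imp_has_derivative bounded_linear_compose[OF bounded_linear_of_real])

lemma dir_deriv_sum_axis:
  assumes "f differentiable at x"
  shows "(\<Sum>i\<in>UNIV. of_real (x $ i) * dir_deriv (axis i 1) f x) = dir_deriv x f x"
proof -
  interpret L: bounded_linear "\<lambda>\<xi>. dir_deriv \<xi> f x"
    using has_derivative_dir_deriv[OF assms] by (rule has_derivative_bounded_linear)
  have "dir_deriv x f x = dir_deriv (\<Sum>i\<in>UNIV. x $ i *\<^sub>R axis i 1) f x"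
    by (simp add: basis_expansion flip: scalar_mult_eq_scaleR)
  also have "\<dots> = (\<Sum>i\<in>UNIV. x $ i *\<^sub>R dir_deriv (axis i 1) f x)" by (simp add: L.sum L.scaleR)
  finally show ?thesis by (simp add: scaleR_conv_of_real)
qed

text \<open>On the hyperplane orthogonal to \<open>\<alpha>\<close> this is the identity \<open>0 = 0\<close>.\<close>

lemma refl_quotient_mult_inner: "of_real (\<alpha> \<bullet> x) * refl_quotient \<alpha> f x = f x - f (refl_along \<alpha> x)"
  by (simp add: refl_quotient_def refl_along_orthogonal)

lemma refl_quotient_add:
  "f differentiable at x \<Longrightarrow> g differentiable at x \<Longrightarrow>
    refl_quotient \<alpha> (\<lambda>y. f y + g y) x = refl_quotient \<alpha> f x + refl_quotient \<alpha> g x"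
  by (simp add: refl_quotient_def dir_deriv_add algebra_simps diff_divide_distrib add_divide_distrib)

lemma refl_quotient_mult:
  "f differentiable at x \<Longrightarrow> g differentiable at x \<Longrightarrow>
    refl_quotient \<alpha> (\<lambda>y. f y * g y) x = f x * refl_quotient \<alpha> g x + g (refl_along \<alpha> x) * refl_quotient \<alpha> f x"
proof (cases "\<alpha> \<bullet> x = 0")
  case True
  define c where "c = complex_of_real (2 / (norm \<alpha>)\<^sup>2)"
  have "refl_quotient \<alpha> h x = c * dir_deriv \<alpha> h x" for h
    using True by (simp add: refl_quotient_def c_def)
  moreover assume "f differentiable at x" "g differentiable at x"
  ultimately show ?thesis
    by (simp add: dir_deriv_mult refl_along_orthogonal[OF True] algebra_simps)
next
  case False
  then show ?thesis by (simp add: refl_quotient_def field_simps)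
qed

lemma refl_quotient_const: "refl_quotient \<alpha> (\<lambda>y. c) x = 0"
  by (simp add: refl_quotient_def dir_deriv_const)

lemma refl_quotient_of_real_linear:
  assumes "bounded_linear f"
  shows "refl_quotient \<alpha> (\<lambda>y. of_real (f y)) x = of_real (2 * f \<alpha> / (norm \<alpha>)\<^sup>2)"
proof -
  interpret bounded_linear f by fact
  have "f x - f (refl_along \<alpha> x) = (2 * (\<alpha> \<bullet> x) / (norm \<alpha>)\<^sup>2) * f \<alpha>"
    by (simp add: refl_along_def diff scaleR)
  then have "of_real (f x) - of_real (f (refl_along \<alpha> x)) = (of_real (\<alpha> \<bullet> x * (2 * f \<alpha> / (norm \<alpha>)\<^sup>2)) :: complex)"
    by (simp flip: of_real_diff add: mult.commute)
  then show ?thesis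
    by (simp add: refl_quotient_def dir_deriv_of_real_linear[OF assms])
qed

lemma dunkl_op_add:
  "f differentiable at x \<Longrightarrow> g differentiable at x \<Longrightarrow>
    dunkl_op P k \<xi> (\<lambda>y. f y + g y) x = dunkl_op P k \<xi> f x + dunkl_op P k \<xi> g x"
  by (simp add: dunkl_op_def dir_deriv_add refl_quotient_add distrib_left sum.distrib)

lemma dunkl_op_cmult:
  assumes "f differentiable at x"
  shows "dunkl_op P k \<xi> (\<lambda>y. c * f y) x = c * dunkl_op P k \<xi> f x"
proof -
  have "dir_deriv \<xi> (\<lambda>y. c * f y) x = c * dir_deriv \<xi> f x"
    "refl_quotient \<alpha> (\<lambda>y. c * f y) x = c * refl_quotient \<alpha> f x" for \<alpha>
    using assms by (simp_all add: dir_deriv_mult dir_deriv_const refl_quotient_mult refl_quotient_const)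
  then show ?thesis by (simp add: dunkl_op_def distrib_left sum_distrib_left ac_simps)
qed

text \<open>The Dunkl operators are derivations with respect to factors that are invariant under the
  reflections: the tangential derivative of such a factor along \<open>\<alpha>\<close> vanishes on the hyperplane
  orthogonal to \<open>\<alpha>\<close>.\<close>

lemma dunkl_op_mult_radial:
  assumes u: "(u has_derivative (\<lambda>h. of_real (x \<bullet> h) * v)) (at x)"
    and inv: "\<And>\<alpha>. \<alpha> \<in> P \<Longrightarrow> u (refl_along \<alpha> x) = u x"
    and f: "f differentiable at x"
  shows "dunkl_op P k \<xi> (\<lambda>y. u y * f y) x = u x * dunkl_op P k \<xi> f x + of_real (x \<bullet> \<xi>) * v * f x"
proof -
  have ud: "u differentiable at x" using u by (auto simp: differentiable_def)
  have du: "dir_deriv \<eta> u x = of_real (x \<bullet> \<eta>) * v" for \<eta> using dir_deriv_eq[OF u] .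
  have "refl_quotient \<alpha> u x = 0" if "\<alpha> \<in> P" for \<alpha>
    using inv[OF that] by (simp add: refl_quotient_def du inner_commute)
  then have "refl_quotient \<alpha> (\<lambda>y. u y * f y) x = u x * refl_quotient \<alpha> f x" if "\<alpha> \<in> P" for \<alpha>
    using that by (simp add: refl_quotient_mult ud f)
  then have "(\<Sum>\<alpha>\<in>P. of_real (k \<alpha> * (\<alpha> \<bullet> \<xi>)) * refl_quotient \<alpha> (\<lambda>y. u y * f y) x)
     = u x * (\<Sum>\<alpha>\<in>P. of_real (k \<alpha> * (\<alpha> \<bullet> \<xi>)) * refl_quotient \<alpha> f x)"
    unfolding sum_distrib_left by (intro sum.cong) auto
  then show ?thesis
    by (simp add: dunkl_op_def dir_deriv_mult ud f du algebra_simps)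
qed

lemma dir_deriv_cong:
  assumes "x \<noteq> 0" "\<And>y. y \<noteq> 0 \<Longrightarrow> f y = g y"
  shows "dir_deriv \<xi> f x = dir_deriv \<xi> g x"
proof -
  have "(f has_derivative D) (at x) \<longleftrightarrow> (g has_derivative D) (at x)" for D
  proof
    assume "(f has_derivative D) (at x)"
    then show "(g has_derivative D) (at x)"
      by (rule has_derivative_transform_within_open[of f D x UNIV "- {0}" g]) (simp_all add: assms open_Compl)
  next
    assume "(g has_derivative D) (at x)"
    then show "(f has_derivative D) (at x)"
      by (rule has_derivative_transform_within_open[of g D x UNIV "- {0}" f]) (simp_all add: assms open_Compl)
  qed
  then show ?thesis unfolding dir_deriv_def frechet_derivative_def by simp
qed

lemma dunkl_op_cong:
  assumes "x \<noteq> 0" "\<And>y. y \<noteq> 0 \<Longrightarrow> f y = g y" "0 \<notin> P"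
  shows "dunkl_op P k \<xi> f x = dunkl_op P k \<xi> g x"
proof -
  have "refl_along \<alpha> x \<noteq> 0" if "\<alpha> \<in> P" for \<alpha>
    using norm_refl_along[of \<alpha> x] assms that by (metis norm_eq_zero)
  then have "refl_quotient \<alpha> f x = refl_quotient \<alpha> g x" if "\<alpha> \<in> P" for \<alpha>
    unfolding refl_quotient_def using that assms(2) dir_deriv_cong[OF assms(1,2)] assms(1) by auto
  then show ?thesis unfolding dunkl_op_def using dir_deriv_cong[OF assms(1,2)] by simp
qed

text \<open>Commutation of the Dunkl operators with the coordinate functions, summed over the coordinates:
  the reflection terms add up to \<open>2 * sum k P\<close>.\<close>

lemma dunkl_coordinate_anticommutator:
  fixes f :: "real^'n \<Rightarrow> complex"
  assumes f: "f differentiable at x" and P: "0 \<notin> P"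
  shows "(\<Sum>j\<in>UNIV. of_real (x $ j) * dunkl_op P k (axis j 1) f x
       + dunkl_op P k (axis j 1) (\<lambda>y. of_real (y $ j) * f y) x)
    = 2 * dir_deriv x f x + of_real (real CARD('n) + 2 * sum k P) * f x"
proof -
  let ?c = "\<lambda>j y. complex_of_real (y $ j)"
  have cd: "?c j differentiable at x" for j
    by (rule bounded_linear_imp_differentiable) (intro bounded_linear_compose[OF bounded_linear_of_real] bounded_linear_vec_nth)
  have dc: "dir_deriv \<xi> (?c j) x = of_real (\<xi> $ j)" for \<xi> j
    by (rule dir_deriv_of_real_linear) (rule bounded_linear_vec_nth)
  have rc: "refl_quotient \<alpha> (?c j) x = of_real (2 * \<alpha> $ j / (norm \<alpha>)\<^sup>2)" for \<alpha> j
    by (rule refl_quotient_of_real_linear) (rule bounded_linear_vec_nth)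
  have in_sum: "(\<Sum>j\<in>UNIV. of_real (\<alpha> $ j) * of_real (y $ j)) = complex_of_real (\<alpha> \<bullet> y)" for \<alpha> y :: "real^'n"
    by (simp add: inner_vec_def)
  have refl: "(\<Sum>j\<in>UNIV. of_real (\<alpha> $ j) * (?c j x * refl_quotient \<alpha> f x + refl_quotient \<alpha> (\<lambda>y. ?c j y * f y) x))
     = 2 * f x" if "\<alpha> \<in> P" for \<alpha>
  proof -
    have "\<alpha> \<noteq> 0" using that P by auto
    have "(\<Sum>j\<in>UNIV. of_real (\<alpha> $ j) * (?c j x * refl_quotient \<alpha> f x + refl_quotient \<alpha> (\<lambda>y. ?c j y * f y) x))
      = 2 * ((\<Sum>j\<in>UNIV. of_real (\<alpha> $ j) * ?c j x) * refl_quotient \<alpha> f x)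
        + (\<Sum>j\<in>UNIV. of_real (\<alpha> $ j) * of_real (\<alpha> $ j)) * (of_real (2 / (norm \<alpha>)\<^sup>2) * f (refl_along \<alpha> x))"
      unfolding refl_quotient_mult[OF cd f] rc
      by (simp add: sum.distrib sum_distrib_left sum_distrib_right sum_divide_distrib algebra_simps)
    also have "\<dots> = 2 * (f x - f (refl_along \<alpha> x)) + (of_real (\<alpha> \<bullet> \<alpha>) * of_real (2 / (norm \<alpha>)\<^sup>2)) * f (refl_along \<alpha> x)"
      unfolding in_sum refl_quotient_mult_inner by simp
    also have "complex_of_real (\<alpha> \<bullet> \<alpha>) * of_real (2 / (norm \<alpha>)\<^sup>2) = 2"
      using \<open>\<alpha> \<noteq> 0\<close> by (simp add: power2_norm_eq_inner)
    finally show ?thesis by simp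
  qed
  have "(\<Sum>j\<in>UNIV. ?c j x * dunkl_op P k (axis j 1) f x + dunkl_op P k (axis j 1) (\<lambda>y. ?c j y * f y) x)
    = (\<Sum>j\<in>UNIV. 2 * (?c j x * dir_deriv (axis j 1) f x) + f x
       + (\<Sum>\<alpha>\<in>P. of_real (k \<alpha>) * (of_real (\<alpha> $ j) * (?c j x * refl_quotient \<alpha> f x + refl_quotient \<alpha> (\<lambda>y. ?c j y * f y) x))))"
  proof (rule sum.cong)
    fix j :: 'n
    show "?c j x * dunkl_op P k (axis j 1) f x + dunkl_op P k (axis j 1) (\<lambda>y. ?c j y * f y) x
      = 2 * (?c j x * dir_deriv (axis j 1) f x) + f x
       + (\<Sum>\<alpha>\<in>P. of_real (k \<alpha>) * (of_real (\<alpha> $ j) * (?c j x * refl_quotient \<alpha> f x + refl_quotient \<alpha> (\<lambda>y. ?c j y * f y) x)))"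
      unfolding dunkl_op_def dir_deriv_mult[OF cd f] dc
      by (simp add: inner_axis sum.distrib sum_distrib_left algebra_simps)
  qed simp
  also have "\<dots> = 2 * (\<Sum>j\<in>UNIV. ?c j x * dir_deriv (axis j 1) f x) + of_nat CARD('n) * f x
       + (\<Sum>\<alpha>\<in>P. of_real (k \<alpha>) * (\<Sum>j\<in>UNIV. of_real (\<alpha> $ j) * (?c j x * refl_quotient \<alpha> f x + refl_quotient \<alpha> (\<lambda>y. ?c j y * f y) x)))"
    by (simp add: sum.distrib sum_distrib_left sum.swap[of _ P])
  also have "(\<Sum>\<alpha>\<in>P. of_real (k \<alpha>) * (\<Sum>j\<in>UNIV. of_real (\<alpha> $ j) * (?c j x * refl_quotient \<alpha> f x + refl_quotient \<alpha> (\<lambda>y. ?c j y * f y) x)))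
     = (\<Sum>\<alpha>\<in>P. of_real (k \<alpha>) * (2 * f x))"
    by (intro sum.cong) (auto simp only: refl)
  also have "\<dots> = of_real (2 * sum k P) * f x"
    by (simp add: sum_distrib_left sum_distrib_right mult.assoc mult.left_commute)
  finally show ?thesis by (simp add: dir_deriv_sum_axis[OF f] algebra_simps)
qed

lemma radial_has_derivative:
  fixes x :: "'a::real_inner"
  assumes "x \<noteq> 0" "(U has_vector_derivative of_real (norm x) * V) (at (norm x))"
  shows "((\<lambda>y. U (norm y) :: complex) has_derivative (\<lambda>h. of_real (x \<bullet> h) * V)) (at x)"
proof -
  have "((\<lambda>y. U (norm y)) has_derivative (\<lambda>h. (inner (sgn x) h) *\<^sub>R (of_real (norm x) * V))) (at x)"
    using assms(2) unfolding has_vector_derivative_def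
    by (intro has_derivative_compose[of norm "\<lambda>h. inner (sgn x) h" x UNIV U "\<lambda>h. h *\<^sub>R (of_real (norm x) * V)"])
      (auto intro!: has_derivative_norm[OF assms(1)] simp: inner_commute)
  moreover have "(\<lambda>h. (inner (sgn x) h) *\<^sub>R (of_real (norm x) * V)) = (\<lambda>h. of_real (x \<bullet> h) * V)"
    using assms(1) by (auto simp: sgn_div_norm scaleR_conv_of_real)
  ultimately show ?thesis by simp
qed

text \<open>The regularity under which the Dunkl Laplacian is linear and satisfies the product rule below. It is
  required away from the origin only, because \<open>\<parallel>x\<parallel>\<^sup>a\<close> need not be differentiable at \<open>0\<close>.\<close>

definition dunkl_C2 :: "(real^'n) set \<Rightarrow> (real^'n \<Rightarrow> real) \<Rightarrow> (real^'n \<Rightarrow> complex) \<Rightarrow> bool" where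
  "dunkl_C2 P k f \<longleftrightarrow> (\<forall>x. x \<noteq> 0 \<longrightarrow> f differentiable at x \<and>
     (\<forall>j. dunkl_op P k (axis j 1) f differentiable at x))"

lemma differentiable_cong_nonzero:
  fixes f :: "'a::real_normed_vector \<Rightarrow> 'b::real_normed_vector"
  assumes "x \<noteq> 0" "\<And>y. y \<noteq> 0 \<Longrightarrow> f y = g y" "g differentiable at x"
  shows "f differentiable at x"
proof -
  obtain D where "(g has_derivative D) (at x)" using assms(3) by (auto simp: differentiable_def)
  then have "(f has_derivative D) (at x)"
    using assms(1,2) by (intro has_derivative_transform_within_open[of g D x UNIV "- {0}" f]) auto
  then show ?thesis by (auto simp: differentiable_def)
qed

lemma dunkl_C2_combination:
  assumes "finite S" "\<And>i. i \<in> S \<Longrightarrow> dunkl_C2 P k (f i)" "0 \<notin> P"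
  shows "dunkl_C2 P k (\<lambda>x. \<Sum>i\<in>S. c i * f i x)"
    and "x \<noteq> 0 \<Longrightarrow> dunkl_op P k (axis j 1) (\<lambda>x. \<Sum>i\<in>S. c i * f i x) x = (\<Sum>i\<in>S. c i * dunkl_op P k (axis j 1) (f i) x)"
    and "x \<noteq> 0 \<Longrightarrow> dunkl_laplacian P k (\<lambda>x. \<Sum>i\<in>S. c i * f i x) x = (\<Sum>i\<in>S. c i * dunkl_laplacian P k (f i) x)"
proof -
  have lin: "(\<lambda>x. \<Sum>i\<in>S. c i * g i x) differentiable at x \<and>
      dunkl_op P k \<xi> (\<lambda>x. \<Sum>i\<in>S. c i * g i x) x = (\<Sum>i\<in>S. c i * dunkl_op P k \<xi> (g i) x)"
    if "\<And>i. i \<in> S \<Longrightarrow> g i differentiable at x" for g :: "'a \<Rightarrow> real^'b \<Rightarrow> complex" and x \<xi>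
    using assms(1) that
  proof (induction S)
    case empty
    show ?case by (simp add: dunkl_op_def dir_deriv_const refl_quotient_const)
  next
    case (insert i S)
    have "(\<lambda>x. c i * g i x) differentiable at x" using insert.prems by simp
    then show ?case using insert by (auto simp: dunkl_op_add dunkl_op_cmult)
  qed
  have d: "i \<in> S \<Longrightarrow> x \<noteq> 0 \<Longrightarrow> f i differentiable at x"
    "i \<in> S \<Longrightarrow> x \<noteq> 0 \<Longrightarrow> dunkl_op P k (axis j 1) (f i) differentiable at x" for i x j
    using assms(2) by (auto simp: dunkl_C2_def)
  show T: "dunkl_op P k (axis j 1) (\<lambda>x. \<Sum>i\<in>S. c i * f i x) x = (\<Sum>i\<in>S. c i * dunkl_op P k (axis j 1) (f i) x)" if "x \<noteq> 0" for x j
    using lin[of f x "axis j 1"] d(1) that by simp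
  have Td: "(\<lambda>x. \<Sum>i\<in>S. c i * dunkl_op P k (axis j 1) (f i) x) differentiable at x" if "x \<noteq> 0" for x j
    using lin[of "\<lambda>i. dunkl_op P k (axis j 1) (f i)" x] d(2) that by simp
  have fd: "(\<lambda>x. \<Sum>i\<in>S. c i * f i x) differentiable at x" if "x \<noteq> 0" for x
    using lin[of f x] d(1) that by simp
  show "dunkl_C2 P k (\<lambda>x. \<Sum>i\<in>S. c i * f i x)"
    unfolding dunkl_C2_def
  proof (intro allI impI conjI fd)
    fix x :: "real^'b" and j assume x: "x \<noteq> 0"
    show "dunkl_op P k (axis j 1) (\<lambda>x. \<Sum>i\<in>S. c i * f i x) differentiable at x"
      by (rule differentiable_cong_nonzero[OF x _ Td[OF x]]) (rule T)
  qed
  show "dunkl_laplacian P k (\<lambda>x. \<Sum>i\<in>S. c i * f i x) x = (\<Sum>i\<in>S. c i * dunkl_laplacian P k (f i) x)" if "x \<noteq> 0"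
  proof -
    have "dunkl_op P k (axis j 1) (dunkl_op P k (axis j 1) (\<lambda>x. \<Sum>i\<in>S. c i * f i x)) x
      = dunkl_op P k (axis j 1) (\<lambda>x. \<Sum>i\<in>S. c i * dunkl_op P k (axis j 1) (f i) x) x" for j
      by (rule dunkl_op_cong[OF that _ assms(3)]) (rule T)
    then have "dunkl_op P k (axis j 1) (dunkl_op P k (axis j 1) (\<lambda>x. \<Sum>i\<in>S. c i * f i x)) x
      = (\<Sum>i\<in>S. c i * dunkl_op P k (axis j 1) (dunkl_op P k (axis j 1) (f i)) x)" for j
      using lin[of "\<lambda>i. dunkl_op P k (axis j 1) (f i)" x "axis j 1"] d(2) that by simp
    then show ?thesis unfolding dunkl_laplacian_def by (simp add: sum_distrib_left sum.swap[of _ S])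
  qed
qed

text \<open>The Dunkl Laplacian of a radial function times \<open>f\<close>. The radial function is written with
  \<open>U' r = r * V r\<close> and \<open>V' r = r * V2 r\<close>, so that no division by the norm occurs.\<close>

lemma dunkl_laplacian_radial_mult:
  fixes f :: "real^'n \<Rightarrow> complex"
  assumes P: "0 \<notin> P" and f: "dunkl_C2 P k f"
    and U: "\<And>r. r > 0 \<Longrightarrow> (U has_vector_derivative of_real r * V r) (at r)"
    and V: "\<And>r. r > 0 \<Longrightarrow> (V has_vector_derivative of_real r * V2 r) (at r)"
  shows "dunkl_C2 P k (\<lambda>x. U (norm x) * f x)"
    and "x \<noteq> 0 \<Longrightarrow> dunkl_laplacian P k (\<lambda>x. U (norm x) * f x) x
      = U (norm x) * dunkl_laplacian P k f x
        + V (norm x) * (2 * dir_deriv x f x + of_real (real CARD('n) + 2 * sum k P) * f x)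
        + of_real ((norm x)\<^sup>2) * V2 (norm x) * f x"
proof -
  define u where "u x = U (norm x)" for x :: "real^'n"
  define v where "v x = V (norm x)" for x :: "real^'n"
  have u': "(u has_derivative (\<lambda>h. of_real (x \<bullet> h) * v x)) (at x)" if "x \<noteq> 0" for x
    unfolding u_def v_def using that U by (intro radial_has_derivative) auto
  have v': "(v has_derivative (\<lambda>h. of_real (x \<bullet> h) * V2 (norm x))) (at x)" if "x \<noteq> 0" for x
    unfolding v_def using that V by (intro radial_has_derivative) auto
  have ud: "u differentiable at x" "v differentiable at x" if "x \<noteq> 0" for x
    using u'[OF that] v'[OF that] by (auto simp: differentiable_def)
  have "norm (refl_along \<alpha> x) = norm x" if "\<alpha> \<in> P" for \<alpha> x
    using that P by (intro norm_refl_along) auto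
  then have inv: "\<alpha> \<in> P \<Longrightarrow> u (refl_along \<alpha> x) = u x" "\<alpha> \<in> P \<Longrightarrow> v (refl_along \<alpha> x) = v x" for \<alpha> x
    by (simp_all add: u_def v_def)
  have fd: "x \<noteq> 0 \<Longrightarrow> f differentiable at x" "x \<noteq> 0 \<Longrightarrow> dunkl_op P k (axis j 1) f differentiable at x" for x j
    using f by (auto simp: dunkl_C2_def)
  have cd: "(\<lambda>y. complex_of_real (y $ j)) differentiable at x" for j and x :: "real^'n"
    by (rule bounded_linear_imp_differentiable) (intro bounded_linear_compose[OF bounded_linear_of_real] bounded_linear_vec_nth)
  have T: "dunkl_op P k (axis j 1) (\<lambda>y. u y * f y) x = u x * dunkl_op P k (axis j 1) f x + v x * (of_real (x $ j) * f x)"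
    if "x \<noteq> 0" for x j
    using dunkl_op_mult_radial[where u = u and x = x and v = "v x" and f = f and P = P and k = k and \<xi> = "axis j 1",
        OF u'[OF that] inv(1) fd(1)[OF that]] by (simp add: inner_axis ac_simps)
  have Td: "(\<lambda>x. u x * dunkl_op P k (axis j 1) f x + v x * (of_real (x $ j) * f x)) differentiable at x" if "x \<noteq> 0" for x j
    using that by (intro differentiable_add differentiable_mult ud fd cd)
  show "dunkl_C2 P k (\<lambda>x. U (norm x) * f x)"
    unfolding dunkl_C2_def u_def[symmetric]
  proof (intro allI impI conjI differentiable_mult ud fd)
    fix x :: "real^'n" and j assume x: "x \<noteq> 0"
    show "dunkl_op P k (axis j 1) (\<lambda>x. u x * f x) differentiable at x"
      by (rule differentiable_cong_nonzero[OF x _ Td[OF x]]) (rule T)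
  qed
  assume x: "x \<noteq> 0"
  have "dunkl_op P k (axis j 1) (dunkl_op P k (axis j 1) (\<lambda>y. u y * f y)) x
     = u x * dunkl_op P k (axis j 1) (dunkl_op P k (axis j 1) f) x
       + v x * (of_real (x $ j) * dunkl_op P k (axis j 1) f x + dunkl_op P k (axis j 1) (\<lambda>y. of_real (y $ j) * f y) x)
       + of_real (x $ j * x $ j) * (V2 (norm x) * f x)" for j
  proof -
    have "dunkl_op P k (axis j 1) (dunkl_op P k (axis j 1) (\<lambda>y. u y * f y)) x
      = dunkl_op P k (axis j 1) (\<lambda>x. u x * dunkl_op P k (axis j 1) f x + v x * (of_real (x $ j) * f x)) x"
      by (rule dunkl_op_cong[OF x _ P]) (rule T)
    also have "\<dots> = dunkl_op P k (axis j 1) (\<lambda>x. u x * dunkl_op P k (axis j 1) f x) x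
       + dunkl_op P k (axis j 1) (\<lambda>x. v x * (of_real (x $ j) * f x)) x"
      by (intro dunkl_op_add differentiable_mult ud fd cd x)
    finally have 1: "dunkl_op P k (axis j 1) (dunkl_op P k (axis j 1) (\<lambda>y. u y * f y)) x
      = dunkl_op P k (axis j 1) (\<lambda>x. u x * dunkl_op P k (axis j 1) f x) x
       + dunkl_op P k (axis j 1) (\<lambda>x. v x * (of_real (x $ j) * f x)) x" .
    have 2: "dunkl_op P k (axis j 1) (\<lambda>x. u x * dunkl_op P k (axis j 1) f x) x
      = u x * dunkl_op P k (axis j 1) (dunkl_op P k (axis j 1) f) x + of_real (x \<bullet> axis j 1) * v x * dunkl_op P k (axis j 1) f x"
      by (rule dunkl_op_mult_radial[where u = u and v = "v x"]) (rule u'[OF x] fd(2)[OF x] | erule inv(1))+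
    have 3: "dunkl_op P k (axis j 1) (\<lambda>x. v x * (of_real (x $ j) * f x)) x
      = v x * dunkl_op P k (axis j 1) (\<lambda>x. of_real (x $ j) * f x) x + of_real (x \<bullet> axis j 1) * V2 (norm x) * (of_real (x $ j) * f x)"
      by (rule dunkl_op_mult_radial[where u = v and v = "V2 (norm x)"])
        (rule v'[OF x] differentiable_mult cd fd(1)[OF x] | erule inv(2))+
    show ?thesis unfolding 1 2 3 by (simp add: inner_axis algebra_simps)
  qed
  then have "dunkl_laplacian P k (\<lambda>y. u y * f y) x
     = u x * dunkl_laplacian P k f x
       + v x * (\<Sum>j\<in>UNIV. of_real (x $ j) * dunkl_op P k (axis j 1) f x + dunkl_op P k (axis j 1) (\<lambda>y. of_real (y $ j) * f y) x)
       + (\<Sum>j\<in>UNIV. of_real (x $ j * x $ j)) * (V2 (norm x) * f x)"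
    unfolding dunkl_laplacian_def by (simp only: sum.distrib sum_distrib_left sum_distrib_right distrib_left)
  moreover have "(\<Sum>j\<in>UNIV. complex_of_real (x $ j * x $ j)) = of_real ((norm x)\<^sup>2)"
    by (simp add: power2_norm_eq_inner inner_vec_def)
  ultimately show "dunkl_laplacian P k (\<lambda>x. U (norm x) * f x) x
      = U (norm x) * dunkl_laplacian P k f x
        + V (norm x) * (2 * dir_deriv x f x + of_real (real CARD('n) + 2 * sum k P) * f x)
        + of_real ((norm x)\<^sup>2) * V2 (norm x) * f x"
    unfolding dunkl_coordinate_anticommutator[OF fd(1)[OF x] P] by (simp add: u_def v_def mult.assoc)
qed

section \<open>Dunkl operators on polynomials\<close>

lemma polynomial_function_of_real:
  assumes "real_polynomial_function f"
  shows "polynomial_function (\<lambda>x. complex_of_real (f x))"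
  unfolding polynomial_function_def
proof (intro allI impI)
  fix g :: "complex \<Rightarrow> real" assume "bounded_linear g"
  then interpret bounded_linear g .
  have "g \<circ> (\<lambda>x. complex_of_real (f x)) = (\<lambda>x. f x * g 1)"
    by (auto simp: fun_eq_iff of_real_def scaleR)
  then show "real_polynomial_function (g \<circ> (\<lambda>x. complex_of_real (f x)))"
    by (simp only:) (intro real_polynomial_function.intros(2-4) assms)
qed

lemma real_polynomial_function_Re_Im:
  assumes "polynomial_function (p :: 'a::euclidean_space \<Rightarrow> complex)"
  shows "real_polynomial_function (\<lambda>x. Re (p x))" "real_polynomial_function (\<lambda>x. Im (p x))"
  using assms bounded_linear_Re bounded_linear_Im unfolding polynomial_function_def o_def by blast+

lemma polynomial_function_Complex:
  assumes "real_polynomial_function f" "real_polynomial_function g"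
  shows "polynomial_function (\<lambda>x. complex_of_real (f x) + \<i> * complex_of_real (g x))"
  unfolding polynomial_function_def
proof (intro allI impI)
  fix h :: "complex \<Rightarrow> real" assume "bounded_linear h"
  then interpret bounded_linear h .
  have "h (complex_of_real (f x) + \<i> * complex_of_real (g x)) = f x * h 1 + g x * h \<i>" for x
    using scaleR[of "f x" 1] scaleR[of "g x" \<i>] by (simp add: add scaleR_conv_of_real mult.commute)
  then show "real_polynomial_function (h \<circ> (\<lambda>x. complex_of_real (f x) + \<i> * complex_of_real (g x)))"
    unfolding o_def
    by (simp only:) (intro real_polynomial_function.intros(2-4) assms)
qed

lemma polynomial_function_mult_complex:
  assumes "polynomial_function (p :: 'a::euclidean_space \<Rightarrow> complex)" "polynomial_function q"
  shows "polynomial_function (\<lambda>x. p x * q x)"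
proof -
  note r = real_polynomial_function_Re_Im[OF assms(1)] real_polynomial_function_Re_Im[OF assms(2)]
  have "polynomial_function (\<lambda>x. complex_of_real (Re (p x) * Re (q x) + (-1) * (Im (p x) * Im (q x)))
      + \<i> * complex_of_real (Re (p x) * Im (q x) + Im (p x) * Re (q x)))"
    by (intro polynomial_function_Complex real_polynomial_function.intros r)
  moreover have "complex_of_real (Re (p x) * Re (q x) + (-1) * (Im (p x) * Im (q x)))
      + \<i> * complex_of_real (Re (p x) * Im (q x) + Im (p x) * Re (q x)) = p x * q x" for x
    by (simp add: complex_eq_iff)
  ultimately show ?thesis by simp
qed

lemma polynomial_function_cnj:
  assumes "polynomial_function (p :: 'a::euclidean_space \<Rightarrow> complex)"
  shows "polynomial_function (\<lambda>x. cnj (p x))"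
proof -
  note r = real_polynomial_function_Re_Im[OF assms(1)]
  have "polynomial_function (\<lambda>x. complex_of_real (Re (p x)) + \<i> * complex_of_real ((-1) * Im (p x)))"
    by (intro polynomial_function_Complex real_polynomial_function.intros r)
  moreover have "complex_of_real (Re (p x)) + \<i> * complex_of_real ((-1) * Im (p x)) = cnj (p x)" for x
    by (simp add: complex_eq_iff)
  ultimately show ?thesis by simp
qed

lemma polynomial_function_coordinate: "polynomial_function (\<lambda>x::real^'n. complex_of_real (x $ j))"
  by (intro polynomial_function_of_real real_polynomial_function.intros bounded_linear_vec_nth)

text \<open>Complex-valued polynomial functions are given by real coordinates; the induction is carried out on
  the real and imaginary parts.\<close>

lemma complex_polynomial_induct [consumes 1, case_names linear const add mult]:
  fixes p :: "'a::euclidean_space \<Rightarrow> complex"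
  assumes p: "polynomial_function p"
    and linear: "\<And>f. bounded_linear f \<Longrightarrow> Q (\<lambda>x. complex_of_real (f x))"
    and const: "\<And>c. Q (\<lambda>x. c)"
    and add: "\<And>f g. polynomial_function f \<Longrightarrow> polynomial_function g \<Longrightarrow> Q f \<Longrightarrow> Q g \<Longrightarrow> Q (\<lambda>x. f x + g x)"
    and mult: "\<And>f g. polynomial_function f \<Longrightarrow> polynomial_function g \<Longrightarrow> Q f \<Longrightarrow> Q g \<Longrightarrow> Q (\<lambda>x. f x * g x)"
  shows "Q p"
proof -
  have real: "Q (\<lambda>x. complex_of_real (f x))" if "real_polynomial_function f" for f
    using that
  proof (induction f)
    case (linear f) then show ?case by (rule assms(2))
  next
    case (const c) show ?case by (rule assms(3))
  next
    case (add f g)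
    then show ?case using assms(4)[of "\<lambda>x. of_real (f x)" "\<lambda>x. of_real (g x)"]
      by (simp add: polynomial_function_of_real)
  next
    case (mult f g)
    then show ?case using assms(5)[of "\<lambda>x. of_real (f x)" "\<lambda>x. of_real (g x)"]
      by (simp add: polynomial_function_of_real)
  qed
  note r = real_polynomial_function_Re_Im[OF p]
  have c: "polynomial_function (\<lambda>x::'a. \<i>)" by (rule polynomial_function_const)
  have "Q (\<lambda>x. complex_of_real (Re (p x)) + \<i> * complex_of_real (Im (p x)))"
    by (intro add mult real r const polynomial_function_of_real c polynomial_function_mult_complex)
  then show ?thesis by (simp flip: complex_eq)
qed

lemma differentiable_polynomial: "polynomial_function (p :: real^'n \<Rightarrow> complex) \<Longrightarrow> p differentiable at x"
  by (rule differentiable_at_polynomial_function)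

lemma polynomial_dir_deriv:
  fixes p :: "real^'n \<Rightarrow> complex"
  assumes "polynomial_function p"
  shows "polynomial_function (dir_deriv \<xi> p)"
  using assms
proof (induction p rule: complex_polynomial_induct)
  case (linear f)
  have "dir_deriv \<xi> (\<lambda>x. of_real (f x)) = (\<lambda>x. of_real (f \<xi>))" using dir_deriv_of_real_linear[OF linear] by auto
  then show ?case by (simp add: polynomial_function_const)
next
  case (const c)
  have "dir_deriv \<xi> (\<lambda>x::real^'n. c) = (\<lambda>x. 0)" by (auto simp: dir_deriv_const)
  then show ?case by (simp add: polynomial_function_const)
next
  case (add f g)
  then have "dir_deriv \<xi> (\<lambda>x. f x + g x) = (\<lambda>x. dir_deriv \<xi> f x + dir_deriv \<xi> g x)"
    by (auto simp: dir_deriv_add differentiable_polynomial)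
  then show ?case using add by (simp add: polynomial_function_add)
next
  case (mult f g)
  then have "dir_deriv \<xi> (\<lambda>x. f x * g x) = (\<lambda>x. f x * dir_deriv \<xi> g x + dir_deriv \<xi> f x * g x)"
    by (auto simp: dir_deriv_mult differentiable_polynomial)
  then show ?case using mult by (simp add: polynomial_function_add polynomial_function_mult_complex)
qed

lemma polynomial_function_refl_along:
  assumes "polynomial_function (p :: real^'n \<Rightarrow> complex)"
  shows "polynomial_function (\<lambda>x. p (refl_along \<alpha> x))"
  using polynomial_function_compose[OF polynomial_function_bounded_linear[OF refl_along_linear] assms]
  by (simp add: o_def)

text \<open>The value of \<open>refl_quotient\<close> on the hyperplane is the one that makes the product rule hold
  everywhere, so the claim passes from linear functions to products.\<close>

lemma polynomial_refl_quotient: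
  fixes p :: "real^'n \<Rightarrow> complex"
  assumes "polynomial_function p"
  shows "polynomial_function (refl_quotient \<alpha> p)"
  using assms
proof (induction p rule: complex_polynomial_induct)
  case (linear f)
  have "refl_quotient \<alpha> (\<lambda>x. of_real (f x)) = (\<lambda>x. of_real (2 * f \<alpha> / (norm \<alpha>)\<^sup>2))"
    using refl_quotient_of_real_linear[OF linear] by auto
  then show ?case by (simp add: polynomial_function_const)
next
  case (const c)
  have "refl_quotient \<alpha> (\<lambda>x::real^'n. c) = (\<lambda>x. 0)" by (auto simp: refl_quotient_const)
  then show ?case by (simp add: polynomial_function_const)
next
  case (add f g)
  then have "refl_quotient \<alpha> (\<lambda>x. f x + g x) = (\<lambda>x. refl_quotient \<alpha> f x + refl_quotient \<alpha> g x)"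
    by (auto simp: refl_quotient_add differentiable_polynomial)
  then show ?case using add by (simp add: polynomial_function_add)
next
  case (mult f g)
  then have "refl_quotient \<alpha> (\<lambda>x. f x * g x) = (\<lambda>x. f x * refl_quotient \<alpha> g x + g (refl_along \<alpha> x) * refl_quotient \<alpha> f x)"
    by (auto simp: refl_quotient_mult differentiable_polynomial)
  then show ?case using mult
    by (simp add: polynomial_function_add polynomial_function_mult_complex polynomial_function_refl_along)
qed

lemma polynomial_dunkl_op:
  fixes p :: "real^'n \<Rightarrow> complex"
  assumes "polynomial_function p" "finite P"
  shows "polynomial_function (dunkl_op P k \<xi> p)"
proof -
  have "polynomial_function (\<lambda>x. dir_deriv \<xi> p x + (\<Sum>\<alpha>\<in>P. of_real (k \<alpha> * (\<alpha> \<bullet> \<xi>)) * refl_quotient \<alpha> p x))"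
    by (intro polynomial_function_add polynomial_dir_deriv assms polynomial_function_sum
        polynomial_function_mult_complex polynomial_function_const polynomial_refl_quotient)
  then show ?thesis by (simp add: dunkl_op_def[abs_def])
qed

lemma dunkl_C2_polynomial: "polynomial_function p \<Longrightarrow> finite P \<Longrightarrow> dunkl_C2 P k p"
  by (simp add: dunkl_C2_def differentiable_polynomial polynomial_dunkl_op)

lemma dir_deriv_cnj:
  fixes p :: "real^'n \<Rightarrow> complex"
  assumes "p differentiable at x"
  shows "dir_deriv \<xi> (\<lambda>x. cnj (p x)) x = cnj (dir_deriv \<xi> p x)"
  by (rule dir_deriv_eq) (intro has_derivative_cnj has_derivative_dir_deriv assms)

lemma dunkl_op_cnj:
  fixes p :: "real^'n \<Rightarrow> complex"
  assumes "p differentiable at x"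
  shows "dunkl_op P k \<xi> (\<lambda>x. cnj (p x)) x = cnj (dunkl_op P k \<xi> p x)"
proof -
  have "refl_quotient \<alpha> (\<lambda>x. cnj (p x)) x = cnj (refl_quotient \<alpha> p x)" for \<alpha>
    using assms by (simp add: refl_quotient_def dir_deriv_cnj)
  then show ?thesis using assms by (simp add: dunkl_op_def dir_deriv_cnj)
qed

lemma dunkl_harmonics_cnj:
  assumes "p \<in> dunkl_harmonics P k m" "finite P"
  shows "(\<lambda>x. cnj (p x)) \<in> dunkl_harmonics P k m"
proof -
  have p: "polynomial_function p" "\<And>t x. p (t *\<^sub>R x) = of_real (t ^ m) * p x" "\<And>x. dunkl_laplacian P k p x = 0"
    using assms(1) by (auto simp: dunkl_harmonics_def)
  have "dunkl_op P k (axis j 1) (\<lambda>x. cnj (p x)) = (\<lambda>x. cnj (dunkl_op P k (axis j 1) p x))" for j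
    using dunkl_op_cnj differentiable_polynomial p(1) by blast
  then have "dunkl_laplacian P k (\<lambda>x. cnj (p x)) x = cnj (dunkl_laplacian P k p x)" for x
    unfolding dunkl_laplacian_def
    by (simp add: dunkl_op_cnj differentiable_polynomial polynomial_dunkl_op p(1) assms(2))
  then show ?thesis using p by (simp add: dunkl_harmonics_def polynomial_function_cnj)
qed

lemma dir_deriv_homogeneous:
  fixes p :: "real^'n \<Rightarrow> complex"
  assumes p: "polynomial_function p" and hom: "\<And>t x. p (t *\<^sub>R x) = of_real (t ^ m) * p x"
  shows "dir_deriv x p x = of_nat m * p x"
proof -
  have "((\<lambda>t. p (t *\<^sub>R x)) has_derivative (\<lambda>h. dir_deriv (h *\<^sub>R x) p x)) (at 1)"
    by (rule has_derivative_compose[of "\<lambda>t. t *\<^sub>R x" "\<lambda>h. h *\<^sub>R x" 1 UNIV p "\<lambda>\<xi>. dir_deriv \<xi> p x"])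
      (use has_derivative_dir_deriv[OF differentiable_polynomial[OF p]] in \<open>auto intro!: derivative_eq_intros\<close>)
  moreover have "((\<lambda>t. p (t *\<^sub>R x)) has_derivative (\<lambda>h. of_real (real m * h) * p x)) (at 1)"
    unfolding hom by (auto intro!: derivative_eq_intros)
  ultimately have "(\<lambda>h. dir_deriv (h *\<^sub>R x) p x) = (\<lambda>h. of_real (real m * h) * p x)"
    by (rule has_derivative_unique)
  then have "dir_deriv (1 *\<^sub>R x) p x = of_real (real m * 1) * p x" by (rule fun_cong)
  then show ?thesis by simp
qed

definition poly_growth :: "('a::real_normed_vector \<Rightarrow> complex) \<Rightarrow> bool" where
  "poly_growth f \<longleftrightarrow> (\<exists>C K. C \<ge> 0 \<and> (\<forall>x. cmod (f x) \<le> C * (1 + norm x) ^ K))"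

lemma poly_growth_mult:
  assumes "poly_growth f" "poly_growth g"
  shows "poly_growth (\<lambda>x. f x * g x)"
proof -
  obtain C K where 1: "C \<ge> 0" "\<And>x. cmod (f x) \<le> C * (1 + norm x) ^ K"
    using assms(1) by (auto simp: poly_growth_def)
  obtain D L where 2: "D \<ge> 0" "\<And>x. cmod (g x) \<le> D * (1 + norm x) ^ L"
    using assms(2) by (auto simp: poly_growth_def)
  have "cmod (f x * g x) \<le> (C * D) * (1 + norm x) ^ (K + L)" for x
  proof -
    have "cmod (f x * g x) \<le> (C * (1 + norm x) ^ K) * (D * (1 + norm x) ^ L)"
      unfolding norm_mult by (intro mult_mono 1 2 mult_nonneg_nonneg) auto
    then show ?thesis by (simp add: power_add ac_simps)
  qed
  then show ?thesis using 1 2 unfolding poly_growth_def by (intro exI[of _ "C * D"] exI[of _ "K + L"]) auto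
qed

lemma poly_growth_add:
  assumes "poly_growth f" "poly_growth g"
  shows "poly_growth (\<lambda>x. f x + g x)"
proof -
  obtain C K where 1: "C \<ge> 0" "\<And>x. cmod (f x) \<le> C * (1 + norm x) ^ K"
    using assms(1) by (auto simp: poly_growth_def)
  obtain D L where 2: "D \<ge> 0" "\<And>x. cmod (g x) \<le> D * (1 + norm x) ^ L"
    using assms(2) by (auto simp: poly_growth_def)
  have "cmod (f x + g x) \<le> (C + D) * (1 + norm x) ^ (K + L)" for x
  proof -
    have "cmod (f x + g x) \<le> C * (1 + norm x) ^ K + D * (1 + norm x) ^ L"
      using norm_triangle_ineq[of "f x" "g x"] 1(2)[of x] 2(2)[of x] by linarith
    also have "\<dots> \<le> C * (1 + norm x) ^ (K + L) + D * (1 + norm x) ^ (K + L)"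
      by (intro add_mono mult_left_mono power_increasing 1 2) auto
    finally show ?thesis by (simp add: distrib_right)
  qed
  then show ?thesis using 1 2 unfolding poly_growth_def by (intro exI[of _ "C + D"] exI[of _ "K + L"]) auto
qed

lemma poly_growth_const: "poly_growth (\<lambda>x. c)"
  unfolding poly_growth_def by (intro exI[of _ "cmod c"] exI[of _ 0]) auto

lemma poly_growth_sum: "(\<And>i. i \<in> S \<Longrightarrow> poly_growth (f i)) \<Longrightarrow> poly_growth (\<lambda>x. \<Sum>i\<in>S. f i x)"
  by (induction S rule: infinite_finite_induct) (auto intro: poly_growth_const poly_growth_add)

lemma poly_growth_linear:
  assumes "bounded_linear f"
  shows "poly_growth (\<lambda>x. complex_of_real (f x))"
proof -
  obtain B where B: "\<And>x. norm (f x) \<le> norm x * B" "B \<ge> 0"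
    using bounded_linear.nonneg_bounded[OF assms] by blast
  have "cmod (complex_of_real (f x)) \<le> B * (1 + norm x) ^ 1" for x
    using B(1)[of x] B(2) by (simp add: distrib_left mult.commute)
  then show ?thesis unfolding poly_growth_def using B(2) by blast
qed

lemma poly_growth_polynomial:
  fixes p :: "'a::euclidean_space \<Rightarrow> complex"
  shows "polynomial_function p \<Longrightarrow> poly_growth p"
  by (induction p rule: complex_polynomial_induct)
    (auto intro: poly_growth_linear poly_growth_const poly_growth_add poly_growth_mult)

lemma poly_growth_mono: "poly_growth g \<Longrightarrow> (\<And>x. cmod (f x) \<le> cmod (g x)) \<Longrightarrow> poly_growth f"
  unfolding poly_growth_def by (meson order_trans)

lemma poly_growth_gaussian_bound:
  assumes "poly_growth f"
  shows "\<exists>C\<ge>0. \<forall>x. cmod (f x) * exp (- (norm x)\<^sup>2 / 2) \<le> C * exp (- norm x)"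
proof -
  obtain C K where 1: "C \<ge> 0" "\<And>x. cmod (f x) \<le> C * (1 + norm x) ^ K"
    using assms(1) by (auto simp: poly_growth_def)
  have "cmod (f x) * exp (- (norm x)\<^sup>2 / 2) \<le> (C * fact K * exp 3) * exp (- norm x)" for x
  proof -
    have "(1 + norm x) ^ K / fact K \<le> exp (1 + norm x)"
      using sum_le_suminf[OF summable_exp_generic[of "1 + norm x"], of "{K}"]
      by (simp add: exp_def divide_inverse mult.commute)
    then have "(1 + norm x) ^ K \<le> fact K * exp (1 + norm x)" by (simp add: field_simps)
    then have "cmod (f x) \<le> C * (fact K * exp (1 + norm x))"
      using 1(2)[of x] mult_left_mono[OF _ 1(1)] order_trans by blast
    then have "cmod (f x) * exp (- (norm x)\<^sup>2 / 2) \<le> C * (fact K * exp (1 + norm x)) * exp (- (norm x)\<^sup>2 / 2)"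
      by (intro mult_right_mono) auto
    also have "\<dots> = C * fact K * (exp (1 + norm x) * exp (- (norm x)\<^sup>2 / 2))"
      by (simp only: mult.assoc)
    also have "exp (1 + norm x) * exp (- (norm x)\<^sup>2 / 2) = exp (1 + norm x - (norm x)\<^sup>2 / 2)"
      by (simp flip: exp_add)
    also have "C * fact K * exp (1 + norm x - (norm x)\<^sup>2 / 2) \<le> C * fact K * exp (3 - norm x)"
    proof (intro mult_left_mono)
      have "0 \<le> (norm x - 2)\<^sup>2" by simp
      then show "exp (1 + norm x - (norm x)\<^sup>2 / 2) \<le> exp (3 - norm x)"
        by (simp add: power2_eq_square algebra_simps)
    qed (use 1 in auto)
    also have "exp (3 - norm x) = exp 3 * exp (- norm x)" by (simp flip: exp_add)
    finally show ?thesis by (simp only: mult.assoc)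
  qed
  then show ?thesis using 1(1) by (intro exI[of _ "C * fact K * exp 3"]) auto
qed

lemma radial_mass_cong: "(\<And>r. r > 0 \<Longrightarrow> f r = g r) \<Longrightarrow> radial_mass D f = radial_mass D g"
  unfolding radial_mass_def by (intro nn_integral_cong) (auto simp: indicator_def)

lemma sphere_mass_finite:
  assumes "\<And>x::'a::euclidean_space. x \<noteq> 0 \<Longrightarrow> h x \<le> ennreal (C * norm x powr d)" "C \<ge> 0"
  shows "(\<integral>\<^sup>+x. h x * indicator {1..exp 1} (norm x) * ennreal (norm x powr - (d + DIM('a))) \<partial>lborel) < \<infinity>"
proof -
  have "h x * indicator {1..exp 1} (norm x) * ennreal (norm x powr - (d + DIM('a))) \<le> ennreal C * indicator (cball 0 (exp 1)) x" for x :: 'a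
  proof (cases "norm x \<in> {1..exp 1}")
    case True
    then have x: "x \<noteq> 0" "norm x \<ge> 1" "norm x > 0" by auto
    have "h x * ennreal (norm x powr - (d + DIM('a))) \<le> ennreal (C * norm x powr d) * ennreal (norm x powr - (d + DIM('a)))"
      by (intro mult_right_mono assms x) auto
    also have "\<dots> = ennreal (C * norm x powr (- DIM('a)))"
    proof -
      have "norm x powr d * norm x powr - (d + DIM('a)) = norm x powr (- DIM('a))" by (simp flip: powr_add)
      then show ?thesis using assms(2) by (simp add: mult.assoc flip: ennreal_mult)
    qed
    also have "\<dots> \<le> ennreal (C * 1)"
    proof (intro ennreal_leI mult_left_mono assms)
      have "norm x powr (- DIM('a)) \<le> norm x powr 0" using x by (intro powr_mono) auto
      then show "norm x powr (- DIM('a)) \<le> 1" using x by simp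
    qed
    finally show ?thesis using True by simp
  qed simp
  then have "(\<integral>\<^sup>+x. h x * indicator {1..exp 1} (norm x) * ennreal (norm x powr - (d + DIM('a))) \<partial>lborel)
    \<le> (\<integral>\<^sup>+x. ennreal C * indicator (cball 0 (exp 1)) (x::'a) \<partial>lborel)" by (intro nn_integral_mono)
  also have "\<dots> < \<infinity>"
    using emeasure_lborel_cball_finite[of "0::'a" "exp 1"] by (simp add: nn_integral_cmult_indicator ennreal_mult_less_top)
  finally show ?thesis .
qed

lemma integrable_exp_norm: "integrable lborel (\<lambda>x::'a::euclidean_space. exp (- norm x))"
proof (rule integrableI_nonneg)
  have "(\<integral>\<^sup>+(x::'a). 1 * ennreal (exp (- norm x)) \<partial>lborel)
    = (\<integral>\<^sup>+(x::'a). 1 * indicator {1..exp 1} (norm x) * ennreal (norm x powr - (0 + real DIM('a))) \<partial>lborel) * radial_mass (0 + real DIM('a)) (\<lambda>r. ennreal (exp (- r)))"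
    by (rule nn_integral_homogeneous_radial) auto
  moreover have "(\<integral>\<^sup>+(x::'a). 1 * indicator {1..exp 1} (norm x) * ennreal (norm x powr - (0 + real DIM('a))) \<partial>lborel) < \<infinity>"
    by (rule sphere_mass_finite[where C = 1]) auto
  moreover have "radial_mass (0 + real DIM('a)) (\<lambda>r. ennreal (exp (- r))) = radial_mass (0 + real DIM('a)) (\<lambda>r. ennreal (r powr 0 * exp (- 1 * r powr 1)))"
    by (rule radial_mass_cong) simp
  moreover have "\<dots> < \<infinity>" by (rule radial_mass_powr_exp_finite) auto
  ultimately show "(\<integral>\<^sup>+(x::'a). ennreal (exp (- norm x)) \<partial>lborel) < \<infinity>" by (simp add: ennreal_mult_less_top)
qed auto

lemma integrable_exp_decay:
  fixes f :: "'a::euclidean_space \<Rightarrow> complex"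
  assumes "f \<in> borel_measurable borel" "\<And>x. cmod (f x) \<le> C * exp (- norm x)"
  shows "integrable lborel f"
proof (rule Bochner_Integration.integrable_bound)
  show "integrable lborel (\<lambda>x::'a. C * exp (- norm x))" by (intro integrable_mult_right integrable_exp_norm)
  show "AE x in lborel. cmod (f x) \<le> norm (C * exp (- norm x))"
    by (intro AE_I2 order_trans[OF assms(2)]) (simp only: real_norm_def abs_ge_self)
qed (use assms in simp)

lemma integral_lborel_translate:
  fixes f :: "'a::euclidean_space \<Rightarrow> complex"
  assumes "f \<in> borel_measurable borel"
  shows "(\<integral>x. f (x + c) \<partial>lborel) = (\<integral>x. f x \<partial>lborel)"
proof -
  have "(\<integral>x. f x \<partial>lborel) = (\<integral>x. f x \<partial>(distr lborel borel ((+) c)))"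
    by (simp add: lborel_distr_plus)
  also have "\<dots> = (\<integral>x. f (c + x) \<partial>lborel)" by (rule integral_distr) (use assms in auto)
  finally show ?thesis by (simp add: add.commute)
qed

text \<open>The integral of a derivative vanishes: it is the limit of integrals of difference quotients,
  which are zero by translation invariance.\<close>

lemma integral_dir_deriv_zero:
  fixes f D :: "'a::euclidean_space \<Rightarrow> complex"
  assumes f: "f \<in> borel_measurable borel" "\<And>x. cmod (f x) \<le> C * exp (- norm x)"
    and D: "D \<in> borel_measurable borel" "\<And>x. cmod (D x) \<le> C * exp (- norm x)"
    and deriv: "\<And>x. ((\<lambda>t. f (x + t *\<^sub>R \<xi>)) has_vector_derivative D x) (at 0)" and \<xi>: "norm \<xi> \<le> 1"
  shows "(\<integral>x. D x \<partial>lborel) = 0"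
proof -
  have "cmod (f 0) \<le> C" using f(2)[of 0] by simp
  then have C: "C \<ge> 0" using norm_ge_zero[of "f 0"] by linarith
  have deriv': "((\<lambda>t. f (x + t *\<^sub>R \<xi>)) has_vector_derivative D (x + s *\<^sub>R \<xi>)) (at s)" for x s
  proof -
    have "((\<lambda>t. f (x + t *\<^sub>R \<xi>)) \<circ> (\<lambda>t. t + s) has_vector_derivative D (x + s *\<^sub>R \<xi>)) (at 0)"
      using deriv[of "x + s *\<^sub>R \<xi>"] by (simp add: o_def algebra_simps)
    then have "((\<lambda>t. f (x + t *\<^sub>R \<xi>)) \<circ> (\<lambda>t. t + s) \<circ> (\<lambda>t. t - s) has_vector_derivative 1 *\<^sub>R D (x + s *\<^sub>R \<xi>)) (at s)"
      by (intro vector_diff_chain_at) (auto intro!: derivative_eq_intros)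
    then show ?thesis by (simp add: o_def)
  qed
  define \<sigma> where "\<sigma> n = 1 / real (Suc n)" for n
  have \<sigma>: "\<sigma> n > 0" "\<sigma> n \<le> 1" for n by (auto simp: \<sigma>_def)
  define q where "q n x = (f (x + \<sigma> n *\<^sub>R \<xi>) - f x) / of_real (\<sigma> n)" for n x
  have q_bound: "cmod (q n x) \<le> C * exp 1 * exp (- norm x)" for n x
  proof -
    have "\<exists>t\<in>{0<..<\<sigma> n}. cmod (f (x + \<sigma> n *\<^sub>R \<xi>) - f (x + 0 *\<^sub>R \<xi>)) \<le> cmod ((\<sigma> n - 0) *\<^sub>R D (x + t *\<^sub>R \<xi>))"
      by (rule mvt_general[where f = "\<lambda>t. f (x + t *\<^sub>R \<xi>)" and f' = "\<lambda>t h. h *\<^sub>R D (x + t *\<^sub>R \<xi>)"])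
        (use \<sigma> deriv' in \<open>auto intro!: continuous_at_imp_continuous_on has_vector_derivative_continuous simp flip: has_vector_derivative_def\<close>)
    then obtain t where t: "0 < t" "t < \<sigma> n" "cmod (f (x + \<sigma> n *\<^sub>R \<xi>) - f x) \<le> \<sigma> n * cmod (D (x + t *\<^sub>R \<xi>))"
      using \<sigma>[of n] by auto
    have "norm x \<le> norm (x + t *\<^sub>R \<xi>) + norm (t *\<^sub>R \<xi>)" using norm_triangle_ineq4[of "x + t *\<^sub>R \<xi>" "t *\<^sub>R \<xi>"] by simp
    also have "norm (t *\<^sub>R \<xi>) \<le> 1" using t \<sigma>(2)[of n] \<xi> by (simp add: mult_le_one)
    finally have "exp (- norm (x + t *\<^sub>R \<xi>)) \<le> exp (1 - norm x)" by simp
    then have "cmod (D (x + t *\<^sub>R \<xi>)) \<le> C * exp (1 - norm x)" using D(2) C mult_left_mono order_trans by blast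
    then have "\<sigma> n * cmod (D (x + t *\<^sub>R \<xi>)) \<le> \<sigma> n * (C * exp (1 - norm x))" using \<sigma>(1)[of n] by simp
    then have "cmod (f (x + \<sigma> n *\<^sub>R \<xi>) - f x) \<le> \<sigma> n * (C * exp (1 - norm x))" using t(3) by linarith
    also have "exp (1 - norm x) = exp 1 * exp (- norm x)" by (simp flip: exp_add)
    finally show ?thesis using \<sigma>(1)[of n] by (simp add: q_def norm_divide pos_divide_le_eq ac_simps)
  qed
  have shift [measurable]: "(\<lambda>x. f (x + c)) \<in> borel_measurable borel" for c
    using f(1) by measurable
  have int_f: "integrable lborel f" by (rule integrable_exp_decay[OF f])
  have q_int: "(\<integral>x. q n x \<partial>lborel) = 0" for n
  proof -
    have "integrable lborel (\<lambda>x. f (x + \<sigma> n *\<^sub>R \<xi>))"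
    proof (rule integrable_exp_decay)
      fix x
      have "norm x \<le> norm (x + \<sigma> n *\<^sub>R \<xi>) + norm (\<sigma> n *\<^sub>R \<xi>)" using norm_triangle_ineq4[of "x + \<sigma> n *\<^sub>R \<xi>" "\<sigma> n *\<^sub>R \<xi>"] by simp
      also have "norm (\<sigma> n *\<^sub>R \<xi>) \<le> 1" using \<sigma>[of n] \<xi> by (simp add: mult_le_one)
      finally have "exp (- norm (x + \<sigma> n *\<^sub>R \<xi>)) \<le> exp (1 - norm x)" by simp
      then have "cmod (f (x + \<sigma> n *\<^sub>R \<xi>)) \<le> C * exp (1 - norm x)" using f(2) C mult_left_mono order_trans by blast
      also have "exp (1 - norm x) = exp 1 * exp (- norm x)" by (simp flip: exp_add)
      finally show "cmod (f (x + \<sigma> n *\<^sub>R \<xi>)) \<le> (C * exp 1) * exp (- norm x)" by (simp only: mult.assoc)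
    qed (rule shift)
    then show ?thesis unfolding q_def using int_f integral_lborel_translate[OF f(1)] by simp
  qed
  have "(\<lambda>n. \<integral>x. q n x \<partial>lborel) \<longlonglongrightarrow> (\<integral>x. D x \<partial>lborel)"
  proof (rule integral_dominated_convergence)
    show "D \<in> borel_measurable lborel" using D by simp
    show "q n \<in> borel_measurable lborel" for n unfolding q_def using f(1) by measurable
    show "integrable lborel (\<lambda>x::'a. C * exp 1 * exp (- norm x))" by (intro integrable_mult_right integrable_exp_norm)
    show "AE x in lborel. cmod (q n x) \<le> C * exp 1 * exp (- norm x)" for n using q_bound by simp
    show "AE x in lborel. (\<lambda>n. q n x) \<longlonglongrightarrow> D x"
    proof (rule AE_I2)
      fix x :: 'a
      have "((\<lambda>h. (f (x + (0 + h) *\<^sub>R \<xi>) - f (x + 0 *\<^sub>R \<xi>)) /\<^sub>R h) \<longlongrightarrow> D x) (at 0)"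
      proof -
        have "((\<lambda>h. norm ((f (x + (0 + h) *\<^sub>R \<xi>) - f (x + 0 *\<^sub>R \<xi>)) - h *\<^sub>R D x) / norm h) \<longlongrightarrow> 0) (at 0)"
          using deriv[of x] unfolding has_vector_derivative_def has_derivative_at by blast
        then have "((\<lambda>h. norm ((f (x + (0 + h) *\<^sub>R \<xi>) - f (x + 0 *\<^sub>R \<xi>)) /\<^sub>R h - D x)) \<longlongrightarrow> 0) (at 0)"
        proof (rule Lim_transform_eventually)
          have "norm (w - h *\<^sub>R D x) / norm h = norm (w /\<^sub>R h - D x)" if "h \<noteq> 0" for w and h :: real
          proof -
            have "w /\<^sub>R h - D x = (w - h *\<^sub>R D x) /\<^sub>R h" using that by (simp add: scaleR_diff_right)
            then show ?thesis by (simp add: divide_inverse mult.commute)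
          qed
          then show "\<forall>\<^sub>F h in at 0. norm ((f (x + (0 + h) *\<^sub>R \<xi>) - f (x + 0 *\<^sub>R \<xi>)) - h *\<^sub>R D x) / norm h
              = norm ((f (x + (0 + h) *\<^sub>R \<xi>) - f (x + 0 *\<^sub>R \<xi>)) /\<^sub>R h - D x)"
            unfolding eventually_at_filter by (intro always_eventually allI impI) blast
        qed
        then show ?thesis by (rule Lim_null[THEN iffD2, OF tendsto_norm_zero_cancel])
      qed
      moreover have "filterlim \<sigma> (at 0) sequentially"
        using LIMSEQ_inverse_real_of_nat by (auto simp: filterlim_at \<sigma>_def[abs_def] inverse_eq_divide)
      ultimately have "(\<lambda>n. (f (x + (0 + \<sigma> n) *\<^sub>R \<xi>) - f (x + 0 *\<^sub>R \<xi>)) /\<^sub>R \<sigma> n) \<longlonglongrightarrow> D x"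
        by (rule filterlim_compose)
      then show "(\<lambda>n. q n x) \<longlonglongrightarrow> D x" by (simp add: q_def scaleR_conv_of_real divide_inverse mult.commute)
    qed
  qed
  then show ?thesis by (simp add: q_int LIMSEQ_const_iff)
qed

lemma nn_integral_lborel_translate:
  fixes f :: "'a::euclidean_space \<Rightarrow> ennreal"
  assumes [measurable]: "f \<in> borel_measurable borel"
  shows "(\<integral>\<^sup>+x. f (x + c) \<partial>lborel) = (\<integral>\<^sup>+x. f x \<partial>lborel)"
proof -
  have "(\<integral>\<^sup>+x. f x \<partial>lborel) = (\<integral>\<^sup>+x. f x \<partial>(distr lborel borel ((+) c)))"
    by (simp add: lborel_distr_plus)
  also have "\<dots> = (\<integral>\<^sup>+x. f (c + x) \<partial>lborel)" by (rule nn_integral_distr) auto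
  finally show ?thesis by (simp add: add.commute)
qed

lemma refl_along_measurable [measurable]: "refl_along \<alpha> \<in> borel_measurable borel"
  by (intro borel_measurable_continuous_onI linear_continuous_on refl_along_linear)

text \<open>Lebesgue measure is determined up to a factor by translation invariance, and the factor is 1
  because a reflection preserves the unit ball. The proof evaluates the double integral of
  \<open>f (refl_along \<alpha> x + y)\<close> over all \<open>x\<close> and all \<open>y\<close> in the unit ball in both orders.\<close>

lemma nn_integral_refl_along:
  fixes f :: "real^'n \<Rightarrow> ennreal"
  assumes \<alpha>: "\<alpha> \<noteq> 0" and [measurable]: "f \<in> borel_measurable borel"
  shows "(\<integral>\<^sup>+x. f (refl_along \<alpha> x) \<partial>lborel) = (\<integral>\<^sup>+x. f x \<partial>lborel)"
proof -
  define r where "r = refl_along \<alpha>"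
  have [measurable]: "r \<in> borel_measurable borel" unfolding r_def by (rule refl_along_measurable)
  interpret r: bounded_linear r unfolding r_def by (rule refl_along_linear)
  have rr: "r (r x) = x" for x unfolding r_def by (rule refl_along_invol[OF \<alpha>])
  define g where "g = (indicator (ball 0 1) :: real^'n \<Rightarrow> ennreal)"
  have [measurable]: "g \<in> borel_measurable borel" unfolding g_def by (intro borel_measurable_indicator borel_open open_ball)
  have g: "g (- r x) = g x" for x
    using norm_refl_along[OF \<alpha>, of x] by (simp add: g_def r_def indicator_def)
  have ball: "(\<integral>\<^sup>+x. g x \<partial>lborel) = emeasure lborel (ball (0::real^'n) 1)" by (simp add: g_def)
  have "(\<integral>\<^sup>+x. f (r x) \<partial>lborel) * (\<integral>\<^sup>+y. g y \<partial>lborel) = (\<integral>\<^sup>+y. (\<integral>\<^sup>+x. f (r x) \<partial>lborel) * g y \<partial>lborel)"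
    by (rule nn_integral_cmult[symmetric]) measurable
  also have "\<dots> = (\<integral>\<^sup>+y. \<integral>\<^sup>+x. f (r x + y) * g y \<partial>lborel \<partial>lborel)"
  proof (rule nn_integral_cong)
    fix y :: "real^'n"
    have "(\<integral>\<^sup>+x. f (r (x + r y)) \<partial>lborel) = (\<integral>\<^sup>+x. f (r x) \<partial>lborel)"
      by (rule nn_integral_lborel_translate) measurable
    then show "(\<integral>\<^sup>+x. f (r x) \<partial>lborel) * g y = (\<integral>\<^sup>+x. f (r x + y) * g y \<partial>lborel)"
      by (simp add: nn_integral_multc r.add rr)
  qed
  also have "\<dots> = (\<integral>\<^sup>+x. \<integral>\<^sup>+y. f (r x + y) * g y \<partial>lborel \<partial>lborel)"
    by (rule lborel_pair.Fubini') measurable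
  also have "\<dots> = (\<integral>\<^sup>+x. \<integral>\<^sup>+y. f y * g (y - r x) \<partial>lborel \<partial>lborel)"
  proof (rule nn_integral_cong)
    fix x :: "real^'n"
    have "(\<integral>\<^sup>+y. f (y + r x) * g ((y + r x) - r x) \<partial>lborel) = (\<integral>\<^sup>+y. f y * g (y - r x) \<partial>lborel)"
      by (rule nn_integral_lborel_translate) measurable
    then show "(\<integral>\<^sup>+y. f (r x + y) * g y \<partial>lborel) = (\<integral>\<^sup>+y. f y * g (y - r x) \<partial>lborel)"
      by (simp add: add.commute)
  qed
  also have "\<dots> = (\<integral>\<^sup>+y. \<integral>\<^sup>+x. f y * g (y - r x) \<partial>lborel \<partial>lborel)"
    by (rule lborel_pair.Fubini') measurable
  also have "\<dots> = (\<integral>\<^sup>+y. f y * (\<integral>\<^sup>+x. g x \<partial>lborel) \<partial>lborel)"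
  proof (rule nn_integral_cong)
    fix y :: "real^'n"
    have "(\<integral>\<^sup>+x. g (y - r (x + r y)) \<partial>lborel) = (\<integral>\<^sup>+x. g (y - r x) \<partial>lborel)"
      by (rule nn_integral_lborel_translate) measurable
    then show "(\<integral>\<^sup>+x. f y * g (y - r x) \<partial>lborel) = f y * (\<integral>\<^sup>+x. g x \<partial>lborel)"
      by (simp add: nn_integral_cmult r.add rr g)
  qed
  also have "\<dots> = (\<integral>\<^sup>+y. f y \<partial>lborel) * (\<integral>\<^sup>+x. g x \<partial>lborel)" by (rule nn_integral_multc) measurable
  finally have "(\<integral>\<^sup>+x. f (r x) \<partial>lborel) * emeasure lborel (ball (0::real^'n) 1)
    = (\<integral>\<^sup>+y. f y \<partial>lborel) * emeasure lborel (ball (0::real^'n) 1)" by (simp only: ball)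
  moreover have "emeasure lborel (ball (0::real^'n) 1) \<noteq> 0"
    using content_ball_pos[of 1 "0::real^'n"] by (auto simp: measure_def)
  moreover have "emeasure lborel (ball (0::real^'n) 1) \<noteq> \<infinity>"
    using emeasure_lborel_ball_finite[of "0::real^'n" 1] by simp
  ultimately show ?thesis unfolding r_def by (simp add: mult.commute[of _ "emeasure lborel _"] ennreal_mult_cancel_left)
qed

lemma lborel_refl_along:
  fixes \<alpha> :: "real^'n"
  assumes "\<alpha> \<noteq> 0"
  shows "distr lborel borel (refl_along \<alpha>) = lborel"
proof (rule measure_eqI)
  fix A :: "(real^'n) set" assume "A \<in> sets (distr lborel borel (refl_along \<alpha>))"
  then have A [measurable]: "A \<in> sets borel" by simp
  have "emeasure (distr lborel borel (refl_along \<alpha>)) A = (\<integral>\<^sup>+x. indicator A x \<partial>(distr lborel borel (refl_along \<alpha>)))" by simp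
  also have "\<dots> = (\<integral>\<^sup>+x. indicator A (refl_along \<alpha> x) \<partial>lborel)" by (rule nn_integral_distr) measurable
  also have "\<dots> = (\<integral>\<^sup>+x. indicator A x \<partial>lborel)" by (rule nn_integral_refl_along[OF assms]) measurable
  finally show "emeasure (distr lborel borel (refl_along \<alpha>)) A = emeasure lborel A" by simp
qed simp

lemma integral_refl_along:
  fixes f :: "real^'n \<Rightarrow> complex"
  assumes "\<alpha> \<noteq> 0" "f \<in> borel_measurable borel"
  shows "(\<integral>x. f (refl_along \<alpha> x) \<partial>lborel) = (\<integral>x. f x \<partial>lborel)"
proof -
  have "(\<integral>x. f x \<partial>lborel) = (\<integral>x. f x \<partial>(distr lborel borel (refl_along \<alpha>)))"
    by (simp add: lborel_refl_along assms)
  also have "\<dots> = (\<integral>x. f (refl_along \<alpha> x) \<partial>lborel)"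
    by (rule integral_distr) (auto intro!: borel_measurable_continuous_onI linear_continuous_on refl_along_linear assms(2))
  finally show ?thesis by simp
qed

section \<open>Orthogonality of Dunkl harmonics\<close>

locale dunkl_setting =
  fixes R P :: "(real^'n) set" and k :: "real^'n \<Rightarrow> real"
  assumes root_system: "root_system R"
    and positive: "positive_subsystem R P"
    and multiplicity: "multiplicity_function R k"
    and k_nonneg: "\<And>\<alpha>. \<alpha> \<in> R \<Longrightarrow> k \<alpha> \<ge> 0"
begin

lemma finite_R: "finite R" and zero_notin_R: "0 \<notin> R"
  using root_system by (auto simp: root_system_def)

lemma P_subset_R: "P \<subseteq> R"
  using positive by (auto simp: positive_subsystem_def)

lemma finite_P: "finite P" and zero_notin_P: "0 \<notin> P"
  using finite_R zero_notin_R P_subset_R by (auto intro: finite_subset)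

lemma R_nonzero: "\<alpha> \<in> R \<Longrightarrow> \<alpha> \<noteq> 0"
  using zero_notin_R by auto

lemma refl_image: "\<alpha> \<in> R \<Longrightarrow> refl_along \<alpha> ` R = R"
  using root_system by (auto simp: root_system_def)

lemma k_refl:
  assumes "\<alpha> \<in> R" "\<beta> \<in> R"
  shows "k (refl_along \<alpha> \<beta>) = k \<beta>"
proof -
  have "refl_along \<alpha> \<in> coxeter_group R"
    unfolding coxeter_group_def using assms by (intro generate.incl) auto
  then show ?thesis using multiplicity assms unfolding multiplicity_function_def by blast
qed

lemma uminus_R: "\<alpha> \<in> R \<Longrightarrow> - \<alpha> \<in> R"
  using refl_image[of \<alpha>] refl_along_self[of \<alpha>] R_nonzero by (metis imageI)

lemma k_uminus: "\<alpha> \<in> R \<Longrightarrow> k (- \<alpha>) = k \<alpha>"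
  using k_refl[of \<alpha> \<alpha>] refl_along_self[of \<alpha>] R_nonzero by metis

lemma sum_R_even:
  fixes F :: "real^'n \<Rightarrow> 'b::comm_semiring_1"
  assumes "\<And>\<alpha>. \<alpha> \<in> R \<Longrightarrow> F (- \<alpha>) = F \<alpha>"
  shows "sum F R = 2 * sum F P"
proof -
  obtain \<beta> where \<beta>: "\<And>\<alpha>. \<alpha> \<in> R \<Longrightarrow> \<alpha> \<bullet> \<beta> \<noteq> 0" "P = {\<alpha> \<in> R. \<alpha> \<bullet> \<beta> > 0}"
    using positive unfolding positive_subsystem_def by blast
  have R: "R = P \<union> uminus ` P"
  proof (rule equalityI; rule subsetI)
    fix \<alpha> assume \<alpha>: "\<alpha> \<in> R"
    show "\<alpha> \<in> P \<union> uminus ` P"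
    proof (cases "\<alpha> \<bullet> \<beta> > 0")
      case True then show ?thesis using \<alpha> \<beta>(2) by simp
    next
      case False
      then have "- \<alpha> \<in> P" using \<alpha> \<beta>(1)[OF \<alpha>] uminus_R[OF \<alpha>] by (simp add: \<beta>(2))
      then have "- (- \<alpha>) \<in> uminus ` P" by (rule imageI)
      then show ?thesis by simp
    qed
  qed (use P_subset_R uminus_R in auto)
  have "P \<inter> uminus ` P = {}" unfolding \<beta>(2) by auto
  then have "sum F R = sum F P + sum F (uminus ` P)"
    by (subst R) (rule sum.union_disjoint, auto simp: finite_P)
  also have "sum F (uminus ` P) = (\<Sum>\<alpha>\<in>P. F (- \<alpha>))" by (simp add: sum.reindex)
  also have "\<dots> = sum F P" using P_subset_R assms by (intro sum.cong) auto
  finally show ?thesis by (simp add: mult_2)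
qed

lemma sum_R_refl:
  fixes F :: "real^'n \<Rightarrow> 'b::comm_monoid_add"
  assumes "\<alpha> \<in> R"
  shows "(\<Sum>\<beta>\<in>R. F (refl_along \<alpha> \<beta>)) = sum F R"
proof -
  have inj: "inj_on (refl_along \<alpha>) R" by (rule inj_on_inverseI[of _ "refl_along \<alpha>"]) (simp add: refl_along_invol R_nonzero assms)
  have "sum F R = sum F (refl_along \<alpha> ` R)" by (simp add: refl_image[OF assms])
  also have "\<dots> = (\<Sum>\<beta>\<in>R. F (refl_along \<alpha> \<beta>))" using inj by (simp add: sum.reindex)
  finally show ?thesis by simp
qed

definition weight :: "real^'n \<Rightarrow> real" where
  "weight x = (\<Prod>\<alpha>\<in>R. \<bar>\<alpha> \<bullet> x\<bar> powr k \<alpha>)"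

text \<open>Each \<open>\<bar>\<langle>\<alpha>, x\<rangle>\<bar>\<close> is replaced by the square root of \<open>\<langle>\<alpha>, x\<rangle>\<^sup>2 + \<epsilon>\<close>, which is smooth and positive.\<close>

definition smooth_weight :: "real \<Rightarrow> real^'n \<Rightarrow> real" where
  "smooth_weight \<epsilon> x = exp (\<Sum>\<alpha>\<in>R. k \<alpha> / 2 * ln ((\<alpha> \<bullet> x)\<^sup>2 + \<epsilon>))"

lemma weight_nonneg: "weight x \<ge> 0"
  unfolding weight_def by (intro prod_nonneg) simp

lemma weight_measurable [measurable]: "weight \<in> borel_measurable borel"
  unfolding weight_def by measurable

lemma smooth_weight_measurable [measurable]: "smooth_weight \<epsilon> \<in> borel_measurable borel"
  unfolding smooth_weight_def by measurable

lemma smooth_weight_refl: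
  assumes "\<alpha> \<in> R"
  shows "smooth_weight \<epsilon> (refl_along \<alpha> x) = smooth_weight \<epsilon> x"
proof -
  have "(\<Sum>\<beta>\<in>R. k \<beta> / 2 * ln ((\<beta> \<bullet> x)\<^sup>2 + \<epsilon>)) = (\<Sum>\<beta>\<in>R. k (refl_along \<alpha> \<beta>) / 2 * ln ((refl_along \<alpha> \<beta> \<bullet> x)\<^sup>2 + \<epsilon>))"
    by (rule sum_R_refl[OF assms, symmetric])
  also have "\<dots> = (\<Sum>\<beta>\<in>R. k \<beta> / 2 * ln ((\<beta> \<bullet> refl_along \<alpha> x)\<^sup>2 + \<epsilon>))"
  proof (rule sum.cong)
    fix \<beta> assume "\<beta> \<in> R"
    have "refl_along \<alpha> \<beta> \<bullet> x = refl_along \<alpha> \<beta> \<bullet> refl_along \<alpha> (refl_along \<alpha> x)"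
      by (simp add: refl_along_invol R_nonzero[OF assms])
    also have "\<dots> = \<beta> \<bullet> refl_along \<alpha> x" by (rule refl_along_inner[OF R_nonzero[OF assms]])
    finally show "k (refl_along \<alpha> \<beta>) / 2 * ln ((refl_along \<alpha> \<beta> \<bullet> x)\<^sup>2 + \<epsilon>) = k \<beta> / 2 * ln ((\<beta> \<bullet> refl_along \<alpha> x)\<^sup>2 + \<epsilon>)"
      using k_refl[OF assms \<open>\<beta> \<in> R\<close>] by simp
  qed simp
  finally show ?thesis by (simp add: smooth_weight_def)
qed

lemma smooth_weight_tendsto:
  assumes "\<And>\<alpha>. \<alpha> \<in> R \<Longrightarrow> \<alpha> \<bullet> x \<noteq> 0" "\<epsilon> \<longlonglongrightarrow> 0"
  shows "(\<lambda>n. smooth_weight (\<epsilon> n) x) \<longlonglongrightarrow> weight x"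
proof -
  have "(\<lambda>n. smooth_weight (\<epsilon> n) x) \<longlonglongrightarrow> exp (\<Sum>\<alpha>\<in>R. k \<alpha> / 2 * ln ((\<alpha> \<bullet> x)\<^sup>2 + 0))"
    unfolding smooth_weight_def
    by (intro tendsto_exp tendsto_sum tendsto_mult tendsto_const tendsto_ln tendsto_add assms(2)) (use assms(1) in simp)
  also have "exp (\<Sum>\<alpha>\<in>R. k \<alpha> / 2 * ln ((\<alpha> \<bullet> x)\<^sup>2 + 0)) = (\<Prod>\<alpha>\<in>R. exp (k \<alpha> / 2 * ln ((\<alpha> \<bullet> x)\<^sup>2)))"
    by (simp add: exp_sum finite_R)
  also have "\<dots> = weight x" unfolding weight_def
  proof (rule prod.cong)
    fix \<alpha> assume "\<alpha> \<in> R"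
    have "ln ((\<alpha> \<bullet> x)\<^sup>2) = ln (\<bar>\<alpha> \<bullet> x\<bar> ^ 2)" by simp
    also have "\<dots> = 2 * ln \<bar>\<alpha> \<bullet> x\<bar>" using assms(1)[OF \<open>\<alpha> \<in> R\<close>] by (subst ln_realpow) auto
    finally show "exp (k \<alpha> / 2 * ln ((\<alpha> \<bullet> x)\<^sup>2)) = \<bar>\<alpha> \<bullet> x\<bar> powr k \<alpha>"
      using assms(1)[OF \<open>\<alpha> \<in> R\<close>] by (simp add: powr_def)
  qed simp
  finally show ?thesis .
qed

lemma smooth_weight_bound:
  "\<exists>C K. C \<ge> 0 \<and> (\<forall>\<epsilon> x. 0 < \<epsilon> \<and> \<epsilon> \<le> 1 \<longrightarrow> smooth_weight \<epsilon> x \<le> C * (1 + norm x) ^ K)"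
proof -
  obtain K :: nat where K: "sum k R \<le> real K" using real_arch_simple by blast
  define C where "C = exp (\<Sum>\<alpha>\<in>R. k \<alpha> * ln (1 + norm \<alpha>))"
  have "smooth_weight \<epsilon> x \<le> C * (1 + norm x) ^ K" if "0 < \<epsilon>" "\<epsilon> \<le> 1" for \<epsilon> x
  proof -
    have "(\<Sum>\<alpha>\<in>R. k \<alpha> / 2 * ln ((\<alpha> \<bullet> x)\<^sup>2 + \<epsilon>)) \<le> (\<Sum>\<alpha>\<in>R. k \<alpha> * ln (1 + norm \<alpha>) + k \<alpha> * ln (1 + norm x))"
    proof (rule sum_mono)
      fix \<alpha> assume \<alpha>: "\<alpha> \<in> R"
      have "\<bar>\<alpha> \<bullet> x\<bar> \<le> norm \<alpha> * norm x" by (rule Cauchy_Schwarz_ineq2)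
      then have "(\<alpha> \<bullet> x)\<^sup>2 \<le> (norm \<alpha> * norm x)\<^sup>2"
        by (metis abs_ge_zero power2_abs power_mono)
      then have "(\<alpha> \<bullet> x)\<^sup>2 + \<epsilon> \<le> (norm \<alpha> * norm x)\<^sup>2 + 1" using that by simp
      also have "\<dots> \<le> ((1 + norm \<alpha>) * (1 + norm x))\<^sup>2"
      proof -
        have "norm \<alpha> * norm x + 1 \<le> (1 + norm \<alpha>) * (1 + norm x)" by (simp add: algebra_simps)
        then have "(norm \<alpha> * norm x + 1)\<^sup>2 \<le> ((1 + norm \<alpha>) * (1 + norm x))\<^sup>2" by (intro power_mono) auto
        moreover have "(norm \<alpha> * norm x)\<^sup>2 + 1 \<le> (norm \<alpha> * norm x + 1)\<^sup>2" by (simp add: power2_sum)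
        ultimately show ?thesis by linarith
      qed
      finally have "ln ((\<alpha> \<bullet> x)\<^sup>2 + \<epsilon>) \<le> ln (((1 + norm \<alpha>) * (1 + norm x))\<^sup>2)"
        using that by (intro ln_mono) (auto intro: add_nonneg_pos)
      also have "\<dots> = 2 * ln ((1 + norm \<alpha>) * (1 + norm x))"
        by (subst ln_realpow) (auto intro!: mult_pos_pos add_pos_nonneg)
      also have "\<dots> = 2 * (ln (1 + norm \<alpha>) + ln (1 + norm x))"
        by (subst ln_mult_pos) (auto intro!: add_pos_nonneg)
      finally have "k \<alpha> / 2 * ln ((\<alpha> \<bullet> x)\<^sup>2 + \<epsilon>) \<le> k \<alpha> / 2 * (2 * (ln (1 + norm \<alpha>) + ln (1 + norm x)))"
        using k_nonneg[OF \<alpha>] by (intro mult_left_mono) auto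
      then show "k \<alpha> / 2 * ln ((\<alpha> \<bullet> x)\<^sup>2 + \<epsilon>) \<le> k \<alpha> * ln (1 + norm \<alpha>) + k \<alpha> * ln (1 + norm x)"
        by (simp add: distrib_left)
    qed
    also have "\<dots> = (\<Sum>\<alpha>\<in>R. k \<alpha> * ln (1 + norm \<alpha>)) + sum k R * ln (1 + norm x)"
      by (simp add: sum.distrib sum_distrib_right)
    also have "\<dots> \<le> (\<Sum>\<alpha>\<in>R. k \<alpha> * ln (1 + norm \<alpha>)) + real K * ln (1 + norm x)"
      using K by (intro add_left_mono mult_right_mono) auto
    finally have "smooth_weight \<epsilon> x \<le> exp ((\<Sum>\<alpha>\<in>R. k \<alpha> * ln (1 + norm \<alpha>)) + real K * ln (1 + norm x))"
      by (simp add: smooth_weight_def)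
    also have "\<dots> = C * (1 + norm x) ^ K"
      by (simp add: C_def exp_add exp_of_nat_mult add_pos_nonneg)
    finally show ?thesis .
  qed
  then show ?thesis by (intro exI[of _ C] exI[of _ K]) (auto simp: C_def)
qed

lemma AE_off_hyperplanes: "AE x in lborel. \<forall>\<alpha>\<in>R. \<alpha> \<bullet> x \<noteq> 0"
proof (rule AE_finite_allI[OF finite_R])
  fix \<alpha> assume "\<alpha> \<in> R"
  have "negligible {x. \<alpha> \<bullet> x = 0}" using R_nonzero[OF \<open>\<alpha> \<in> R\<close>] by (intro negligible_hyperplane) auto
  then have "{x. \<alpha> \<bullet> x = 0} \<in> null_sets lebesgue" by (simp add: negligible_iff_null_sets)
  moreover have "{x. \<alpha> \<bullet> x = 0} \<in> sets borel" by (intro borel_closed closed_hyperplane)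
  ultimately have "{x. \<alpha> \<bullet> x = 0} \<in> null_sets lborel" by (auto simp: null_sets_def)
  then show "AE x in lborel. \<alpha> \<bullet> x \<noteq> 0" by (rule AE_I') auto
qed

lemma weight_eq_0: "\<alpha> \<in> R \<Longrightarrow> \<alpha> \<bullet> x = 0 \<Longrightarrow> weight x = 0"
  unfolding weight_def using finite_R by (auto simp: prod_zero_iff)

lemma weight_bound: "\<exists>C K. C \<ge> 0 \<and> (\<forall>x. weight x \<le> C * (1 + norm x) ^ K)"
proof -
  obtain C K where C: "C \<ge> 0" "\<And>\<epsilon> x. 0 < \<epsilon> \<Longrightarrow> \<epsilon> \<le> 1 \<Longrightarrow> smooth_weight \<epsilon> x \<le> C * (1 + norm x) ^ K"
    using smooth_weight_bound by blast
  have "weight x \<le> C * (1 + norm x) ^ K" for x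
  proof (cases "\<exists>\<alpha>\<in>R. \<alpha> \<bullet> x = 0")
    case True then show ?thesis using weight_eq_0 C by auto
  next
    case False
    have "(\<lambda>n. smooth_weight (inverse (real (Suc n))) x) \<longlonglongrightarrow> weight x"
      by (rule smooth_weight_tendsto) (use False LIMSEQ_inverse_real_of_nat in auto)
    moreover have "smooth_weight (inverse (real (Suc n))) x \<le> C * (1 + norm x) ^ K" for n
      by (rule C(2)) (auto simp: field_simps)
    ultimately show ?thesis by (intro LIMSEQ_le_const2) auto
  qed
  then show ?thesis using C by blast
qed

lemma poly_growth_weight: "poly_growth (\<lambda>x. complex_of_real (weight x))"
  using weight_bound weight_nonneg unfolding poly_growth_def by simp

lemma gaussian_integrable:
  assumes "p \<in> borel_measurable borel" "poly_growth p"
  shows "integrable lborel (\<lambda>x. p x * of_real (exp (- (norm x)\<^sup>2 / 2) * weight x))"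
proof -
  obtain C where C: "\<And>x. cmod (p x * of_real (weight x)) * exp (- (norm x)\<^sup>2 / 2) \<le> C * exp (- norm x)"
    using poly_growth_gaussian_bound[OF poly_growth_mult[OF assms(2) poly_growth_weight]] by blast
  show ?thesis
  proof (rule integrable_exp_decay)
    show "(\<lambda>x. p x * of_real (exp (- (norm x)\<^sup>2 / 2) * weight x)) \<in> borel_measurable borel"
      using assms(1) by measurable
    show "cmod (p x * of_real (exp (- (norm x)\<^sup>2 / 2) * weight x)) \<le> C * exp (- norm x)" for x
      using C[of x] by (simp add: norm_mult mult.commute mult.left_commute)
  qed
qed

definition gaussian_pairing :: "(real^'n \<Rightarrow> complex) \<Rightarrow> complex" where
  "gaussian_pairing p = (\<integral>x. p x * of_real (exp (- (norm x)\<^sup>2 / 2) * weight x) \<partial>lborel)"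

lemma polynomial_measurable: "polynomial_function (p :: real^'n \<Rightarrow> complex) \<Longrightarrow> p \<in> borel_measurable borel"
  by (intro borel_measurable_continuous_onI continuous_on_polymonial_function)

text \<open>The mean of a Dunkl derivative against the Gaussian. The singular weight is first replaced by
  its smooth regularisation; symmetrising under each reflection turns the logarithmic derivative of
  the regularised weight into a bounded multiple of \<open>refl_quotient\<close>, so that the limit can be taken by
  dominated convergence for every non-negative multiplicity, however small.\<close>

lemma gaussian_pairing_dunkl_op:
  assumes A: "polynomial_function A"
  shows "gaussian_pairing (\<lambda>x. dunkl_op P k (axis j 1) A x - of_real (x $ j) * A x) = 0"
proof -
  define \<xi> where "\<xi> = (axis j 1 :: real^'n)"
  define E where "E x = exp (- (norm x)\<^sup>2 / 2)" for x :: "real^'n"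
  define q where "q \<epsilon> \<alpha> x = (\<alpha> \<bullet> x) / ((\<alpha> \<bullet> x)\<^sup>2 + \<epsilon>)" for \<epsilon> and \<alpha> x :: "real^'n"
  define B where "B x = dir_deriv \<xi> A x - of_real (x \<bullet> \<xi>) * A x" for x
  define \<epsilon> where "\<epsilon> n = inverse (real (Suc n))" for n
  have \<epsilon>: "\<epsilon> n > 0" "\<epsilon> n \<le> 1" for n by (auto simp: \<epsilon>_def field_simps)
  have mA: "A \<in> borel_measurable borel" "poly_growth A"
    using polynomial_measurable[OF A] poly_growth_polynomial[OF A] by auto
  have coord: "polynomial_function (\<lambda>x. complex_of_real (x \<bullet> \<xi>))"
    by (intro polynomial_function_of_real real_polynomial_function.intros bounded_linear_inner_left)
  have "polynomial_function (\<lambda>x. dir_deriv \<xi> A x + (-1) * (of_real (x \<bullet> \<xi>) * A x))"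
    by (intro polynomial_function_add polynomial_function_mult_complex polynomial_dir_deriv A coord polynomial_function_const)
  then have "polynomial_function B" by (simp add: B_def[abs_def])
  then have mB: "B \<in> borel_measurable borel" "poly_growth B"
    using polynomial_measurable poly_growth_polynomial by auto
  have mq [measurable]: "q \<epsilon> \<alpha> \<in> borel_measurable borel" for \<epsilon> \<alpha> unfolding q_def by measurable
  have mE [measurable]: "E \<in> borel_measurable borel" unfolding E_def by measurable
  have qbound: "\<bar>q \<epsilon> \<alpha> x\<bar> \<le> \<bar>\<alpha> \<bullet> x\<bar> / \<epsilon>" if "\<epsilon> > 0" for \<epsilon> \<alpha> x
  proof -
    have "\<bar>q \<epsilon> \<alpha> x\<bar> = \<bar>\<alpha> \<bullet> x\<bar> / ((\<alpha> \<bullet> x)\<^sup>2 + \<epsilon>)" using that by (simp add: q_def abs_of_nonneg)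
    also have "\<dots> \<le> \<bar>\<alpha> \<bullet> x\<bar> / \<epsilon>" using that by (intro divide_left_mono) (auto intro!: mult_pos_pos add_nonneg_pos)
    finally show ?thesis .
  qed
  have qgrowth: "poly_growth (\<lambda>x. complex_of_real (q \<epsilon> \<alpha> x))" if "\<epsilon> > 0" for \<epsilon> \<alpha>
  proof (rule poly_growth_mono)
    show "poly_growth (\<lambda>x. complex_of_real ((\<alpha> \<bullet> x) * (1 / \<epsilon>)))"
      by (intro poly_growth_linear bounded_linear_mult_const bounded_linear_inner_right)
    show "cmod (complex_of_real (q \<epsilon> \<alpha> x)) \<le> cmod (complex_of_real ((\<alpha> \<bullet> x) * (1 / \<epsilon>)))" for x
      using qbound[OF that, of \<alpha> x] that unfolding norm_of_real by (simp add: abs_mult)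
  qed
  obtain C0 K0 where C0: "C0 \<ge> 0" "\<And>\<epsilon> x. 0 < \<epsilon> \<Longrightarrow> \<epsilon> \<le> 1 \<Longrightarrow> smooth_weight \<epsilon> x \<le> C0 * (1 + norm x) ^ K0"
    using smooth_weight_bound by blast
  define G where "G x = complex_of_real (C0 * (1 + norm x) ^ K0)" for x :: "real^'n"
  have G: "poly_growth G" unfolding poly_growth_def G_def norm_of_real
    using C0(1) by (intro exI[of _ C0] exI[of _ K0]) auto
  have wG: "smooth_weight \<epsilon> x \<le> cmod (G x)" if "0 < \<epsilon>" "\<epsilon> \<le> 1" for \<epsilon> x
    using C0(1) C0(2)[OF that, of x] unfolding G_def norm_of_real by (simp add: abs_of_nonneg)
  have sw_pos: "smooth_weight \<epsilon> x > 0" for \<epsilon> x by (simp add: smooth_weight_def)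
  have decay: "\<exists>C. \<forall>x. cmod (h x * of_real (E x * smooth_weight \<epsilon> x)) \<le> C * exp (- norm x)"
    if "0 < \<epsilon>" "\<epsilon> \<le> 1" "poly_growth h" for h \<epsilon>
  proof -
    note h = that
    obtain C where C: "\<And>x. cmod (h x * G x) * exp (- (norm x)\<^sup>2 / 2) \<le> C * exp (- norm x)"
      using poly_growth_gaussian_bound[OF poly_growth_mult[OF h(3) G]] by blast
    have "cmod (h x * of_real (E x * smooth_weight \<epsilon> x)) \<le> C * exp (- norm x)" for x
    proof -
      have "cmod (h x * of_real (E x * smooth_weight \<epsilon> x)) = (cmod (h x) * exp (- (norm x)\<^sup>2 / 2)) * smooth_weight \<epsilon> x"
        using sw_pos[of \<epsilon> x] by (simp add: norm_mult E_def)
      also have "\<dots> \<le> (cmod (h x) * exp (- (norm x)\<^sup>2 / 2)) * cmod (G x)"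
        by (intro mult_left_mono wG h) auto
      also have "\<dots> \<le> C * exp (- norm x)" using C[of x] by (simp add: norm_mult mult.commute mult.left_commute)
      finally show ?thesis .
    qed
    then show ?thesis by blast
  qed
  have integrable: "integrable lborel (\<lambda>x. h x * of_real (E x * smooth_weight \<epsilon> x))"
    if "0 < \<epsilon>" "\<epsilon> \<le> 1" "poly_growth h" "h \<in> borel_measurable borel" for h \<epsilon>
  proof -
    note h = that
    obtain C where "\<And>x. cmod (h x * of_real (E x * smooth_weight \<epsilon> x)) \<le> C * exp (- norm x)"
      using decay[OF h(1-3)] by blast
    moreover have "(\<lambda>x. h x * of_real (E x * smooth_weight \<epsilon> x)) \<in> borel_measurable borel"
    proof (rule borel_measurable_times[OF h(4)])
      have "(\<lambda>x. E x * smooth_weight \<epsilon> x) \<in> borel_measurable borel"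
        by (intro borel_measurable_times mE smooth_weight_measurable)
      then show "(\<lambda>x. complex_of_real (E x * smooth_weight \<epsilon> x)) \<in> borel_measurable borel"
        by (rule measurable_compose[OF _ borel_measurable_continuous_onI]) (intro continuous_intros)
    qed
    ultimately show ?thesis by (intro integrable_exp_decay[of _ C])
  qed
  define F where "F \<epsilon> x = B x + (\<Sum>\<alpha>\<in>P. of_real (2 * k \<alpha> * (\<alpha> \<bullet> \<xi>) * q \<epsilon> \<alpha> x) * A x)" for \<epsilon> x
  have Fg: "poly_growth (F \<epsilon>)" if "\<epsilon> > 0" for \<epsilon>
  proof -
    have "poly_growth (\<lambda>x. B x + (\<Sum>\<alpha>\<in>P. (of_real (2 * k \<alpha> * (\<alpha> \<bullet> \<xi>)) * of_real (q \<epsilon> \<alpha> x)) * A x))"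
      by (intro poly_growth_add poly_growth_sum poly_growth_mult poly_growth_const qgrowth that mA mB)
    then show ?thesis by (simp add: F_def[abs_def])
  qed
  have mF: "F \<epsilon> \<in> borel_measurable borel" for \<epsilon>
    unfolding F_def using mA(1) mB(1) by measurable
  \<comment> \<open>The directional derivative of \<open>A * E * smooth_weight \<epsilon>\<close> has integral 0, and \<open>q\<close> comes from the
    logarithmic derivative of \<open>smooth_weight\<close>.\<close>
  have step1: "(\<integral>x. F \<epsilon> x * of_real (E x * smooth_weight \<epsilon> x) \<partial>lborel) = 0" if "0 < \<epsilon>" "\<epsilon> \<le> 1" for \<epsilon>
  proof -
    note h = that
    obtain C where C: "\<And>x. cmod (A x * of_real (E x * smooth_weight \<epsilon> x)) \<le> C * exp (- norm x)"
      using decay[OF h mA(2)] by blast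
    obtain C' where C': "\<And>x. cmod (F \<epsilon> x * of_real (E x * smooth_weight \<epsilon> x)) \<le> C' * exp (- norm x)"
      using decay[OF h Fg[OF h(1)]] by blast
    show ?thesis
    proof (rule integral_dir_deriv_zero[where f = "\<lambda>x. A x * of_real (E x * smooth_weight \<epsilon> x)" and C = "max C C'" and \<xi> = \<xi>])
      show "(\<lambda>x. A x * of_real (E x * smooth_weight \<epsilon> x)) \<in> borel_measurable borel"
        "(\<lambda>x. F \<epsilon> x * of_real (E x * smooth_weight \<epsilon> x)) \<in> borel_measurable borel"
        using mA(1) mF by measurable
      show "cmod (A x * of_real (E x * smooth_weight \<epsilon> x)) \<le> max C C' * exp (- norm x)" for x
        by (rule order_trans[OF C]) (intro mult_right_mono; simp)
      show "cmod (F \<epsilon> x * of_real (E x * smooth_weight \<epsilon> x)) \<le> max C C' * exp (- norm x)" for x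
        by (rule order_trans[OF C']) (intro mult_right_mono; simp)
      show "norm \<xi> \<le> 1" by (simp add: \<xi>_def)
      fix x :: "real^'n"
      have pos: "(\<alpha> \<bullet> (x + 0 *\<^sub>R \<xi>))\<^sup>2 + \<epsilon> > 0" for \<alpha> using h by (simp add: add_nonneg_pos)
      have 1: "((\<lambda>t. E (x + t *\<^sub>R \<xi>) * smooth_weight \<epsilon> (x + t *\<^sub>R \<xi>)) has_real_derivative
          (- (x \<bullet> \<xi>) + (\<Sum>\<alpha>\<in>R. k \<alpha> * (\<alpha> \<bullet> \<xi>) * q \<epsilon> \<alpha> x)) * (E x * smooth_weight \<epsilon> x)) (at 0)"
      proof -
        have "((\<lambda>t. - ((x + t *\<^sub>R \<xi>) \<bullet> (x + t *\<^sub>R \<xi>)) / 2) has_real_derivative - (x \<bullet> \<xi>)) (at 0)"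
          by (auto intro!: derivative_eq_intros simp: inner_add_left inner_add_right inner_commute)
        moreover have "((\<lambda>t. \<Sum>\<alpha>\<in>R. k \<alpha> / 2 * ln ((\<alpha> \<bullet> (x + t *\<^sub>R \<xi>))\<^sup>2 + \<epsilon>)) has_real_derivative (\<Sum>\<alpha>\<in>R. k \<alpha> * (\<alpha> \<bullet> \<xi>) * q \<epsilon> \<alpha> x)) (at 0)"
        proof (rule DERIV_sum)
          fix \<alpha>
          have "((\<lambda>t. \<alpha> \<bullet> (x + t *\<^sub>R \<xi>)) has_real_derivative (\<alpha> \<bullet> \<xi>)) (at 0)"
            by (auto intro!: derivative_eq_intros simp: inner_add_right)
          then show "((\<lambda>t. k \<alpha> / 2 * ln ((\<alpha> \<bullet> (x + t *\<^sub>R \<xi>))\<^sup>2 + \<epsilon>)) has_real_derivative k \<alpha> * (\<alpha> \<bullet> \<xi>) * q \<epsilon> \<alpha> x) (at 0)"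
            using pos[of \<alpha>] by (auto intro!: derivative_eq_intros simp: q_def divide_simps)
        qed
        ultimately have "((\<lambda>t. exp (- ((x + t *\<^sub>R \<xi>) \<bullet> (x + t *\<^sub>R \<xi>)) / 2 + (\<Sum>\<alpha>\<in>R. k \<alpha> / 2 * ln ((\<alpha> \<bullet> (x + t *\<^sub>R \<xi>))\<^sup>2 + \<epsilon>)))) has_real_derivative
          exp (- ((x + 0 *\<^sub>R \<xi>) \<bullet> (x + 0 *\<^sub>R \<xi>)) / 2 + (\<Sum>\<alpha>\<in>R. k \<alpha> / 2 * ln ((\<alpha> \<bullet> (x + 0 *\<^sub>R \<xi>))\<^sup>2 + \<epsilon>))) * (- (x \<bullet> \<xi>) + (\<Sum>\<alpha>\<in>R. k \<alpha> * (\<alpha> \<bullet> \<xi>) * q \<epsilon> \<alpha> x))) (at 0)"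
          by (intro DERIV_fun_exp DERIV_add)
        then show ?thesis
          by (simp only: E_def smooth_weight_def power2_norm_eq_inner exp_add[symmetric] scaleR_zero_left add_0_right mult.commute)
      qed
      have 2: "((\<lambda>t. A (x + t *\<^sub>R \<xi>)) has_vector_derivative dir_deriv \<xi> A x) (at 0)"
      proof -
        have "((\<lambda>t. A (x + t *\<^sub>R \<xi>)) has_derivative (\<lambda>h. dir_deriv (h *\<^sub>R \<xi>) A x)) (at 0)"
          by (rule has_derivative_compose[of "\<lambda>t. x + t *\<^sub>R \<xi>" "\<lambda>h. h *\<^sub>R \<xi>" 0 UNIV A "\<lambda>\<eta>. dir_deriv \<eta> A x"])
            (use has_derivative_dir_deriv[OF differentiable_polynomial[OF A]] in \<open>auto intro!: derivative_eq_intros\<close>)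
        moreover have "dir_deriv (h *\<^sub>R \<xi>) A x = h *\<^sub>R dir_deriv \<xi> A x" for h
          using has_derivative_dir_deriv[OF differentiable_polynomial[OF A], THEN has_derivative_linear] by (rule linear_cmul)
        ultimately show ?thesis by (simp add: has_vector_derivative_def)
      qed
      have sumR: "(\<Sum>\<alpha>\<in>R. k \<alpha> * (\<alpha> \<bullet> \<xi>) * q \<epsilon> \<alpha> x) = 2 * (\<Sum>\<alpha>\<in>P. k \<alpha> * (\<alpha> \<bullet> \<xi>) * q \<epsilon> \<alpha> x)"
        by (rule sum_R_even) (simp add: k_uminus q_def)
      have "((\<lambda>t. A (x + t *\<^sub>R \<xi>) * of_real (E (x + t *\<^sub>R \<xi>) * smooth_weight \<epsilon> (x + t *\<^sub>R \<xi>))) has_vector_derivative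
         A (x + 0 *\<^sub>R \<xi>) * of_real ((- (x \<bullet> \<xi>) + (\<Sum>\<alpha>\<in>R. k \<alpha> * (\<alpha> \<bullet> \<xi>) * q \<epsilon> \<alpha> x)) * (E x * smooth_weight \<epsilon> x))
         + dir_deriv \<xi> A x * of_real (E (x + 0 *\<^sub>R \<xi>) * smooth_weight \<epsilon> (x + 0 *\<^sub>R \<xi>))) (at 0)"
        by (intro has_vector_derivative_mult 2 has_vector_derivative_of_real 1)
      moreover have "A (x + 0 *\<^sub>R \<xi>) * of_real ((- (x \<bullet> \<xi>) + (\<Sum>\<alpha>\<in>R. k \<alpha> * (\<alpha> \<bullet> \<xi>) * q \<epsilon> \<alpha> x)) * (E x * smooth_weight \<epsilon> x))
         + dir_deriv \<xi> A x * of_real (E (x + 0 *\<^sub>R \<xi>) * smooth_weight \<epsilon> (x + 0 *\<^sub>R \<xi>))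
         = F \<epsilon> x * of_real (E x * smooth_weight \<epsilon> x)"
        unfolding sumR F_def B_def
        by (simp add: algebra_simps sum_distrib_left sum_distrib_right)
      ultimately show "((\<lambda>t. A (x + t *\<^sub>R \<xi>) * of_real (E (x + t *\<^sub>R \<xi>) * smooth_weight \<epsilon> (x + t *\<^sub>R \<xi>))) has_vector_derivative
         F \<epsilon> x * of_real (E x * smooth_weight \<epsilon> x)) (at 0)" by simp
    qed
  qed
  define H where "H \<epsilon> x = B x + (\<Sum>\<alpha>\<in>P. of_real (k \<alpha> * (\<alpha> \<bullet> \<xi>)) * (of_real (q \<epsilon> \<alpha> x) * (A x - A (refl_along \<alpha> x))))" for \<epsilon> x
  have Ar: "A \<circ> refl_along \<alpha> \<in> borel_measurable borel" "poly_growth (\<lambda>x. A (refl_along \<alpha> x))" for \<alpha>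
    using polynomial_measurable[OF polynomial_function_refl_along[OF A]] poly_growth_polynomial[OF polynomial_function_refl_along[OF A]]
    by (auto simp: o_def)
  have mAr [measurable]: "(\<lambda>x. A (refl_along \<alpha> x)) \<in> borel_measurable borel" for \<alpha> using Ar(1) by (simp add: o_def)
  note [measurable] = mA(1) mB(1)
  \<comment> \<open>As \<open>q \<epsilon> \<alpha>\<close> is odd under the reflection, \<open>2 A\<close> may be replaced by \<open>A - A \<circ> refl_along \<alpha>\<close>; this cancels
    the singularity of \<open>q \<epsilon> \<alpha>\<close> that appears on the hyperplane as \<open>\<epsilon>\<close> tends to 0.\<close>
  have step2: "(\<integral>x. H \<epsilon> x * of_real (E x * smooth_weight \<epsilon> x) \<partial>lborel) = 0" if "0 < \<epsilon>" "\<epsilon> \<le> 1" for \<epsilon>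
  proof -
    let ?w = "\<lambda>x. complex_of_real (E x * smooth_weight \<epsilon> x)"
    have i0: "integrable lborel (\<lambda>x. B x * ?w x)" by (intro integrable that mB)
    have i1: "integrable lborel (\<lambda>x. (of_real (q \<epsilon> \<alpha> x) * A x) * ?w x)" for \<alpha>
      by (intro integrable that poly_growth_mult qgrowth mA) measurable
    have i2: "integrable lborel (\<lambda>x. (of_real (q \<epsilon> \<alpha> x) * A (refl_along \<alpha> x)) * ?w x)" for \<alpha>
      by (intro integrable that poly_growth_mult qgrowth Ar) measurable
    have sym: "(\<integral>x. (of_real (q \<epsilon> \<alpha> x) * A (refl_along \<alpha> x)) * ?w x \<partial>lborel) = - (\<integral>x. (of_real (q \<epsilon> \<alpha> x) * A x) * ?w x \<partial>lborel)" if "\<alpha> \<in> P" for \<alpha>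
    proof -
      have \<alpha>: "\<alpha> \<in> R" "\<alpha> \<noteq> 0" using that P_subset_R R_nonzero by auto
      have "(\<integral>x. (of_real (q \<epsilon> \<alpha> x) * A x) * ?w x \<partial>lborel)
         = (\<integral>x. (of_real (q \<epsilon> \<alpha> (refl_along \<alpha> x)) * A (refl_along \<alpha> x)) * ?w (refl_along \<alpha> x) \<partial>lborel)"
        by (rule integral_refl_along[OF \<alpha>(2), symmetric]) measurable
      also have "\<dots> = (\<integral>x. - ((of_real (q \<epsilon> \<alpha> x) * A (refl_along \<alpha> x)) * ?w x) \<partial>lborel)"
        by (intro Bochner_Integration.integral_cong refl)
          (simp add: q_def E_def inner_refl_along[OF \<alpha>(2)] norm_refl_along[OF \<alpha>(2)] smooth_weight_refl[OF \<alpha>(1)])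
      finally show ?thesis by simp
    qed
    have "(\<integral>x. H \<epsilon> x * ?w x \<partial>lborel) = (\<integral>x. B x * ?w x + (\<Sum>\<alpha>\<in>P. of_real (k \<alpha> * (\<alpha> \<bullet> \<xi>)) *
        ((of_real (q \<epsilon> \<alpha> x) * A x) * ?w x - (of_real (q \<epsilon> \<alpha> x) * A (refl_along \<alpha> x)) * ?w x)) \<partial>lborel)"
      unfolding H_def by (simp add: distrib_right sum_distrib_right sum_distrib_left algebra_simps)
    also have "\<dots> = (\<integral>x. B x * ?w x \<partial>lborel) + (\<Sum>\<alpha>\<in>P. of_real (k \<alpha> * (\<alpha> \<bullet> \<xi>)) *
        ((\<integral>x. (of_real (q \<epsilon> \<alpha> x) * A x) * ?w x \<partial>lborel) - (\<integral>x. (of_real (q \<epsilon> \<alpha> x) * A (refl_along \<alpha> x)) * ?w x \<partial>lborel)))"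
      using i0 i1 i2 by (simp add: Bochner_Integration.integral_add Bochner_Integration.integral_sum Bochner_Integration.integral_diff)
    also have "\<dots> = (\<integral>x. B x * ?w x \<partial>lborel) + (\<Sum>\<alpha>\<in>P. of_real (2 * k \<alpha> * (\<alpha> \<bullet> \<xi>)) * (\<integral>x. (of_real (q \<epsilon> \<alpha> x) * A x) * ?w x \<partial>lborel))"
      by (intro arg_cong2[where f = "(+)"] sum.cong refl) (simp only: sym, simp)
    also have "\<dots> = (\<integral>x. B x * ?w x + (\<Sum>\<alpha>\<in>P. of_real (2 * k \<alpha> * (\<alpha> \<bullet> \<xi>)) * ((of_real (q \<epsilon> \<alpha> x) * A x) * ?w x)) \<partial>lborel)"
      using i0 i1 by (simp add: Bochner_Integration.integral_add Bochner_Integration.integral_sum)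
    also have "\<dots> = (\<integral>x. F \<epsilon> x * ?w x \<partial>lborel)"
      unfolding F_def by (simp add: distrib_right sum_distrib_right sum_distrib_left algebra_simps)
    finally show ?thesis using step1[OF that] by simp
  qed
  define H0 where "H0 x = B x + (\<Sum>\<alpha>\<in>P. of_real (k \<alpha> * (\<alpha> \<bullet> \<xi>)) * refl_quotient \<alpha> A x)" for x
  have rq: "refl_quotient \<alpha> A \<in> borel_measurable borel" "poly_growth (refl_quotient \<alpha> A)" for \<alpha>
    using polynomial_measurable[OF polynomial_refl_quotient[OF A]] poly_growth_polynomial[OF polynomial_refl_quotient[OF A]] by auto
  note [measurable] = rq(1)
  have Hq: "H \<epsilon> x = B x + (\<Sum>\<alpha>\<in>P. of_real (k \<alpha> * (\<alpha> \<bullet> \<xi>)) * (of_real (q \<epsilon> \<alpha> x * (\<alpha> \<bullet> x)) * refl_quotient \<alpha> A x))" for \<epsilon> x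
    unfolding H_def by (simp flip: refl_quotient_mult_inner add: mult.assoc)
  define D where "D x = complex_of_real (cmod (B x)) + (\<Sum>\<alpha>\<in>P. of_real (cmod (of_real (k \<alpha> * (\<alpha> \<bullet> \<xi>)) * refl_quotient \<alpha> A x)))" for x
  have D: "poly_growth D"
    unfolding D_def
    by (intro poly_growth_add poly_growth_sum poly_growth_mono[OF mB(2)] poly_growth_mono[OF poly_growth_mult[OF poly_growth_const rq(2)]]) auto
  obtain C where C: "\<And>x. cmod (D x * G x) * exp (- (norm x)\<^sup>2 / 2) \<le> C * exp (- norm x)"
    using poly_growth_gaussian_bound[OF poly_growth_mult[OF D G]] by blast
  have "(\<lambda>n. \<integral>x. H (\<epsilon> n) x * of_real (E x * smooth_weight (\<epsilon> n) x) \<partial>lborel) \<longlonglongrightarrow> (\<integral>x. H0 x * of_real (E x * weight x) \<partial>lborel)"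
  proof (rule integral_dominated_convergence)
    show "(\<lambda>x. H0 x * of_real (E x * weight x)) \<in> borel_measurable lborel" unfolding H0_def by measurable
    show "(\<lambda>x. H (\<epsilon> n) x * of_real (E x * smooth_weight (\<epsilon> n) x)) \<in> borel_measurable lborel" for n unfolding H_def by measurable
    show "integrable lborel (\<lambda>x::real^'n. C * exp (- norm x))" by (intro integrable_mult_right integrable_exp_norm)
    show "AE x in lborel. cmod (H (\<epsilon> n) x * of_real (E x * smooth_weight (\<epsilon> n) x)) \<le> C * exp (- norm x)" for n
    proof (rule AE_I2)
      fix x :: "real^'n"
      have q1: "\<bar>q (\<epsilon> n) \<alpha> x * (\<alpha> \<bullet> x)\<bar> \<le> 1" for \<alpha>
      proof -
        have "q (\<epsilon> n) \<alpha> x * (\<alpha> \<bullet> x) = (\<alpha> \<bullet> x)\<^sup>2 / ((\<alpha> \<bullet> x)\<^sup>2 + \<epsilon> n)" by (simp add: q_def power2_eq_square)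
        moreover have "0 \<le> (\<alpha> \<bullet> x)\<^sup>2 / ((\<alpha> \<bullet> x)\<^sup>2 + \<epsilon> n)" "(\<alpha> \<bullet> x)\<^sup>2 / ((\<alpha> \<bullet> x)\<^sup>2 + \<epsilon> n) \<le> 1"
          using \<epsilon>(1)[of n] by (auto simp: divide_le_eq add_nonneg_pos intro!: divide_nonneg_nonneg)
        ultimately show ?thesis by (simp only: abs_of_nonneg)
      qed
      have "cmod (H (\<epsilon> n) x) \<le> cmod (B x) + (\<Sum>\<alpha>\<in>P. cmod (of_real (k \<alpha> * (\<alpha> \<bullet> \<xi>)) * (of_real (q (\<epsilon> n) \<alpha> x * (\<alpha> \<bullet> x)) * refl_quotient \<alpha> A x)))"
        unfolding Hq by (rule order_trans[OF norm_triangle_ineq add_left_mono[OF norm_sum]])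
      also have "\<dots> \<le> cmod (B x) + (\<Sum>\<alpha>\<in>P. cmod (of_real (k \<alpha> * (\<alpha> \<bullet> \<xi>)) * refl_quotient \<alpha> A x))"
      proof (intro add_left_mono sum_mono)
        fix \<alpha>
        have "cmod (of_real (k \<alpha> * (\<alpha> \<bullet> \<xi>)) * (of_real (q (\<epsilon> n) \<alpha> x * (\<alpha> \<bullet> x)) * refl_quotient \<alpha> A x))
          = \<bar>q (\<epsilon> n) \<alpha> x * (\<alpha> \<bullet> x)\<bar> * cmod (of_real (k \<alpha> * (\<alpha> \<bullet> \<xi>)) * refl_quotient \<alpha> A x)"
          by (simp only: norm_mult norm_of_real mult.left_commute)
        also have "\<dots> \<le> 1 * cmod (of_real (k \<alpha> * (\<alpha> \<bullet> \<xi>)) * refl_quotient \<alpha> A x)" by (intro mult_right_mono q1) simp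
        finally show "cmod (of_real (k \<alpha> * (\<alpha> \<bullet> \<xi>)) * (of_real (q (\<epsilon> n) \<alpha> x * (\<alpha> \<bullet> x)) * refl_quotient \<alpha> A x))
          \<le> cmod (of_real (k \<alpha> * (\<alpha> \<bullet> \<xi>)) * refl_quotient \<alpha> A x)" by simp
      qed
      also have "\<dots> = cmod (D x)"
      proof -
        have "D x = complex_of_real (cmod (B x) + (\<Sum>\<alpha>\<in>P. cmod (of_real (k \<alpha> * (\<alpha> \<bullet> \<xi>)) * refl_quotient \<alpha> A x)))"
          unfolding D_def by (simp only: of_real_add of_real_sum)
        then show ?thesis by (simp only: norm_of_real abs_of_nonneg add_nonneg_nonneg sum_nonneg norm_ge_zero)
      qed
      finally have HD: "cmod (H (\<epsilon> n) x) \<le> cmod (D x)" .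
      have "cmod (H (\<epsilon> n) x * of_real (E x * smooth_weight (\<epsilon> n) x)) = cmod (H (\<epsilon> n) x) * E x * smooth_weight (\<epsilon> n) x"
        using sw_pos[of "\<epsilon> n" x] by (simp add: norm_mult E_def)
      also have "\<dots> \<le> cmod (D x) * E x * cmod (G x)"
        by (intro mult_mono HD wG \<epsilon> mult_nonneg_nonneg) (auto simp: E_def less_imp_le[OF sw_pos])
      also have "\<dots> \<le> C * exp (- norm x)" using C[of x] by (simp add: norm_mult E_def mult.commute mult.left_commute)
      finally show "cmod (H (\<epsilon> n) x * of_real (E x * smooth_weight (\<epsilon> n) x)) \<le> C * exp (- norm x)" .
    qed
    show "AE x in lborel. (\<lambda>n. H (\<epsilon> n) x * of_real (E x * smooth_weight (\<epsilon> n) x)) \<longlonglongrightarrow> H0 x * of_real (E x * weight x)"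
      using AE_off_hyperplanes
    proof eventually_elim
      case (elim x)
      have \<epsilon>0: "\<epsilon> \<longlonglongrightarrow> 0" unfolding \<epsilon>_def by (rule LIMSEQ_inverse_real_of_nat)
      have "(\<lambda>n. q (\<epsilon> n) \<alpha> x * (\<alpha> \<bullet> x)) \<longlonglongrightarrow> 1" if "\<alpha> \<in> P" for \<alpha>
      proof -
        have nz: "\<alpha> \<bullet> x \<noteq> 0" using elim that P_subset_R by auto
        then have "(\<lambda>n. q (\<epsilon> n) \<alpha> x * (\<alpha> \<bullet> x)) \<longlonglongrightarrow> (\<alpha> \<bullet> x) / ((\<alpha> \<bullet> x)\<^sup>2 + 0) * (\<alpha> \<bullet> x)"
          unfolding q_def by (intro tendsto_intros \<epsilon>0) auto
        then show ?thesis using nz by (simp add: power2_eq_square)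
      qed
      then have "(\<lambda>n. H (\<epsilon> n) x) \<longlonglongrightarrow> B x + (\<Sum>\<alpha>\<in>P. of_real (k \<alpha> * (\<alpha> \<bullet> \<xi>)) * (of_real 1 * refl_quotient \<alpha> A x))"
        unfolding Hq by (intro tendsto_add tendsto_const tendsto_sum tendsto_mult tendsto_of_real)
      then have "(\<lambda>n. H (\<epsilon> n) x) \<longlonglongrightarrow> H0 x" by (simp add: H0_def)
      moreover have "(\<lambda>n. smooth_weight (\<epsilon> n) x) \<longlonglongrightarrow> weight x" by (rule smooth_weight_tendsto[OF _ \<epsilon>0]) (use elim in auto)
      ultimately show ?case by (intro tendsto_mult tendsto_of_real tendsto_const)
    qed
  qed
  then have "(\<integral>x. H0 x * of_real (E x * weight x) \<partial>lborel) = 0"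
    using step2 \<epsilon> by (simp add: LIMSEQ_const_iff)
  moreover have "H0 x = dunkl_op P k (axis j 1) A x - of_real (x $ j) * A x" for x
    by (simp add: H0_def B_def dunkl_op_def \<xi>_def inner_axis)
  ultimately show ?thesis by (simp add: gaussian_pairing_def E_def)
qed

lemma gaussian_pairing_add:
  assumes "polynomial_function p" "polynomial_function q"
  shows "gaussian_pairing (\<lambda>x. p x + q x) = gaussian_pairing p + gaussian_pairing q"
  unfolding gaussian_pairing_def distrib_right
  by (intro Bochner_Integration.integral_add gaussian_integrable polynomial_measurable poly_growth_polynomial assms)

lemma gaussian_pairing_cmult: "gaussian_pairing (\<lambda>x. c * p x) = c * gaussian_pairing p"
  unfolding gaussian_pairing_def by (simp add: mult.assoc)

lemma gaussian_pairing_diff: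
  assumes "polynomial_function p" "polynomial_function q"
  shows "gaussian_pairing (\<lambda>x. p x - q x) = gaussian_pairing p - gaussian_pairing q"
  unfolding gaussian_pairing_def left_diff_distrib
  by (intro Bochner_Integration.integral_diff gaussian_integrable polynomial_measurable poly_growth_polynomial assms)

lemma gaussian_pairing_sum:
  assumes "\<And>i. i \<in> S \<Longrightarrow> polynomial_function (p i)" "finite S"
  shows "gaussian_pairing (\<lambda>x. \<Sum>i\<in>S. p i x) = (\<Sum>i\<in>S. gaussian_pairing (p i))"
  using assms(2,1)
proof (induction S)
  case empty show ?case by (simp add: gaussian_pairing_def)
next
  case (insert i S)
  then show ?case by (simp add: gaussian_pairing_add polynomial_function_sum)
qed

lemma weight_refl:
  assumes "\<alpha> \<in> R"
  shows "weight (refl_along \<alpha> x) = weight x"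
proof -
  have inj: "inj_on (refl_along \<alpha>) R" by (rule inj_on_inverseI[of _ "refl_along \<alpha>"]) (simp add: refl_along_invol R_nonzero assms)
  have "weight x = (\<Prod>\<beta>\<in>refl_along \<alpha> ` R. \<bar>\<beta> \<bullet> x\<bar> powr k \<beta>)" by (simp add: weight_def refl_image[OF assms])
  also have "\<dots> = (\<Prod>\<beta>\<in>R. \<bar>refl_along \<alpha> \<beta> \<bullet> x\<bar> powr k (refl_along \<alpha> \<beta>))" using inj by (simp add: prod.reindex)
  also have "\<dots> = weight (refl_along \<alpha> x)" unfolding weight_def
  proof (rule prod.cong)
    fix \<beta> assume "\<beta> \<in> R"
    have "refl_along \<alpha> \<beta> \<bullet> x = refl_along \<alpha> \<beta> \<bullet> refl_along \<alpha> (refl_along \<alpha> x)"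
      by (simp add: refl_along_invol R_nonzero[OF assms])
    also have "\<dots> = \<beta> \<bullet> refl_along \<alpha> x" by (rule refl_along_inner[OF R_nonzero[OF assms]])
    finally show "\<bar>refl_along \<alpha> \<beta> \<bullet> x\<bar> powr k (refl_along \<alpha> \<beta>) = \<bar>\<beta> \<bullet> refl_along \<alpha> x\<bar> powr k \<beta>"
      using k_refl[OF assms \<open>\<beta> \<in> R\<close>] by simp
  qed simp
  finally show ?thesis by simp
qed

text \<open>The defect of the Leibniz rule for \<open>refl_quotient\<close> is odd under the reflection, so it does not
  contribute and \<open>x\<^sub>j - T\<^sub>j\<close> is the adjoint of \<open>T\<^sub>j\<close> for the Gaussian pairing.\<close>

lemma gaussian_pairing_adjoint:
  assumes p: "polynomial_function p" and q: "polynomial_function q"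
  shows "gaussian_pairing (\<lambda>x. dunkl_op P k (axis j 1) p x * q x)
    = gaussian_pairing (\<lambda>x. p x * (of_real (x $ j) * q x - dunkl_op P k (axis j 1) q x))"
proof -
  let ?T = "dunkl_op P k (axis j 1)"
  let ?rq = refl_quotient
  note poly = polynomial_function_mult_complex polynomial_function_add polynomial_dunkl_op polynomial_function_const
    polynomial_refl_quotient polynomial_function_coordinate
  have d: "p differentiable at x" "q differentiable at x" for x using p q differentiable_polynomial by auto
  have odd: "gaussian_pairing (\<lambda>x. (p x - p (refl_along \<alpha> x)) * ?rq \<alpha> q x) = 0" if "\<alpha> \<in> P" for \<alpha>
  proof -
    have \<alpha>: "\<alpha> \<in> R" "\<alpha> \<noteq> 0" using that P_subset_R R_nonzero by auto
    have r: "?rq \<alpha> q (refl_along \<alpha> x) = ?rq \<alpha> q x" for x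
    proof (cases "\<alpha> \<bullet> x = 0")
      case True then show ?thesis by (simp add: refl_along_orthogonal)
    next
      case False
      then show ?thesis
        by (simp add: refl_quotient_def inner_refl_along[OF \<alpha>(2)] refl_along_invol[OF \<alpha>(2)] field_simps)
    qed
    let ?f = "\<lambda>x. (p x - p (refl_along \<alpha> x)) * ?rq \<alpha> q x * of_real (exp (- (norm x)\<^sup>2 / 2) * weight x)"
    have "(\<integral>x. ?f x \<partial>lborel) = (\<integral>x. ?f (refl_along \<alpha> x) \<partial>lborel)"
    proof (rule integral_refl_along[OF \<alpha>(2), symmetric])
      note [measurable] = polynomial_measurable[OF p] polynomial_measurable[OF polynomial_function_refl_along[OF p]]
        polynomial_measurable[OF polynomial_refl_quotient[OF q]]
      show "?f \<in> borel_measurable borel" by measurable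
    qed
    also have "\<dots> = (\<integral>x. - ?f x \<partial>lborel)"
      by (intro Bochner_Integration.integral_cong refl)
        (simp add: r refl_along_invol[OF \<alpha>(2)] norm_refl_along[OF \<alpha>(2)] weight_refl[OF \<alpha>(1)] algebra_simps)
    finally have "(\<integral>x. ?f x \<partial>lborel) = - (\<integral>x. ?f x \<partial>lborel)" by simp
    then show ?thesis by (simp add: gaussian_pairing_def)
  qed
  have leibniz: "?T p x * q x + p x * ?T q x = ?T (\<lambda>x. q x * p x) x
      + (\<Sum>\<alpha>\<in>P. of_real (k \<alpha> * (\<alpha> \<bullet> axis j 1)) * ((p x - p (refl_along \<alpha> x)) * ?rq \<alpha> q x))" for x
    unfolding dunkl_op_def dir_deriv_mult[OF d(2) d(1)] refl_quotient_mult[OF d(2) d(1)]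
    by (simp add: algebra_simps sum.distrib sum_distrib_left sum_subtractf)
  have pd: "polynomial_function (\<lambda>x. (p x - p (refl_along \<alpha> x)) * ?rq \<alpha> q x)" for \<alpha>
    by (intro polynomial_function_mult_complex polynomial_function_diff p q polynomial_function_refl_along polynomial_refl_quotient)
  have pqp: "polynomial_function (\<lambda>x. q x * p x)" by (intro poly p q)
  have "gaussian_pairing (\<lambda>x. ?T p x * q x + p x * ?T q x) = gaussian_pairing (?T (\<lambda>x. q x * p x))
      + (\<Sum>\<alpha>\<in>P. of_real (k \<alpha> * (\<alpha> \<bullet> axis j 1)) * gaussian_pairing (\<lambda>x. (p x - p (refl_along \<alpha> x)) * ?rq \<alpha> q x))"
  proof -
    have cpd: "polynomial_function (\<lambda>x. of_real (k \<alpha> * (\<alpha> \<bullet> axis j 1)) * ((p x - p (refl_along \<alpha> x)) * ?rq \<alpha> q x))" for \<alpha>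
      by (intro poly pd)
    have "gaussian_pairing (\<lambda>x. ?T p x * q x + p x * ?T q x) = gaussian_pairing (?T (\<lambda>x. q x * p x))
      + gaussian_pairing (\<lambda>x. \<Sum>\<alpha>\<in>P. of_real (k \<alpha> * (\<alpha> \<bullet> axis j 1)) * ((p x - p (refl_along \<alpha> x)) * ?rq \<alpha> q x))"
      unfolding leibniz
      by (rule gaussian_pairing_add) (intro poly pqp polynomial_function_sum finite_P cpd)+
    then show ?thesis by (simp only: gaussian_pairing_sum[OF cpd finite_P] gaussian_pairing_cmult)
  qed
  also have "\<dots> = gaussian_pairing (?T (\<lambda>x. q x * p x))" by (simp add: odd)
  also have "\<dots> = gaussian_pairing (\<lambda>x. of_real (x $ j) * (q x * p x))"
    using gaussian_pairing_dunkl_op[OF pqp, of j]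
    by (subst (asm) gaussian_pairing_diff) (auto intro!: poly pqp finite_P p q)
  finally have 1: "gaussian_pairing (\<lambda>x. ?T p x * q x + p x * ?T q x) = gaussian_pairing (\<lambda>x. of_real (x $ j) * (q x * p x))" .
  have 2: "gaussian_pairing (\<lambda>x. ?T p x * q x) + gaussian_pairing (\<lambda>x. p x * ?T q x) = gaussian_pairing (\<lambda>x. of_real (x $ j) * (q x * p x))"
    unfolding 1[symmetric] by (rule gaussian_pairing_add[symmetric]) (intro poly p q finite_P)+
  have 3: "gaussian_pairing (\<lambda>x. p x * (of_real (x $ j) * q x - ?T q x))
    = gaussian_pairing (\<lambda>x. of_real (x $ j) * (q x * p x)) - gaussian_pairing (\<lambda>x. p x * ?T q x)"
  proof -
    have "(\<lambda>x. p x * (of_real (x $ j) * q x - ?T q x)) = (\<lambda>x. of_real (x $ j) * (q x * p x) - p x * ?T q x)"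
      by (auto simp: algebra_simps)
    then show ?thesis by (simp only:) (rule gaussian_pairing_diff; intro poly p q finite_P)
  qed
  show ?thesis unfolding 3 eq_diff_eq by (rule 2)
qed

text \<open>With \<open>A\<^sub>j = T\<^sub>j\<close> and its adjoint \<open>x\<^sub>j - T\<^sub>j\<close>, the sum over \<open>j\<close> of the anticommutators is symmetric and equals
  \<open>2 E + N + 2 sum k P - 2 \<Delta>\<close> with the Euler operator \<open>E\<close>; on harmonics of degree \<open>m\<close> it is the scalar
  \<open>2 m + N + 2 sum k P\<close>.\<close>

lemma gaussian_harmonics_orthogonal:
  assumes p: "p \<in> dunkl_harmonics P k m" and q: "q \<in> dunkl_harmonics P k n" and "m \<noteq> n"
  shows "gaussian_pairing (\<lambda>x. p x * q x) = 0"
proof -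
  let ?T = "\<lambda>j. dunkl_op P k (axis j 1)"
  let ?x = "\<lambda>j (x::real^'n). complex_of_real (x $ j)"
  note poly = polynomial_function_mult_complex polynomial_function_add polynomial_dunkl_op polynomial_function_const
    polynomial_function_coordinate polynomial_function_diff finite_P
  define S where "S p q = (\<Sum>j\<in>UNIV. gaussian_pairing (\<lambda>x. ?T j p x * ?T j q x)
      + gaussian_pairing (\<lambda>x. (?x j x * p x - ?T j p x) * (?x j x * q x - ?T j q x)))" for p q
  have key: "S p q = of_real (2 * real n + real CARD('n) + 2 * sum k P) * gaussian_pairing (\<lambda>x. p x * q x)"
    if p: "p \<in> dunkl_harmonics P k m" and q: "q \<in> dunkl_harmonics P k n" for p q m n
  proof -
    have pp: "polynomial_function p" using p by (simp add: dunkl_harmonics_def)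
    have qp: "polynomial_function q" and q0: "\<And>x. dunkl_laplacian P k q x = 0"
      and qh: "\<And>t x. q (t *\<^sub>R x) = of_real (t ^ n) * q x" using q by (auto simp: dunkl_harmonics_def)
    have Tq: "polynomial_function (?T j q)" for j by (intro poly qp)
    have xTq: "polynomial_function (\<lambda>x. ?x j x * q x - ?T j q x)" for j by (intro poly qp)
    have "gaussian_pairing (\<lambda>x. ?T j p x * ?T j q x) = gaussian_pairing (\<lambda>x. p x * (?x j x * ?T j q x - ?T j (?T j q) x))" for j
      by (rule gaussian_pairing_adjoint[OF pp Tq])
    moreover have "gaussian_pairing (\<lambda>x. (?x j x * p x - ?T j p x) * (?x j x * q x - ?T j q x))
       = gaussian_pairing (\<lambda>x. p x * ?T j (\<lambda>x. ?x j x * q x - ?T j q x) x)" for j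
      using gaussian_pairing_adjoint[OF xTq pp, of j j] by (simp add: mult.commute)
    moreover have "?T j (\<lambda>x. ?x j x * q x - ?T j q x) x = ?T j (\<lambda>x. ?x j x * q x) x - ?T j (?T j q) x" for j x
    proof -
      have "?T j (\<lambda>x. ?x j x * q x + (-1) * ?T j q x) x = ?T j (\<lambda>x. ?x j x * q x) x + ?T j (\<lambda>x. (-1) * ?T j q x) x"
        by (intro dunkl_op_add differentiable_polynomial poly qp)
      also have "?T j (\<lambda>x. (-1) * ?T j q x) x = (-1) * ?T j (?T j q) x" by (intro dunkl_op_cmult differentiable_polynomial Tq)
      finally show ?thesis by simp
    qed
    ultimately have "S p q = (\<Sum>j\<in>UNIV. gaussian_pairing (\<lambda>x. p x * (?x j x * ?T j q x - ?T j (?T j q) x))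
       + gaussian_pairing (\<lambda>x. p x * (?T j (\<lambda>x. ?x j x * q x) x - ?T j (?T j q) x)))"
      unfolding S_def by simp
    also have "\<dots> = (\<Sum>j\<in>UNIV. gaussian_pairing (\<lambda>x. p x * (?x j x * ?T j q x - ?T j (?T j q) x) + p x * (?T j (\<lambda>x. ?x j x * q x) x - ?T j (?T j q) x)))"
      by (intro sum.cong refl gaussian_pairing_add[symmetric] poly pp qp Tq)
    also have "\<dots> = gaussian_pairing (\<lambda>x. \<Sum>j\<in>UNIV. p x * (?x j x * ?T j q x - ?T j (?T j q) x) + p x * (?T j (\<lambda>x. ?x j x * q x) x - ?T j (?T j q) x))"
      by (intro gaussian_pairing_sum[symmetric] poly pp qp Tq finite)
    also have "\<dots> = gaussian_pairing (\<lambda>x. of_real (2 * real n + real CARD('n) + 2 * sum k P) * (p x * q x))"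
    proof (rule arg_cong[where f = gaussian_pairing], rule ext)
      fix x
      have "(\<Sum>j\<in>UNIV. p x * (?x j x * ?T j q x - ?T j (?T j q) x) + p x * (?T j (\<lambda>x. ?x j x * q x) x - ?T j (?T j q) x))
        = p x * ((\<Sum>j\<in>UNIV. ?x j x * ?T j q x + ?T j (\<lambda>x. ?x j x * q x) x) - 2 * dunkl_laplacian P k q x)"
        unfolding dunkl_laplacian_def by (simp add: sum_distrib_left sum_subtractf sum.distrib algebra_simps)
      also have "\<dots> = of_real (2 * real n + real CARD('n) + 2 * sum k P) * (p x * q x)"
        unfolding dunkl_coordinate_anticommutator[OF differentiable_polynomial[OF qp] zero_notin_P]
          dir_deriv_homogeneous[OF qp qh] q0 by (simp add: algebra_simps)
      finally show "(\<Sum>j\<in>UNIV. p x * (?x j x * ?T j q x - ?T j (?T j q) x) + p x * (?T j (\<lambda>x. ?x j x * q x) x - ?T j (?T j q) x))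
        = of_real (2 * real n + real CARD('n) + 2 * sum k P) * (p x * q x)" .
    qed
    finally show ?thesis by (simp only: gaussian_pairing_cmult)
  qed
  have "S p q = S q p" unfolding S_def by (simp add: mult.commute)
  then have "complex_of_real (2 * real n + real CARD('n) + 2 * sum k P) * gaussian_pairing (\<lambda>x. p x * q x)
     = of_real (2 * real m + real CARD('n) + 2 * sum k P) * gaussian_pairing (\<lambda>x. p x * q x)"
    using key[OF p q] key[OF q p] by (simp add: mult.commute)
  then have "gaussian_pairing (\<lambda>x. p x * q x) = 0 \<or>
      complex_of_real (2 * real n + real CARD('n) + 2 * sum k P) = of_real (2 * real m + real CARD('n) + 2 * sum k P)"
    by (simp only: mult_cancel_right)
  moreover have "complex_of_real (2 * real n + real CARD('n) + 2 * sum k P) \<noteq> of_real (2 * real m + real CARD('n) + 2 * sum k P)"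
    using \<open>m \<noteq> n\<close> by simp
  ultimately show ?thesis by blast
qed

end

section \<open>Gaussians and their Gram matrix\<close>

lemma nn_integral_eq_homogeneous_radial_finite:
  fixes H :: "'a::euclidean_space \<Rightarrow> real" and g :: "real \<Rightarrow> real"
  assumes [measurable]: "H \<in> borel_measurable borel" "g \<in> borel_measurable borel"
    and H0: "\<And>x. H x \<ge> 0" and g0: "\<And>r. g r \<ge> 0"
    and hom: "\<And>t x. t > 0 \<Longrightarrow> H (t *\<^sub>R x) = t powr d * H x"
    and bound: "\<And>x. x \<noteq> 0 \<Longrightarrow> H x \<le> C * norm x powr d" and C: "C \<ge> 0"
    and fin: "radial_mass (d + DIM('a)) (\<lambda>r. ennreal (g r)) < \<infinity>"
  shows "integrable lborel (\<lambda>x. H x * g (norm x))"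
    and "(\<integral>x. H x * g (norm x) \<partial>lborel)
      = enn2real (\<integral>\<^sup>+x. ennreal (H x) * indicator {1..exp 1} (norm x) * ennreal (norm x powr - (d + DIM('a))) \<partial>lborel)
        * enn2real (radial_mass (d + DIM('a)) (\<lambda>r. ennreal (g r)))"
proof -
  let ?S = "\<integral>\<^sup>+x. ennreal (H x) * indicator {1..exp 1} (norm x) * ennreal (norm x powr - (d + DIM('a))) \<partial>lborel"
  have S: "?S < \<infinity>" by (rule sphere_mass_finite[OF _ C]) (use bound in \<open>auto intro: ennreal_leI\<close>)
  have "(\<integral>\<^sup>+x. ennreal (H x * g (norm x)) \<partial>lborel) = (\<integral>\<^sup>+x. ennreal (H x) * ennreal (g (norm x)) \<partial>lborel)"
    by (simp add: ennreal_mult H0 g0)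
  also have "\<dots> = ?S * radial_mass (d + DIM('a)) (\<lambda>r. ennreal (g r))"
    by (rule nn_integral_homogeneous_radial) (auto simp: hom H0 ennreal_mult)
  finally have eq: "(\<integral>\<^sup>+x. ennreal (H x * g (norm x)) \<partial>lborel) = ?S * radial_mass (d + DIM('a)) (\<lambda>r. ennreal (g r))" .
  show "integrable lborel (\<lambda>x. H x * g (norm x))"
    by (rule integrableI_nonneg) (use S fin eq H0 g0 in \<open>auto simp: ennreal_mult_less_top\<close>)
  show "(\<integral>x. H x * g (norm x) \<partial>lborel) = enn2real ?S * enn2real (radial_mass (d + DIM('a)) (\<lambda>r. ennreal (g r)))"
    by (subst integral_eq_nn_integral) (auto simp: eq enn2real_mult H0 g0)
qed

lemma integral_homogeneous_radial:
  fixes G :: "'a::euclidean_space \<Rightarrow> complex"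
  assumes G [measurable]: "G \<in> borel_measurable borel"
    and hom: "\<And>t x. t > 0 \<Longrightarrow> G (t *\<^sub>R x) = of_real (t powr d) * G x"
    and bound: "\<And>x. x \<noteq> 0 \<Longrightarrow> cmod (G x) \<le> C * norm x powr d" and C: "C \<ge> 0"
  obtains c where "\<And>g :: real \<Rightarrow> real. g \<in> borel_measurable borel \<Longrightarrow> (\<And>r. g r \<ge> 0) \<Longrightarrow>
      radial_mass (d + DIM('a)) (\<lambda>r. ennreal (g r)) < \<infinity> \<Longrightarrow>
      (\<integral>x. G x * of_real (g (norm x)) \<partial>lborel) = c * of_real (enn2real (radial_mass (d + DIM('a)) (\<lambda>r. ennreal (g r))))"
proof -
  define S where "S H = enn2real (\<integral>\<^sup>+(x::'a). ennreal (H x) * indicator {1..exp 1} (norm x) * ennreal (norm x powr - (d + DIM('a))) \<partial>lborel)" for H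
  define Rp where "Rp x = max (Re (G x)) 0" for x
  define Rm where "Rm x = max (- Re (G x)) 0" for x
  define Ip where "Ip x = max (Im (G x)) 0" for x
  define Im' where "Im' x = max (- Im (G x)) 0" for x
  define c where "c = complex_of_real (S Rp) - of_real (S Rm) + \<i> * (of_real (S Ip) - of_real (S Im'))"
  have decomp: "G x = of_real (Rp x) - of_real (Rm x) + \<i> * (of_real (Ip x) - of_real (Im' x))" for x
  proof -
    have "y = max y 0 - max (- y) 0" for y :: real by (simp add: max_def)
    then show ?thesis unfolding complex_eq_iff Rp_def Rm_def Ip_def Im'_def by simp
  qed
  have maxmul: "max (t powr d * y) 0 = t powr d * max y 0" for t y
    by (simp add: max_mult_distrib_left)
  show thesis
  proof (rule that)
    fix g :: "real \<Rightarrow> real"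
    assume g [measurable]: "g \<in> borel_measurable borel" and g0: "\<And>r. g r \<ge> 0"
      and fin: "radial_mass (d + DIM('a)) (\<lambda>r. ennreal (g r)) < \<infinity>"
    let ?k = "enn2real (radial_mass (d + DIM('a)) (\<lambda>r. ennreal (g r)))"
    have part: "integrable lborel (\<lambda>x. complex_of_real (H x * g (norm x))) \<and>
        (\<integral>x. complex_of_real (H x * g (norm x)) \<partial>lborel) = of_real (S H * ?k)"
      if m: "H \<in> borel_measurable borel" and h: "\<And>t x. t > 0 \<Longrightarrow> H (t *\<^sub>R x) = t powr d * H x"
        and le: "\<And>x. 0 \<le> H x" "\<And>x. H x \<le> cmod (G x)" for H
    proof -
      note * = nn_integral_eq_homogeneous_radial_finite[OF m g le(1) g0 h order_trans[OF le(2) bound] C fin]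
      have i: "integrable lborel (\<lambda>x. H x * g (norm x))" by (rule *(1))
      have e: "(\<integral>x. H x * g (norm x) \<partial>lborel) = S H * ?k" unfolding S_def by (rule *(2))
      show ?thesis unfolding integral_complex_of_real e
        using Bochner_Integration.integrable_of_real[OF i, where 'a = complex] by blast
    qed
    have hRe: "Re (G (t *\<^sub>R x)) = t powr d * Re (G x)" "Im (G (t *\<^sub>R x)) = t powr d * Im (G x)" if "t > 0" for t x
      using hom[OF that, of x] by simp_all
    have p: "integrable lborel (\<lambda>x. complex_of_real (H x * g (norm x))) \<and>
        (\<integral>x. complex_of_real (H x * g (norm x)) \<partial>lborel) = of_real (S H * ?k)" if "H \<in> {Rp, Rm, Ip, Im'}" for H
    proof (rule part)
      show "H \<in> borel_measurable borel" using that unfolding Rp_def Rm_def Ip_def Im'_def by auto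
      show "H (t *\<^sub>R x) = t powr d * H x" if "t > 0" for t x
      proof -
        have "Rp (t *\<^sub>R x) = t powr d * Rp x" "Ip (t *\<^sub>R x) = t powr d * Ip x"
          by (simp_all only: Rp_def Ip_def hRe[OF that] maxmul)
        moreover have "Rm (t *\<^sub>R x) = t powr d * Rm x" "Im' (t *\<^sub>R x) = t powr d * Im' x"
          by (simp_all only: Rm_def Im'_def hRe[OF that] mult_minus_right[symmetric] maxmul)
        ultimately show ?thesis using \<open>H \<in> {Rp, Rm, Ip, Im'}\<close> by blast
      qed
      show "0 \<le> H x" "H x \<le> cmod (G x)" for x
        using that abs_Re_le_cmod[of "G x"] abs_Im_le_cmod[of "G x"]
        by (auto simp: Rp_def Rm_def Ip_def Im'_def)
    qed
    have "(\<integral>x. G x * of_real (g (norm x)) \<partial>lborel)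
      = (\<integral>x. (of_real (Rp x * g (norm x)) - of_real (Rm x * g (norm x))) + \<i> * (of_real (Ip x * g (norm x)) - of_real (Im' x * g (norm x))) \<partial>lborel)"
      by (rule Bochner_Integration.integral_cong[OF refl]) (subst decomp, simp add: algebra_simps)
    also have "\<dots> = c * of_real ?k"
      using p[of Rp] p[of Rm] p[of Ip] p[of Im']
      by (simp add: Bochner_Integration.integral_add Bochner_Integration.integral_diff c_def algebra_simps del: integral_complex_of_real)
    finally show "(\<integral>x. G x * of_real (g (norm x)) \<partial>lborel) = c * of_real ?k" .
  qed
qed

lemma L2_norm_mono:
  assumes "f \<in> borel_measurable M" "g \<in> L2 M" "\<And>x. cmod (f x) \<le> cmod (g x)"
  shows "f \<in> L2 M" "L2_norm M f \<le> L2_norm M g"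
proof -
  have "(\<integral>\<^sup>+x. ennreal ((cmod (f x))\<^sup>2) \<partial>M) \<le> (\<integral>\<^sup>+x. ennreal ((cmod (g x))\<^sup>2) \<partial>M)"
    using assms(3) by (intro nn_integral_mono ennreal_leI power_mono) auto
  also have "\<dots> = ennreal ((L2_norm M g)\<^sup>2)" by (rule L2_nn_integral[OF assms(2)])
  finally have "f \<in> L2 M \<and> L2_norm M f \<le> L2_norm M g"
    by (intro L2_if_nn_integral_le assms L2_norm_nonneg)
  then show "f \<in> L2 M" "L2_norm M f \<le> L2_norm M g" by auto
qed

lemma norm_exp_remainder: "cmod (exp w - 1 - w) \<le> (cmod w)\<^sup>2 * exp (cmod w)"
  using Taylor_exp_field[of w 1] by (simp add: power2_eq_square mult.commute diff_diff_eq)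

locale dunkl_laguerre_setting = dunkl_setting R P k for R P :: "(real^'n) set" and k +
  fixes a :: real
  assumes a_pos: "a > 0" and index_pos: "a + 2 * sum k P + real CARD('n) - 2 > 0"
begin

abbreviation M where "M \<equiv> theta_measure R k a"

definition kappa :: "nat \<Rightarrow> real" where "kappa m = lambda_kam P k a m + 1"

lemma kappa_eq: "kappa m = (2 * real m + 2 * sum k P + real CARD('n) + a - 2) / a"
  using a_pos by (simp add: kappa_def lambda_kam_def field_simps)

definition radius :: "real^'n \<Rightarrow> real" where "radius x = norm x powr a / a"

lemma radius_nonneg: "radius x \<ge> 0"
  using a_pos by (simp add: radius_def)

lemma radius_measurable [measurable]: "radius \<in> borel_measurable borel"
  unfolding radius_def by measurable

text \<open>The functions \<open>p u\<^sup>j e\<^bsup>- z u\<^esup>\<close> with \<open>u = \<parallel>x\<parallel>\<^sup>a / a\<close>; for \<open>j = 0\<close> the group acts on them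
  explicitly, for \<open>z = 1\<close> they span \<open>W_space\<close>.\<close>

definition gauss :: "(real^'n \<Rightarrow> complex) \<Rightarrow> nat \<Rightarrow> complex \<Rightarrow> real^'n \<Rightarrow> complex" where
  "gauss p j z x = p x * of_real (radius x) ^ j * exp (- z * of_real (radius x))"

lemma sum_k_R: "sum k R = 2 * sum k P"
  using sum_R_even[of k] k_uminus by simp

lemma theta_eq: "theta R k a x = norm x powr (a - 2) * weight x"
  by (simp add: theta_def weight_def)

lemma theta_nonneg: "theta R k a x \<ge> 0"
  using weight_nonneg by (simp add: theta_eq)

lemma theta_measurable [measurable]: "theta R k a \<in> borel_measurable borel"
  unfolding theta_eq[abs_def] by measurable

lemma weight_homogeneous: "t > 0 \<Longrightarrow> weight (t *\<^sub>R x) = t powr (2 * sum k P) * weight x"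
  unfolding weight_def sum_k_R[symmetric]
  by (simp add: abs_mult powr_mult prod.distrib powr_sum finite_R)

lemma weight_norm_bound: "\<exists>C\<ge>0. \<forall>x. x \<noteq> 0 \<longrightarrow> weight x \<le> C * norm x powr (2 * sum k P)"
proof (intro exI[of _ "\<Prod>\<alpha>\<in>R. norm \<alpha> powr k \<alpha>"] conjI allI impI)
  fix x :: "real^'n" assume "x \<noteq> 0"
  have "weight x \<le> (\<Prod>\<alpha>\<in>R. (norm \<alpha> * norm x) powr k \<alpha>)"
    unfolding weight_def by (intro prod_mono conjI powr_mono2 k_nonneg Cauchy_Schwarz_ineq2) auto
  also have "\<dots> = (\<Prod>\<alpha>\<in>R. norm \<alpha> powr k \<alpha>) * norm x powr (2 * sum k P)"
    using \<open>x \<noteq> 0\<close> by (simp add: powr_mult prod.distrib powr_sum finite_R sum_k_R[symmetric])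
  finally show "weight x \<le> (\<Prod>\<alpha>\<in>R. norm \<alpha> powr k \<alpha>) * norm x powr (2 * sum k P)" .
qed (simp add: prod_nonneg)

lemma harmonicD:
  assumes "p \<in> dunkl_harmonics P k m"
  shows "polynomial_function p" "p (t *\<^sub>R x) = of_real (t ^ m) * p x" "dunkl_laplacian P k p x = 0"
    "p \<in> borel_measurable borel"
proof -
  have *: "polynomial_function p \<and> (\<forall>t x. p (t *\<^sub>R x) = of_real (t ^ m) * p x) \<and> (\<forall>x. dunkl_laplacian P k p x = 0)"
    using assms unfolding dunkl_harmonics_def mem_Collect_eq .
  show "polynomial_function p" using * by blast
  then show "p \<in> borel_measurable borel" by (rule polynomial_measurable)
  show "p (t *\<^sub>R x) = of_real (t ^ m) * p x" "dunkl_laplacian P k p x = 0" using * by blast+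
qed

lemma harmonic_bound:
  assumes p: "p \<in> dunkl_harmonics P k m"
  shows "\<exists>C\<ge>0. \<forall>x. x \<noteq> 0 \<longrightarrow> cmod (p x) \<le> C * norm x ^ m"
proof -
  have "compact (p ` sphere 0 1)"
    by (rule compact_continuous_image[OF continuous_on_polymonial_function[OF harmonicD(1)[OF p]] compact_sphere])
  then have "bounded (p ` sphere 0 1)" by (rule compact_imp_bounded)
  then obtain C where "\<forall>y\<in>p ` sphere 0 1. cmod y \<le> C" unfolding bounded_iff by blast
  then have C: "cmod (p x) \<le> C" if "x \<in> sphere 0 1" for x using that by blast
  have "cmod (p x) \<le> max C 0 * norm x ^ m" if "x \<noteq> 0" for x
  proof -
    have "p x = p (norm x *\<^sub>R (x /\<^sub>R norm x))" using that by simp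
    also have "\<dots> = of_real (norm x ^ m) * p (x /\<^sub>R norm x)" by (rule harmonicD(2)[OF p])
    finally have "cmod (p x) = norm x ^ m * cmod (p (x /\<^sub>R norm x))" by (simp add: norm_mult norm_power)
    also have "\<dots> \<le> norm x ^ m * max C 0" using C[of "x /\<^sub>R norm x"] that by (intro mult_left_mono) auto
    finally show ?thesis by (simp add: mult.commute)
  qed
  then show ?thesis by (intro exI[of _ "max C 0"]) auto
qed

lemma gauss_measurable:
  assumes "p \<in> dunkl_harmonics P k m"
  shows "gauss p j z \<in> borel_measurable borel"
  unfolding gauss_def using harmonicD(4)[OF assms] by measurable

text \<open>In polar coordinates the exponent at the origin is \<open>2 m + 2 sum k P + N + a - 2\<close> or larger, which is
  positive by \<open>index_pos\<close>.\<close>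

lemma gauss_L2:
  assumes p: "p \<in> dunkl_harmonics P k m" and z: "Re z > 0"
  shows "gauss p j z \<in> L2 M"
proof -
  obtain C where C: "C \<ge> 0" "\<And>x. x \<noteq> 0 \<Longrightarrow> cmod (p x) \<le> C * norm x ^ m" using harmonic_bound[OF p] by blast
  obtain C' where C': "C' \<ge> 0" "\<And>x. x \<noteq> 0 \<Longrightarrow> weight x \<le> C' * norm x powr (2 * sum k P)" using weight_norm_bound by blast
  define d where "d = 2 * real m + 2 * sum k P"
  define b where "b = 2 * a * real j + (a - 2)"
  define c where "c = 2 * Re z / a"
  define A where "A = C\<^sup>2 * C' / a ^ (2 * j)"
  have A: "A \<ge> 0" using C(1) C'(1) a_pos by (simp add: A_def)
  have c: "c > 0" using z a_pos by (simp add: c_def)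
  have meas: "gauss p j z \<in> borel_measurable M"
    using gauss_measurable[OF p] by (simp add: theta_measure_def)
  have bound: "theta R k a x * (cmod (gauss p j z x))\<^sup>2 \<le> (A * norm x powr d) * (norm x powr b * exp (- c * norm x powr a))" for x
  proof (cases "x = 0")
    case True then show ?thesis by (simp add: theta_eq)
  next
    case False
    define r where "r = norm x"
    have r: "r > 0" using False by (simp add: r_def)
    have "(cmod (gauss p j z x))\<^sup>2 = (cmod (p x))\<^sup>2 * (r powr a / a) ^ (2 * j) * exp (- c * r powr a)"
    proof -
      have "cmod (gauss p j z x) = cmod (p x) * radius x ^ j * exp (- Re z * radius x)"
        using radius_nonneg[of x] by (simp add: gauss_def norm_mult norm_power)
      moreover have "(exp (- Re z * radius x))\<^sup>2 = exp (- c * r powr a)"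
        by (simp add: radius_def r_def c_def flip: exp_double)
      moreover have "(radius x ^ j)\<^sup>2 = (r powr a / a) ^ (2 * j)"
        by (simp add: radius_def r_def power_mult[symmetric] mult.commute)
      ultimately show ?thesis by (simp only: power_mult_distrib)
    qed
    also have "(r powr a / a) ^ (2 * j) = r powr (2 * a * real j) / a ^ (2 * j)"
      using r by (simp add: power_divide powr_powr flip: powr_realpow) (simp add: mult.commute mult.left_commute)
    finally have 1: "(cmod (gauss p j z x))\<^sup>2 = (cmod (p x))\<^sup>2 * (r powr (2 * a * real j) / a ^ (2 * j)) * exp (- c * r powr a)" .
    have 2: "(cmod (p x))\<^sup>2 \<le> (C * r ^ m)\<^sup>2" using C(2)[OF False] by (intro power_mono) (auto simp: r_def)
    have 3: "weight x \<le> C' * r powr (2 * sum k P)" using C'(2)[OF False] by (simp add: r_def)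
    have "theta R k a x * (cmod (gauss p j z x))\<^sup>2 = ((cmod (p x))\<^sup>2 * weight x) * (r powr (a - 2) * (r powr (2 * a * real j) / a ^ (2 * j)) * exp (- c * r powr a))"
      unfolding theta_eq 1 by (simp add: r_def)
    also have "\<dots> \<le> ((C * r ^ m)\<^sup>2 * (C' * r powr (2 * sum k P))) * (r powr (a - 2) * (r powr (2 * a * real j) / a ^ (2 * j)) * exp (- c * r powr a))"
      using weight_nonneg a_pos by (intro mult_right_mono mult_mono 2 3) auto
    also have "\<dots> = (A * r powr d) * (r powr b * exp (- c * r powr a))"
    proof -
      have "(r ^ m)\<^sup>2 = r ^ (2 * m)" by (simp add: power_mult[symmetric] mult.commute)
      also have "\<dots> = r powr real (2 * m)" using r by (rule powr_realpow[symmetric])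
      finally have "(r ^ m)\<^sup>2 = r powr (2 * real m)" by simp
      then show ?thesis by (simp add: A_def d_def b_def powr_add power_mult_distrib)
    qed
    finally show ?thesis by (simp add: r_def)
  qed
  have "(\<integral>\<^sup>+x. ennreal ((cmod (gauss p j z x))\<^sup>2) \<partial>M) = (\<integral>\<^sup>+x. ennreal (theta R k a x * (cmod (gauss p j z x))\<^sup>2) \<partial>lborel)"
    using meas theta_nonneg unfolding theta_measure_def
    by (subst nn_integral_density) (auto simp: ennreal_mult)
  also have "\<dots> \<le> (\<integral>\<^sup>+x. ennreal ((A * norm x powr d) * (norm x powr b * exp (- c * norm x powr a))) \<partial>(lborel :: (real^'n) measure))"
    by (intro nn_integral_mono ennreal_leI bound)
  also have "\<dots> = (\<integral>\<^sup>+x. ennreal (A * norm x powr d) * ennreal (norm x powr b * exp (- c * norm x powr a)) \<partial>(lborel :: (real^'n) measure))"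
    using A by (simp add: ennreal_mult)
  also have "\<dots> = (\<integral>\<^sup>+(x::real^'n). ennreal (A * norm x powr d) * indicator {1..exp 1} (norm x) * ennreal (norm x powr - (d + DIM(real^'n))) \<partial>lborel)
      * radial_mass (d + DIM(real^'n)) (\<lambda>r. ennreal (r powr b * exp (- c * r powr a)))"
    by (rule nn_integral_homogeneous_radial) (use A in \<open>auto simp: powr_mult ennreal_mult ac_simps\<close>)
  also have "\<dots> < \<infinity>"
  proof -
    have "(\<integral>\<^sup>+(x::real^'n). ennreal (A * norm x powr d) * indicator {1..exp 1} (norm x) * ennreal (norm x powr - (d + DIM(real^'n))) \<partial>lborel) < \<infinity>"
      by (rule sphere_mass_finite[OF _ A]) simp
    moreover have "radial_mass (d + DIM(real^'n)) (\<lambda>r. ennreal (r powr b * exp (- c * r powr a))) < \<infinity>"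
    proof (rule radial_mass_powr_exp_finite[OF a_pos c])
      have "a * real j \<ge> 0" using a_pos by simp
      then show "b + (d + DIM(real^'n)) > 0" using index_pos by (simp add: b_def d_def)
    qed
    ultimately show ?thesis by (simp add: ennreal_mult_less_top)
  qed
  finally have "(\<integral>\<^sup>+x. ennreal ((cmod (gauss p j z x))\<^sup>2) \<partial>M) < \<infinity>" .
  then show ?thesis unfolding L2_def using meas by (auto simp: integrable_iff_bounded)
qed

text \<open>The Taylor remainder of the exponential is at most \<open>\<bar>h\<bar>\<^sup>2 u\<^sup>2 e\<^bsup>\<bar>h\<bar> u\<^esup>\<close>, and half of the decay \<open>e\<^bsup>- Re z u\<^esup>\<close>
  absorbs the last factor.\<close>

lemma gauss_difference_quotient:
  assumes p: "p \<in> dunkl_harmonics P k m" and z: "Re z > 0"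
  shows "L2_tendsto M (at 0) (\<lambda>h x. inverse h * (gauss p j (z + h) x - gauss p j z x)) (\<lambda>x. - gauss p (Suc j) z x)"
proof (rule L2_tendstoI)
  define \<rho> where "\<rho> = Re z / 2"
  have \<rho>: "\<rho> > 0" using z by (simp add: \<rho>_def)
  define B where "B = gauss p (j + 2) (of_real \<rho>)"
  have B: "B \<in> L2 M" unfolding B_def by (rule gauss_L2[OF p]) (simp add: \<rho>)
  have "L2_norm M (\<lambda>x. inverse h * (gauss p j (z + h) x - gauss p j z x) - - gauss p (Suc j) z x) \<le> cmod h * L2_norm M B"
    if h: "h \<noteq> 0" "cmod h < \<rho>" for h
  proof -
    have pw: "cmod (inverse h * (gauss p j (z + h) x - gauss p j z x) - - gauss p (Suc j) z x) \<le> cmod (h * B x)" for x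
    proof -
      define u where "u = radius x"
      have u: "u \<ge> 0" by (simp add: u_def radius_nonneg)
      have "inverse h * (gauss p j (z + h) x - gauss p j z x) - - gauss p (Suc j) z x
        = p x * of_real u ^ j * exp (- z * of_real u) * (inverse h * (exp (- h * of_real u) - 1 - (- h * of_real u)))"
      proof -
        have "exp (- (z + h) * of_real u) = exp (- z * of_real u) * exp (- h * of_real u)"
          by (simp add: algebra_simps flip: exp_add)
        then show ?thesis
          using h unfolding gauss_def u_def[symmetric] by (simp add: field_simps del: exp_minus)
      qed
      then have "cmod (inverse h * (gauss p j (z + h) x - gauss p j z x) - - gauss p (Suc j) z x)
        = cmod (p x) * u ^ j * exp (- Re z * u) * (cmod (exp (- h * of_real u) - 1 - (- h * of_real u)) / cmod h)"
        using u h by (simp add: norm_mult norm_power norm_inverse divide_inverse)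
      also have "cmod (exp (- h * of_real u) - 1 - (- h * of_real u)) / cmod h \<le> cmod h * u\<^sup>2 * exp (cmod h * u)"
      proof -
        have "cmod (exp (- h * of_real u) - 1 - (- h * of_real u)) \<le> (cmod (- h * of_real u))\<^sup>2 * exp (cmod (- h * of_real u))"
          by (rule norm_exp_remainder)
        also have "\<dots> = cmod h * (cmod h * u\<^sup>2 * exp (cmod h * u))"
          using u by (simp add: norm_mult power_mult_distrib power2_eq_square)
        finally show ?thesis using h by (simp add: field_simps)
      qed
      also have "cmod h * u\<^sup>2 * exp (cmod h * u) \<le> cmod h * u\<^sup>2 * exp (\<rho> * u)"
        using h u by (intro mult_left_mono) (auto intro: mult_right_mono)
      finally have "cmod (inverse h * (gauss p j (z + h) x - gauss p j z x) - - gauss p (Suc j) z x)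
        \<le> cmod (p x) * u ^ j * exp (- Re z * u) * (cmod h * u\<^sup>2 * exp (\<rho> * u))"
        using u by (simp add: mult_left_mono)
      also have "\<dots> = cmod h * (cmod (p x) * u ^ (j + 2) * (exp (- Re z * u) * exp (\<rho> * u)))"
        by (simp add: power_add power2_eq_square)
      also have "exp (- Re z * u) * exp (\<rho> * u) = exp (- \<rho> * u)"
        by (simp add: \<rho>_def flip: exp_add)
      also have "cmod h * (cmod (p x) * u ^ (j + 2) * exp (- \<rho> * u)) = cmod (h * B x)"
        using u by (simp add: B_def gauss_def u_def[symmetric] norm_mult norm_power power2_eq_square)
      finally show ?thesis .
    qed
    have "L2_norm M (\<lambda>x. inverse h * (gauss p j (z + h) x - gauss p j z x) - - gauss p (Suc j) z x) \<le> L2_norm M (\<lambda>x. h * B x)"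
    proof (rule L2_norm_mono(2)[OF _ L2_cmult[OF B] pw])
      note [measurable] = gauss_measurable[OF p]
      show "(\<lambda>x. inverse h * (gauss p j (z + h) x - gauss p j z x) - - gauss p (Suc j) z x) \<in> borel_measurable M"
        unfolding theta_measure_def by measurable
    qed
    then show ?thesis by (simp only: L2_norm_cmult)
  qed
  then show "\<forall>\<^sub>F h in at 0. L2_norm M (\<lambda>x. inverse h * (gauss p j (z + h) x - gauss p j z x) - - gauss p (Suc j) z x) \<le> cmod h * L2_norm M B"
    using \<rho> unfolding eventually_at by (intro exI[of _ \<rho>]) auto
  have "((\<lambda>h::complex. cmod h * L2_norm M B) \<longlongrightarrow> cmod 0 * L2_norm M B) (at 0)" by (intro tendsto_intros)
  then show "((\<lambda>h::complex. cmod h * L2_norm M B) \<longlongrightarrow> 0) (at 0)" by simp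
qed

text \<open>The inner products of the Gaussians as a function of the single variable \<open>z + cnj w\<close>.\<close>

definition gram_integral :: "(real^'n \<Rightarrow> complex) \<Rightarrow> (real^'n \<Rightarrow> complex) \<Rightarrow> complex \<Rightarrow> complex" where
  "gram_integral p q s = (\<integral>x. p x * cnj (q x) * exp (- s * of_real (radius x)) \<partial>M)"

lemma gauss_inner: "L2_inner M (gauss p 0 z) (gauss q 0 w) = gram_integral p q (z + cnj w)"
  unfolding L2_inner_def gram_integral_def gauss_def
  by (rule Bochner_Integration.integral_cong[OF refl]) (simp add: exp_cnj exp_diff exp_minus exp_add field_simps)

text \<open>Near \<open>s\<close> this is an inner product of \<open>gauss p 0 (s - w)\<close>, which is differentiable in \<open>L\<^sup>2\<close>, with a fixed
  Gaussian \<open>gauss q 0 w\<close>.\<close>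

lemma gram_integral_holomorphic:
  assumes p: "p \<in> dunkl_harmonics P k m" and q: "q \<in> dunkl_harmonics P k n"
  shows "gram_integral p q holomorphic_on {s. Re s > 0}"
proof -
  have "open {s::complex. Re s > 0}" by (rule open_halfspace_Re_gt)
  moreover have "gram_integral p q field_differentiable (at s)" if s: "Re s > 0" for s
  proof -
    define w where "w = complex_of_real (Re s / 2)"
    have w: "Re w > 0" "Re (s - w) > 0" "cnj w = w" using s by (auto simp: w_def)
    have gL: "gauss p 0 (s - w) \<in> L2 M" "gauss q 0 w \<in> L2 M" "gauss p (Suc 0) (s - w) \<in> L2 M"
      using gauss_L2 p q w by blast+
    have ev: "\<forall>\<^sub>F h in at 0. Re ((s - w) + h) > 0"
    proof -
      have "((\<lambda>h. Re ((s - w) + h)) \<longlongrightarrow> Re ((s - w) + 0)) (at 0)" by (intro tendsto_intros)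
      then show ?thesis using w(2) by (intro order_tendstoD) auto
    qed
    define Q where "Q h = (if Re ((s - w) + h) > 0 then (\<lambda>x. inverse h * (gauss p 0 ((s - w) + h) x - gauss p 0 (s - w) x)) else (\<lambda>x. 0))" for h
    have QL: "Q h \<in> L2 M" for h
      unfolding Q_def using gL p by (auto intro!: L2_cmult L2_diff L2_zero gauss_L2)
    have "L2_tendsto M (at 0) (\<lambda>h x. inverse h * (gauss p 0 ((s - w) + h) x - gauss p 0 (s - w) x)) (\<lambda>x. - gauss p (Suc 0) (s - w) x)"
      by (rule gauss_difference_quotient[OF p w(2)])
    then have "L2_tendsto M (at 0) Q (\<lambda>x. - gauss p (Suc 0) (s - w) x)"
      unfolding L2_tendsto_def
      by (rule Lim_transform_eventually) (use ev in \<open>auto simp: Q_def elim: eventually_mono\<close>)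
    then have "((\<lambda>h. L2_inner M (Q h) (gauss q 0 w)) \<longlongrightarrow> L2_inner M (\<lambda>x. - gauss p (Suc 0) (s - w) x) (gauss q 0 w)) (at 0)"
      by (rule L2_tendsto_inner[OF _ L2_tendsto_const QL gL(2) _ gL(2)]) (use L2_cmult[OF gL(3), of "-1"] in simp)
    then have "((\<lambda>h. (gram_integral p q (s + h) - gram_integral p q s) / h) \<longlongrightarrow> L2_inner M (\<lambda>x. - gauss p (Suc 0) (s - w) x) (gauss q 0 w)) (at 0)"
    proof (rule Lim_transform_eventually)
      show "\<forall>\<^sub>F h in at 0. L2_inner M (Q h) (gauss q 0 w) = (gram_integral p q (s + h) - gram_integral p q s) / h"
        using ev
      proof eventually_elim
        case (elim h)
        have "gauss p 0 ((s - w) + h) \<in> L2 M" using gauss_L2[OF p] elim by blast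
        then have "L2_inner M (Q h) (gauss q 0 w) = inverse h * (L2_inner M (gauss p 0 ((s - w) + h)) (gauss q 0 w) - L2_inner M (gauss p 0 (s - w)) (gauss q 0 w))"
          unfolding Q_def using elim gL by (simp add: L2_inner_cmult_left L2_inner_diff_left)
        then show ?case unfolding gauss_inner w(3) by (simp add: divide_inverse mult.commute)
      qed
    qed
    then show ?thesis unfolding field_differentiable_def DERIV_def by blast
  qed
  ultimately show ?thesis unfolding holomorphic_on_def using field_differentiable_at_within by blast
qed

lemma integral_theta_measure:
  assumes "f \<in> borel_measurable borel"
  shows "(\<integral>x. f x \<partial>M) = (\<integral>x. of_real (theta R k a x) * (f x :: complex) \<partial>lborel)"
  unfolding theta_measure_def
  by (subst integral_density) (use assms theta_nonneg in \<open>auto simp: scaleR_conv_of_real\<close>)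

text \<open>In polar coordinates the integral is a constant, depending only on \<open>p\<close> and \<open>q\<close>, times a radial integral,
  and the radial integral scales with \<open>s\<close>. The constant is the same for every radial factor, in
  particular for \<open>e\<^bsup>- \<parallel>x\<parallel>\<^sup>2 / 2\<^esup>\<close>; hence it is \<open>0\<close> for \<open>m \<noteq> n\<close> by \<open>gaussian_harmonics_orthogonal\<close>.\<close>

lemma gram_integral_real:
  assumes p: "p \<in> dunkl_harmonics P k m" and q: "q \<in> dunkl_harmonics P k n" and s: "s > 0"
  shows "gram_integral p q (of_real s) = (if m = n then gram_integral p q 1 * of_real (s powr - kappa m) else 0)"
proof -
  let ?N = "DIM(real^'n)"
  define G where "G x = p x * cnj (q x) * of_real (weight x)" for x
  define d where "d = real (m + n) + 2 * sum k P"
  define g where "g s r = r powr (a - 2) * exp (- (s / a) * r powr a)" for s r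
  have q': "(\<lambda>x. cnj (q x)) \<in> dunkl_harmonics P k n" using dunkl_harmonics_cnj[OF q finite_P] .
  have [measurable]: "p \<in> borel_measurable borel" "(\<lambda>x. cnj (q x)) \<in> borel_measurable borel"
    using harmonicD(4)[OF p] harmonicD(4)[OF q'] by auto
  have Gm [measurable]: "G \<in> borel_measurable borel" unfolding G_def by measurable
  obtain C1 where C1: "C1 \<ge> 0" "\<And>x. x \<noteq> 0 \<Longrightarrow> cmod (p x) \<le> C1 * norm x ^ m" using harmonic_bound[OF p] by blast
  obtain C2 where C2: "C2 \<ge> 0" "\<And>x. x \<noteq> 0 \<Longrightarrow> cmod (q x) \<le> C2 * norm x ^ n" using harmonic_bound[OF q] by blast
  obtain C3 where C3: "C3 \<ge> 0" "\<And>x. x \<noteq> 0 \<Longrightarrow> weight x \<le> C3 * norm x powr (2 * sum k P)" using weight_norm_bound by blast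
  have bG: "cmod (G x) \<le> (C1 * C2 * C3) * norm x powr d" if "x \<noteq> 0" for x
  proof -
    have "cmod (G x) = cmod (p x) * cmod (q x) * weight x" using weight_nonneg by (simp add: G_def norm_mult)
    also have "\<dots> \<le> (C1 * norm x ^ m) * (C2 * norm x ^ n) * (C3 * norm x powr (2 * sum k P))"
      using C1 C2 C3 that weight_nonneg by (intro mult_mono) auto
    also have "\<dots> = (C1 * C2 * C3) * norm x powr d"
      using that by (simp add: d_def powr_add powr_realpow power_add)
    finally show ?thesis .
  qed
  have hG: "G (t *\<^sub>R x) = of_real (t powr d) * G x" if "t > 0" for t x
  proof -
    have "G (t *\<^sub>R x) = (of_real (t ^ m) * p x) * cnj (of_real (t ^ n) * q x) * of_real (t powr (2 * sum k P) * weight x)"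
      unfolding G_def harmonicD(2)[OF p] harmonicD(2)[OF q] weight_homogeneous[OF that] ..
    also have "t powr d = t ^ m * t ^ n * t powr (2 * sum k P)"
      using that by (simp add: d_def powr_add powr_realpow power_add)
    then have "(of_real (t ^ m) * p x) * cnj (of_real (t ^ n) * q x) * of_real (t powr (2 * sum k P) * weight x) = of_real (t powr d) * G x"
      by (simp add: G_def)
    finally show ?thesis .
  qed
  have cG: "C1 * C2 * C3 \<ge> 0" using C1(1) C2(1) C3(1) by simp
  obtain c where c: "\<And>g :: real \<Rightarrow> real. g \<in> borel_measurable borel \<Longrightarrow> (\<And>r. g r \<ge> 0) \<Longrightarrow>
      radial_mass (d + ?N) (\<lambda>r. ennreal (g r)) < \<infinity> \<Longrightarrow>
      (\<integral>x. G x * of_real (g (norm x)) \<partial>lborel) = c * of_real (enn2real (radial_mass (d + ?N) (\<lambda>r. ennreal (g r))))"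
    using integral_homogeneous_radial[OF Gm hG bG cG] by blast
  have gm: "g s \<in> borel_measurable borel" for s unfolding g_def by measurable
  have d_pos: "a - 2 + (d + ?N) > 0" using index_pos by (simp add: d_def)
  have mass_fin: "radial_mass (d + ?N) (\<lambda>r. ennreal (g s r)) < \<infinity>" if "s > 0" for s
    unfolding g_def by (rule radial_mass_powr_exp_finite) (use a_pos that d_pos in auto)
  have gram: "gram_integral p q (of_real s) = c * of_real (enn2real (radial_mass (d + ?N) (\<lambda>r. ennreal (g s r))))" if "s > 0" for s
  proof -
    have "gram_integral p q (of_real s) = (\<integral>x. of_real (theta R k a x) * (p x * cnj (q x) * exp (- of_real s * of_real (radius x))) \<partial>lborel)"
      unfolding gram_integral_def by (rule integral_theta_measure) measurable
    also have "\<dots> = (\<integral>x. G x * of_real (g s (norm x)) \<partial>lborel)"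
    proof (rule Bochner_Integration.integral_cong[OF refl])
      fix x
      have "exp (- of_real s * of_real (radius x)) = complex_of_real (exp (- (s / a) * norm x powr a))"
        by (simp add: radius_def exp_of_real[symmetric])
      then show "of_real (theta R k a x) * (p x * cnj (q x) * exp (- of_real s * of_real (radius x))) = G x * of_real (g s (norm x))"
        by (simp only: theta_eq G_def g_def of_real_mult ac_simps)
    qed
    also have "\<dots> = c * of_real (enn2real (radial_mass (d + ?N) (\<lambda>r. ennreal (g s r))))"
      by (rule c[OF gm _ mass_fin[OF that]]) (simp add: g_def)
    finally show ?thesis .
  qed
  show ?thesis
  proof (cases "m = n")
    case True
    define \<sigma> where "\<sigma> = s powr (- (1 / a))"
    have \<sigma>: "\<sigma> > 0" using s by (simp add: \<sigma>_def)
    have "\<sigma> powr a = inverse s"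
    proof -
      have "\<sigma> powr a = s powr (- (1 / a) * a)" unfolding \<sigma>_def by (rule powr_powr)
      also have "- (1 / a) * a = - 1" using a_pos by simp
      finally show ?thesis using s by (simp add: powr_minus)
    qed
    then have gs: "g s (\<sigma> * r) = \<sigma> powr (a - 2) * g 1 r" if "r > 0" for r
      using that \<sigma> s by (simp add: g_def powr_mult)
    have "radial_mass (d + ?N) (\<lambda>r. ennreal (g s r)) = ennreal (\<sigma> powr (d + ?N)) * radial_mass (d + ?N) (\<lambda>r. ennreal (g s (\<sigma> * r)))"
      by (rule radial_mass_scale[OF _ \<sigma>]) (use gm in measurable)
    also have "radial_mass (d + ?N) (\<lambda>r. ennreal (g s (\<sigma> * r))) = radial_mass (d + ?N) (\<lambda>r. ennreal (\<sigma> powr (a - 2)) * ennreal (g 1 r))"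
      by (rule radial_mass_cong) (simp add: gs ennreal_mult')
    also have "\<dots> = ennreal (\<sigma> powr (a - 2)) * radial_mass (d + ?N) (\<lambda>r. ennreal (g 1 r))"
    proof -
      note [measurable] = gm
      show ?thesis unfolding radial_mass_def by (subst nn_integral_cmult[symmetric]) (auto simp: mult.assoc)
    qed
    finally have "enn2real (radial_mass (d + ?N) (\<lambda>r. ennreal (g s r))) = \<sigma> powr (d + ?N) * \<sigma> powr (a - 2) * enn2real (radial_mass (d + ?N) (\<lambda>r. ennreal (g 1 r)))"
      by (simp add: enn2real_mult)
    moreover have "\<sigma> powr (d + ?N) * \<sigma> powr (a - 2) = s powr (- kappa m)"
    proof -
      have "\<sigma> powr (d + ?N) * \<sigma> powr (a - 2) = s powr (- (1 / a) * ((d + ?N) + (a - 2)))"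
        unfolding powr_add[symmetric] \<sigma>_def by (rule powr_powr)
      also have "- (1 / a) * ((d + ?N) + (a - 2)) = - kappa m"
        using a_pos True by (simp add: kappa_eq d_def field_simps)
      finally show ?thesis .
    qed
    ultimately show ?thesis using gram[OF s] gram[of 1] True by simp
  next
    case False
    define g0 where "g0 r = exp (- r\<^sup>2 / 2)" for r :: real
    have g0m: "g0 \<in> borel_measurable borel" unfolding g0_def by measurable
    have "gaussian_pairing (\<lambda>x. p x * cnj (q x)) = 0"
      by (rule gaussian_harmonics_orthogonal[OF p q' False])
    then have "(\<integral>x. G x * of_real (g0 (norm x)) \<partial>lborel) = 0"
      unfolding gaussian_pairing_def G_def g0_def by (simp add: ac_simps)
    moreover have dN: "d + ?N > 0"
    proof -
      have "sum k P \<ge> 0" using k_nonneg P_subset_R by (intro sum_nonneg) auto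
      then show ?thesis by (auto simp: d_def intro!: add_nonneg_pos)
    qed
    have fin0: "radial_mass (d + ?N) (\<lambda>r. ennreal (g0 r)) < \<infinity>"
    proof -
      have "radial_mass (d + ?N) (\<lambda>r. ennreal (g0 r)) = radial_mass (d + ?N) (\<lambda>r. ennreal (r powr 0 * exp (- (1/2) * r powr 2)))"
        by (rule radial_mass_cong) (simp add: g0_def powr_numeral)
      also have "\<dots> < \<infinity>" by (rule radial_mass_powr_exp_finite) (use dN in auto)
      finally show ?thesis .
    qed
    moreover have "radial_mass (d + ?N) (\<lambda>r. ennreal (g0 r)) > 0"
      by (rule radial_mass_pos) (use g0m in \<open>auto simp: g0_def\<close>)
    ultimately have "enn2real (radial_mass (d + ?N) (\<lambda>r. ennreal (g0 r))) > 0"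
      and "c * of_real (enn2real (radial_mass (d + ?N) (\<lambda>r. ennreal (g0 r)))) = 0"
      using c[OF g0m _ fin0] by (simp_all add: g0_def enn2real_positive_iff)
    then have "c = 0" by simp
    then show ?thesis using gram[OF s] False by simp
  qed
qed

text \<open>Both sides are holomorphic in the right half-plane and agree on the positive reals.\<close>

lemma gram_integral_eq:
  assumes p: "p \<in> dunkl_harmonics P k m" and q: "q \<in> dunkl_harmonics P k n" and s: "Re s > 0"
  shows "gram_integral p q s = (if m = n then gram_integral p q 1 * exp (- of_real (kappa m) * Ln s) else 0)"
proof -
  define \<Phi> where "\<Phi> s = (if m = n then gram_integral p q 1 * exp (- of_real (kappa m) * Ln s) else 0)" for s
  have "\<Phi> holomorphic_on {s. Re s > 0}"
    unfolding \<Phi>_def by (cases "m = n") (auto intro!: holomorphic_intros simp: complex_nonpos_Reals_iff)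
  then have hol: "(\<lambda>s. gram_integral p q s - \<Phi> s) holomorphic_on {s. Re s > 0}"
    by (intro holomorphic_intros gram_integral_holomorphic[OF p q])
  have "(\<lambda>s. gram_integral p q s - \<Phi> s) s = 0"
  proof (rule analytic_continuation[OF hol])
    show "open {s::complex. Re s > 0}" by (rule open_halfspace_Re_gt)
    show "connected {s::complex. Re s > 0}" by (intro convex_connected convex_halfspace_Re_gt)
    show "complex_of_real ` {0<..} \<subseteq> {s. Re s > 0}" by auto
    show "(1::complex) \<in> {s. Re s > 0}" "s \<in> {s. Re s > 0}" using s by auto
    show "(1::complex) islimpt complex_of_real ` {0<..}"
      unfolding islimpt_sequential
    proof (intro exI[of _ "\<lambda>n. complex_of_real (1 + inverse (real (Suc n)))"] conjI allI)
      show "complex_of_real (1 + inverse (real (Suc n))) \<in> complex_of_real ` {0<..} - {1}" for n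
      proof -
        have "complex_of_real (1 + inverse (real (Suc n))) \<noteq> of_real 1" unfolding of_real_eq_iff by simp
        moreover have "1 + inverse (real (Suc n)) > 0" by (intro add_pos_pos) auto
        ultimately show ?thesis by (intro DiffI imageI) auto
      qed
      have "(\<lambda>n. complex_of_real (1 + inverse (real (Suc n)))) \<longlonglongrightarrow> of_real (1 + 0)"
        by (intro tendsto_of_real tendsto_add tendsto_const LIMSEQ_inverse_real_of_nat)
      then show "(\<lambda>n. complex_of_real (1 + inverse (real (Suc n)))) \<longlonglongrightarrow> 1" by simp
    qed
    fix t assume "t \<in> complex_of_real ` {0<..}"
    then obtain r where r: "t = of_real r" "r > 0" by auto
    have e: "exp (- of_real (kappa m) * Ln (of_real r)) = complex_of_real (r powr - kappa m)"
      using r by (simp add: powr_def Ln_of_real exp_of_real[symmetric])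
    then show "gram_integral p q t - \<Phi> t = 0"
      unfolding \<Phi>_def r(1) gram_integral_real[OF p q r(2)] e by simp
  qed
  then show ?thesis by (simp add: \<Phi>_def)
qed

end

section \<open>The operators attached to paths\<close>

context dunkl_laguerre_setting
begin

lemma gauss_L2_tau: "p \<in> dunkl_harmonics P k m \<Longrightarrow> Im \<tau> > 0 \<Longrightarrow> gauss p j (- \<i> * \<tau>) \<in> L2 M"
  by (rule gauss_L2) auto

type_synonym 'b index = "nat \<times> (real^'b \<Rightarrow> complex) \<times> complex + (real^'b \<Rightarrow> complex)"

definition gauss_index :: "(nat \<times> (real^'n \<Rightarrow> complex) \<times> complex) set" where
  "gauss_index = {(m, p, \<tau>). p \<in> dunkl_harmonics P k m \<and> Im \<tau> > 0}"

definition complement :: "(real^'n \<Rightarrow> complex) set" where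
  "complement = {u \<in> L2 M. \<forall>(m, p, \<tau>) \<in> gauss_index. L2_inner M u (gauss p 0 (- \<i> * \<tau>)) = 0}"

text \<open>The family on which the group acts: the Gaussians, and all functions orthogonal to them, which are
  kept fixed and make the family total.\<close>

definition family :: "'n index set" where
  "family = Inl ` gauss_index \<union> Inr ` complement"

definition member :: "'n index \<Rightarrow> real^'n \<Rightarrow> complex" where
  "member i = (case i of Inl (m, p, \<tau>) \<Rightarrow> gauss p 0 (- \<i> * \<tau>) | Inr u \<Rightarrow> u)"

text \<open>The multiplier \<open>j(\<gamma>, \<tau>)\<^bsup>- \<kappa>\<^esup>\<close>, with the logarithm continued along \<open>\<gamma>\<close>.\<close>

definition factor :: "nat \<Rightarrow> (real \<Rightarrow> real^2^2) \<Rightarrow> complex \<Rightarrow> complex" where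
  "factor m \<gamma> \<tau> = exp (- of_real (kappa m) * path_log \<gamma> \<tau>)"

definition moved :: "(real \<Rightarrow> real^2^2) \<Rightarrow> 'n index \<Rightarrow> real^'n \<Rightarrow> complex" where
  "moved \<gamma> i = (case i of
      Inl (m, p, \<tau>) \<Rightarrow> (\<lambda>x. factor m \<gamma> \<tau> * gauss p 0 (- \<i> * mobius_act (\<gamma> 1) \<tau>) x)
    | Inr u \<Rightarrow> u)"

lemma family_cases [consumes 1, case_names gauss complement]:
  assumes "i \<in> family"
  obtains m p \<tau> where "i = Inl (m, p, \<tau>)" "p \<in> dunkl_harmonics P k m" "Im \<tau> > 0"
  | u where "i = Inr u" "u \<in> complement"
  using assms unfolding family_def gauss_index_def by blast

lemma member_simps [simp]: "member (Inl (m, p, \<tau>)) = gauss p 0 (- \<i> * \<tau>)" "member (Inr u) = u"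
  by (simp_all add: member_def)

lemma moved_simps [simp]:
  "moved \<gamma> (Inl (m, p, \<tau>)) = (\<lambda>x. factor m \<gamma> \<tau> * gauss p 0 (- \<i> * mobius_act (\<gamma> 1) \<tau>) x)"
  "moved \<gamma> (Inr u) = u"
  by (simp_all add: moved_def)

lemma family_gauss: "p \<in> dunkl_harmonics P k m \<Longrightarrow> Im \<tau> > 0 \<Longrightarrow> Inl (m, p, \<tau>) \<in> family"
  by (simp add: family_def gauss_index_def)

lemma complement_L2: "u \<in> complement \<Longrightarrow> u \<in> L2 M"
  by (simp add: complement_def)

lemma complement_orthogonal:
  assumes "u \<in> complement" "p \<in> dunkl_harmonics P k m" "Im \<tau> > 0"
  shows "L2_inner M u (gauss p 0 (- \<i> * \<tau>)) = 0" "L2_inner M (gauss p 0 (- \<i> * \<tau>)) u = 0"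
proof -
  have "(m, p, \<tau>) \<in> gauss_index" using assms by (simp add: gauss_index_def)
  then show 1: "L2_inner M u (gauss p 0 (- \<i> * \<tau>)) = 0" using assms(1) unfolding complement_def by blast
  show "L2_inner M (gauss p 0 (- \<i> * \<tau>)) u = 0" by (subst L2_inner_cnj) (simp only: 1 complex_cnj_zero)
qed

lemma complementI:
  assumes "u \<in> L2 M" "\<And>m p \<tau>. p \<in> dunkl_harmonics P k m \<Longrightarrow> Im \<tau> > 0 \<Longrightarrow> L2_inner M u (gauss p 0 (- \<i> * \<tau>)) = 0"
  shows "u \<in> complement"
  using assms unfolding complement_def gauss_index_def by blast

lemma path_end_SL2: "\<gamma> \<in> SL2_paths \<Longrightarrow> \<gamma> 1 \<in> SL2"
  by (rule SL2_pathsD(2)) auto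

lemma member_L2: "i \<in> family \<Longrightarrow> member i \<in> L2 M"
  by (erule family_cases) (simp_all only: member_simps gauss_L2_tau complement_L2)

lemma moved_L2: "\<gamma> \<in> SL2_paths \<Longrightarrow> i \<in> family \<Longrightarrow> moved \<gamma> i \<in> L2 M"
  by (erule family_cases)
    (simp_all only: moved_simps L2_cmult gauss_L2_tau mobius_act_upper_half_plane path_end_SL2 complement_L2)

lemma member_total: "L2_total M member family"
proof (rule L2_total_if_only_null_orthogonal[OF member_L2])
  fix u assume u: "u \<in> L2 M" and orth: "\<And>i. i \<in> family \<Longrightarrow> L2_inner M u (member i) = 0"
  have "u \<in> complement"
    by (rule complementI[OF u]) (use orth[OF family_gauss] in simp)
  then have "Inr u \<in> family" by (simp add: family_def)
  from orth[OF this] have "L2_inner M u u = 0" by simp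
  then show "L2_norm M u = 0" by (simp add: L2_inner_self)
qed

lemma SL2_inverse:
  assumes "A \<in> SL2"
  obtains B where "B \<in> SL2" "A ** B = mat 1"
proof -
  have "invertible A" using assms by (simp add: SL2_def invertible_det_nz)
  then obtain B where B: "A ** B = mat 1" unfolding invertible_def by blast
  then have "det A * det B = 1" by (metis det_mul det_I)
  then have "B \<in> SL2" using assms by (simp add: SL2_def)
  then show thesis using B that by blast
qed

text \<open>The parameters of the moved Gaussians again exhaust the upper half-plane, because \<open>\<gamma> 1\<close> acts
  bijectively on it. So a function orthogonal to all of them belongs to \<open>complement\<close>.\<close>

lemma moved_total:
  assumes \<gamma>: "\<gamma> \<in> SL2_paths"
  shows "L2_total M (moved \<gamma>) family"
proof (rule L2_total_if_only_null_orthogonal[OF moved_L2[OF \<gamma>]])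
  fix u assume u: "u \<in> L2 M" and orth: "\<And>i. i \<in> family \<Longrightarrow> L2_inner M u (moved \<gamma> i) = 0"
  have "u \<in> complement"
  proof (rule complementI[OF u])
    fix m p \<tau> assume p: "p \<in> dunkl_harmonics P k m" and \<tau>: "Im \<tau> > 0"
    obtain B where B: "B \<in> SL2" "\<gamma> 1 ** B = mat 1" using SL2_inverse[OF path_end_SL2[OF \<gamma>]] by blast
    define \<sigma> where "\<sigma> = mobius_act B \<tau>"
    have \<sigma>: "Im \<sigma> > 0" unfolding \<sigma>_def by (rule mobius_act_upper_half_plane[OF B(1) \<tau>])
    have "mobius_act (\<gamma> 1) \<sigma> = \<tau>"
      unfolding \<sigma>_def by (simp add: B(2) flip: mobius_act_mult[OF path_end_SL2[OF \<gamma>] B(1) \<tau>])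
    then have "L2_inner M u (\<lambda>x. factor m \<gamma> \<sigma> * gauss p 0 (- \<i> * \<tau>) x) = 0"
      using orth[OF family_gauss[OF p \<sigma>]] by simp
    then have "cnj (factor m \<gamma> \<sigma>) * L2_inner M u (gauss p 0 (- \<i> * \<tau>)) = 0"
      by (simp only: L2_inner_cmult_right)
    moreover have "cnj (factor m \<gamma> \<sigma>) \<noteq> 0" by (simp add: factor_def)
    ultimately show "L2_inner M u (gauss p 0 (- \<i> * \<tau>)) = 0" by (simp only: mult_eq_0_iff) blast
  qed
  then have "Inr u \<in> family" by (simp add: family_def)
  from orth[OF this] have "L2_inner M u u = 0" by simp
  then show "L2_norm M u = 0" by (simp add: L2_inner_self)
qed

lemma gauss_inner_tau:
  assumes p: "p \<in> dunkl_harmonics P k m" and q: "q \<in> dunkl_harmonics P k n"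
    and \<tau>: "Im \<tau> > 0" and \<sigma>: "Im \<sigma> > 0"
  shows "L2_inner M (gauss p 0 (- \<i> * \<tau>)) (gauss q 0 (- \<i> * \<sigma>))
    = (if m = n then gram_integral p q 1 * exp (- of_real (kappa m) * Ln (- \<i> * (\<tau> - cnj \<sigma>))) else 0)"
proof -
  have "- \<i> * \<tau> + cnj (- \<i> * \<sigma>) = - \<i> * (\<tau> - cnj \<sigma>)" by (simp add: algebra_simps)
  moreover have "Re (- \<i> * (\<tau> - cnj \<sigma>)) > 0" using \<tau> \<sigma> by simp
  ultimately show ?thesis unfolding gauss_inner by (simp only: gram_integral_eq[OF p q])
qed

text \<open>By \<open>gauss_inner_tau\<close> the inner product is \<open>(- \<i> (\<tau> - cnj \<sigma>))\<^bsup>- \<kappa>\<^esup>\<close> up to a constant, and \<open>path_log_gram\<close> states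
  that the two factors compensate the change of this kernel.\<close>

lemma moved_gram:
  assumes \<gamma>: "\<gamma> \<in> SL2_paths" and i: "i \<in> family" and j: "j \<in> family"
  shows "L2_inner M (moved \<gamma> i) (moved \<gamma> j) = L2_inner M (member i) (member j)"
  using i
proof (cases rule: family_cases)
  case i: (gauss m p \<tau>)
  let ?A = "\<gamma> 1"
  have i': "Im (mobius_act ?A \<tau>) > 0" by (rule mobius_act_upper_half_plane[OF path_end_SL2[OF \<gamma>] i(3)])
  from j show ?thesis
  proof (cases rule: family_cases)
    case j: (gauss n q \<sigma>)
    have j': "Im (mobius_act ?A \<sigma>) > 0" by (rule mobius_act_upper_half_plane[OF path_end_SL2[OF \<gamma>] j(3)])
    let ?L = "\<lambda>\<tau> \<sigma>. Ln (- \<i> * (\<tau> - cnj \<sigma>))"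
    have "factor m \<gamma> \<tau> * (cnj (factor m \<gamma> \<sigma>) * exp (- of_real (kappa m) * ?L (mobius_act ?A \<tau>) (mobius_act ?A \<sigma>)))
      = exp (- of_real (kappa m) * (path_log \<gamma> \<tau> + cnj (path_log \<gamma> \<sigma>) + ?L (mobius_act ?A \<tau>) (mobius_act ?A \<sigma>)))"
      unfolding factor_def exp_cnj exp_add[symmetric] by (simp add: algebra_simps)
    then have "factor m \<gamma> \<tau> * (cnj (factor m \<gamma> \<sigma>) * exp (- of_real (kappa m) * ?L (mobius_act ?A \<tau>) (mobius_act ?A \<sigma>)))
      = exp (- of_real (kappa m) * ?L \<tau> \<sigma>)"
      unfolding path_log_gram[OF \<gamma> i(3) j(3)] .
    then show ?thesis
      unfolding i(1) j(1) moved_simps member_simps L2_inner_cmult_left L2_inner_cmult_right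
        gauss_inner_tau[OF i(2) j(2) i(3) j(3)] gauss_inner_tau[OF i(2) j(2) i' j']
      by (cases "m = n") (simp_all add: mult.left_commute)
  next
    case j: (complement u)
    show ?thesis
      unfolding i(1) j(1) moved_simps member_simps L2_inner_cmult_left
        complement_orthogonal(2)[OF j(2) i(2) i(3)] complement_orthogonal(2)[OF j(2) i(2) i'] by simp
  qed
next
  case i: (complement u)
  from j show ?thesis
  proof (cases rule: family_cases)
    case j: (gauss n q \<sigma>)
    have j': "Im (mobius_act (\<gamma> 1) \<sigma>) > 0" by (rule mobius_act_upper_half_plane[OF path_end_SL2[OF \<gamma>] j(3)])
    show ?thesis
      unfolding i(1) j(1) moved_simps member_simps L2_inner_cmult_right
        complement_orthogonal(1)[OF i(2) j(2) j(3)] complement_orthogonal(1)[OF i(2) j(2) j'] by simp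
  next
    case j: (complement w)
    show ?thesis unfolding i(1) j(1) by simp
  qed
qed

lemma gram_equivalent_moved: "\<gamma> \<in> SL2_paths \<Longrightarrow> gram_equivalent M family member (moved \<gamma>)"
  by standard (simp_all only: member_L2 moved_L2 moved_gram member_total moved_total)

definition path_op :: "(real \<Rightarrow> real^2^2) \<Rightarrow> (real^'n \<Rightarrow> complex) \<Rightarrow> real^'n \<Rightarrow> complex" where
  "path_op \<gamma> = isometric_extension M family member (moved \<gamma>)"

lemma path_op_unitary: "\<gamma> \<in> SL2_paths \<Longrightarrow> L2_unitary M (path_op \<gamma>)"
  unfolding path_op_def by (rule gram_equivalent.U_unitary[OF gram_equivalent_moved])

lemma path_op_inner:
  "\<gamma> \<in> SL2_paths \<Longrightarrow> f \<in> L2 M \<Longrightarrow> i \<in> family \<Longrightarrow> L2_inner M (path_op \<gamma> f) (moved \<gamma> i) = L2_inner M f (member i)"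
  unfolding path_op_def by (rule gram_equivalent.U_inner[OF gram_equivalent_moved])

lemma path_op_eqI:
  "\<gamma> \<in> SL2_paths \<Longrightarrow> f \<in> L2 M \<Longrightarrow> u \<in> L2 M \<Longrightarrow>
    (\<And>i. i \<in> family \<Longrightarrow> L2_inner M u (moved \<gamma> i) = L2_inner M f (member i)) \<Longrightarrow>
    AE x in M. path_op \<gamma> f x = u x"
  unfolding path_op_def by (rule gram_equivalent.U_eqI[OF gram_equivalent_moved])

lemma path_op_member: "\<gamma> \<in> SL2_paths \<Longrightarrow> i \<in> family \<Longrightarrow> AE x in M. path_op \<gamma> (member i) x = moved \<gamma> i x"
  unfolding path_op_def by (rule gram_equivalent.U_basis[OF gram_equivalent_moved])

lemma path_op_L2: "\<gamma> \<in> SL2_paths \<Longrightarrow> f \<in> L2 M \<Longrightarrow> path_op \<gamma> f \<in> L2 M"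
  by (rule L2_unitaryD(1)[OF path_op_unitary])

lemma path_op_homotopic:
  assumes "(\<gamma>, \<delta>) \<in> SL2_homotopy"
  shows "path_op \<gamma> = path_op \<delta>"
proof -
  have \<gamma>: "\<gamma> \<in> SL2_paths" and hom: "homotopic_paths SL2 \<gamma> \<delta>" using assms by (auto simp: SL2_homotopy_def)
  have e: "\<gamma> 1 = \<delta> 1" using homotopic_paths_imp_pathfinish[OF hom] by (simp add: pathfinish_def)
  have "moved \<gamma> i = moved \<delta> i" if "i \<in> family" for i
    using that
  proof (cases rule: family_cases)
    case (gauss m p \<tau>)
    then show ?thesis by (simp add: factor_def e path_log_homotopic[OF hom SL2_pathsD(3)[OF \<gamma>]])
  qed simp
  then show ?thesis unfolding path_op_def isometric_extension_def by (simp cong: ball_cong)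
qed

text \<open>The cocycle law \<open>path_log_mult\<close>, tested against the total family \<open>moved\<close>.\<close>

lemma path_op_mult:
  assumes \<gamma>: "\<gamma> \<in> SL2_paths" and \<delta>: "\<delta> \<in> SL2_paths" and f: "f \<in> L2 M"
  shows "AE x in M. path_op (\<lambda>t. \<gamma> t ** \<delta> t) f x = path_op \<gamma> (path_op \<delta> f) x"
proof (rule path_op_eqI[OF SL2_paths_mult[OF \<gamma> \<delta>] f])
  have \<delta>f: "path_op \<delta> f \<in> L2 M" by (rule path_op_L2[OF \<delta> f])
  then show "path_op \<gamma> (path_op \<delta> f) \<in> L2 M" by (rule path_op_L2[OF \<gamma>])
  fix i assume i: "i \<in> family"
  then show "L2_inner M (path_op \<gamma> (path_op \<delta> f)) (moved (\<lambda>t. \<gamma> t ** \<delta> t) i) = L2_inner M f (member i)"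
  proof (cases rule: family_cases)
    case g: (gauss m p \<tau>)
    define \<sigma> where "\<sigma> = mobius_act (\<delta> 1) \<tau>"
    have \<sigma>: "Im \<sigma> > 0" unfolding \<sigma>_def by (rule mobius_act_upper_half_plane[OF path_end_SL2[OF \<delta>] g(3)])
    have fac: "factor m (\<lambda>t. \<gamma> t ** \<delta> t) \<tau> = factor m \<delta> \<tau> * factor m \<gamma> \<sigma>"
      unfolding factor_def path_log_mult[OF \<gamma> \<delta> g(3)] \<sigma>_def exp_add[symmetric] by (simp add: algebra_simps)
    have mv: "moved (\<lambda>t. \<gamma> t ** \<delta> t) i = (\<lambda>x. factor m \<delta> \<tau> * moved \<gamma> (Inl (m, p, \<sigma>)) x)"
      unfolding g(1) moved_simps fac mobius_act_mult[OF path_end_SL2[OF \<gamma>] path_end_SL2[OF \<delta>] g(3)]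
      by (simp add: \<sigma>_def mult.assoc)
    have "L2_inner M (path_op \<gamma> (path_op \<delta> f)) (moved (\<lambda>t. \<gamma> t ** \<delta> t) i)
      = cnj (factor m \<delta> \<tau>) * L2_inner M (path_op \<delta> f) (member (Inl (m, p, \<sigma>)))"
      unfolding mv L2_inner_cmult_right path_op_inner[OF \<gamma> \<delta>f family_gauss[OF g(2) \<sigma>]] ..
    also have "\<dots> = L2_inner M (path_op \<delta> f) (moved \<delta> i)"
      unfolding g(1) moved_simps member_simps L2_inner_cmult_right \<sigma>_def ..
    also have "\<dots> = L2_inner M f (member i)" by (rule path_op_inner[OF \<delta> f i])
    finally show ?thesis .
  next
    case c: (complement u)
    have "L2_inner M (path_op \<gamma> (path_op \<delta> f)) u = L2_inner M (path_op \<delta> f) u"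
      using path_op_inner[OF \<gamma> \<delta>f i] by (simp add: c(1))
    also have "\<dots> = L2_inner M f u" using path_op_inner[OF \<delta> f i] by (simp add: c(1))
    finally show ?thesis by (simp add: c(1))
  qed
qed

lemma const_path: "(\<lambda>t. mat 1) \<in> SL2_paths"
  by (rule SL2_pathsI) (simp_all add: SL2_one)

lemma path_op_one:
  assumes f: "f \<in> L2 M"
  shows "AE x in M. path_op (\<lambda>t. mat 1) f x = f x"
proof (rule path_op_eqI[OF const_path f f])
  fix i assume "i \<in> family"
  then have "moved (\<lambda>t. mat 1) i = member i"
    by (cases rule: family_cases) (simp_all add: factor_def path_log_one)
  then show "L2_inner M f (moved (\<lambda>t. mat 1) i) = L2_inner M f (member i)" by simp
qed

subsection \<open>Continuity of the Gaussians in their parameter\<close>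

text \<open>The difference quotient of the Gaussians in the parameter, with the derivative as its value on
  the diagonal, so that it can be composed with any function tending to \<open>z\<close>.\<close>

definition gauss_quotient :: "(real^'n \<Rightarrow> complex) \<Rightarrow> nat \<Rightarrow> complex \<Rightarrow> complex \<Rightarrow> real^'n \<Rightarrow> complex" where
  "gauss_quotient p j z v x =
     (if v = z then - gauss p (Suc j) z x else inverse (v - z) * (gauss p j v x - gauss p j z x))"

lemma gauss_quotient: "gauss p j v x - gauss p j z x = (v - z) * gauss_quotient p j z v x"
  by (simp add: gauss_quotient_def)

lemma gauss_uminus_L2:
  assumes "p \<in> dunkl_harmonics P k m" "Re z > 0"
  shows "(\<lambda>x. - gauss p j z x) \<in> L2 M"
  using L2_cmult[OF gauss_L2[OF assms, of j], of "-1"] by simp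

lemma gauss_quotient_L2:
  assumes p: "p \<in> dunkl_harmonics P k m" and z: "Re z > 0" and v: "Re v > 0"
  shows "gauss_quotient p j z v \<in> L2 M"
proof (cases "v = z")
  case True
  then show ?thesis using gauss_uminus_L2[OF p z, of "Suc j"] by (simp add: gauss_quotient_def[abs_def])
next
  case False
  have "(\<lambda>x. inverse (v - z) * (gauss p j v x - gauss p j z x)) \<in> L2 M"
    by (intro L2_cmult L2_diff gauss_L2[OF p] z v)
  then show ?thesis using False by (simp add: gauss_quotient_def[abs_def])
qed

lemma gauss_quotient_continuous:
  assumes p: "p \<in> dunkl_harmonics P k m" and z: "Re z > 0" and w: "(w \<longlongrightarrow> z) F"
  shows "L2_tendsto M F (\<lambda>h. gauss_quotient p j z (w h)) (\<lambda>x. - gauss p (Suc j) z x)"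
proof -
  define \<nu> where "\<nu> v = L2_norm M (\<lambda>x. gauss_quotient p j z v x - - gauss p (Suc j) z x)" for v
  have "((\<lambda>h. \<nu> (z + h)) \<longlongrightarrow> 0) (at 0)"
    using gauss_difference_quotient[OF p z, of j] unfolding L2_tendsto_def
  proof (rule Lim_transform_eventually)
    show "\<forall>\<^sub>F h in at 0. L2_norm M (\<lambda>x. inverse h * (gauss p j (z + h) x - gauss p j z x) - - gauss p (Suc j) z x) = \<nu> (z + h)"
      unfolding eventually_at_filter by (intro always_eventually allI impI) (simp add: \<nu>_def gauss_quotient_def)
  qed
  then have "(\<nu> \<longlongrightarrow> 0) (at z)" by (rule LIM_offset_zero_cancel)
  moreover have "\<nu> z = 0" by (simp add: \<nu>_def gauss_quotient_def L2_norm_zero)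
  ultimately have "isCont \<nu> z" by (simp add: isCont_def)
  from isCont_tendsto_compose[OF this w] show ?thesis
    unfolding L2_tendsto_def \<open>\<nu> z = 0\<close> by (simp only: \<nu>_def)
qed

lemma gauss_continuous:
  assumes p: "p \<in> dunkl_harmonics P k m" and z: "Re z > 0" and w: "(w \<longlongrightarrow> z) F"
  shows "L2_tendsto M F (\<lambda>h. gauss p j (w h)) (gauss p j z)"
proof (rule L2_tendstoI)
  let ?q = "gauss_quotient p j z"
  have q: "L2_tendsto M F (\<lambda>h. ?q (w h)) (\<lambda>x. - gauss p (Suc j) z x)"
    by (rule gauss_quotient_continuous[OF p z w])
  let ?n = "\<lambda>h. L2_norm M (\<lambda>x. ?q (w h) x - - gauss p (Suc j) z x)"
  have g1: "(\<lambda>x. - gauss p (Suc j) z x) \<in> L2 M" by (rule gauss_uminus_L2[OF p z])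
  have "\<forall>\<^sub>F h in F. Re (w h) > 0" using tendsto_Re[OF w] z by (rule order_tendstoD)
  then show "\<forall>\<^sub>F h in F. L2_norm M (\<lambda>x. gauss p j (w h) x - gauss p j z x)
      \<le> cmod (w h - z) * (?n h + L2_norm M (gauss p (Suc j) z))"
  proof eventually_elim
    case (elim h)
    have qL: "?q (w h) \<in> L2 M" by (rule gauss_quotient_L2[OF p z elim])
    have "L2_norm M (\<lambda>x. gauss p j (w h) x - gauss p j z x) = L2_norm M (\<lambda>x. (w h - z) * ?q (w h) x)"
      by (simp only: gauss_quotient)
    also have "\<dots> = cmod (w h - z) * L2_norm M (?q (w h))" by (rule L2_norm_cmult)
    finally have eq: "L2_norm M (\<lambda>x. gauss p j (w h) x - gauss p j z x) = cmod (w h - z) * L2_norm M (?q (w h))" .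
    have "L2_norm M (?q (w h)) \<le> ?n h + L2_norm M (gauss p (Suc j) z)"
      using L2_norm_triangle[OF L2_diff[OF qL g1] g1] by (simp add: L2_norm_uminus)
    then show ?case unfolding eq by (rule mult_left_mono) simp
  qed
  have "((\<lambda>h. cmod (w h - z) * (?n h + L2_norm M (gauss p (Suc j) z))) \<longlongrightarrow> cmod (z - z) * (0 + L2_norm M (gauss p (Suc j) z))) F"
    by (intro tendsto_intros w q[unfolded L2_tendsto_def])
  then show "((\<lambda>h. cmod (w h - z) * (?n h + L2_norm M (gauss p (Suc j) z))) \<longlongrightarrow> 0) F" by simp
qed

subsection \<open>The representation of the universal cover\<close>

text \<open>By \<open>path_op_homotopic\<close> all paths in a class give the same operator.\<close>

definition Omega :: "(real \<Rightarrow> real^2^2) set \<Rightarrow> (real^'n \<Rightarrow> complex) \<Rightarrow> real^'n \<Rightarrow> complex" where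
  "Omega c = path_op (SOME \<gamma>. \<gamma> \<in> c)"

lemma SL2_homotopy_refl: "\<gamma> \<in> SL2_paths \<Longrightarrow> (\<gamma>, \<gamma>) \<in> SL2_homotopy"
  unfolding SL2_homotopy_def SL2_paths_def by (simp add: homotopic_paths_refl)

lemma Omega_class:
  assumes "\<gamma> \<in> SL2_paths"
  shows "Omega (SL2_homotopy `` {\<gamma>}) = path_op \<gamma>"
proof -
  have "\<gamma> \<in> SL2_homotopy `` {\<gamma>}" using SL2_homotopy_refl[OF assms] by simp
  then have "(SOME \<delta>. \<delta> \<in> SL2_homotopy `` {\<gamma>}) \<in> SL2_homotopy `` {\<gamma>}"
    by (rule someI[where P = "\<lambda>\<delta>. \<delta> \<in> SL2_homotopy `` {\<gamma>}"])
  then show ?thesis unfolding Omega_def by (simp add: path_op_homotopic[of \<gamma>])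
qed

lemma carrier_class:
  assumes "c \<in> carrier SL2_cover"
  obtains \<gamma> where "\<gamma> \<in> SL2_paths" "c = SL2_homotopy `` {\<gamma>}"
  using assms by (auto simp: SL2_cover_def quotient_def)

lemma Omega_element:
  assumes "c \<in> carrier SL2_cover" "\<gamma> \<in> c"
  shows "\<gamma> \<in> SL2_paths" "Omega c = path_op \<gamma>"
proof -
  obtain \<delta> where \<delta>: "\<delta> \<in> SL2_paths" "c = SL2_homotopy `` {\<delta>}" by (rule carrier_class[OF assms(1)])
  then have h: "(\<delta>, \<gamma>) \<in> SL2_homotopy" using assms(2) by simp
  then show "\<gamma> \<in> SL2_paths" by (simp add: SL2_homotopy_def)
  show "Omega c = path_op \<gamma>" unfolding \<delta>(2) Omega_class[OF \<delta>(1)] by (rule path_op_homotopic[OF h])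
qed

lemma Omega_mult:
  assumes c: "c \<in> carrier SL2_cover" and d: "d \<in> carrier SL2_cover" and f: "f \<in> L2 M"
  shows "AE x in M. Omega (c \<otimes>\<^bsub>SL2_cover\<^esub> d) f x = Omega c (Omega d f) x"
proof -
  let ?cd = "c \<otimes>\<^bsub>SL2_cover\<^esub> d"
  have cd: "?cd = (\<Union>\<gamma>\<in>c. \<Union>\<delta>\<in>d. SL2_homotopy `` {\<lambda>t. \<gamma> t ** \<delta> t})" by (simp add: SL2_cover_def)
  obtain \<gamma> where \<gamma>: "\<gamma> \<in> SL2_paths" "c = SL2_homotopy `` {\<gamma>}" by (rule carrier_class[OF c])
  obtain \<delta> where \<delta>: "\<delta> \<in> SL2_paths" "d = SL2_homotopy `` {\<delta>}" by (rule carrier_class[OF d])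
  have "(\<lambda>t. \<gamma> t ** \<delta> t) \<in> SL2_homotopy `` {\<lambda>t. \<gamma> t ** \<delta> t}"
    using SL2_homotopy_refl[OF SL2_paths_mult[OF \<gamma>(1) \<delta>(1)]] by simp
  moreover have "\<gamma> \<in> c" "\<delta> \<in> d" using SL2_homotopy_refl \<gamma> \<delta> by auto
  ultimately have "(\<lambda>t. \<gamma> t ** \<delta> t) \<in> ?cd" unfolding cd by blast
  then have "(SOME \<rho>. \<rho> \<in> ?cd) \<in> ?cd" by (rule someI[where P = "\<lambda>\<rho>. \<rho> \<in> ?cd"])
  then obtain \<gamma>' \<delta>' where *: "\<gamma>' \<in> c" "\<delta>' \<in> d" "((\<lambda>t. \<gamma>' t ** \<delta>' t), (SOME \<rho>. \<rho> \<in> ?cd)) \<in> SL2_homotopy"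
    unfolding cd by blast
  have "Omega ?cd = path_op (\<lambda>t. \<gamma>' t ** \<delta>' t)"
    unfolding Omega_def by (rule path_op_homotopic[OF *(3), symmetric])
  then show ?thesis
    using path_op_mult[OF Omega_element(1)[OF c *(1)] Omega_element(1)[OF d *(2)] f]
    by (simp only: Omega_element(2)[OF c *(1)] Omega_element(2)[OF d *(2)])
qed

text \<open>A class near \<open>c\<close> prolongs a path in \<open>c\<close> by a short path \<open>\<eta>\<close>. Along \<open>\<eta>\<close> the automorphy factor
  stays in a half-plane, so its logarithm is continued by the principal branch.\<close>

lemma Omega_continuous_gauss:
  assumes c: "c \<in> carrier SL2_cover" and p: "p \<in> dunkl_harmonics P k m" and \<tau>: "Im \<tau> > 0"
  shows "L2_tendsto M (atin SL2_cover_topology c) (\<lambda>h. Omega h (gauss p 0 (- \<i> * \<tau>))) (Omega c (gauss p 0 (- \<i> * \<tau>)))"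
  unfolding L2_tendsto_def
proof (rule tendstoI)
  fix \<epsilon> :: real assume \<epsilon>: "\<epsilon> > 0"
  obtain \<gamma> where \<gamma>: "\<gamma> \<in> SL2_paths" "c = SL2_homotopy `` {\<gamma>}" by (rule carrier_class[OF c])
  have \<gamma>c: "\<gamma> \<in> c" using SL2_homotopy_refl \<gamma> by auto
  define A0 where "A0 = \<gamma> 1"
  have A0: "A0 \<in> SL2" unfolding A0_def by (rule path_end_SL2[OF \<gamma>(1)])
  define j0 where "j0 = auto_factor A0 \<tau>"
  have j0: "j0 \<noteq> 0" unfolding j0_def by (rule auto_factor_nonzero[OF A0 \<tau>])
  define L0 where "L0 = path_log \<gamma> \<tau>"
  define s where "s A = exp (- of_real (kappa m) * (L0 + Ln (auto_factor A \<tau> / j0)))" for A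
  define \<Psi> where "\<Psi> A = (\<lambda>x. s A * gauss p 0 (- \<i> * mobius_act A \<tau>) x)" for A
  have j_lim: "((\<lambda>A. auto_factor A \<tau> / j0) \<longlongrightarrow> 1) (at A0 within SL2)"
  proof -
    have "((\<lambda>A. auto_factor A \<tau> / j0) \<longlongrightarrow> auto_factor A0 \<tau> / j0) (at A0 within SL2)"
      unfolding auto_factor_def by (intro tendsto_intros j0)
    then show ?thesis using j0 by (simp add: j0_def)
  qed
  have s_lim: "(s \<longlongrightarrow> s A0) (at A0 within SL2)"
  proof -
    have e1: "auto_factor A0 \<tau> / j0 = 1" using j0 by (simp add: j0_def)
    show ?thesis unfolding s_def e1 by (intro tendsto_intros j_lim) simp
  qed
  have m_lim: "((\<lambda>A. - \<i> * mobius_act A \<tau>) \<longlongrightarrow> - \<i> * mobius_act A0 \<tau>) (at A0 within SL2)"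
    unfolding mobius_act_def auto_factor_def
    by (intro tendsto_intros) (use j0 in \<open>simp add: j0_def auto_factor_def\<close>)
  have m0: "Im (mobius_act A0 \<tau>) > 0" by (rule mobius_act_upper_half_plane[OF A0 \<tau>])
  have inL2: "\<Psi> A \<in> L2 M" if "A \<in> SL2" for A
    unfolding \<Psi>_def by (intro L2_cmult gauss_L2_tau[OF p] mobius_act_upper_half_plane that \<tau>)
  have "L2_tendsto M (at A0 within SL2) \<Psi> (\<Psi> A0)"
    unfolding \<Psi>_def
  proof (rule L2_tendsto_cmult[OF s_lim])
    show "L2_tendsto M (at A0 within SL2) (\<lambda>A. gauss p 0 (- \<i> * mobius_act A \<tau>)) (gauss p 0 (- \<i> * mobius_act A0 \<tau>))"
      by (rule gauss_continuous[OF p _ m_lim]) (use m0 in simp)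
    show "\<forall>\<^sub>F A in at A0 within SL2. gauss p 0 (- \<i> * mobius_act A \<tau>) \<in> L2 M"
      unfolding eventually_at_filter
      by (intro always_eventually allI impI gauss_L2_tau[OF p] mobius_act_upper_half_plane \<tau>)
  qed (rule gauss_L2_tau[OF p m0])
  then have "\<forall>\<^sub>F A in at A0 within SL2. dist (L2_norm M (\<lambda>x. \<Psi> A x - \<Psi> A0 x)) 0 < \<epsilon>"
    unfolding L2_tendsto_def using \<epsilon> by (rule tendstoD)
  moreover have "\<forall>\<^sub>F A in at A0 within SL2. Re (auto_factor A \<tau> / j0) > 0"
    by (rule order_tendstoD[OF tendsto_Re[OF j_lim]]) simp
  ultimately have "\<forall>\<^sub>F A in at A0 within SL2. L2_norm M (\<lambda>x. \<Psi> A x - \<Psi> A0 x) < \<epsilon> \<and> Re (auto_factor A \<tau> / j0) > 0"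
    by eventually_elim (simp add: L2_norm_nonneg abs_of_nonneg)
  then obtain \<delta> where \<delta>: "\<delta> > 0" "\<And>A. A \<in> SL2 \<Longrightarrow> A \<noteq> A0 \<Longrightarrow> dist A A0 < \<delta> \<Longrightarrow>
      L2_norm M (\<lambda>x. \<Psi> A x - \<Psi> A0 x) < \<epsilon> \<and> Re (auto_factor A \<tau> / j0) > 0"
    unfolding eventually_at by blast
  define U where "U = SL2 \<inter> ball A0 \<delta>"
  have U: "L2_norm M (\<lambda>x. \<Psi> A x - \<Psi> A0 x) < \<epsilon>" "Re (auto_factor A \<tau> / j0) > 0" if "A \<in> U" for A
    using \<delta>(2)[of A] that \<epsilon> j0 by (cases "A = A0"; simp add: U_def dist_commute L2_norm_zero j0_def)+
  have openU: "openin (top_of_set SL2) U" unfolding U_def by (rule openin_open_Int) simp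
  have basic_open: "openin SL2_cover_topology (SL2_cover_basic c U)"
    unfolding SL2_cover_topology_def by (rule topology_generated_by_Basis) (use c openU in blast)
  have c_in: "c \<in> SL2_cover_basic c U"
  proof -
    define \<eta> where "\<eta> = (\<lambda>t::real. A0)"
    have path_\<gamma>: "path \<gamma>" "path_image \<gamma> \<subseteq> SL2" using \<gamma>(1) by (auto simp: SL2_paths_def)
    have "path \<eta>" "path_image \<eta> \<subseteq> U" "pathstart \<eta> = pathfinish \<gamma>"
      using A0 \<delta>(1) by (auto simp: \<eta>_def path_def path_image_def pathstart_def pathfinish_def A0_def U_def)
    moreover have "homotopic_paths SL2 (\<gamma> +++ linepath (pathfinish \<gamma>) (pathfinish \<gamma>)) \<gamma>"
      by (rule homotopic_paths_rid[OF path_\<gamma>])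
    then have "homotopic_paths SL2 (\<gamma> +++ \<eta>) \<gamma>"
      by (simp add: \<eta>_def linepath_refl A0_def pathfinish_def)
    then have h: "(\<gamma> +++ \<eta>, \<gamma>) \<in> SL2_homotopy"
      using \<gamma>(1) homotopic_paths_imp_path[of SL2 "\<gamma> +++ \<eta>" \<gamma>] homotopic_paths_imp_subset[of SL2 "\<gamma> +++ \<eta>" \<gamma>]
        homotopic_paths_imp_pathstart[of SL2 "\<gamma> +++ \<eta>" \<gamma>]
      by (simp add: SL2_homotopy_def SL2_paths_def)
    have "SL2_homotopy `` {\<gamma> +++ \<eta>} = c"
      unfolding \<gamma>(2) using h by (auto simp: SL2_homotopy_def intro: homotopic_paths_trans homotopic_paths_sym)
    ultimately show ?thesis unfolding SL2_cover_basic_def using \<gamma>c by blast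
  qed
  have close: "L2_norm M (\<lambda>x. Omega h (gauss p 0 (- \<i> * \<tau>)) x - Omega c (gauss p 0 (- \<i> * \<tau>)) x) < \<epsilon>"
    if h: "h \<in> SL2_cover_basic c U" for h
  proof -
    obtain \<gamma>' \<eta> where h: "h = SL2_homotopy `` {\<gamma>' +++ \<eta>}" "\<gamma>' \<in> c" "path \<eta>" "path_image \<eta> \<subseteq> U" "pathstart \<eta> = pathfinish \<gamma>'"
      using h unfolding SL2_cover_basic_def by blast
    have \<gamma>': "\<gamma>' \<in> SL2_paths" by (rule Omega_element(1)[OF c h(2)])
    have hom: "homotopic_paths SL2 \<gamma> \<gamma>'" using h(2) unfolding \<gamma>(2) by (simp add: SL2_homotopy_def)
    have e: "\<gamma>' 1 = A0" using homotopic_paths_imp_pathfinish[OF hom] by (simp add: A0_def pathfinish_def)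
    have L: "path_log \<gamma>' \<tau> = L0" unfolding L0_def
      by (rule path_log_homotopic[OF hom SL2_pathsD(3)[OF \<gamma>(1)] \<tau>, symmetric])
    have join: "\<gamma>' +++ \<eta> \<in> SL2_paths"
      using \<gamma>' h(3-5) by (auto simp: SL2_paths_def U_def path_image_join intro!: path_join_imp)
    have \<eta>1: "\<eta> 1 \<in> U" using h(4) by (auto simp: path_image_def)
    have "path_log (\<gamma>' +++ \<eta>) \<tau> = path_log \<gamma>' \<tau> + Ln (auto_factor (\<eta> 1) \<tau> / auto_factor (\<gamma>' 1) \<tau>)"
      by (rule path_log_join[OF \<gamma>' \<tau> h(3) h(5)]) (use U(2) h(4) in \<open>auto simp: e j0_def\<close>)
    then have "factor m (\<gamma>' +++ \<eta>) \<tau> = s (\<eta> 1)" unfolding factor_def s_def by (simp add: L e j0_def)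
    then have mv: "moved (\<gamma>' +++ \<eta>) (Inl (m, p, \<tau>)) = \<Psi> (\<eta> 1)"
      unfolding moved_simps \<Psi>_def by (simp add: joinpaths_def)
    have "AE x in M. Omega h (gauss p 0 (- \<i> * \<tau>)) x = \<Psi> (\<eta> 1) x"
      using path_op_member[OF join family_gauss[OF p \<tau>]] unfolding mv h(1) Omega_class[OF join] by simp
    moreover have "moved \<gamma> (Inl (m, p, \<tau>)) = \<Psi> A0"
      unfolding moved_simps \<Psi>_def factor_def s_def using j0 by (simp add: A0_def[symmetric] j0_def L0_def)
    then have "AE x in M. Omega c (gauss p 0 (- \<i> * \<tau>)) x = \<Psi> A0 x"
      using path_op_member[OF \<gamma>(1) family_gauss[OF p \<tau>]] unfolding \<gamma>(2) Omega_class[OF \<gamma>(1)] by simp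
    ultimately have ae: "AE x in M. Omega h (gauss p 0 (- \<i> * \<tau>)) x - Omega c (gauss p 0 (- \<i> * \<tau>)) x = \<Psi> (\<eta> 1) x - \<Psi> A0 x"
      by eventually_elim simp
    have "L2_norm M (\<lambda>x. Omega h (gauss p 0 (- \<i> * \<tau>)) x - Omega c (gauss p 0 (- \<i> * \<tau>)) x) = L2_norm M (\<lambda>x. \<Psi> (\<eta> 1) x - \<Psi> A0 x)"
    proof (rule L2_norm_cong_AE[OF ae])
      show "(\<lambda>x. Omega h (gauss p 0 (- \<i> * \<tau>)) x - Omega c (gauss p 0 (- \<i> * \<tau>)) x) \<in> borel_measurable M"
        unfolding h(1) Omega_class[OF join] \<gamma>(2) Omega_class[OF \<gamma>(1)]
        by (intro L2_measurable L2_diff path_op_L2 join \<gamma>(1) gauss_L2_tau[OF p \<tau>])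
      show "(\<lambda>x. \<Psi> (\<eta> 1) x - \<Psi> A0 x) \<in> borel_measurable M"
        by (intro L2_measurable L2_diff inL2 A0) (use \<eta>1 in \<open>simp add: U_def\<close>)
    qed
    then show ?thesis using U(1)[OF \<eta>1] by simp
  qed
  show "\<forall>\<^sub>F h in atin SL2_cover_topology c. dist (L2_norm M (\<lambda>x. Omega h (gauss p 0 (- \<i> * \<tau>)) x - Omega c (gauss p 0 (- \<i> * \<tau>)) x)) 0 < \<epsilon>"
    unfolding eventually_atin
  proof (intro disjI2 exI conjI ballI)
    show "openin SL2_cover_topology (SL2_cover_basic c U)" by (rule basic_open)
    show "c \<in> SL2_cover_basic c U" by (rule c_in)
    fix h assume "h \<in> SL2_cover_basic c U - {c}"
    then have "h \<in> SL2_cover_basic c U" by simp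
    from close[OF this] show "dist (L2_norm M (\<lambda>x. Omega h (gauss p 0 (- \<i> * \<tau>)) x - Omega c (gauss p 0 (- \<i> * \<tau>)) x)) 0 < \<epsilon>"
      by (simp add: L2_norm_nonneg abs_of_nonneg)
  qed
qed

lemma SL2_cover_topology_carrier:
  assumes "h \<in> topspace SL2_cover_topology"
  shows "h \<in> carrier SL2_cover"
proof -
  obtain c U where c: "c \<in> carrier SL2_cover" and U: "openin (top_of_set SL2) U" and h: "h \<in> SL2_cover_basic c U"
    using assms unfolding SL2_cover_topology_def topology_generated_by_topspace by blast
  obtain \<gamma> \<eta> where *: "h = SL2_homotopy `` {\<gamma> +++ \<eta>}" "\<gamma> \<in> c" "path \<eta>" "path_image \<eta> \<subseteq> U" "pathstart \<eta> = pathfinish \<gamma>"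
    using h unfolding SL2_cover_basic_def by blast
  have "U \<subseteq> SL2" using openin_subset[OF U] by simp
  then have "\<gamma> +++ \<eta> \<in> SL2_paths"
    using Omega_element(1)[OF c *(2)] *(3-5) by (auto simp: SL2_paths_def path_image_join intro!: path_join_imp)
  then show ?thesis unfolding *(1) SL2_cover_def by (simp add: quotientI)
qed

lemma Omega_unitary: "c \<in> carrier SL2_cover \<Longrightarrow> L2_unitary M (Omega c)"
  by (erule carrier_class) (simp add: Omega_class path_op_unitary)

lemma Omega_representation: "unitary_representation SL2_cover SL2_cover_topology M Omega"
  unfolding unitary_representation_def
proof (intro conjI ballI)
  fix f g assume f: "f \<in> L2 M" and g: "g \<in> carrier SL2_cover"
  have "L2_tendsto M (atin SL2_cover_topology g) (\<lambda>h. Omega h f) (Omega g f)"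
  proof (rule L2_unitary_tendsto[OF _ Omega_unitary[OF g] member_total member_L2 _ f])
    have "\<forall>\<^sub>F h in atin SL2_cover_topology g. h \<in> topspace SL2_cover_topology"
      unfolding eventually_atin by (cases "g \<in> topspace SL2_cover_topology") auto
    then show "\<forall>\<^sub>F h in atin SL2_cover_topology g. L2_unitary M (Omega h)"
      by eventually_elim (intro Omega_unitary SL2_cover_topology_carrier)
    fix i assume i: "i \<in> family"
    then show "L2_tendsto M (atin SL2_cover_topology g) (\<lambda>h. Omega h (member i)) (Omega g (member i))"
    proof (cases rule: family_cases)
      case (gauss m p \<tau>)
      then show ?thesis using Omega_continuous_gauss[OF g] by simp
    next
      case (complement u)
      have fix_u: "AE x in M. Omega c u x = u x" if c: "c \<in> carrier SL2_cover" for c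
      proof -
        obtain \<gamma> where \<gamma>: "\<gamma> \<in> SL2_paths" "c = SL2_homotopy `` {\<gamma>}" by (rule carrier_class[OF c])
        show ?thesis using path_op_member[OF \<gamma>(1) i] unfolding \<gamma>(2) Omega_class[OF \<gamma>(1)] complement(1) by simp
      qed
      have u: "u \<in> L2 M" by (rule complement_L2[OF complement(2)])
      have "L2_norm M (\<lambda>x. Omega h u x - Omega g u x) = 0" if h: "h \<in> carrier SL2_cover" for h
      proof -
        have "AE x in M. Omega h u x - Omega g u x = 0"
          using fix_u[OF h] fix_u[OF g] by eventually_elim simp
        then show ?thesis
          by (subst L2_norm_eq_0_iff) (intro L2_diff L2_unitaryD(1)[OF Omega_unitary] h g u)
      qed
      moreover have "\<forall>\<^sub>F h in atin SL2_cover_topology g. h \<in> carrier SL2_cover"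
        using \<open>\<forall>\<^sub>F h in atin SL2_cover_topology g. h \<in> topspace SL2_cover_topology\<close>
        by eventually_elim (rule SL2_cover_topology_carrier)
      ultimately have "\<forall>\<^sub>F h in atin SL2_cover_topology g. L2_norm M (\<lambda>x. Omega h u x - Omega g u x) \<le> 0"
        by (auto elim: eventually_mono)
      then show ?thesis unfolding complement(1) member_simps by (rule L2_tendstoI) (rule tendsto_const)
    qed
  qed
  then show "((\<lambda>h. L2_norm M (\<lambda>x. Omega h f x - Omega g f x)) \<longlongrightarrow> 0) (atin SL2_cover_topology g)"
    by (simp add: L2_tendsto_def)
next
  fix f assume f: "f \<in> L2 M"
  show "AE x in M. Omega \<one>\<^bsub>SL2_cover\<^esub> f x = f x"
    using path_op_one[OF f] Omega_class[OF const_path] by (simp add: SL2_cover_def)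
qed (simp_all only: Omega_unitary Omega_mult)

end

section \<open>The generators on Gaussians\<close>

lemma (in unitary_group) generates_scaled_diff:
  assumes "f \<in> L2 M" "f' \<in> L2 M" "generates f g" "generates f' g'"
  shows "generates (\<lambda>x. c * (f' x - f x)) (\<lambda>x. c * (g' x - g x))"
proof -
  have "generates (\<lambda>x. \<Sum>i\<in>(UNIV::bool set). (if i then c else - c) * (if i then f' else f) x)
      (\<lambda>x. \<Sum>i\<in>(UNIV::bool set). (if i then c else - c) * (if i then g' else g) x)"
    by (rule generates_combination) (use assms in auto)
  then show ?thesis by (simp add: UNIV_bool algebra_simps)
qed

lemma L2_unitary_id: "L2_unitary M (\<lambda>f. f)"
  unfolding L2_unitary_def by auto

lemma vector_derivative_quotient:
  fixes f :: "real \<Rightarrow> complex"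
  assumes "(f has_vector_derivative D) (at 0)"
  shows "((\<lambda>t. (f t - f 0) / of_real t) \<longlongrightarrow> D) (at 0)"
proof (rule LIM_zero_cancel, rule tendsto_norm_zero_cancel)
  have "((\<lambda>t. norm (f t - f 0 - (t - 0) *\<^sub>R D) / norm (t - 0)) \<longlongrightarrow> 0) (at 0)"
    using assms unfolding has_vector_derivative_def has_derivative_iff_norm by blast
  then show "((\<lambda>t. norm ((f t - f 0) / of_real t - D)) \<longlongrightarrow> 0) (at 0)"
  proof (rule Lim_transform_eventually)
    show "\<forall>\<^sub>F t in at 0. norm (f t - f 0 - (t - 0) *\<^sub>R D) / norm (t - 0) = norm ((f t - f 0) / of_real t - D)"
      unfolding eventually_at_filter
    proof (intro always_eventually allI impI)
      fix t :: real assume t: "t \<noteq> 0"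
      have "(f t - f 0) / of_real t - D = (f t - f 0 - (t - 0) *\<^sub>R D) / of_real t"
        using t by (simp add: field_simps scaleR_conv_of_real)
      then show "norm (f t - f 0 - (t - 0) *\<^sub>R D) / norm (t - 0) = norm ((f t - f 0) / of_real t - D)"
        by (simp add: norm_divide)
    qed
  qed
qed

definition exp_path :: "real^2^2 \<Rightarrow> real \<Rightarrow> real \<Rightarrow> real^2^2" where
  "exp_path X t s = matrix_exp (s *\<^sub>R (t *\<^sub>R X))"

lemma exp_path_eq: "exp_path X t s = matrix_exp ((s * t) *\<^sub>R X)"
  by (simp add: exp_path_def)

lemma exp_path_SL2_paths: "X \<in> sl2 \<Longrightarrow> exp_path X t \<in> SL2_paths"
proof (rule SL2_pathsI)
  assume X: "X \<in> sl2"
  have "continuous_on {0..1} ((\<lambda>t. matrix_exp (t *\<^sub>R X)) \<circ> (\<lambda>s. s * t))"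
    by (intro continuous_on_compose matrix_exp_continuous X continuous_intros)
  then show "continuous_on {0..1} (exp_path X t)" by (simp add: exp_path_eq[abs_def] o_def)
  show "exp_path X t s \<in> SL2" for s unfolding exp_path_eq by (rule matrix_exp_SL2[OF X])
  show "exp_path X t 0 = mat 1" using matrix_exp_0[OF X] by (simp add: exp_path_eq)
qed

lemma exp_path_add: "X \<in> sl2 \<Longrightarrow> exp_path X (s + t) = (\<lambda>r. exp_path X s r ** exp_path X t r)"
  by (auto simp: exp_path_eq distrib_left matrix_exp_add)

lemma exp_path_zero: "X \<in> sl2 \<Longrightarrow> exp_path X 0 = (\<lambda>r. mat 1)"
  using matrix_exp_0 by (auto simp: exp_path_eq)

text \<open>The entries of \<open>exp (t X)\<close> have the derivatives \<open>X $ i $ j\<close> at \<open>t = 0\<close>, and \<open>auto_factor\<close> is linear in them.\<close>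

lemma auto_factor_exp_derivative:
  assumes X: "X \<in> sl2"
  shows "((\<lambda>t. auto_factor (exp_path X t 1) \<tau>) has_vector_derivative auto_factor X \<tau>) (at 0)"
proof -
  have e: "((\<lambda>t. of_real (matrix_exp (t *\<^sub>R X) $ i $ j)) has_vector_derivative complex_of_real (X $ i $ j)) (at 0)" for i j
    using matrix_exp_entry_derivative[OF X, of i j] has_vector_derivative_of_real has_real_derivative_iff_has_vector_derivative by blast
  show ?thesis
    unfolding auto_factor_def exp_path_eq mult_1
    by (intro has_vector_derivative_add has_vector_derivative_mult_left e)
qed

lemma path_log_exp_derivative:
  assumes X: "X \<in> sl2" and \<tau>: "Im \<tau> > 0"
  shows "((\<lambda>t. exp (c * path_log (exp_path X t) \<tau>)) has_vector_derivative c * auto_factor X \<tau>) (at 0)"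
proof -
  define A where "A t = auto_factor (exp_path X t 1) \<tau>" for t
  have A0: "A 0 = 1" by (simp add: A_def exp_path_zero[OF X])
  have dA: "(A has_vector_derivative auto_factor X \<tau>) (at 0)"
    unfolding A_def by (rule auto_factor_exp_derivative[OF X])
  have "((\<lambda>w. exp (c * Ln w)) has_field_derivative c) (at (A 0))"
    unfolding A0 by (auto intro!: derivative_eq_intros)
  from field_vector_diff_chain_at[OF dA this]
  have d: "((\<lambda>t. exp (c * Ln (A t))) has_vector_derivative c * auto_factor X \<tau>) (at 0)"
    by (simp add: o_def mult.commute)
  have "isCont A 0" using dA by (rule has_vector_derivative_continuous)
  then have "((\<lambda>t. Re (A t)) \<longlongrightarrow> Re (A 0)) (at 0)" unfolding isCont_def by (rule tendsto_Re)
  then have "\<forall>\<^sub>F t in at 0. Re (A t) > 0" by (rule order_tendstoD) (simp add: A0)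
  then obtain \<delta> where \<delta>: "\<delta> > 0" "\<And>t. t \<noteq> 0 \<Longrightarrow> dist t 0 < \<delta> \<Longrightarrow> Re (A t) > 0"
    unfolding eventually_at by blast
  have pos: "Re (A t) > 0" if "\<bar>t\<bar> < \<delta>" for t
    using \<delta>(2)[of t] that A0 by (cases "t = 0") simp_all
  have eq: "path_log (exp_path X t) \<tau> = Ln (A t)" if t: "\<bar>t\<bar> < \<delta>" for t
    unfolding A_def
  proof (rule path_log_Ln[OF exp_path_SL2_paths[OF X]])
    fix s :: real assume s: "s \<in> {0..1}"
    have "\<bar>s * t\<bar> \<le> \<bar>t\<bar>" using s by (simp add: abs_mult mult_left_le_one_le)
    then have "Re (A (s * t)) > 0" using t by (intro pos) linarith
    then show "Re (auto_factor (exp_path X t s) \<tau>) > 0" by (simp add: A_def exp_path_eq)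
  qed
  show ?thesis
  proof (rule has_vector_derivative_transform_within_open[OF d])
    show "open {- \<delta><..<\<delta>}" "0 \<in> {- \<delta><..<\<delta>}" using \<delta>(1) by auto
    show "exp (c * Ln (A t)) = exp (c * path_log (exp_path X t) \<tau>)" if "t \<in> {- \<delta><..<\<delta>}" for t
      using eq[of t] that by (simp add: abs_less_iff)
  qed
qed

lemma mobius_act_exp_derivative:
  assumes X: "X \<in> sl2" and \<tau>: "Im \<tau> > 0"
  shows "((\<lambda>t. (mobius_act (exp_path X t 1) \<tau> - \<tau>) / of_real t)
    \<longlongrightarrow> of_real (X $ 1 $ 1) * \<tau> + of_real (X $ 1 $ 2) - \<tau> * auto_factor X \<tau>) (at 0)"
proof -
  define A where "A t = auto_factor (exp_path X t 1) \<tau>" for t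
  define B where "B t = of_real (exp_path X t 1 $ 1 $ 1) * \<tau> + of_real (exp_path X t 1 $ 1 $ 2) - \<tau> * A t" for t
  have A0: "A 0 = 1" by (simp add: A_def exp_path_zero[OF X])
  have B0: "B 0 = 0" unfolding B_def A0 exp_path_zero[OF X] by (simp add: mat_def)
  have dA: "(A has_vector_derivative auto_factor X \<tau>) (at 0)"
    unfolding A_def by (rule auto_factor_exp_derivative[OF X])
  have e: "((\<lambda>t. of_real (exp_path X t 1 $ i $ j)) has_vector_derivative complex_of_real (X $ i $ j)) (at 0)" for i j
    using matrix_exp_entry_derivative[OF X, of i j] has_vector_derivative_of_real has_real_derivative_iff_has_vector_derivative
    unfolding exp_path_eq mult_1 by blast
  have "(B has_vector_derivative of_real (X $ 1 $ 1) * \<tau> + of_real (X $ 1 $ 2) - \<tau> * auto_factor X \<tau>) (at 0)"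
    unfolding B_def
    by (intro has_vector_derivative_diff has_vector_derivative_add has_vector_derivative_mult_left has_vector_derivative_mult_right e dA)
  from vector_derivative_quotient[OF this]
  have 1: "((\<lambda>t. B t / of_real t) \<longlongrightarrow> of_real (X $ 1 $ 1) * \<tau> + of_real (X $ 1 $ 2) - \<tau> * auto_factor X \<tau>) (at 0)"
    by (simp add: B0)
  have "isCont A 0" using dA by (rule has_vector_derivative_continuous)
  then have "(A \<longlongrightarrow> 1) (at 0)" unfolding isCont_def A0 .
  from tendsto_divide[OF 1 this]
  have "((\<lambda>t. B t / of_real t / A t) \<longlongrightarrow> of_real (X $ 1 $ 1) * \<tau> + of_real (X $ 1 $ 2) - \<tau> * auto_factor X \<tau>) (at 0)"
    by simp
  moreover have "B t / of_real t / A t = (mobius_act (exp_path X t 1) \<tau> - \<tau>) / of_real t" for t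
  proof -
    have "A t \<noteq> 0" unfolding A_def
      by (rule auto_factor_nonzero[OF _ \<tau>]) (use SL2_pathsD(2)[OF exp_path_SL2_paths[OF X]] in auto)
    then have "mobius_act (exp_path X t 1) \<tau> - \<tau> = B t / A t"
      unfolding mobius_act_def A_def[symmetric] B_def by (simp add: diff_divide_distrib)
    then show ?thesis by (simp add: mult.commute)
  qed
  ultimately show ?thesis by simp
qed

context dunkl_laguerre_setting
begin

definition flow :: "real^2^2 \<Rightarrow> real \<Rightarrow> (real^'n \<Rightarrow> complex) \<Rightarrow> real^'n \<Rightarrow> complex" where
  "flow X t = path_op (exp_path X t)"

lemma Omega_Exp:
  assumes "X \<in> sl2"
  shows "Omega (SL2_cover_Exp (t *\<^sub>R X)) = flow X t"
  using Omega_class[OF exp_path_SL2_paths[OF assms, of t]]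
  by (simp add: SL2_cover_Exp_def flow_def exp_path_def[abs_def])

lemma flow_gauss:
  assumes X: "X \<in> sl2" and p: "p \<in> dunkl_harmonics P k m" and \<tau>: "Im \<tau> > 0"
  shows "AE x in M. flow X t (gauss p 0 (- \<i> * \<tau>)) x
    = factor m (exp_path X t) \<tau> * gauss p 0 (- \<i> * mobius_act (exp_path X t 1) \<tau>) x"
  using path_op_member[OF exp_path_SL2_paths[OF X] family_gauss[OF p \<tau>]] by (simp add: flow_def)

lemma mobius_exp_upper: "X \<in> sl2 \<Longrightarrow> Im \<tau> > 0 \<Longrightarrow> Im (mobius_act (exp_path X t 1) \<tau>) > 0"
  by (intro mobius_act_upper_half_plane path_end_SL2 exp_path_SL2_paths)

lemma factor_exp_quotient:
  assumes X: "X \<in> sl2" and \<tau>: "Im \<tau> > 0"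
  shows "((\<lambda>t. (factor m (exp_path X t) \<tau> - 1) / of_real t) \<longlongrightarrow> - of_real (kappa m) * auto_factor X \<tau>) (at 0)"
    and "((\<lambda>t. factor m (exp_path X t) \<tau>) \<longlongrightarrow> 1) (at 0)"
proof -
  have 0: "factor m (exp_path X 0) \<tau> = 1" by (simp add: factor_def exp_path_zero[OF X] path_log_one)
  have d: "((\<lambda>t. factor m (exp_path X t) \<tau>) has_vector_derivative - of_real (kappa m) * auto_factor X \<tau>) (at 0)"
    unfolding factor_def by (rule path_log_exp_derivative[OF X \<tau>])
  show "((\<lambda>t. (factor m (exp_path X t) \<tau> - 1) / of_real t) \<longlongrightarrow> - of_real (kappa m) * auto_factor X \<tau>) (at 0)"
    using vector_derivative_quotient[OF d] unfolding 0 .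
  show "((\<lambda>t. factor m (exp_path X t) \<tau>) \<longlongrightarrow> 1) (at 0)"
    using has_vector_derivative_continuous[OF d] unfolding isCont_def 0 .
qed

lemma mobius_exp_tendsto:
  assumes X: "X \<in> sl2" and \<tau>: "Im \<tau> > 0"
  shows "((\<lambda>t. - \<i> * mobius_act (exp_path X t 1) \<tau>) \<longlongrightarrow> - \<i> * \<tau>) (at 0)"
proof -
  let ?D = "of_real (X $ 1 $ 1) * \<tau> + of_real (X $ 1 $ 2) - \<tau> * auto_factor X \<tau>"
  have "((\<lambda>t. \<tau> + (mobius_act (exp_path X t 1) \<tau> - \<tau>) / of_real t * of_real t) \<longlongrightarrow> \<tau> + ?D * of_real 0) (at 0)"
    by (intro tendsto_intros mobius_act_exp_derivative[OF X \<tau>])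
  then have "((\<lambda>t. \<tau> + (mobius_act (exp_path X t 1) \<tau> - \<tau>) / of_real t * of_real t) \<longlongrightarrow> \<tau>) (at 0)" by simp
  then have "((\<lambda>t. mobius_act (exp_path X t 1) \<tau>) \<longlongrightarrow> \<tau>) (at 0)"
    by (rule Lim_transform_eventually) (simp add: eventually_at_filter)
  then show ?thesis by (intro tendsto_intros)
qed

lemma flow_continuous:
  assumes X: "X \<in> sl2" and f: "f \<in> L2 M"
  shows "L2_tendsto M (at 0) (\<lambda>t. flow X t f) f"
proof (rule L2_unitary_tendsto[where V = "\<lambda>f. f", OF _ L2_unitary_id member_total member_L2 _ f])
  have un: "L2_unitary M (flow X t)" for t
    unfolding flow_def by (rule path_op_unitary[OF exp_path_SL2_paths[OF X]])
  then show "\<forall>\<^sub>F t in at 0. L2_unitary M (flow X t)" by simp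
  fix i assume i: "i \<in> family"
  then show "L2_tendsto M (at 0) (\<lambda>t. flow X t (member i)) (member i)"
  proof (cases rule: family_cases)
    case (gauss m p \<tau>)
    let ?F = "\<lambda>t x. factor m (exp_path X t) \<tau> * gauss p 0 (- \<i> * mobius_act (exp_path X t 1) \<tau>) x"
    have gL: "gauss p 0 (- \<i> * mobius_act (exp_path X t 1) \<tau>) \<in> L2 M" for t
      by (rule gauss_L2_tau[OF gauss(2) mobius_exp_upper[OF X gauss(3)]])
    have g0: "gauss p 0 (- \<i> * \<tau>) \<in> L2 M" by (rule gauss_L2_tau[OF gauss(2,3)])
    have "L2_tendsto M (at 0) ?F (\<lambda>x. 1 * gauss p 0 (- \<i> * \<tau>) x)"
    proof (rule L2_tendsto_cmult[OF factor_exp_quotient(2)[OF X gauss(3)]])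
      show "L2_tendsto M (at 0) (\<lambda>t. gauss p 0 (- \<i> * mobius_act (exp_path X t 1) \<tau>)) (gauss p 0 (- \<i> * \<tau>))"
        by (rule gauss_continuous[OF gauss(2) _ mobius_exp_tendsto[OF X gauss(3)]]) (simp add: gauss(3))
      show "\<forall>\<^sub>F t in at 0. gauss p 0 (- \<i> * mobius_act (exp_path X t 1) \<tau>) \<in> L2 M" by (simp only: gL eventually_True)
    qed (rule g0)
    moreover have "L2_norm M (\<lambda>x. flow X t (gauss p 0 (- \<i> * \<tau>)) x - gauss p 0 (- \<i> * \<tau>) x)
        = L2_norm M (\<lambda>x. ?F t x - 1 * gauss p 0 (- \<i> * \<tau>) x)" for t
    proof (rule L2_norm_cong_AE)
      show "AE x in M. flow X t (gauss p 0 (- \<i> * \<tau>)) x - gauss p 0 (- \<i> * \<tau>) x = ?F t x - 1 * gauss p 0 (- \<i> * \<tau>) x"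
        using flow_gauss[OF X gauss(2,3)] by eventually_elim simp
    qed (intro L2_measurable L2_diff L2_cmult L2_unitaryD(1)[OF un] g0 gL)+
    ultimately show ?thesis unfolding gauss(1) member_simps L2_tendsto_def by (simp only:)
  next
    case (complement u)
    have u: "u \<in> L2 M" by (rule complement_L2[OF complement(2)])
    have "AE x in M. flow X t u x = u x" for t
      using path_op_member[OF exp_path_SL2_paths[OF X] i] by (simp add: flow_def complement(1))
    then have "AE x in M. flow X t u x - u x = 0" for t by simp
    then have "L2_norm M (\<lambda>x. flow X t u x - u x) = 0" for t
      by (subst L2_norm_eq_0_iff) (intro L2_diff L2_unitaryD(1)[OF un] u)
    then show ?thesis unfolding complement(1) member_simps L2_tendsto_def by simp
  qed
qed

lemma flow_group: "X \<in> sl2 \<Longrightarrow> unitary_group M (flow X)"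
proof (rule unitary_group.intro)
  assume X: "X \<in> sl2"
  show "L2_unitary M (flow X t)" for t
    unfolding flow_def by (rule path_op_unitary[OF exp_path_SL2_paths[OF X]])
  show "AE x in M. flow X 0 f x = f x" if "f \<in> L2 M" for f
    unfolding flow_def exp_path_zero[OF X] by (rule path_op_one[OF that])
  show "AE x in M. flow X (s + t) f x = flow X s (flow X t f) x" if "f \<in> L2 M" for f s t
    unfolding flow_def exp_path_add[OF X] by (rule path_op_mult[OF exp_path_SL2_paths[OF X] exp_path_SL2_paths[OF X] that])
  show "L2_tendsto M (at 0) (\<lambda>t. flow X t f) f" if "f \<in> L2 M" for f
    by (rule flow_continuous[OF X that])
qed

text \<open>The image of a Gaussian under the infinitesimal generator of the one-parameter group of \<open>X\<close>. For
  \<open>j = 0\<close> the coefficient of \<open>gauss p (j - 1) z\<close> vanishes.\<close>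

definition gauss_gen :: "real^2^2 \<Rightarrow> nat \<Rightarrow> (real^'n \<Rightarrow> complex) \<Rightarrow> nat \<Rightarrow> complex \<Rightarrow> real^'n \<Rightarrow> complex" where
  "gauss_gen X m p j z x =
     \<i> * of_real (X $ 2 $ 1) * (of_nat j * (of_nat j - 1 + of_real (kappa m))) * gauss p (j - 1) z x
     + (of_real (X $ 1 $ 1) - \<i> * of_real (X $ 2 $ 1) * z) * (of_real (kappa m) + 2 * of_nat j) * gauss p j z x
     + (\<i> * of_real (X $ 1 $ 2) - 2 * of_real (X $ 1 $ 1) * z + \<i> * of_real (X $ 2 $ 1) * z\<^sup>2) * gauss p (Suc j) z x"

lemma gauss_gen_L2: "p \<in> dunkl_harmonics P k m \<Longrightarrow> Re z > 0 \<Longrightarrow> gauss_gen X m p j z \<in> L2 M"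
  unfolding gauss_gen_def by (intro L2_add L2_cmult gauss_L2)

text \<open>The group moves \<open>gauss p 0 z\<close> inside the family of multiples of Gaussians, so its derivative is obtained
  from the derivatives of the multiplier and of the parameter.\<close>

lemma generates_gauss_0:
  assumes X: "X \<in> sl2" and p: "p \<in> dunkl_harmonics P k m" and z: "Re z > 0"
  shows "unitary_group.generates M (flow X) (gauss p 0 z) (gauss_gen X m p 0 z)"
proof -
  interpret unitary_group M "flow X" by (rule flow_group[OF X])
  define \<tau> where "\<tau> = \<i> * z"
  have \<tau>: "Im \<tau> > 0" and z\<tau>: "- \<i> * \<tau> = z" using z by (simp_all add: \<tau>_def)
  let ?f = "gauss p 0 z"
  define c where "c t = factor m (exp_path X t) \<tau>" for t
  define w where "w t = - \<i> * mobius_act (exp_path X t 1) \<tau>" for t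
  define D where "D = of_real (X $ 1 $ 1) * \<tau> + of_real (X $ 1 $ 2) - \<tau> * auto_factor X \<tau>"
  have w_upper: "Re (w t) > 0" for t using mobius_exp_upper[OF X \<tau>] by (simp add: w_def)
  have f: "?f \<in> L2 M" by (rule gauss_L2[OF p z])
  have fw: "gauss p 0 (w t) \<in> L2 M" for t by (rule gauss_L2[OF p w_upper])
  have flow_eq: "AE x in M. flow X t ?f x = c t * gauss p 0 (w t) x" for t
    using flow_gauss[OF X p \<tau>] unfolding z\<tau> c_def w_def .
  have w_lim: "(w \<longlongrightarrow> z) (at 0)" using mobius_exp_tendsto[OF X \<tau>] unfolding z\<tau> w_def .
  have w_quot: "((\<lambda>t. (w t - z) / of_real t) \<longlongrightarrow> - \<i> * D) (at 0)"
  proof -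
    have "((\<lambda>t. - \<i> * ((mobius_act (exp_path X t 1) \<tau> - \<tau>) / of_real t)) \<longlongrightarrow> - \<i> * D) (at 0)"
      unfolding D_def by (intro tendsto_intros mobius_act_exp_derivative[OF X \<tau>])
    moreover have "- \<i> * ((mobius_act (exp_path X t 1) \<tau> - \<tau>) / of_real t) = (w t - z) / of_real t" for t
      unfolding w_def z\<tau>[symmetric] by (simp add: field_simps)
    ultimately show ?thesis by (simp only:)
  qed
  have c_lim: "(c \<longlongrightarrow> 1) (at 0)" "((\<lambda>t. (c t - 1) / of_real t) \<longlongrightarrow> - of_real (kappa m) * auto_factor X \<tau>) (at 0)"
    unfolding c_def by (rule factor_exp_quotient[OF X \<tau>])+
  define Q where "Q t = (\<lambda>x. (c t * ((w t - z) / of_real t)) * gauss_quotient p 0 z (w t) x)" for t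
  define E where "E t = (\<lambda>x. (c t - 1) / of_real t * ?f x)" for t
  have gq: "gauss_quotient p 0 z (w t) \<in> L2 M" for t by (rule gauss_quotient_L2[OF p z w_upper])
  have QE: "Q t \<in> L2 M" "E t \<in> L2 M" for t unfolding Q_def E_def by (intro L2_cmult gq f)+
  have Q: "L2_tendsto M (at 0) Q (\<lambda>x. (1 * (- \<i> * D)) * - gauss p (Suc 0) z x)"
    unfolding Q_def
    by (rule L2_tendsto_cmult[OF tendsto_mult[OF c_lim(1) w_quot] gauss_quotient_continuous[OF p z w_lim] _ gauss_uminus_L2[OF p z]])
      (simp only: gq eventually_True)
  have E: "L2_tendsto M (at 0) E (\<lambda>x. (- of_real (kappa m) * auto_factor X \<tau>) * ?f x)"
    unfolding E_def by (rule L2_tendsto_cmult[OF c_lim(2) L2_tendsto_const _ f]) (simp add: f)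
  have "L2_tendsto M (at 0) (\<lambda>t x. Q t x + E t x)
     (\<lambda>x. (1 * (- \<i> * D)) * - gauss p (Suc 0) z x + (- of_real (kappa m) * auto_factor X \<tau>) * ?f x)"
    by (rule L2_tendsto_add[OF Q E QE]) (intro L2_cmult gauss_uminus_L2[OF p z] f)+
  moreover have "(\<lambda>x. (1 * (- \<i> * D)) * - gauss p (Suc 0) z x + (- of_real (kappa m) * auto_factor X \<tau>) * ?f x) = gauss_gen X m p 0 z"
  proof -
    have "X $ 2 $ 2 = - X $ 1 $ 1" using X by (simp add: sl2_def trace_2)
    then show ?thesis
      unfolding gauss_gen_def D_def auto_factor_def \<tau>_def by (intro ext) (simp add: algebra_simps power2_eq_square)
  qed
  ultimately have lim: "L2_tendsto M (at 0) (\<lambda>t x. Q t x + E t x) (gauss_gen X m p 0 z)" by simp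
  have "L2_norm M (\<lambda>x. (flow X t ?f x - flow X 0 ?f x) / of_real t - gauss_gen X m p 0 z x)
      = L2_norm M (\<lambda>x. Q t x + E t x - gauss_gen X m p 0 z x)" if t: "t \<noteq> 0" for t
  proof (rule L2_norm_cong_AE)
    show "AE x in M. (flow X t ?f x - flow X 0 ?f x) / of_real t - gauss_gen X m p 0 z x = Q t x + E t x - gauss_gen X m p 0 z x"
      using flow_eq[of t] zero[OF f]
    proof eventually_elim
      case (elim x)
      have "Q t x = c t / of_real t * (gauss p 0 (w t) x - ?f x)"
        unfolding Q_def gauss_quotient by simp
      then have "Q t x + E t x = (c t * gauss p 0 (w t) x - ?f x) / of_real t"
        using t unfolding E_def by (simp add: field_simps)
      then show ?case by (simp only: elim)
    qed
    have "(\<lambda>x. inverse (of_real t) * (flow X t ?f x - flow X 0 ?f x) - gauss_gen X m p 0 z x) \<in> L2 M"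
      by (intro L2_diff L2_cmult U_L2 f gauss_gen_L2[OF p z])
    then show "(\<lambda>x. (flow X t ?f x - flow X 0 ?f x) / of_real t - gauss_gen X m p 0 z x) \<in> borel_measurable M"
      by (simp add: L2_measurable divide_inverse mult.commute)
    show "(\<lambda>x. Q t x + E t x - gauss_gen X m p 0 z x) \<in> borel_measurable M"
      by (intro L2_measurable L2_diff L2_add QE gauss_gen_L2[OF p z])
  qed
  then have "L2_tendsto M (at 0) (\<lambda>t x. (flow X t ?f x - flow X 0 ?f x) / of_real t) (gauss_gen X m p 0 z)"
    using lim unfolding L2_tendsto_def
    by (elim Lim_transform_eventually) (simp add: eventually_at_filter)
  then show ?thesis
    unfolding generates_def has_L2_derivative_iff using U_L2[OF f] gauss_gen_L2[OF p z] by simp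
qed

lemma gauss_product_rule:
  assumes p: "p \<in> dunkl_harmonics P k m" and z: "Re z > 0" and c: "(c has_field_derivative c') (at z)"
    and h: "h \<longlonglongrightarrow> 0" "\<And>n. h n > 0"
  shows "L2_tendsto M sequentially
    (\<lambda>n x. inverse (of_real (h n)) * (c (z + of_real (h n)) * gauss p j (z + of_real (h n)) x - c z * gauss p j z x))
    (\<lambda>x. c' * gauss p j z x - c z * gauss p (Suc j) z x)"
proof -
  define w where "w n = z + of_real (h n)" for n
  have w_upper: "Re (w n) > 0" for n using h(2)[of n] z by (simp add: w_def)
  have w_lim: "w \<longlonglongrightarrow> z" using tendsto_add[OF tendsto_const[of z] tendsto_of_real[OF h(1)]] by (simp add: w_def[abs_def])
  have wz: "w n - z = of_real (h n)" "w n \<noteq> z" for n using h(2)[of n] by (simp_all add: w_def)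
  have f: "gauss p j z \<in> L2 M" by (rule gauss_L2[OF p z])
  have gq: "gauss_quotient p j z (w n) \<in> L2 M" for n by (rule gauss_quotient_L2[OF p z w_upper])
  have "isCont c z" using c by (rule DERIV_isCont)
  then have c_lim: "(\<lambda>n. c (w n)) \<longlonglongrightarrow> c z" using w_lim by (rule isCont_tendsto_compose)
  have c_quot: "(\<lambda>n. (c (w n) - c z) / (w n - z)) \<longlonglongrightarrow> c'"
  proof -
    have "filterlim w (at z) sequentially" unfolding filterlim_at using w_lim wz(2) by simp
    with c[unfolded has_field_derivative_iff] show ?thesis by (rule filterlim_compose)
  qed
  have "L2_tendsto M sequentially (\<lambda>n x. c (w n) * gauss_quotient p j z (w n) x) (\<lambda>x. c z * - gauss p (Suc j) z x)"
    by (rule L2_tendsto_cmult[OF c_lim gauss_quotient_continuous[OF p z w_lim] _ gauss_uminus_L2[OF p z]])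
      (simp only: gq eventually_True)
  moreover have "L2_tendsto M sequentially (\<lambda>n x. (c (w n) - c z) / (w n - z) * gauss p j z x) (\<lambda>x. c' * gauss p j z x)"
    by (rule L2_tendsto_cmult[OF c_quot L2_tendsto_const _ f]) (simp add: f)
  ultimately have lim: "L2_tendsto M sequentially (\<lambda>n x. c (w n) * gauss_quotient p j z (w n) x + (c (w n) - c z) / (w n - z) * gauss p j z x)
    (\<lambda>x. c z * - gauss p (Suc j) z x + c' * gauss p j z x)"
    by (rule L2_tendsto_add) (intro L2_cmult gauss_uminus_L2[OF p z] gq f)+
  have eq: "c (w n) * gauss_quotient p j z (w n) x + (c (w n) - c z) / (w n - z) * gauss p j z x
    = inverse (of_real (h n)) * (c (w n) * gauss p j (w n) x - c z * gauss p j z x)" for n x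
    using wz(2)[of n] unfolding gauss_quotient_def wz(1)[symmetric] by (simp add: divide_inverse algebra_simps)
  have "(\<lambda>x. c z * - gauss p (Suc j) z x + c' * gauss p j z x) = (\<lambda>x. c' * gauss p j z x - c z * gauss p (Suc j) z x)"
    by simp
  with lim show ?thesis unfolding eq unfolding w_def by (simp only:)
qed

text \<open>Differentiation in \<open>z\<close> raises \<open>j\<close>, commutes with the group and is compatible with the formula for
  the generator; since the generator is closed, the case \<open>j = 0\<close> implies all others.\<close>

lemma generates_gauss:
  assumes X: "X \<in> sl2" and p: "p \<in> dunkl_harmonics P k m"
  shows "Re z > 0 \<Longrightarrow> unitary_group.generates M (flow X) (gauss p j z) (gauss_gen X m p j z)"
proof (induction j arbitrary: z)
  case 0
  then show ?case by (rule generates_gauss_0[OF X p])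
next
  case (Suc j)
  interpret unitary_group M "flow X" by (rule flow_group[OF X])
  note z = Suc.prems
  define h where "h n = 1 / real (Suc n)" for n
  have h: "h \<longlonglongrightarrow> 0" "h n > 0" for n unfolding h_def by (rule lim_1_over_n[THEN LIMSEQ_Suc]) simp
  let ?w = "\<lambda>n. z + complex_of_real (h n)"
  have w: "Re (?w n) > 0" for n using h(2)[of n] z by simp
  define fn where "fn n = (\<lambda>x. - inverse (of_real (h n)) * (gauss p j (?w n) x - gauss p j z x))" for n
  define gn where "gn n = (\<lambda>x. - inverse (of_real (h n)) * (gauss_gen X m p j (?w n) x - gauss_gen X m p j z x))" for n
  have fL: "fn n \<in> L2 M" for n unfolding fn_def by (intro L2_cmult L2_diff gauss_L2[OF p] w z)
  have gen: "generates (fn n) (gn n)" for n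
    unfolding fn_def gn_def by (intro generates_scaled_diff gauss_L2[OF p] w z Suc.IH)
  show ?case
  proof (rule generates_closed[OF _ gauss_L2[OF p z] gauss_gen_L2[OF p z]])
    show "\<forall>\<^sub>F n in sequentially. fn n \<in> L2 M \<and> generates (fn n) (gn n)" by (simp only: fL gen) simp
    let ?Q = "\<lambda>c i n x. inverse (of_real (h n)) * (c (?w n) * gauss p i (?w n) x - c z * gauss p i z x)"
    have QL: "?Q c i n \<in> L2 M" for c i n by (intro L2_cmult L2_diff gauss_L2[OF p] w z)
    note prod = gauss_product_rule[OF p z _ h]
    have neg: "L2_tendsto M sequentially F l \<Longrightarrow> (\<And>n. F n \<in> L2 M) \<Longrightarrow> l \<in> L2 M \<Longrightarrow>
        L2_tendsto M sequentially (\<lambda>n x. - 1 * F n x) (\<lambda>x. - 1 * l x)" for F l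
      by (rule L2_tendsto_cmult[OF tendsto_const]) auto
    have "L2_tendsto M sequentially (?Q (\<lambda>_. 1) j) (\<lambda>x. 0 * gauss p j z x - 1 * gauss p (Suc j) z x)"
      by (rule prod) (rule DERIV_const)
    then have "L2_tendsto M sequentially (\<lambda>n x. - 1 * ?Q (\<lambda>_. 1) j n x) (\<lambda>x. - 1 * (0 * gauss p j z x - 1 * gauss p (Suc j) z x))"
      by (rule neg) (intro QL L2_diff L2_cmult gauss_L2[OF p z])+
    then show "L2_tendsto M sequentially fn (gauss p (Suc j) z)" by (simp add: fn_def[abs_def])
    define c0 where "c0 = (\<lambda>z::complex. \<i> * of_real (X $ 2 $ 1) * (of_nat j * (of_nat j - 1 + of_real (kappa m))))"
    define c1 where "c1 = (\<lambda>z. (of_real (X $ 1 $ 1) - \<i> * of_real (X $ 2 $ 1) * z) * (of_real (kappa m) + 2 * of_nat j))"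
    define c2 where "c2 = (\<lambda>z. \<i> * of_real (X $ 1 $ 2) - 2 * of_real (X $ 1 $ 1) * z + \<i> * of_real (X $ 2 $ 1) * z\<^sup>2)"
    have d0: "(c0 has_field_derivative 0) (at z)" unfolding c0_def by (rule DERIV_const)
    have d1: "(c1 has_field_derivative - \<i> * of_real (X $ 2 $ 1) * (of_real (kappa m) + 2 * of_nat j)) (at z)"
      unfolding c1_def by (auto intro!: derivative_eq_intros)
    have d2: "(c2 has_field_derivative - 2 * of_real (X $ 1 $ 1) + 2 * \<i> * of_real (X $ 2 $ 1) * z) (at z)"
      unfolding c2_def by (auto intro!: derivative_eq_intros)
    have "L2_tendsto M sequentially (\<lambda>n x. ?Q c0 (j - 1) n x + ?Q c1 j n x + ?Q c2 (Suc j) n x)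
      (\<lambda>x. (0 * gauss p (j - 1) z x - c0 z * gauss p (Suc (j - 1)) z x)
        + ((- \<i> * of_real (X $ 2 $ 1) * (of_real (kappa m) + 2 * of_nat j)) * gauss p j z x - c1 z * gauss p (Suc j) z x)
        + ((- 2 * of_real (X $ 1 $ 1) + 2 * \<i> * of_real (X $ 2 $ 1) * z) * gauss p (Suc j) z x - c2 z * gauss p (Suc (Suc j)) z x))"
      (is "L2_tendsto _ _ ?S ?l")
      by (intro L2_tendsto_add prod d0 d1 d2 L2_add QL) (intro L2_add L2_diff L2_cmult gauss_L2[OF p z])+
    then have "L2_tendsto M sequentially (\<lambda>n x. - 1 * ?S n x) (\<lambda>x. - 1 * ?l x)"
      by (rule neg) (intro QL L2_add L2_diff L2_cmult gauss_L2[OF p z])+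
    moreover have "(\<lambda>n x. - 1 * ?S n x) = gn"
      unfolding gn_def gauss_gen_def c0_def c1_def c2_def by (intro ext) (simp add: algebra_simps)
    moreover have "(\<lambda>x. - 1 * ?l x) = gauss_gen X m p (Suc j) z"
      unfolding gauss_gen_def c0_def c1_def c2_def by (intro ext) (cases j; simp add: algebra_simps)
    ultimately show "L2_tendsto M sequentially gn (gauss_gen X m p (Suc j) z)" by simp
  qed simp
qed

end

section \<open>The operators omega on Gaussians\<close>

lemma has_vector_derivative_powr:
  assumes "r > 0" "a > 0"
  shows "((\<lambda>r. complex_of_real (r powr a / a)) has_vector_derivative of_real (r powr a / r)) (at r)"
proof -
  have "((\<lambda>r. r powr a / a) has_real_derivative r powr a / r) (at r)"
    using assms by (auto intro!: derivative_eq_intros simp: powr_diff)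
  then show ?thesis
    using has_vector_derivative_of_real has_real_derivative_iff_has_vector_derivative by blast
qed

context dunkl_laguerre_setting
begin

text \<open>The radial factor of the Gaussians as a function of \<open>u = \<parallel>x\<parallel>\<^sup>a / a\<close>, and its derivatives.\<close>

definition profile :: "nat \<Rightarrow> complex \<Rightarrow> complex \<Rightarrow> complex" where
  "profile j z u = u ^ j * exp (- z * u)"

definition profile' :: "nat \<Rightarrow> complex \<Rightarrow> complex \<Rightarrow> complex" where
  "profile' j z u = (of_nat j * u ^ (j - 1) - z * u ^ j) * exp (- z * u)"

definition profile'' :: "nat \<Rightarrow> complex \<Rightarrow> complex \<Rightarrow> complex" where
  "profile'' j z u = (of_nat j * (of_nat (j - 1) * u ^ (j - 2)) - 2 * z * of_nat j * u ^ (j - 1) + z\<^sup>2 * u ^ j) * exp (- z * u)"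

lemma profile_derivatives:
  "(profile j z has_field_derivative profile' j z u) (at u)"
  "(profile' j z has_field_derivative profile'' j z u) (at u)"
proof -
  show "(profile j z has_field_derivative profile' j z u) (at u)"
    unfolding profile_def[abs_def] profile'_def
    by (auto intro!: derivative_eq_intros simp: algebra_simps)
  have e: "((\<lambda>u. of_nat j * u ^ (j - 1) - z * u ^ j) has_field_derivative
      of_nat j * (of_nat (j - 1) * u ^ (j - 2)) - z * (of_nat j * u ^ (j - 1))) (at u)"
    by (auto intro!: derivative_eq_intros simp: numeral_2_eq_2)
  have "((\<lambda>u. exp (- z * u)) has_field_derivative - z * exp (- z * u)) (at u)"
    by (auto intro!: derivative_eq_intros)
  from DERIV_mult[OF e this]
  show "(profile' j z has_field_derivative profile'' j z u) (at u)"
    unfolding profile'_def[abs_def] profile''_def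
    by (rule DERIV_cong) (simp add: algebra_simps power2_eq_square)
qed

lemma gauss_profile: "gauss p j z x = profile j z (of_real (norm x powr a / a)) * p x"
  by (simp add: gauss_def profile_def radius_def)

text \<open>The functions \<open>V\<close> and \<open>V2\<close> of \<open>dunkl_laplacian_radial_mult\<close> for the radial factor of a Gaussian.\<close>

definition radial1 :: "nat \<Rightarrow> complex \<Rightarrow> real \<Rightarrow> complex" where
  "radial1 j z r = of_real (r powr a / r\<^sup>2) * profile' j z (of_real (r powr a / a))"

definition radial2 :: "nat \<Rightarrow> complex \<Rightarrow> real \<Rightarrow> complex" where
  "radial2 j z r = of_real ((a - 2) * r powr a / r ^ 4) * profile' j z (of_real (r powr a / a))
    + of_real ((r powr a)\<^sup>2 / r ^ 4) * profile'' j z (of_real (r powr a / a))"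

lemma radial_derivatives:
  assumes r: "r > 0"
  shows "((\<lambda>r. profile j z (of_real (r powr a / a))) has_vector_derivative of_real r * radial1 j z r) (at r)"
    and "(radial1 j z has_vector_derivative of_real r * radial2 j z r) (at r)"
proof -
  note u = has_vector_derivative_powr[OF r a_pos]
  let ?u = "complex_of_real (r powr a / a)"
  have "((\<lambda>r. profile j z (of_real (r powr a / a))) has_vector_derivative of_real (r powr a / r) * profile' j z ?u) (at r)"
    using field_vector_diff_chain_at[OF u profile_derivatives(1)] by (simp add: o_def)
  moreover have "of_real (r powr a / r) * profile' j z ?u = of_real r * radial1 j z r"
    using r by (simp add: radial1_def power2_eq_square)
  ultimately show "((\<lambda>r. profile j z (of_real (r powr a / a))) has_vector_derivative of_real r * radial1 j z r) (at r)"
    by simp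
  have 1: "((\<lambda>r. profile' j z (of_real (r powr a / a))) has_vector_derivative of_real (r powr a / r) * profile'' j z ?u) (at r)"
    using field_vector_diff_chain_at[OF u profile_derivatives(2)] by (simp add: o_def)
  have "((\<lambda>r. r powr a / r\<^sup>2) has_real_derivative (a - 2) * r powr a / r ^ 3) (at r)"
    using r by (auto intro!: derivative_eq_intros simp: powr_diff field_simps eval_nat_numeral)
  then have 2: "((\<lambda>r. complex_of_real (r powr a / r\<^sup>2)) has_vector_derivative of_real ((a - 2) * r powr a / r ^ 3)) (at r)"
    using has_vector_derivative_of_real has_real_derivative_iff_has_vector_derivative by blast
  have "(radial1 j z has_vector_derivative of_real (r powr a / r\<^sup>2) * (of_real (r powr a / r) * profile'' j z ?u)
      + of_real ((a - 2) * r powr a / r ^ 3) * profile' j z ?u) (at r)"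
    unfolding radial1_def[abs_def] by (rule has_vector_derivative_mult[OF 2 1])
  moreover have "of_real (r powr a / r\<^sup>2) * (of_real (r powr a / r) * profile'' j z ?u)
      + of_real ((a - 2) * r powr a / r ^ 3) * profile' j z ?u = of_real r * radial2 j z r"
  proof -
    have "(r powr a / r\<^sup>2) * (r powr a / r) = r * ((r powr a)\<^sup>2 / r ^ 4)" "(a - 2) * r powr a / r ^ 3 = r * ((a - 2) * r powr a / r ^ 4)"
      using r by (simp_all add: field_simps eval_nat_numeral)
    then show ?thesis unfolding radial2_def distrib_left mult.assoc[symmetric] of_real_mult[symmetric] by simp
  qed
  ultimately show "(radial1 j z has_vector_derivative of_real r * radial2 j z r) (at r)" by simp
qed

lemma harmonic_C2: "p \<in> dunkl_harmonics P k m \<Longrightarrow> dunkl_C2 P k p"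
  by (rule dunkl_C2_polynomial[OF harmonicD(1) finite_P])

lemma gauss_C2:
  assumes p: "p \<in> dunkl_harmonics P k m"
  shows "dunkl_C2 P k (gauss p j z)"
  unfolding gauss_profile[abs_def]
  by (rule dunkl_laplacian_radial_mult(1)[where U = "\<lambda>r. profile j z (of_real (r powr a / a))",
        OF zero_notin_P harmonic_C2[OF p] radial_derivatives])

lemma profile_relations:
  "u * profile j z u = profile (Suc j) z u"
  "u * profile' j z u = of_nat j * profile j z u - z * profile (Suc j) z u"
  "K * profile' j z u + u * profile'' j z u
     = of_nat j * (of_nat j - 1 + K) * profile (j - 1) z u - z * (K + 2 * of_nat j) * profile j z u + z\<^sup>2 * profile (Suc j) z u"
proof -
  have 1: "of_nat j * (u * u ^ (j - 1)) = of_nat j * u ^ j" by (cases j) simp_all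
  have 2: "of_nat j * (of_nat (j - 1) * (u * u ^ (j - 2))) = of_nat j * ((of_nat j - 1) * u ^ (j - 1))"
  proof (cases j)
    case (Suc i)
    then show ?thesis by (cases i) simp_all
  qed simp
  show "u * profile j z u = profile (Suc j) z u" by (simp add: profile_def)
  have "u * profile' j z u = (of_nat j * (u * u ^ (j - 1)) - z * (u * u ^ j)) * exp (- z * u)"
    unfolding profile'_def by (simp only: algebra_simps)
  then show "u * profile' j z u = of_nat j * profile j z u - z * profile (Suc j) z u"
    unfolding 1 by (simp add: profile_def algebra_simps)
  have "u * profile'' j z u = (of_nat j * (of_nat (j - 1) * (u * u ^ (j - 2))) - 2 * z * (of_nat j * (u * u ^ (j - 1))) + z\<^sup>2 * (u * u ^ j)) * exp (- z * u)"
    unfolding profile''_def by (simp only: algebra_simps)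
  then show "K * profile' j z u + u * profile'' j z u
     = of_nat j * (of_nat j - 1 + K) * profile (j - 1) z u - z * (K + 2 * of_nat j) * profile j z u + z\<^sup>2 * profile (Suc j) z u"
    unfolding 1 2 by (simp add: profile_def profile'_def algebra_simps)
qed

lemma euler_gauss:
  assumes p: "p \<in> dunkl_harmonics P k m" and x: "x \<noteq> 0"
  shows "(\<Sum>i\<in>UNIV. of_real (x $ i) * dir_deriv (axis i 1) (gauss p j z) x)
    = (of_real (norm x powr a) * profile' j z (of_real (norm x powr a / a)) + of_nat m * profile j z (of_real (norm x powr a / a))) * p x"
proof -
  let ?U = "\<lambda>r. profile j z (of_real (r powr a / a))"
  have d: "((\<lambda>y. ?U (norm y)) has_derivative (\<lambda>h. of_real (x \<bullet> h) * radial1 j z (norm x))) (at x)"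
    by (rule radial_has_derivative[OF x]) (rule radial_derivatives, use x in simp)
  then have Ud: "(\<lambda>y. ?U (norm y)) differentiable at x" by (auto simp: differentiable_def)
  have pd: "p differentiable at x" by (rule differentiable_polynomial[OF harmonicD(1)[OF p]])
  have "(\<Sum>i\<in>UNIV. of_real (x $ i) * dir_deriv (axis i 1) (gauss p j z) x) = dir_deriv x (gauss p j z) x"
    by (rule dir_deriv_sum_axis) (use gauss_C2[OF p] x in \<open>simp add: dunkl_C2_def\<close>)
  also have "\<dots> = ?U (norm x) * dir_deriv x p x + dir_deriv x (\<lambda>y. ?U (norm y)) x * p x"
    unfolding gauss_profile[abs_def] by (rule dir_deriv_mult[OF Ud pd])
  also have "dir_deriv x p x = of_nat m * p x"
    by (rule dir_deriv_homogeneous[OF harmonicD(1)[OF p] harmonicD(2)[OF p]])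
  also have "dir_deriv x (\<lambda>y. ?U (norm y)) x = of_real ((norm x)\<^sup>2) * radial1 j z (norm x)"
    by (subst dir_deriv_eq[OF d]) (simp only: power2_norm_eq_inner)
  also have "\<dots> = of_real (norm x powr a) * profile' j z (of_real (norm x powr a / a))"
    using x by (simp add: radial1_def)
  finally show ?thesis by (simp add: algebra_simps)
qed

text \<open>The radial part of the Dunkl Laplacian on \<open>p * f(\<parallel>x\<parallel>\<^sup>a / a)\<close> is the confluent hypergeometric
  operator \<open>u f'' + \<kappa> f'\<close>.\<close>

lemma laplacian_gauss:
  assumes p: "p \<in> dunkl_harmonics P k m" and x: "x \<noteq> 0"
  defines "u \<equiv> complex_of_real (norm x powr a / a)"
  shows "of_real (norm x powr (2 - a)) * dunkl_laplacian P k (gauss p j z) x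
    = of_real a * (of_real (kappa m) * profile' j z u + u * profile'' j z u) * p x"
proof -
  let ?U = "\<lambda>r. profile j z (of_real (r powr a / a))"
  define A where "A = norm x powr a"
  define n where "n = norm x"
  have n: "n > 0" and A: "A > 0" using x by (simp_all add: n_def A_def)
  define K where "K = 2 * real m + real CARD('n) + 2 * sum k P"
  have hom: "dir_deriv x p x = of_nat m * p x"
    by (rule dir_deriv_homogeneous[OF harmonicD(1)[OF p] harmonicD(2)[OF p]])
  have "dunkl_laplacian P k (gauss p j z) x
    = ?U (norm x) * dunkl_laplacian P k p x
        + radial1 j z (norm x) * (2 * dir_deriv x p x + of_real (real CARD('n) + 2 * sum k P) * p x)
        + of_real ((norm x)\<^sup>2) * radial2 j z (norm x) * p x"
    unfolding gauss_profile[abs_def]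
    by (rule dunkl_laplacian_radial_mult(2)[where U = ?U, OF zero_notin_P harmonic_C2[OF p] radial_derivatives x])
  also have "\<dots> = (of_real K * radial1 j z n + of_real (n\<^sup>2) * radial2 j z n) * p x"
    unfolding hom harmonicD(3)[OF p] K_def n_def by (simp add: algebra_simps)
  also have "\<dots> = (of_real (A / n\<^sup>2 * (K + a - 2)) * profile' j z u + of_real (A\<^sup>2 / n\<^sup>2) * profile'' j z u) * p x"
  proof -
    have "n\<^sup>2 * ((a - 2) * A / n ^ 4) = (a - 2) * A / n\<^sup>2" "n\<^sup>2 * (A\<^sup>2 / n ^ 4) = A\<^sup>2 / n\<^sup>2"
      using n by (simp_all add: field_simps eval_nat_numeral)
    then have "of_real (n\<^sup>2) * radial2 j z n = of_real ((a - 2) * A / n\<^sup>2) * profile' j z u + of_real (A\<^sup>2 / n\<^sup>2) * profile'' j z u"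
      unfolding radial2_def u_def A_def n_def distrib_left mult.assoc[symmetric] of_real_mult[symmetric] by simp
    moreover have "of_real K * radial1 j z n = of_real (K * (A / n\<^sup>2)) * profile' j z u"
      unfolding radial1_def u_def A_def n_def by simp
    moreover have "A / n\<^sup>2 * (K + a - 2) = K * (A / n\<^sup>2) + (a - 2) * A / n\<^sup>2"
      by (simp add: algebra_simps add_divide_distrib diff_divide_distrib)
    ultimately show ?thesis by (simp only: of_real_add distrib_right add.assoc)
  qed
  finally have L: "dunkl_laplacian P k (gauss p j z) x
    = (of_real (A / n\<^sup>2 * (K + a - 2)) * profile' j z u + of_real (A\<^sup>2 / n\<^sup>2) * profile'' j z u) * p x" .
  have pw: "norm x powr (2 - a) = n\<^sup>2 / A" using x by (simp add: n_def A_def powr_diff)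
  have e1: "n\<^sup>2 / A * (A / n\<^sup>2 * (K + a - 2)) = a * kappa m"
    using n A a_pos by (simp add: kappa_eq K_def)
  have e2: "n\<^sup>2 / A * (A\<^sup>2 / n\<^sup>2) = a * (A / a)"
    using n A a_pos by (simp add: power2_eq_square)
  have "of_real (norm x powr (2 - a)) * dunkl_laplacian P k (gauss p j z) x
     = (of_real (n\<^sup>2 / A * (A / n\<^sup>2 * (K + a - 2))) * profile' j z u + of_real (n\<^sup>2 / A * (A\<^sup>2 / n\<^sup>2)) * profile'' j z u) * p x"
    unfolding L pw of_real_mult by (simp only: algebra_simps)
  also have "\<dots> = of_real a * (of_real (kappa m) * profile' j z u + u * profile'' j z u) * p x"
    unfolding e1 e2 unfolding u_def A_def of_real_mult by (simp only: algebra_simps)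
  finally show ?thesis .
qed

lemma omega_gauss:
  assumes X: "X \<in> sl2" and p: "p \<in> dunkl_harmonics P k m" and x: "x \<noteq> 0"
  shows "omega P k a X (gauss p j z) x
    = of_real (X $ 1 $ 1) * ((of_real (kappa m) + 2 * of_nat j) * gauss p j z x - 2 * z * gauss p (Suc j) z x)
      + of_real (X $ 1 $ 2) * (\<i> * gauss p (Suc j) z x)
      + of_real (X $ 2 $ 1) * (\<i> * (of_nat j * (of_nat j - 1 + of_real (kappa m)) * gauss p (j - 1) z x
          - z * (of_real (kappa m) + 2 * of_nat j) * gauss p j z x + z\<^sup>2 * gauss p (Suc j) z x))"
proof -
  define u where "u = complex_of_real (norm x powr a / a)"
  have a: "complex_of_real a \<noteq> 0" using a_pos by simp
  have A: "complex_of_real (norm x powr a) = of_real a * u" using a by (simp add: u_def)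
  have g: "gauss p i z x = profile i z u * p x" for i by (simp add: gauss_profile u_def)
  note rel = profile_relations[where u = u and j = j and z = z]
  have plus: "omega_e_plus a (gauss p j z) x = \<i> * gauss p (Suc j) z x"
    unfolding omega_e_plus_def A g using rel(1) a by simp
  have minus: "omega_e_minus P k a (gauss p j z) x = \<i> * ((of_real (kappa m) * profile' j z u + u * profile'' j z u) * p x)"
  proof -
    have "omega_e_minus P k a (gauss p j z) x = (\<i> / of_real a) * (of_real (norm x powr (2 - a)) * dunkl_laplacian P k (gauss p j z) x)"
      by (simp add: omega_e_minus_def)
    also have "\<dots> = (\<i> / of_real a) * (of_real a * (of_real (kappa m) * profile' j z u + u * profile'' j z u) * p x)"
      unfolding laplacian_gauss[OF p x] u_def ..
    finally show ?thesis using a by simp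
  qed
  have kap: "complex_of_real (2 / a) * of_nat m + of_real ((real CARD('n) + 2 * sum k P + a - 2) / a) = of_real (kappa m)"
  proof -
    have "2 / a * real m + (real CARD('n) + 2 * sum k P + a - 2) / a = kappa m"
      by (simp add: kappa_eq add_divide_distrib diff_divide_distrib)
    then show ?thesis by (metis of_real_add of_real_mult of_real_of_nat_eq)
  qed
  have "omega_h P k a (gauss p j z) x
    = of_real (2 / a) * ((of_real a * u * profile' j z u + of_nat m * profile j z u) * p x)
      + of_real ((real CARD('n) + 2 * sum k P + a - 2) / a) * (profile j z u * p x)"
    unfolding omega_h_def euler_gauss[OF p x] A g u_def[symmetric] ..
  also have "\<dots> = 2 * (u * profile' j z u) * p x
      + (complex_of_real (2 / a) * of_nat m + of_real ((real CARD('n) + 2 * sum k P + a - 2) / a)) * profile j z u * p x"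
  proof -
    have "complex_of_real (2 / a) * of_real a = 2" using a by simp
    then have "complex_of_real (2 / a) * ((of_real a * u * profile' j z u + of_nat m * profile j z u) * p x)
       = 2 * (u * profile' j z u) * p x + of_real (2 / a) * of_nat m * profile j z u * p x"
      by (simp only: distrib_left distrib_right mult.assoc[symmetric])
    then show ?thesis by (simp only: distrib_right mult.assoc add.assoc)
  qed
  finally have h: "omega_h P k a (gauss p j z) x = 2 * (of_nat j * profile j z u - z * profile (Suc j) z u) * p x + of_real (kappa m) * profile j z u * p x"
    unfolding kap rel(2) .
  show ?thesis
    unfolding omega_def h plus minus rel(3) g by (simp add: algebra_simps)
qed

end

section \<open>Differentiation of the representation\<close>

context dunkl_laguerre_setting
begin

lemma generator_eq_omega:
  assumes "X \<in> sl2" "p \<in> dunkl_harmonics P k m" "x \<noteq> 0"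
  shows "omega P k a X (gauss p j z) x = gauss_gen X m p j z x"
  unfolding omega_gauss[OF assms] gauss_gen_def by (simp add: algebra_simps)

text \<open>The functions on which the derived representation is given by \<open>omega\<close>. They are singular at the origin,
  a null set, so the equality is required off the origin.\<close>

definition infinitesimal :: "(real^'n \<Rightarrow> complex) \<Rightarrow> bool" where
  "infinitesimal f \<longleftrightarrow> dunkl_C2 P k f \<and> f \<in> L2 M \<and>
     (\<forall>X\<in>sl2. \<exists>D. unitary_group.generates M (flow X) f D \<and> (\<forall>x. x \<noteq> 0 \<longrightarrow> omega P k a X f x = D x))"

lemma infinitesimal_gauss:
  assumes p: "p \<in> dunkl_harmonics P k m" and z: "Re z > 0"
  shows "infinitesimal (gauss p j z)"
  unfolding infinitesimal_def
  using gauss_C2[OF p] gauss_L2[OF p z] generates_gauss[OF _ p z] generator_eq_omega[OF _ p] by blast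

lemma omega_combination:
  assumes S: "finite S" and f: "\<And>i. i \<in> S \<Longrightarrow> dunkl_C2 P k (f i)" and x: "x \<noteq> 0"
  shows "omega P k a X (\<lambda>x. \<Sum>i\<in>S. c i * f i x) x = (\<Sum>i\<in>S. c i * omega P k a X (f i) x)"
proof -
  have d: "f i differentiable at x" if "i \<in> S" for i using f[OF that] x by (simp add: dunkl_C2_def)
  have dd: "dir_deriv \<xi> (\<lambda>x. \<Sum>i\<in>S. c i * f i x) x = (\<Sum>i\<in>S. c i * dir_deriv \<xi> (f i) x)" for \<xi>
    by (rule dir_deriv_eq) (intro has_derivative_sum has_derivative_mult_right has_derivative_dir_deriv d)
  have lap: "dunkl_laplacian P k (\<lambda>x. \<Sum>i\<in>S. c i * f i x) x = (\<Sum>i\<in>S. c i * dunkl_laplacian P k (f i) x)"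
    by (rule dunkl_C2_combination(3)[OF S f zero_notin_P x])
  have h: "omega_h P k a (\<lambda>x. \<Sum>i\<in>S. c i * f i x) x = (\<Sum>i\<in>S. c i * omega_h P k a (f i) x)"
  proof -
    have "C * (\<Sum>j\<in>UNIV. of_real (x $ j) * (\<Sum>i\<in>S. c i * dir_deriv (axis j 1) (f i) x)) + K * (\<Sum>i\<in>S. c i * f i x)
      = (\<Sum>i\<in>S. c i * (C * (\<Sum>j\<in>UNIV. of_real (x $ j) * dir_deriv (axis j 1) (f i) x) + K * f i x))" for C K
      by (simp add: sum_distrib_left sum.distrib distrib_left sum.swap[of _ S] ac_simps)
    then show ?thesis unfolding omega_h_def dd .
  qed
  have p: "omega_e_plus a (\<lambda>x. \<Sum>i\<in>S. c i * f i x) x = (\<Sum>i\<in>S. c i * omega_e_plus a (f i) x)"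
    by (simp add: omega_e_plus_def sum_distrib_left sum_divide_distrib ac_simps)
  have m: "omega_e_minus P k a (\<lambda>x. \<Sum>i\<in>S. c i * f i x) x = (\<Sum>i\<in>S. c i * omega_e_minus P k a (f i) x)"
    by (simp add: omega_e_minus_def lap sum_distrib_left sum_divide_distrib ac_simps)
  show ?thesis
    unfolding omega_def h p m by (simp add: sum_distrib_left sum.distrib distrib_left ac_simps)
qed

lemma infinitesimal_combination:
  assumes S: "finite S" and f: "\<And>i. i \<in> S \<Longrightarrow> infinitesimal (f i)"
  shows "infinitesimal (\<lambda>x. \<Sum>i\<in>S. c i * f i x)"
proof -
  have C2: "dunkl_C2 P k (f i)" and L: "f i \<in> L2 M" if "i \<in> S" for i
    using f[OF that] by (simp_all add: infinitesimal_def)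
  show ?thesis
    unfolding infinitesimal_def
  proof (intro conjI ballI)
    show "dunkl_C2 P k (\<lambda>x. \<Sum>i\<in>S. c i * f i x)" by (rule dunkl_C2_combination(1)[OF S C2 zero_notin_P])
    show "(\<lambda>x. \<Sum>i\<in>S. c i * f i x) \<in> L2 M" by (intro L2_sum L2_cmult L)
    fix X :: "real^2^2" assume X: "X \<in> sl2"
    have "\<forall>i\<in>S. \<exists>D. unitary_group.generates M (flow X) (f i) D \<and> (\<forall>x. x \<noteq> 0 \<longrightarrow> omega P k a X (f i) x = D x)"
      using f X by (simp add: infinitesimal_def)
    then obtain D where D: "\<And>i. i \<in> S \<Longrightarrow> unitary_group.generates M (flow X) (f i) (D i)"
        "\<And>i x. i \<in> S \<Longrightarrow> x \<noteq> 0 \<Longrightarrow> omega P k a X (f i) x = D i x"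
      by (auto simp: bchoice_iff)
    have "unitary_group.generates M (flow X) (\<lambda>x. \<Sum>i\<in>S. c i * f i x) (\<lambda>x. \<Sum>i\<in>S. c i * D i x)"
      by (rule unitary_group.generates_combination[OF flow_group[OF X] S L D(1)])
    moreover have "omega P k a X (\<lambda>x. \<Sum>i\<in>S. c i * f i x) x = (\<Sum>i\<in>S. c i * D i x)" if "x \<noteq> 0" for x
    proof -
      have "omega P k a X (\<lambda>x. \<Sum>i\<in>S. c i * f i x) x = (\<Sum>i\<in>S. c i * omega P k a X (f i) x)"
        by (rule omega_combination[OF S C2 that])
      also have "\<dots> = (\<Sum>i\<in>S. c i * D i x)" by (intro sum.cong refl) (simp add: D(2) that)
      finally show ?thesis .
    qed
    ultimately show "\<exists>D. unitary_group.generates M (flow X) (\<lambda>x. \<Sum>i\<in>S. c i * f i x) D \<and>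
        (\<forall>x. x \<noteq> 0 \<longrightarrow> omega P k a X (\<lambda>x. \<Sum>i\<in>S. c i * f i x) x = D x)" by blast
  qed
qed

text \<open>The Laguerre polynomial in \<open>2 u\<close> times \<open>e\<^bsup>- u\<^esup>\<close> expands into the Gaussians \<open>gauss p j 1\<close> with \<open>j \<le> l\<close>.\<close>

lemma infinitesimal_W_generator:
  assumes "g \<in> W_generators P k a"
  shows "infinitesimal g"
proof -
  obtain p l m where p: "p \<in> dunkl_harmonics P k m"
    and g: "g = (\<lambda>x. p x * of_real (laguerre l (lambda_kam P k a m) (2 / a * norm x powr a) * exp (- (norm x powr a) / a)))"
    using assms unfolding W_generators_def by blast
  define b where "b j = (-1) ^ j * ((real l + lambda_kam P k a m) gchoose (l - j)) * 2 ^ j / fact j" for j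
  have "g = (\<lambda>x. \<Sum>j\<in>{..l}. of_real (b j) * gauss p j 1 x)"
  proof (rule ext)
    fix x :: "real^'n"
    have "laguerre l (lambda_kam P k a m) (2 / a * norm x powr a) = (\<Sum>j\<le>l. b j * radius x ^ j)"
      unfolding laguerre_def by (intro sum.cong refl) (simp add: b_def radius_def power_mult_distrib power_divide ac_simps)
    then show "g x = (\<Sum>j\<in>{..l}. of_real (b j) * gauss p j 1 x)"
      unfolding g gauss_def
      by (simp add: radius_def exp_of_real[symmetric] sum_distrib_left sum_distrib_right ac_simps)
  qed
  then show ?thesis by (simp only:) (rule infinitesimal_combination[OF finite_atMost infinitesimal_gauss[OF p]], simp)
qed

lemma infinitesimal_W_space:
  assumes "f \<in> W_space P k a"
  shows "infinitesimal f"
proof -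
  obtain S c where S: "finite S" "S \<subseteq> W_generators P k a" and f: "f = (\<lambda>x. \<Sum>g\<in>S. c g * g x)"
    using assms unfolding W_space_def by blast
  show ?thesis
    unfolding f by (rule infinitesimal_combination[OF S(1)]) (use infinitesimal_W_generator S(2) in blast)
qed

lemma AE_nonzero: "AE x in M. x \<noteq> 0"
proof -
  have "AE x in lborel. x \<noteq> (0::real^'n)" by (rule AE_lborel_singleton)
  then show ?thesis unfolding theta_measure_def by (subst AE_density) auto
qed

lemma Omega_derivative:
  assumes f: "infinitesimal f" and X: "X \<in> sl2"
  shows "has_L2_derivative M (\<lambda>t. Omega (SL2_cover_Exp (t *\<^sub>R X)) f) (omega P k a X f) 0"
proof -
  interpret unitary_group M "flow X" by (rule flow_group[OF X])
  have fL: "f \<in> L2 M" using f by (simp add: infinitesimal_def)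
  obtain D where D: "generates f D" "\<And>x. x \<noteq> 0 \<Longrightarrow> omega P k a X f x = D x"
    using f X unfolding infinitesimal_def by blast
  have DL: "D \<in> L2 M" by (rule generates_L2[OF D(1) fL])
  have ae: "AE x in M. D x = omega P k a X f x"
    using AE_nonzero by eventually_elim (simp add: D(2))
  have "D \<in> borel_measurable borel" using L2_measurable[OF DL] by (simp add: theta_measure_def)
  then have [measurable]: "(\<lambda>x. if x = 0 then omega P k a X f 0 else D x) \<in> borel_measurable borel" by measurable
  have "omega P k a X f = (\<lambda>x. if x = 0 then omega P k a X f 0 else D x)" using D(2) by auto
  then have "omega P k a X f \<in> borel_measurable borel"
    using \<open>(\<lambda>x. if x = 0 then omega P k a X f 0 else D x) \<in> borel_measurable borel\<close> by (simp only:)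
  then have "omega P k a X f \<in> borel_measurable M" by (simp add: theta_measure_def)
  then have "generates f (omega P k a X f)"
    by (intro generates_cong_AE[OF D(1) fL _ ae] L2_cong_AE[OF DL _ ae])
  then show ?thesis unfolding generates_def by (simp only: Omega_Exp[OF X])
qed

lemma Omega_lifts: "lifts_omega R P k a Omega"
  unfolding lifts_omega_def
  using Omega_derivative infinitesimal_W_space by (auto simp: infinitesimal_def)

end

theorem theoremG:
  fixes R P :: "(real^'n) set" and k :: "real^'n \<Rightarrow> real" and a :: real
  assumes "root_system R"
    and "positive_subsystem R P"
    and "multiplicity_function R k"
    and "\<forall>\<alpha>\<in>R. k \<alpha> \<ge> 0"
    and "a > 0"
    and "a + 2 * sum k P + real CARD('n) - 2 > 0"
  shows "\<exists>\<Omega>. unitary_representation SL2_cover SL2_cover_topology (theta_measure R k a) \<Omega> \<and>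
             lifts_omega R P k a \<Omega>"
proof -
  interpret dunkl_laguerre_setting R P k a
    by unfold_locales (use assms in auto)
  show ?thesis using Omega_representation Omega_lifts by blast
qed

end
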